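(* There are no constants $0<m<M<\infty$ independent of $\Omega$ with the property that $$m\,F_S^\Omega(z,\xi)\le F_B^\Omega(z,\xi)\le M\,F_S^\Omega(z,\xi)\qquad\text{for all }(z,\xi)\in T\Omega=\Omega\times\mathbb{C}^n$$ holds for every strongly pseudoconvex domain $\Omega\subset\subset\mathbb{C}^n$ with $C^\infty$ boundary ($n\ge1$), where $F_S^\Omega$ and $F_B^\Omega$ denote the Szegő metric (with respect to the Fefferman measure) and the Bergman metric of $\Omega$.
   Context: Let $\Omega=\{\rho<0\}\subset\subset\mathbb{C}^n$ be a strongly pseudoconvex domain with $C^\infty$ boundary and defining function $\rho$ (for $n=1$, any bounded domain with $C^\infty$ boundary). The Fefferman measure on $\partial\Omega$ is $$d\sigma_F=c_n\left(-\det\begin{pmatrix}0&\rho_{\bar k}\\ \rho_j&\rho_{j\bar k}\end{pmatrix}_{1\le j,k\le n}\right)^{1/(n+1)}\frac{d\sigma_E}{\|d\rho\|},$$ where $\sigma_E$ is Euclidean surface measure, $\rho_j=\partial\rho/\partial z_j$, $\rho_{\bar k}=\partial\rho/\partial\bar z_k$, $\rho_{j\bar k}=\partial^2\rho/\partial z_j\partial\bar z_k$, and $c_n>0$ is a fixed constant depending only on $n$. It does not depend on the choice of $\rho$ (for $n=1$ it equals $\frac{c_1}{2}$ times arclength). Let $H^2(\partial\Omega)$ be the closure in $L^2(\partial\Omega,\sigma_F)$ of $\mathcal{O}(\Omega)\cap C(\overline\Omega)$; its elements are identified with their holomorphic extensions to $\Omega$. The Szegő kernel $S_\Omega(z,w)$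 is the reproducing kernel of $H^2(\partial\Omega)$, so $S_\Omega(z,w)=\sum_\alpha\phi_\alpha(z)\overline{\phi_\alpha(w)}$ for any orthonormal basis $\{\phi_\alpha\}$. The Bergman kernel $K_\Omega(z,w)$ is the reproducing kernel of the space of $L^2$ (Lebesgue measure) holomorphic functions on $\Omega$. The Szegő and Bergman metrics are, for $z\in\Omega$, $\xi\in\mathbb{C}^n$, $$F_S^\Omega(z,\xi)=\Big(\sum_{j,k=1}^n\frac{\partial^2\log S_\Omega(z,z)}{\partial z_j\partial\bar z_k}\xi_j\bar\xi_k\Big)^{1/2},\qquad F_B^\Omega(z,\xi)=\Big(\sum_{j,k=1}^n\frac{\partial^2\log K_\Omega(z,z)}{\partial z_j\partial\bar z_k}\xi_j\bar\xi_k\Big)^{1/2}$$ (independent of $c_n$). *)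

theory Defs
  imports "HOL-Analysis.Analysis"
begin

section \<open>Calculus on complex n-space\<close>

primrec times_differentiable :: "nat \<Rightarrow> ('a::real_normed_vector \<Rightarrow> 'b::real_normed_vector) \<Rightarrow> bool"
where
  "times_differentiable 0 f \<longleftrightarrow> continuous_on UNIV f"
| "times_differentiable (Suc k) f \<longleftrightarrow>
     f differentiable_on UNIV \<and>
     (\<forall>v. times_differentiable k (\<lambda>x. frechet_derivative f (at x) v))"

definition smooth :: "('a::real_normed_vector \<Rightarrow> 'b::real_normed_vector) \<Rightarrow> bool" where
  "smooth f \<longleftrightarrow> (\<forall>k. times_differentiable k f)"

definition holomorphic_several :: "(complex ^ 'n \<Rightarrow> complex) \<Rightarrow> (complex ^ 'n) set \<Rightarrow> bool" where
  "holomorphic_several f S \<longleftrightarrow>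
     (\<forall>z\<in>S. \<exists>D. (f has_derivative D) (at z) \<and> (\<forall>a v. D (a *s v) = a * D v))"

definition d_z :: "'n \<Rightarrow> (complex ^ 'n \<Rightarrow> complex) \<Rightarrow> complex ^ 'n \<Rightarrow> complex" where
  "d_z j f p = (frechet_derivative f (at p) (axis j 1)
                - \<i> * frechet_derivative f (at p) (axis j \<i>)) / 2"

definition d_zbar :: "'n \<Rightarrow> (complex ^ 'n \<Rightarrow> complex) \<Rightarrow> complex ^ 'n \<Rightarrow> complex" where
  "d_zbar j f p = (frechet_derivative f (at p) (axis j 1)
                   + \<i> * frechet_derivative f (at p) (axis j \<i>)) / 2"

text \<open>Where \<^term>\<open>u\<close> is twice continuously differentiable the Levi form is Hermitian, so that
  the sum below is real.\<close>

definition levi_form :: "(complex ^ 'n \<Rightarrow> real) \<Rightarrow> complex ^ 'n \<Rightarrow> complex ^ 'n \<Rightarrow> real" where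
  "levi_form u p \<xi> =
     Re (\<Sum>j\<in>UNIV. \<Sum>k\<in>UNIV.
           d_z j (d_zbar k (\<lambda>z. complex_of_real (u z))) p * \<xi> $ j * cnj (\<xi> $ k))"


section \<open>Strongly pseudoconvex domains\<close>

text \<open>For \<^term>\<open>n = 1\<close> the condition on the Levi form is vacuous: the only complex tangent
  vector is zero, because the differential of \<^term>\<open>\<rho>\<close> does not vanish on the boundary.\<close>

definition strongly_pseudoconvex :: "(complex ^ 'n) set \<Rightarrow> (complex ^ 'n \<Rightarrow> real) \<Rightarrow> bool" where
  "strongly_pseudoconvex \<Omega> \<rho> \<longleftrightarrow>
     \<Omega> = {z. \<rho> z < 0} \<and> smooth \<rho> \<and>
     \<Omega> \<noteq> {} \<and> connected \<Omega> \<and> bounded \<Omega> \<and>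
     (\<forall>p\<in>frontier \<Omega>. frechet_derivative \<rho> (at p) \<noteq> (\<lambda>v. 0)) \<and>
     (\<forall>p\<in>frontier \<Omega>. \<forall>\<xi>. \<xi> \<noteq> 0 \<and> (\<Sum>j\<in>UNIV. d_z j (\<lambda>z. complex_of_real (\<rho> z)) p * \<xi> $ j) = 0
        \<longrightarrow> levi_form \<rho> p \<xi> > 0)"


section \<open>Euclidean surface measure and Fefferman measure\<close>

text \<open>Euclidean surface measure on hypersurfaces is the Hausdorff measure of codimension one, with
  the usual normalisation. The definitions are for dimension \<^term>\<open>d \<ge> 1\<close> (for
  \<^term>\<open>d = 0\<close> empty covering sets would count). Covering sets are required to be bounded because
  \<^term>\<open>diameter\<close> is unspecified on unbounded sets. On Borel sets the outer measure is countably
  additive, so that \<^term>\<open>measure_of\<close> does not degenerate.\<close>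

definition hausdorff_content :: "nat \<Rightarrow> real \<Rightarrow> 'a::metric_space set \<Rightarrow> ennreal" where
  "hausdorff_content d \<delta> A =
     (INF E\<in>{E :: nat \<Rightarrow> 'a set. A \<subseteq> (\<Union>i. E i) \<and> (\<forall>i. bounded (E i) \<and> diameter (E i) \<le> \<delta>)}.
        \<Sum>i. ennreal (unit_ball_vol (real d) * (diameter (E i) / 2) ^ d))"

definition hausdorff_outer_measure :: "nat \<Rightarrow> 'a::metric_space set \<Rightarrow> ennreal" where
  "hausdorff_outer_measure d A = (SUP \<delta>\<in>{0<..}. hausdorff_content d \<delta> A)"

definition surface_measure :: "'a::euclidean_space measure" where
  "surface_measure = measure_of UNIV (sets borel) (hausdorff_outer_measure (DIM('a) - 1))"

text \<open>The bordered complex Hessian; the index \<^term>\<open>None\<close> stands for the extra row and column.\<close>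

definition bordered_hessian ::
    "(complex ^ 'n \<Rightarrow> real) \<Rightarrow> complex ^ 'n \<Rightarrow> complex ^ ('n option) ^ ('n option)" where
  "bordered_hessian \<rho> p =
     (let r = (\<lambda>z. complex_of_real (\<rho> z)) in
      \<chi> a b. case a of
          None \<Rightarrow> (case b of None \<Rightarrow> 0 | Some k \<Rightarrow> d_zbar k r p)
        | Some j \<Rightarrow> (case b of None \<Rightarrow> d_z j r p | Some k \<Rightarrow> d_z j (d_zbar k r) p))"

text \<open>The matrix is Hermitian, so its determinant is real; the
  operator norm of the differential is the Euclidean norm of the gradient.\<close>

definition fefferman_measure ::
    "real \<Rightarrow> (complex ^ 'n) set \<Rightarrow> (complex ^ 'n \<Rightarrow> real) \<Rightarrow> (complex ^ 'n) measure" where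
  "fefferman_measure c \<Omega> \<rho> =
     density (restrict_space surface_measure (frontier \<Omega>))
       (\<lambda>p. ennreal (c * Re (- det (bordered_hessian \<rho> p)) powr (1 / (real CARD('n) + 1))
                      / onorm (frechet_derivative \<rho> (at p))))"


section \<open>Reproducing kernels\<close>

definition square_integrable :: "'a measure \<Rightarrow> ('a \<Rightarrow> complex) \<Rightarrow> bool" where
  "square_integrable M f \<longleftrightarrow>
     f \<in> borel_measurable M \<and> integrable M (\<lambda>z. (norm (f z))\<^sup>2)"

text \<open>A Hilbert space of functions on \<^term>\<open>\<Omega>\<close> is given by a set of pairs \<^term>\<open>(f, F)\<close>: the inner
  product is the one of \<^term>\<open>f\<close> in the square-integrable functions for \<^term>\<open>M\<close>, and \<^term>\<open>F\<close> is the
  function on \<^term>\<open>\<Omega>\<close> with which \<^term>\<open>f\<close> is identified. Only the values of \<^term>\<open>F\<close> and of the kernel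
  at points of \<^term>\<open>\<Omega>\<close> are meaningful.\<close>

definition is_reproducing_kernel ::
    "'a measure \<Rightarrow> (('a \<Rightarrow> complex) \<times> ('a \<Rightarrow> complex)) set \<Rightarrow> 'a set \<Rightarrow>
     ('a \<Rightarrow> 'a \<Rightarrow> complex) \<Rightarrow> bool" where
  "is_reproducing_kernel M H \<Omega> K \<longleftrightarrow>
     (\<forall>w\<in>\<Omega>. \<exists>k. (k, \<lambda>z. K z w) \<in> H \<and>
        (\<forall>(f, F)\<in>H. F w = (\<integral>z. f z * cnj (k z) \<partial>M)))"

definition reproducing_kernel ::
    "'a measure \<Rightarrow> (('a \<Rightarrow> complex) \<times> ('a \<Rightarrow> complex)) set \<Rightarrow> 'a set \<Rightarrow> 'a \<Rightarrow> 'a \<Rightarrow> complex" where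
  "reproducing_kernel M H \<Omega> = (SOME K. is_reproducing_kernel M H \<Omega> K)"

text \<open>In the Hardy space, \<^term>\<open>f\<close> is a limit in the square-integrable functions on the boundary of
  functions \<^term>\<open>g i\<close> continuous up to the boundary, and its holomorphic extension \<^term>\<open>F\<close> is the
  limit of the \<^term>\<open>g i\<close> inside.\<close>

definition hardy_space ::
    "(complex ^ 'n) measure \<Rightarrow> (complex ^ 'n) set \<Rightarrow>
     ((complex ^ 'n \<Rightarrow> complex) \<times> (complex ^ 'n \<Rightarrow> complex)) set" where
  "hardy_space \<sigma> \<Omega> =
     {(f, F). square_integrable \<sigma> f \<and>
        (\<exists>g :: nat \<Rightarrow> complex ^ 'n \<Rightarrow> complex.
           (\<forall>i. holomorphic_several (g i) \<Omega> \<and> continuous_on (closure \<Omega>) (g i)) \<and>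
           (\<lambda>i. \<integral>\<^sup>+ z. ennreal ((norm (g i z - f z))\<^sup>2) \<partial>\<sigma>) \<longlonglongrightarrow> 0 \<and>
           (\<forall>z\<in>\<Omega>. (\<lambda>i. g i z) \<longlonglongrightarrow> F z))}"

definition bergman_space ::
    "(complex ^ 'n) set \<Rightarrow> ((complex ^ 'n \<Rightarrow> complex) \<times> (complex ^ 'n \<Rightarrow> complex)) set" where
  "bergman_space \<Omega> =
     {(f, f) | f. holomorphic_several f \<Omega> \<and> square_integrable (lebesgue_on \<Omega>) f}"

definition szego_kernel ::
    "real \<Rightarrow> (complex ^ 'n) set \<Rightarrow> (complex ^ 'n \<Rightarrow> real) \<Rightarrow>
     complex ^ 'n \<Rightarrow> complex ^ 'n \<Rightarrow> complex" where
  "szego_kernel c \<Omega> \<rho> =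
     (let \<sigma> = fefferman_measure c \<Omega> \<rho> in reproducing_kernel \<sigma> (hardy_space \<sigma> \<Omega>) \<Omega>)"

definition bergman_kernel ::
    "(complex ^ 'n) set \<Rightarrow> complex ^ 'n \<Rightarrow> complex ^ 'n \<Rightarrow> complex" where
  "bergman_kernel \<Omega> = reproducing_kernel (lebesgue_on \<Omega>) (bergman_space \<Omega>) \<Omega>"


section \<open>The two metrics\<close>

text \<open>On the diagonal the kernels are positive real numbers.\<close>

definition szego_metric ::
    "real \<Rightarrow> (complex ^ 'n) set \<Rightarrow> (complex ^ 'n \<Rightarrow> real) \<Rightarrow> complex ^ 'n \<Rightarrow> complex ^ 'n \<Rightarrow> real" where
  "szego_metric c \<Omega> \<rho> z \<xi> = sqrt (levi_form (\<lambda>w. ln (Re (szego_kernel c \<Omega> \<rho> w w))) z \<xi>)"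

definition bergman_metric ::
    "(complex ^ 'n) set \<Rightarrow> complex ^ 'n \<Rightarrow> complex ^ 'n \<Rightarrow> real" where
  "bergman_metric \<Omega> z \<xi> = sqrt (levi_form (\<lambda>w. ln (Re (bergman_kernel \<Omega> w w))) z \<xi>)"

end

theory Submission
  imports Defs "HOL-Complex_Analysis.Complex_Analysis"
begin

no_notation fps_nth (infixl "$" 75)

text \<open>
  For small \<open>\<epsilon>\<close> let \<open>\<Omega>\<^sub>\<epsilon> = {|z\<^sub>i|\<^sup>2 (1 - |z|\<^sup>2) > \<epsilon>}\<close>: the unit ball without a thin neighbourhood of
  the hyperplane \<open>z\<^sub>i = 0\<close>. It is strongly pseudoconvex, and for \<open>n = 1\<close> it is an annulus. The two
  metrics are compared at \<open>p = (p\<^sub>1, 0)\<close> with \<open>p\<^sub>1\<^sup>4 = \<epsilon>\<close>, in the direction of \<open>z\<^sub>i\<close>; the squared metric is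
  the quotient of the largest \<open>|f'(p)|\<^sup>2\<close> (over unit vectors \<open>f\<close> with \<open>f p = 0\<close>) by \<open>K(p, p)\<close>.

  Bergman: the function \<open>1/z\<^sub>i\<close> has squared norm \<open>O(log (1/\<epsilon>))\<close>, so that \<open>K(p, p)\<close> is at least a
  multiple of \<open>1/(p\<^sub>1\<^sup>2 log (1/\<epsilon>))\<close>, while the Cauchy formula for the derivative on the slices
  gives \<open>|f'(p)|\<^sup>2 = O(1/p\<^sub>1\<^sup>2)\<close> if \<open>f p = 0\<close>. Hence the squared Bergman metric is \<open>O(log (1/\<epsilon>))\<close>.

  Szegoe: the inner boundary carries little Fefferman measure, about \<open>\<epsilon>/Y\<close> with
  \<open>Y = \<epsilon>\<^bsup>1/(n+1)\<^esup>\<close>. The Cauchy formula on slices gives \<open>S(p, p) = O(Y/p\<^sub>1\<^sup>2)\<close>, and the function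
  \<open>1 - p\<^sub>1/z\<^sub>i\<close>, with derivative \<open>1/p\<^sub>1\<close> at its zero \<open>p\<close>, has squared norm \<open>O(1 + \<epsilon>\<^bsup>1/16\<^esup>/Y)\<close>. Hence the
  squared Szegoe metric is at least a multiple of \<open>1/(Y + \<epsilon>\<^bsup>1/16\<^esup>)\<close>, a negative power of \<open>\<epsilon>\<close>.
\<close>

text \<open>The base point has modulus p1, halfway on the logarithmic scale between the hole of its
  slice, of radius about p1^2, and the outer circle, of radius about 1. Both boundary circles are
  therefore far from it in ratio, and the Cauchy kernels taken there have simple bounds.

  Surface measure is given as a Hausdorff measure and enters only through two one-sided comparisons,
  with constants that depend on n alone. Point evaluations need it from below: a ring of full
  dimension is projected radially onto a boundary sheet, and the image measure is dominated by
  surface measure. Test functions need it from above: the boundary is described by the pairs of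
  moduli of \<open>z $ i\<close> and of the remaining coordinates, and on each of two halves these
  pairs form a monotone curve, which meets few cells of a grid.

  All holomorphic estimates are one-variable Cauchy formulas on slices, averaged over the remaining
  coordinates by rotations. This treats n = 1 and n > 1 alike.\<close>

lemmas norm_coord_le = Finite_Cartesian_Product.norm_nth_le

section \<open>Hausdorff outer measure, its Caratheodory measurability and its comparison with other
  measures\<close>

section \<open>Hausdorff measure\<close>

lemma hausdorff_content_antimono:
  assumes "\<delta> <= \<delta>'"
  shows "hausdorff_content d \<delta>' A <= hausdorff_content d \<delta> A"
  unfolding hausdorff_content_def
  by (rule INF_superset_mono) (use assms in \<open>auto intro: order_trans\<close>)

lemma hausdorff_content_mono:
  assumes "A \<subseteq> B"
  shows "hausdorff_content d \<delta> A <= hausdorff_content d \<delta> B"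
  unfolding hausdorff_content_def
  by (rule INF_superset_mono) (use assms in auto)

lemma hausdorff_content_le:
  assumes "A \<subseteq> (\<Union>i. E i)" "\<And>i. bounded (E i)" "\<And>i. diameter (E i) <= \<delta>"
  shows "hausdorff_content d \<delta> A <= (\<Sum>i. ennreal (unit_ball_vol (real d) * (diameter (E i) / 2) ^ d))"
  unfolding hausdorff_content_def by (rule INF_lower) (use assms in auto)

lemma hausdorff_content_empty:
  assumes "d >= 1" "\<delta> > 0"
  shows "hausdorff_content d \<delta> {} = 0"
proof -
  have "hausdorff_content d \<delta> ({} :: 'a set)
      <= (\<Sum>i::nat. ennreal (unit_ball_vol (real d) * (diameter ({} :: 'a set) / 2) ^ d))"
    by (rule hausdorff_content_le) (use assms in auto)
  also have "... = 0" using assms by (simp add: power_0_left)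
  finally show ?thesis by simp
qed

text \<open>Each piece gets a covering that is optimal up to \<open>e * (1/2) ^ Suc i\<close>; the
  double sequence of covering sets is listed along \<open>prod_decode\<close>.\<close>

lemma hausdorff_content_subadditive:
  "hausdorff_content d \<delta> (\<Union>i::nat. A i) <= (\<Sum>i. hausdorff_content d \<delta> (A i))"
proof (cases "(\<Sum>i. hausdorff_content d \<delta> (A i)) = \<infinity>")
  case False
  then have fin: "hausdorff_content d \<delta> (A i) < \<infinity>" for i
    by (metis ennreal_suminf_lessD infinity_ennreal_def top.not_eq_extremum)
  show ?thesis
  proof (rule ennreal_le_epsilon)
    fix e :: real assume e: "0 < e"
    define val where "val E = (\<Sum>i. ennreal (unit_ball_vol (real d) * (diameter (E i) / 2) ^ d))"
      for E :: "nat => 'a set"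
    have "\<exists>E. A i \<subseteq> (\<Union>j. E j) \<and> (\<forall>j. bounded (E j) \<and> diameter (E j) <= \<delta>) \<and>
         val E < hausdorff_content d \<delta> (A i) + ennreal (e * (1/2)^Suc i)" for i
    proof -
      have "hausdorff_content d \<delta> (A i) < hausdorff_content d \<delta> (A i) + ennreal (e * (1/2)^Suc i)"
        using fin[of i] e ennreal_add_left_cancel_less[of "hausdorff_content d \<delta> (A i)" 0]
        by (simp add: less_top)
      then show ?thesis
        unfolding hausdorff_content_def[of d \<delta> "A i"] INF_less_iff by (auto simp: val_def)
    qed
    then obtain E where E: "\<And>i. A i \<subseteq> (\<Union>j. E i j)" "\<And>i j. bounded (E i j)"
        "\<And>i j. diameter (E i j) <= \<delta>"
        "\<And>i. val (E i) < hausdorff_content d \<delta> (A i) + ennreal (e * (1/2)^Suc i)"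
      by metis
    define G where "G k = (case prod_decode k of (i, j) => E i j)" for k
    have "hausdorff_content d \<delta> (\<Union>i. A i) <= val G"
      unfolding val_def
    proof (rule hausdorff_content_le)
      show "(\<Union>i. A i) \<subseteq> (\<Union>k. G k)"
      proof
        fix x assume "x \<in> (\<Union>i. A i)"
        then obtain i j where "x \<in> E i j" using E(1) by blast
        then have "x \<in> G (prod_encode (i, j))" by (simp add: G_def)
        then show "x \<in> (\<Union>k. G k)" by blast
      qed
    qed (auto simp: G_def E split: prod.split)
    also have "val G = (\<Sum>i. val (E i))"
    proof -
      have "val G = (\<Sum>k. (%(i, j). ennreal (unit_ball_vol (real d) * (diameter (E i j) / 2) ^ d)) (prod_decode k))"
        unfolding val_def G_def by (intro suminf_cong) (auto split: prod.split)
      also have "... = (\<Sum>i. val (E i))"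
        by (rule suminf_ennreal_2dimen) (simp add: val_def)
      finally show ?thesis .
    qed
    also have "... <= (\<Sum>i. hausdorff_content d \<delta> (A i) + ennreal (e * (1/2)^Suc i))"
      using E(4) by (intro suminf_le) (auto intro: less_imp_le)
    also have "... = (\<Sum>i. hausdorff_content d \<delta> (A i)) + (\<Sum>i. ennreal (e * (1/2)^Suc i))"
      by (rule suminf_add[symmetric]) auto
    also have "(\<Sum>i. ennreal (e * (1/2)^Suc i)) = ennreal e"
    proof -
      have "(%i. e * (1/2)^Suc i) sums (e * 1)"
        by (rule sums_mult[OF power_half_series])
      then have "(\<Sum>i. ennreal (e * (1/2)^Suc i)) = ennreal (e * 1)"
        by (rule suminf_ennreal_eq[rotated]) (use e in auto)
      then show ?thesis by (simp only: mult_1_right)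
    qed
    finally show "hausdorff_content d \<delta> (\<Union>i. A i) <= (\<Sum>i. hausdorff_content d \<delta> (A i)) + ennreal e" .
  qed
qed simp

lemma hausdorff_outer_measure_mono:
  "A \<subseteq> B ==> hausdorff_outer_measure d A <= hausdorff_outer_measure d B"
  unfolding hausdorff_outer_measure_def by (intro SUP_mono') (rule hausdorff_content_mono)

lemma hausdorff_outer_measure_empty:
  assumes "d >= 1"
  shows "hausdorff_outer_measure d {} = 0"
proof -
  have "hausdorff_outer_measure d ({} :: 'a set) = (SUP \<delta>\<in>{0::real<..}. 0)"
    unfolding hausdorff_outer_measure_def using hausdorff_content_empty[OF assms]
    by (intro SUP_cong) auto
  then show ?thesis by simp
qed

lemma hausdorff_content_le_outer_measure:
  "\<delta> > 0 ==> hausdorff_content d \<delta> A <= hausdorff_outer_measure d A"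
  unfolding hausdorff_outer_measure_def by (rule SUP_upper) auto

lemma hausdorff_outer_measure_subadditive:
  "hausdorff_outer_measure d (\<Union>i::nat. A i) <= (\<Sum>i. hausdorff_outer_measure d (A i))"
  unfolding hausdorff_outer_measure_def[of d "\<Union>i. A i"]
proof (rule SUP_least)
  fix \<delta> :: real assume "\<delta> \<in> {0<..}"
  then have "(\<Sum>i. hausdorff_content d \<delta> (A i)) <= (\<Sum>i. hausdorff_outer_measure d (A i))"
    by (intro suminf_le hausdorff_content_le_outer_measure) auto
  then show "hausdorff_content d \<delta> (\<Union>i. A i) <= (\<Sum>i. hausdorff_outer_measure d (A i))"
    using hausdorff_content_subadditive order_trans by blast
qed

lemma hausdorff_outer_measure_Un:
  assumes "d >= 1"
  shows "hausdorff_outer_measure d (A \<union> B) <= hausdorff_outer_measure d A + hausdorff_outer_measure d B"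
proof -
  have "hausdorff_outer_measure d (\<Union>i. binaryset A B i) <= (\<Sum>i. hausdorff_outer_measure d (binaryset A B i))"
    by (rule hausdorff_outer_measure_subadditive)
  also have "... = hausdorff_outer_measure d A + hausdorff_outer_measure d B"
    using suminf_binaryset_eq[of "hausdorff_outer_measure d" A B] hausdorff_outer_measure_empty[OF assms]
    by blast
  finally show ?thesis by (simp add: UN_binaryset_eq)
qed

text \<open>A set whose diameter is below the distance between A and B meets at most one of them, so
  a covering of the union splits into a covering of A and one of B that share no set.\<close>

lemma hausdorff_content_separated:
  assumes d: "d >= 1" and sep: "\<And>x y. x \<in> A ==> y \<in> B ==> \<eta> <= dist x y" and \<delta>: "0 < \<delta>" "\<delta> < \<eta>"
  shows "hausdorff_content d \<delta> A + hausdorff_content d \<delta> B <= hausdorff_content d \<delta> (A \<union> B)"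
  unfolding hausdorff_content_def[of d \<delta> "A \<union> B"]
proof (rule INF_greatest, clarify)
  fix E :: "nat => 'a set"
  assume cov: "A \<union> B \<subseteq> (\<Union>i. E i)" and E: "\<forall>i. bounded (E i) \<and> diameter (E i) <= \<delta>"
  define f where "f X = ennreal (unit_ball_vol (real d) * (diameter X / 2) ^ d)" for X :: "'a set"
  have f0: "f {} = 0" using d by (simp add: f_def)
  \<comment> \<open>Covering sets that miss A become empty; their term is 0 because
    \<open>d >= 1\<close>.\<close>
  define EA where "EA i = (if E i \<inter> A ~= {} then E i else {})" for i
  define EB where "EB i = (if E i \<inter> B ~= {} then E i else {})" for i
  have "hausdorff_content d \<delta> A <= (\<Sum>i. f (EA i))"
    unfolding f_def
  proof (rule hausdorff_content_le)
    show "A \<subseteq> (\<Union>i. EA i)" using cov unfolding EA_def by (auto split: if_splits) blast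
  qed (use E \<delta> in \<open>auto simp: EA_def\<close>)
  moreover have "hausdorff_content d \<delta> B <= (\<Sum>i. f (EB i))"
    unfolding f_def
  proof (rule hausdorff_content_le)
    show "B \<subseteq> (\<Union>i. EB i)" using cov unfolding EB_def by (auto split: if_splits) blast
  qed (use E \<delta> in \<open>auto simp: EB_def\<close>)
  moreover have "(\<Sum>i. f (EA i)) + (\<Sum>i. f (EB i)) = (\<Sum>i. f (EA i) + f (EB i))"
    by (rule suminf_add) auto
  moreover have "(\<Sum>i. f (EA i) + f (EB i)) <= (\<Sum>i. f (E i))"
  proof (rule suminf_le)
    fix i
    have "\<not> (E i \<inter> A ~= {} \<and> E i \<inter> B ~= {})"
    proof
      assume "E i \<inter> A ~= {} \<and> E i \<inter> B ~= {}"
      then obtain x y where xy: "x \<in> E i" "x \<in> A" "y \<in> E i" "y \<in> B" by blast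
      then have "dist x y <= diameter (E i)" using E diameter_bounded_bound by blast
      then have "dist x y <= \<delta>" using E order_trans by blast
      moreover have "\<eta> <= dist x y" using sep xy by blast
      ultimately show False using \<delta> by linarith
    qed
    then show "f (EA i) + f (EB i) <= f (E i)" by (auto simp: EA_def EB_def f0)
  qed auto
  ultimately show "hausdorff_content d \<delta> A + hausdorff_content d \<delta> B \<le>
      (\<Sum>i. ennreal (unit_ball_vol (real d) * (diameter (E i) / 2) ^ d))"
    unfolding f_def by (metis (no_types, lifting) add_mono order_trans)
qed

lemma hausdorff_outer_measure_SUP_seq:
  "hausdorff_outer_measure d A = (SUP n::nat. hausdorff_content d (1 / real (Suc n)) A)"
  unfolding hausdorff_outer_measure_def
proof (rule SUP_eq)
  fix \<delta> :: real assume "\<delta> \<in> {0<..}"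
  then obtain n where "1 / real (Suc n) < \<delta>"
    using nat_approx_posE by auto
  then show "\<exists>n\<in>UNIV. hausdorff_content d \<delta> A <= hausdorff_content d (1 / real (Suc n)) A"
    using hausdorff_content_antimono less_imp_le by blast
qed auto

text \<open>Contents add as soon as the mesh is below the separation, and this survives the supremum
  along the common sequence of mesh sizes 1/(n+1).\<close>

lemma hausdorff_outer_measure_separated:
  assumes d: "d >= 1" and sep: "\<And>x y. x \<in> A ==> y \<in> B ==> \<eta> <= dist x y" and \<eta>: "\<eta> > 0"
  shows "hausdorff_outer_measure d A + hausdorff_outer_measure d B <= hausdorff_outer_measure d (A \<union> B)"
proof -
  have inc: "incseq (%n::nat. hausdorff_content d (1 / real (Suc n)) X)" for X :: "'a set"
    by (intro monoI hausdorff_content_antimono) (auto intro: divide_left_mono)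
  have "hausdorff_outer_measure d A + hausdorff_outer_measure d B =
      (SUP n::nat. hausdorff_content d (1 / real (Suc n)) A + hausdorff_content d (1 / real (Suc n)) B)"
    unfolding hausdorff_outer_measure_SUP_seq by (rule ennreal_SUP_add[symmetric]) (rule inc)+
  also have "... <= hausdorff_outer_measure d (A \<union> B)"
  proof (rule SUP_least)
    fix n :: nat
    obtain m where m: "1 / real (Suc m) < \<eta>" using nat_approx_posE[OF \<eta>] by auto
    define k where "k = max n m"
    have k1: "1 / real (Suc k) <= 1 / real (Suc n)" by (auto simp: k_def field_simps)
    have "1 / real (Suc k) <= 1 / real (Suc m)" by (auto simp: k_def field_simps)
    then have k: "1 / real (Suc k) <= 1 / real (Suc n)" "1 / real (Suc k) < \<eta>"
      using m k1 by auto
    have "hausdorff_content d (1 / real (Suc n)) A + hausdorff_content d (1 / real (Suc n)) B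
      <= hausdorff_content d (1 / real (Suc k)) A + hausdorff_content d (1 / real (Suc k)) B"
      using k by (intro add_mono hausdorff_content_antimono)
    also have "... <= hausdorff_content d (1 / real (Suc k)) (A \<union> B)"
      by (rule hausdorff_content_separated[OF d sep]) (use k in auto)
    also have "... <= hausdorff_outer_measure d (A \<union> B)"
      by (rule hausdorff_content_le_outer_measure) auto
    finally show "hausdorff_content d (1 / real (Suc n)) A + hausdorff_content d (1 / real (Suc n)) B
      <= hausdorff_outer_measure d (A \<union> B)" .
  qed
  finally show ?thesis .
qed

text \<open>Each piece has positive distance from all later ones together, so the pieces can be
  split off one at a time. The induction runs over the number of pieces with an arbitrary starting
  index.\<close>

lemma hausdorff_outer_measure_finite_separated:
  fixes R :: "nat => 'a::metric_space set"
  assumes d: "d >= 1"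
    and sep: "\<And>i j. i < j ==> \<exists>\<eta>>0. \<forall>k\<ge>j. \<forall>x\<in>R i. \<forall>y\<in>R k. \<eta> <= dist x y"
  shows "(\<Sum>i<n. hausdorff_outer_measure d (R i)) <= hausdorff_outer_measure d (\<Union>i. R i)"
proof -
  have *: "(\<Sum>i<n. hausdorff_outer_measure d (R (m + i))) <= hausdorff_outer_measure d (\<Union>i\<in>{m..}. R i)" for m
  proof (induction n arbitrary: m)
    case (Suc n)
    obtain \<eta> where \<eta>: "\<eta> > 0" "\<forall>k\<ge>Suc m. \<forall>x\<in>R m. \<forall>y\<in>R k. \<eta> <= dist x y"
      using sep[of m "Suc m"] by auto
    have "(\<Sum>i<Suc n. hausdorff_outer_measure d (R (m + i))) =
        hausdorff_outer_measure d (R m) + (\<Sum>i<n. hausdorff_outer_measure d (R (Suc m + i)))"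
      by (subst sum.lessThan_Suc_shift) simp
    also have "... <= hausdorff_outer_measure d (R m) + hausdorff_outer_measure d (\<Union>i\<in>{Suc m..}. R i)"
      using Suc.IH[of "Suc m"] by (intro add_left_mono)
    also have "... <= hausdorff_outer_measure d (R m \<union> (\<Union>i\<in>{Suc m..}. R i))"
      by (rule hausdorff_outer_measure_separated[OF d, of _ _ \<eta>]) (use \<eta> in auto)
    also have "R m \<union> (\<Union>i\<in>{Suc m..}. R i) = (\<Union>i\<in>{m..}. R i)"
      using atLeast_Suc_greaterThan[of m] by (auto simp: Suc_le_eq)
    finally show ?case .
  qed simp
  have "{0::nat..} = UNIV" by auto
  then show ?thesis using *[of 0] by simp
qed

text \<open>Caratheodory's criterion for closed sets. \<open>A k\<close> is the part of X at
  distance at least 1/(k+1) from C, hence separated from C. What is lost between \<open>A m\<close>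
  and the complement of C lies in the layers \<open>R k\<close>. Layers of equal parity are
  separated from each other, so the measures of all layers have a finite sum and their tail
  vanishes.\<close>

lemma hausdorff_outer_measure_closed_split:
  fixes C X :: "'a::metric_space set"
  assumes d: "d >= 1" and C: "closed C"
  shows "hausdorff_outer_measure d (C \<inter> X) + hausdorff_outer_measure d ((UNIV - C) \<inter> X) = hausdorff_outer_measure d X"
proof (rule antisym)
  let ?H = "hausdorff_outer_measure d :: 'a set => ennreal"
  have "X = (C \<inter> X) \<union> ((UNIV - C) \<inter> X)" by auto
  then show "?H X <= ?H (C \<inter> X) + ?H ((UNIV - C) \<inter> X)"
    using hausdorff_outer_measure_Un[OF d, of "C \<inter> X" "(UNIV - C) \<inter> X"] by simp
  show "?H (C \<inter> X) + ?H ((UNIV - C) \<inter> X) <= ?H X"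
  \<comment> \<open>The distance to the empty set is 0 by convention, so layers make sense only for
    nonempty C.\<close>
  proof (cases "C = {} \<or> ?H X = \<infinity>")
    case True
    then show ?thesis using hausdorff_outer_measure_empty[OF d] by auto
  next
    case False
    then have ne: "C ~= {}" and fin: "?H X < \<infinity>" by (auto simp: top.not_eq_extremum)
    define A where "A k = {x \<in> X. infdist x C >= 1 / real (Suc k)}" for k
    define R where "R k = A (Suc k) - A k" for k
    have Rin: "1 / real (Suc (Suc k)) <= infdist x C" "infdist x C < 1 / real (Suc k)" if "x \<in> R k" for x k
      using that unfolding R_def A_def by (simp_all add: not_le)
    \<comment> \<open>Layers whose indices differ by at least two are separated by a gap in the
      distance to C; adjacent layers may touch.\<close>
    have sepR: "\<exists>\<eta>>0. \<forall>k'\<ge>k. \<forall>x\<in>R i. \<forall>y\<in>R k'. \<eta> <= dist x y" if "Suc i < k" for i k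
    proof (intro exI conjI allI impI ballI)
      have "1 / real (Suc k) < 1 / real (Suc (Suc i))"
        using that by (intro divide_strict_left_mono) auto
      then show "0 < 1 / real (Suc (Suc i)) - 1 / real (Suc k)" by simp
      fix k' x y assume k': "k <= k'" and x: "x \<in> R i" and y: "y \<in> R k'"
      have "infdist x C <= infdist y C + dist x y" by (rule infdist_triangle)
      moreover have "1 / real (Suc k') <= 1 / real (Suc k)" using k' by (intro divide_left_mono) auto
      ultimately show "1 / real (Suc (Suc i)) - 1 / real (Suc k) <= dist x y"
        using Rin[OF x] Rin[OF y] by linarith
    qed
    have sep_even: "\<exists>\<eta>>0. \<forall>k\<ge>j. \<forall>x\<in>R (2 * i). \<forall>y\<in>R (2 * k). \<eta> <= dist x y" if "i < j" for i j
    proof -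
      have "Suc (2*i) < 2*j" using that by linarith
      then obtain \<eta> where "\<eta> > 0" "\<forall>k'\<ge>2*j. \<forall>x\<in>R (2*i). \<forall>y\<in>R k'. \<eta> <= dist x y"
        using sepR by blast
      then show ?thesis by (intro exI[of _ \<eta>] conjI allI impI) (simp, metis mult_le_mono2)
    qed
    have sep_odd: "\<exists>\<eta>>0. \<forall>k\<ge>j. \<forall>x\<in>R (2 * i + 1). \<forall>y\<in>R (2 * k + 1). \<eta> <= dist x y" if "i < j" for i j
    proof -
      have "Suc (2*i+1) < 2*j+1" using that by linarith
      then obtain \<eta> where "\<eta> > 0" "\<forall>k'\<ge>2*j+1. \<forall>x\<in>R (2*i+1). \<forall>y\<in>R k'. \<eta> <= dist x y"
        using sepR by blast
      then show ?thesis by (intro exI[of _ \<eta>] conjI allI impI) (simp, metis mult_le_mono2 add_le_mono1)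
    qed
    have RX: "R k \<subseteq> X" for k by (auto simp: R_def A_def)
    have UR: "?H (\<Union>i::nat. R (f i)) <= ?H X" for f
      by (rule hausdorff_outer_measure_mono) (use RX in blast)
    have even: "(\<Sum>i<n. ?H (R (2 * i))) <= ?H X" for n
      using order_trans[OF hausdorff_outer_measure_finite_separated[where R = "%i. R (2*i)", OF d sep_even] UR[of "%i. 2*i"], of n]
      by simp
    have odd: "(\<Sum>i<n. ?H (R (2 * i + 1))) <= ?H X" for n
      using order_trans[OF hausdorff_outer_measure_finite_separated[where R = "%i. R (2*i+1)", OF d sep_odd] UR[of "%i. 2*i+1"], of n]
      by simp
    have "(\<Sum>i<n. ?H (R i)) <= ?H X + ?H X" for n
    proof -
      have "(\<Sum>i<n. ?H (R i)) <= (\<Sum>i<2*n. ?H (R i))"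
        by (intro sum_mono2) auto
      also have "... = (\<Sum>i<n. ?H (R (2 * i))) + (\<Sum>i<n. ?H (R (2 * i + 1)))"
        by (induction n) (auto simp: algebra_simps)
      also have "... <= ?H X + ?H X" using even odd by (intro add_mono)
      finally show ?thesis .
    qed
    then have "(\<Sum>i. ?H (R i)) <= ?H X + ?H X"
      by (simp add: suminf_eq_SUP SUP_least)
    then have sumfin: "(\<Sum>i. ?H (R i)) ~= \<infinity>" using fin
      by (metis ennreal_add_eq_top infinity_ennreal_def less_irrefl top.extremum_unique)
    have pos: "infdist x C > 0" if "x \<notin> C" for x
      using that C ne in_closed_iff_infdist_zero infdist_nonneg by (metis order_le_less)
    have bound: "?H (C \<inter> X) + ?H ((UNIV - C) \<inter> X) <= ?H X + (\<Sum>i. ?H (R (i + m)))" for m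
    proof -
      \<comment> \<open>A point outside C belongs to some \<open>A n\<close>; if the first such n
        exceeds m, the point lies in the layer just before it.\<close>
      have "(UNIV - C) \<inter> X \<subseteq> A m \<union> (\<Union>i. R (i + m))"
      proof
        fix x assume x: "x \<in> (UNIV - C) \<inter> X"
        obtain n where "1 / real (Suc n) < infdist x C"
          using nat_approx_posE[OF pos[of x]] x by auto
        then have ex: "x \<in> A n" using x by (auto simp: A_def)
        define l where "l = (LEAST n. x \<in> A n)"
        have l: "x \<in> A l" unfolding l_def using ex by (rule LeastI)
        show "x \<in> A m \<union> (\<Union>i. R (i + m))"
        proof (cases "l <= m")
          case True
          then have "1 / real (Suc m) <= 1 / real (Suc l)" by (intro divide_left_mono) auto
          then have "A l \<subseteq> A m"
            unfolding A_def by (auto simp del: of_nat_Suc)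
          then show ?thesis using l by auto
        next
          case False
          then obtain j where "l = Suc (m + j)"
            using less_imp_Suc_add[of m l] by auto
          then have j: "l = Suc (j + m)" by simp
          have "x \<notin> A (j + m)" using not_less_Least[of "j + m" "%n. x \<in> A n"] j l_def by auto
          then have "x \<in> R (j + m)" using l j by (auto simp: R_def)
          then show ?thesis by blast
        qed
      qed
      then have "?H ((UNIV - C) \<inter> X) <= ?H (A m \<union> (\<Union>i. R (i + m)))"
        by (rule hausdorff_outer_measure_mono)
      also have "... <= ?H (A m) + ?H (\<Union>i. R (i + m))" by (rule hausdorff_outer_measure_Un[OF d])
      also have "... <= ?H (A m) + (\<Sum>i. ?H (R (i + m)))"
        by (intro add_left_mono hausdorff_outer_measure_subadditive)
      finally have 1: "?H ((UNIV - C) \<inter> X) <= ?H (A m) + (\<Sum>i. ?H (R (i + m)))" .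
      have "?H (C \<inter> X) + ?H (A m) <= ?H (C \<inter> X \<union> A m)"
      proof (rule hausdorff_outer_measure_separated[OF d])
        fix x y assume x: "x \<in> C \<inter> X" and y: "y \<in> A m"
        have "infdist y C <= dist y x" using x by (intro infdist_le) auto
        then show "1 / real (Suc m) <= dist x y" using y by (auto simp: A_def dist_commute)
      qed auto
      also have "... <= ?H X" by (rule hausdorff_outer_measure_mono) (auto simp: A_def)
      finally have 2: "?H (C \<inter> X) + ?H (A m) <= ?H X" .
      have "?H (C \<inter> X) + ?H ((UNIV - C) \<inter> X) <= ?H (C \<inter> X) + (?H (A m) + (\<Sum>i. ?H (R (i + m))))"
        using 1 by (rule add_left_mono)
      also have "... <= ?H X + (\<Sum>i. ?H (R (i + m)))"
        using 2 by (simp add: add.assoc[symmetric] add_right_mono)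
      finally show ?thesis .
    qed
    have "(%m. \<Sum>i. ?H (R (i + m))) \<longlonglongrightarrow> 0"
    proof -
      have "?H (R i) ~= \<infinity>" for i
        using sumfin by (metis ennreal_suminf_lessD infinity_ennreal_def top.not_eq_extremum)
      then have eq: "ennreal (enn2real (?H (R i))) = ?H (R i)" for i
        by (simp add: less_top)
      then have summ: "summable (%i. enn2real (?H (R i)))"
        using sumfin by (intro summable_suminf_not_top) auto
      have "(\<Sum>i. ?H (R (i + m))) = ennreal (\<Sum>i. enn2real (?H (R (i + m))))" for m
        using suminf_ennreal2[OF _ summable_ignore_initial_segment[OF summ, of m]] eq by simp
      moreover have "(%m. \<Sum>i. enn2real (?H (R (i + m)))) \<longlonglongrightarrow> 0"
        by (rule suminf_exist_split2[OF summ])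
      ultimately show ?thesis using tendsto_ennrealI by fastforce
    qed
    then have "(%m. ?H X + (\<Sum>i. ?H (R (i + m)))) \<longlonglongrightarrow> ?H X + 0"
      by (intro tendsto_intros) auto
    then show ?thesis using bound by (intro LIMSEQ_le_const[where X = "%m. ?H X + (\<Sum>i. ?H (R (i + m)))"]) auto
  qed
qed

text \<open>The sets that split every test set additively form a sigma-algebra on which the outer
  measure is countably additive; it contains the closed sets and hence the Borel sets.\<close>

lemma measure_space_hausdorff:
  assumes d: "d >= 1"
  shows "measure_space UNIV (sets (borel :: 'a::metric_space measure)) (hausdorff_outer_measure d)"
proof -
  let ?H = "hausdorff_outer_measure d :: 'a set => ennreal"
  interpret P: sigma_algebra UNIV "Pow (UNIV :: 'a set)" by (rule sigma_algebra_Pow)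
  have "outer_measure_space (Pow UNIV) ?H"
    unfolding outer_measure_space_def positive_def increasing_def countably_subadditive_def
    by (auto intro: hausdorff_outer_measure_mono hausdorff_outer_measure_empty[OF d] hausdorff_outer_measure_subadditive)
  then have ms: "measure_space UNIV (lambda_system UNIV (Pow UNIV) ?H) ?H"
    by (rule P.caratheodory_lemma)
  then have sa: "sigma_algebra UNIV (lambda_system UNIV (Pow UNIV) ?H)"
    by (simp add: measure_space_def)
  have "sets (borel :: 'a measure) = sigma_sets UNIV {S. closed S}"
    by (simp add: borel_eq_closed)
  also have "... \<subseteq> lambda_system UNIV (Pow UNIV) ?H"
    by (rule sigma_algebra.sigma_sets_subset[OF sa])
       (auto simp: lambda_system_def hausdorff_outer_measure_closed_split[OF d])
  finally have sub: "sets (borel :: 'a measure) \<subseteq> lambda_system UNIV (Pow UNIV) ?H" .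
  have "sigma_algebra UNIV (sets (borel :: 'a measure))"
    using sets.sigma_algebra_axioms[of "borel :: 'a measure"] by simp
  then show ?thesis by (rule measure_down[OF ms _ sub])
qed

lemma sets_surface_measure [simp, measurable_cong]: "sets surface_measure = sets borel"
  using sets.sets_measure_of_eq[of borel] by (simp add: surface_measure_def)

lemma space_surface_measure [simp]: "space surface_measure = UNIV"
  using sets_eq_imp_space_eq[OF sets_surface_measure] by simp

text \<open>\<open>measure_of\<close> gives the zero measure unless its third argument is countably
  additive, so this rests on the Caratheodory argument. Real dimension at least 2 makes the
  Hausdorff dimension positive.\<close>

lemma emeasure_surface_measure:
  fixes A :: "'a::euclidean_space set"
  assumes "2 <= DIM('a)" "A \<in> sets borel"
  shows "emeasure surface_measure A = hausdorff_outer_measure (DIM('a) - 1) A"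
  unfolding surface_measure_def
proof (rule emeasure_measure_of_sigma)
  have ms: "measure_space UNIV (sets (borel :: 'a measure)) (hausdorff_outer_measure (DIM('a) - 1))"
    using assms by (intro measure_space_hausdorff) auto
  then show "sigma_algebra UNIV (sets (borel :: 'a measure))"
    "positive (sets (borel :: 'a measure)) (hausdorff_outer_measure (DIM('a) - 1))"
    "countably_additive (sets (borel :: 'a measure)) (hausdorff_outer_measure (DIM('a) - 1))"
    by (auto simp: measure_space_def)
qed (use assms in auto)

text \<open>The balls used at scale \<delta> have total content \<open>card F\<close> times a
  multiple of \<open>\<delta> ^ d\<close>, which the counting hypothesis bounds independently of
  \<delta>.\<close>

lemma hausdorff_outer_measure_le_card:
  fixes A :: "'a::euclidean_space set" and \<kappa> B :: real
  assumes d: "d >= 1" and \<delta>0: "\<delta>0 > 0" and \<kappa>: "\<kappa> >= 0"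
    and cov: "\<And>\<delta>. 0 < \<delta> ==> \<delta> < \<delta>0 ==> \<exists>F. finite F \<and> A \<subseteq> (\<Union>x\<in>F. cball x (\<kappa> * \<delta>)) \<and> real (card F) * \<delta> ^ d <= B"
  shows "hausdorff_outer_measure d A <= ennreal (unit_ball_vol (real d) * \<kappa> ^ d * B)"
  unfolding hausdorff_outer_measure_def
proof (rule SUP_least)
  fix \<delta>' :: real assume "\<delta>' \<in> {0<..}"
  then have \<delta>': "\<delta>' > 0" by simp
  \<comment> \<open>Small enough that balls of radius \<open>\<kappa> * \<delta>\<close> have
    diameter at most \<delta>'; the summand 1 covers \<open>\<kappa> = 0\<close>.\<close>
  define \<delta> where "\<delta> = min (\<delta>0 / 2) (\<delta>' / (2 * \<kappa> + 1))"
  have \<delta>: "0 < \<delta>" "\<delta> < \<delta>0" using \<delta>0 \<delta>' \<kappa> by (auto simp: \<delta>_def)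
  have "\<delta> <= \<delta>' / (2 * \<kappa> + 1)" by (simp add: \<delta>_def)
  then have "\<delta> * (2 * \<kappa> + 1) <= \<delta>'" using \<kappa> by (simp add: pos_le_divide_eq)
  then have \<delta>\<kappa>: "2 * (\<kappa> * \<delta>) <= \<delta>'" using \<delta> by (simp add: algebra_simps)
  obtain F where F: "finite F" "A \<subseteq> (\<Union>x\<in>F. cball x (\<kappa> * \<delta>))" "real (card F) * \<delta> ^ d <= B"
    using cov[OF \<delta>] by blast
  obtain h where h: "bij_betw h {..<card F} F"
    using F(1) by (metis atLeast0LessThan ex_bij_betw_nat_finite)
  define E where "E i = (if i < card F then cball (h i) (\<kappa> * \<delta>) else {})" for i
  have diam: "diameter (E i) <= 2 * (\<kappa> * \<delta>)" for i
  proof -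
    have "diameter (cball x (\<kappa> * \<delta>)) <= 2 * (\<kappa> * \<delta>)" for x :: 'a
      using \<kappa> \<delta> by (simp add: diameter_cball)
    then show ?thesis using \<kappa> \<delta> by (auto simp: E_def)
  qed
  have "hausdorff_content d \<delta>' A <= (\<Sum>i. ennreal (unit_ball_vol (real d) * (diameter (E i) / 2) ^ d))"
  proof (rule hausdorff_content_le)
    show "A \<subseteq> (\<Union>i. E i)"
    proof
      fix x assume "x \<in> A"
      then obtain y where y: "y \<in> F" "x \<in> cball y (\<kappa> * \<delta>)" using F(2) by blast
      then obtain i where "i < card F" "h i = y" using h unfolding bij_betw_def by (metis imageE lessThan_iff)
      then have "x \<in> E i" using y by (simp add: E_def)
      then show "x \<in> (\<Union>i. E i)" by blast
    qed
    show "diameter (E i) <= \<delta>'" for i using diam[of i] \<delta>\<kappa> by linarith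
  qed (auto simp: E_def)
  also have "... = (\<Sum>i<card F. ennreal (unit_ball_vol (real d) * (diameter (E i) / 2) ^ d))"
    using d by (intro suminf_finite) (auto simp: E_def)
  also have "... <= (\<Sum>i<card F. ennreal (unit_ball_vol (real d) * (\<kappa> * \<delta>) ^ d))"
  proof (intro sum_mono ennreal_leI mult_left_mono power_mono)
    fix i show "diameter (E i) / 2 <= \<kappa> * \<delta>" using diam[of i] by simp
    show "0 <= diameter (E i) / 2" by (cases "i < card F") (auto simp: E_def diameter_ge_0)
  qed auto
  also have "... = ennreal (real (card F) * (unit_ball_vol (real d) * (\<kappa> * \<delta>) ^ d))"
    by (simp add: ennreal_mult' ennreal_of_nat_eq_real_of_nat)
  also have "... <= ennreal (unit_ball_vol (real d) * \<kappa> ^ d * B)"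
  proof (rule ennreal_leI)
    have "real (card F) * (unit_ball_vol (real d) * (\<kappa> * \<delta>) ^ d) =
        (unit_ball_vol (real d) * \<kappa> ^ d) * (real (card F) * \<delta> ^ d)"
      by (simp add: power_mult_distrib)
    also have "... <= (unit_ball_vol (real d) * \<kappa> ^ d) * B"
      using F(3) \<kappa> by (intro mult_left_mono) auto
    finally show "real (card F) * (unit_ball_vol (real d) * (\<kappa> * \<delta>) ^ d) <= unit_ball_vol (real d) * \<kappa> ^ d * B" .
  qed
  finally show "hausdorff_content d \<delta>' A <= ennreal (unit_ball_vol (real d) * \<kappa> ^ d * B)" .
qed

text \<open>The mass distribution principle: a cover of A has content at least proportional to the
  mass of A. Covering sets may fail to be measurable, so the growth condition speaks of a measurable
  superset G of \<open>E \<inter> A\<close>.\<close>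

lemma emeasure_le_hausdorff_outer_measure:
  fixes \<mu> :: "'a::metric_space measure"
  assumes "C > 0" "\<delta>0 > 0" and A: "A \<in> sets \<mu>"
    and bnd: "\<And>E. bounded E ==> E ~= {} ==> diameter E < \<delta>0 ==>
      \<exists>G\<in>sets \<mu>. E \<inter> A \<subseteq> G \<and> emeasure \<mu> G <= ennreal (C * diameter E ^ d)"
    and d: "d >= 1"
  shows "emeasure \<mu> A <= ennreal (C * 2 ^ d / unit_ball_vol (real d)) * hausdorff_outer_measure d A"
proof -
  let ?K = "C * 2 ^ d / unit_ball_vol (real d)"
  have vp: "unit_ball_vol (real d) > 0" by simp
  have Kp: "?K > 0" using \<open>C > 0\<close> vp by simp
  have "emeasure \<mu> A / ennreal ?K <= hausdorff_content d (\<delta>0/2) A"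
    unfolding hausdorff_content_def
  proof (rule INF_greatest, clarify)
      fix E :: "nat => 'a set"
      assume cov: "A \<subseteq> \<Union> (range E)" and E: "\<forall>i. bounded (E i) \<and> diameter (E i) <= \<delta>0 / 2"
      have "\<exists>G\<in>sets \<mu>. E i \<inter> A \<subseteq> G \<and> emeasure \<mu> G <= ennreal (C * diameter (E i) ^ d)" for i
      proof (cases "E i = {}")
        case False
        have "diameter (E i) < \<delta>0" using E \<open>\<delta>0 > 0\<close> by (smt (verit) field_sum_of_halves)
        then show ?thesis using bnd E False by blast
      qed (auto intro!: bexI[of _ "{}"])
      then obtain G where G: "\<And>i. G i \<in> sets \<mu>" "\<And>i. E i \<inter> A \<subseteq> G i"
          "\<And>i. emeasure \<mu> (G i) <= ennreal (C * diameter (E i) ^ d)"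
        by metis
      have "A \<subseteq> (\<Union>i. G i)" using cov G(2) by blast
      then have "emeasure \<mu> A <= emeasure \<mu> (\<Union>i. G i)"
        using G by (intro emeasure_mono) auto
      also have "... <= (\<Sum>i. emeasure \<mu> (G i))"
        using G by (intro emeasure_subadditive_countably) auto
      also have "... <= (\<Sum>i. ennreal ?K * ennreal (unit_ball_vol (real d) * (diameter (E i) / 2) ^ d))"
      proof (rule suminf_le)
        fix i
        have "C * diameter (E i) ^ d = ?K * (unit_ball_vol (real d) * (diameter (E i) / 2) ^ d)"
          using less_imp_neq[OF vp] by (simp add: power_divide)
        then show "emeasure \<mu> (G i) <= ennreal ?K * ennreal (unit_ball_vol (real d) * (diameter (E i) / 2) ^ d)"
          using G(3)[of i] Kp by (simp only: ennreal_mult'[OF less_imp_le[OF Kp], symmetric])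
      qed auto
      also have "... = ennreal ?K * (\<Sum>i. ennreal (unit_ball_vol (real d) * (diameter (E i) / 2) ^ d))"
        by simp
      finally show "emeasure \<mu> A / ennreal ?K <= (\<Sum>i. ennreal (unit_ball_vol (real d) * (diameter (E i) / 2) ^ d))"
        using Kp by (intro divide_le_posI_ennreal) auto
  qed
  also have "... <= hausdorff_outer_measure d A"
    using \<open>\<delta>0 > 0\<close> by (intro hausdorff_content_le_outer_measure) auto
  finally have "ennreal ?K * (emeasure \<mu> A / ennreal ?K) <= ennreal ?K * hausdorff_outer_measure d A"
    by (rule mult_left_mono) auto
  then show ?thesis
    using Kp by (simp add: ennreal_times_divide mult.commute[of _ "emeasure \<mu> A"] ennreal_mult_divide_eq ennreal_eq_0_iff not_le)
qed

section \<open>Square integrable functions: Cauchy-Schwarz, the Riesz theorem, completeness\<close>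

section \<open>Hilbert spaces of functions\<close>

definition ip :: "'a measure => ('a => complex) => ('a => complex) => complex" where
  "ip M f g = (\<integral>z. f z * cnj (g z) \<partial>M)"

text \<open>The square of a seminorm only: functions that agree almost everywhere are not
  identified.\<close>

definition nsq :: "'a measure => ('a => complex) => real" where
  "nsq M f = (\<integral>z. (norm (f z))\<^sup>2 \<partial>M)"

lemma borel_measurable_cnj [measurable (raw)]:
  "f \<in> borel_measurable M ==> (%x. cnj (f x)) \<in> borel_measurable M"
  by (rule measurable_compose[OF _ borel_measurable_continuous_onI[OF continuous_on_cnj[OF continuous_on_id]]])

lemma square_integrable_prod:
  assumes "square_integrable M f" "square_integrable M g"
  shows "integrable M (%z. f z * cnj (g z))"
proof (rule Bochner_Integration.integrable_bound)
  have [measurable]: "f \<in> borel_measurable M" "g \<in> borel_measurable M"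
    using assms by (auto simp: square_integrable_def)
  show "integrable M (%z. (norm (f z))\<^sup>2 + (norm (g z))\<^sup>2)"
    using assms by (auto simp: square_integrable_def)
  show "(%z. f z * cnj (g z)) \<in> borel_measurable M" by measurable
  have "a * b <= \<bar>a\<^sup>2 + b\<^sup>2\<bar>" if "a >= 0" "b >= 0" for a b :: real
    using sum_squares_bound[of a b] mult_nonneg_nonneg[OF that] by simp
  then show "AE z in M. norm (f z * cnj (g z)) <= norm ((norm (f z))\<^sup>2 + (norm (g z))\<^sup>2)"
    by (intro AE_I2) (simp add: norm_mult)
qed

lemma norm_add_sq_le: "(norm (x + y :: complex))\<^sup>2 <= 2 * (norm x)\<^sup>2 + 2 * (norm y)\<^sup>2"
proof -
  have "(norm (x + y))\<^sup>2 <= (norm x + norm y)\<^sup>2" by (intro power_mono norm_triangle_ineq) auto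
  also have "... <= 2 * (norm x)\<^sup>2 + 2 * (norm y)\<^sup>2"
    using sum_squares_bound[of "norm x" "norm y"] by (simp add: power2_sum)
  finally show ?thesis .
qed

lemma square_integrable_lin:
  assumes "square_integrable M f" "square_integrable M g"
  shows "square_integrable M (%z. c * f z + g z)"
  unfolding square_integrable_def
proof
  have [measurable]: "f \<in> borel_measurable M" "g \<in> borel_measurable M"
    using assms by (auto simp: square_integrable_def)
  show "(%z. c * f z + g z) \<in> borel_measurable M" by measurable
  show "integrable M (%z. (norm (c * f z + g z))\<^sup>2)"
  proof (rule Bochner_Integration.integrable_bound)
    show "integrable M (%z. 2 * ((norm c)\<^sup>2 * (norm (f z))\<^sup>2) + 2 * (norm (g z))\<^sup>2)"
      using assms by (auto simp: square_integrable_def)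
    show "AE z in M. norm ((norm (c * f z + g z))\<^sup>2) <= norm (2 * ((norm c)\<^sup>2 * (norm (f z))\<^sup>2) + 2 * (norm (g z))\<^sup>2)"
      using norm_add_sq_le[of "c * f _" "g _"] by (intro AE_I2) (simp add: norm_mult power_mult_distrib)
  qed measurable
qed

lemma square_integrable_diff:
  assumes "square_integrable M f" "square_integrable M g"
  shows "square_integrable M (%z. f z - g z)"
  using square_integrable_lin[OF assms(2,1), of "-1"] by simp

lemma nsq_nonneg [simp]: "0 <= nsq M f"
  by (simp add: nsq_def)

lemma nsq_minus_commute: "nsq M (%z. f z - g z) = nsq M (%z. g z - f z)"
  by (simp add: nsq_def norm_minus_commute)

lemma ip_lin_left:
  assumes "square_integrable M f" "square_integrable M g" "square_integrable M h"
  shows "ip M (%z. c * f z + g z) h = c * ip M f h + ip M g h"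
proof -
  have "ip M (%z. c * f z + g z) h = (\<integral>z. c * (f z * cnj (h z)) + g z * cnj (h z) \<partial>M)"
    by (simp add: ip_def algebra_simps)
  also have "... = c * ip M f h + ip M g h"
    using square_integrable_prod[OF assms(1,3)] square_integrable_prod[OF assms(2,3)]
    by (simp add: ip_def)
  finally show ?thesis .
qed

lemma ip_commute: "ip M g f = cnj (ip M f g)"
proof -
  have "cnj (ip M f g) = (\<integral>z. cnj (f z * cnj (g z)) \<partial>M)"
    unfolding ip_def by (rule Bochner_Integration.integral_cnj[symmetric])
  then show ?thesis by (simp add: ip_def mult.commute)
qed

lemma ip_lin_right:
  assumes "square_integrable M f" "square_integrable M g" "square_integrable M h"
  shows "ip M h (%z. c * f z + g z) = cnj c * ip M h f + ip M h g"
  using ip_lin_left[OF assms, of c] by (metis complex_cnj_add complex_cnj_mult ip_commute)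

lemma ip_diff_left:
  assumes "square_integrable M f" "square_integrable M g" "square_integrable M h"
  shows "ip M (%z. f z - g z) h = ip M f h - ip M g h"
  using ip_lin_left[OF assms(2,1,3), of "-1"] by simp

lemma ip_diff_right:
  assumes "square_integrable M f" "square_integrable M g" "square_integrable M h"
  shows "ip M h (%z. f z - g z) = ip M h f - ip M h g"
  using ip_lin_right[OF assms(2,1,3), of "-1"] by simp

lemma ip_self: "ip M f f = complex_of_real (nsq M f)"
proof -
  have "ip M f f = (\<integral>z. complex_of_real ((norm (f z))\<^sup>2) \<partial>M)"
    by (simp only: ip_def complex_norm_square)
  also have "... = complex_of_real (nsq M f)"
    unfolding nsq_def by (rule integral_complex_of_real)
  finally show ?thesis .
qed

lemma nsq_lin:
  assumes "square_integrable M f" "square_integrable M g"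
  shows "nsq M (%z. c * f z + g z) = (norm c)\<^sup>2 * nsq M f + nsq M g + 2 * Re (c * ip M f g)"
proof -
  let ?h = "%z. c * f z + g z"
  have h: "square_integrable M ?h" using assms by (rule square_integrable_lin)
  have "complex_of_real (nsq M ?h) = c * ip M f ?h + ip M g ?h"
    using ip_lin_left[OF assms h, of c] by (simp add: ip_self)
  also have "... = c * (cnj c * ip M f f + ip M f g) + (cnj c * ip M g f + ip M g g)"
    using ip_lin_right[OF assms assms(1), of c] ip_lin_right[OF assms assms(2), of c] by simp
  also have "... = complex_of_real ((norm c)\<^sup>2 * nsq M f + nsq M g) + (c * ip M f g + cnj (c * ip M f g))"
    using complex_norm_square[of c] by (simp add: ip_self algebra_simps ip_commute[of M g f])
  also have "... = complex_of_real ((norm c)\<^sup>2 * nsq M f + nsq M g + 2 * Re (c * ip M f g))"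
    by (simp only: complex_add_cnj of_real_add of_real_mult)
  finally show ?thesis by (simp only: of_real_eq_iff)
qed

lemma nsq_scale: "nsq M (%z. c * f z) = (norm c)\<^sup>2 * nsq M f"
  by (simp add: nsq_def norm_mult power_mult_distrib)

text \<open>A quadratic function that is minimal at \<open>c = 0\<close> has no linear part: a small
  step in the direction \<open>- cnj w\<close> would decrease it. The step length 1/(a+1) is small
  enough for every \<open>a >= 0\<close>.\<close>

lemma ip_zero_of_minimal:
  fixes w :: complex and a :: real
  assumes "\<And>c :: complex. 0 <= (norm c)\<^sup>2 * a + 2 * Re (c * w)" "a >= 0"
  shows "w = 0"
proof (rule ccontr)
  assume w: "w ~= 0"
  define t where "t = 1 / (a + 1)"
  have t: "t > 0" "t * a < 1" using assms(2) by (auto simp: t_def field_simps)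
  have "- (of_real t * cnj w) * w = of_real (- t * (norm w)\<^sup>2)"
    using complex_norm_square[of w] by (simp add: algebra_simps)
  then have re: "Re (- (of_real t * cnj w) * w) = - t * (norm w)\<^sup>2" by (simp only: Re_complex_of_real)
  have "0 <= (norm (- (of_real t * cnj w)))\<^sup>2 * a + 2 * Re (- (of_real t * cnj w) * w)"
    by (rule assms(1))
  also have "... = t * (norm w)\<^sup>2 * (t * a - 2)"
    unfolding re using t by (simp add: norm_mult power_mult_distrib algebra_simps power2_eq_square)
  also have "... < 0" using t w by (intro mult_pos_neg) auto
  finally show False by simp
qed

lemma cauchy_schwarz:
  assumes f: "square_integrable M f" and g: "square_integrable M g"
  shows "(norm (ip M f g))\<^sup>2 <= nsq M f * nsq M g"
\<comment> \<open>A function of seminorm 0 need not be the zero function. In this case the squared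
  seminorm of \<open>t c f + g\<close> is affine in the real number t and bounded below, so its
  linear term vanishes.\<close>
proof (cases "nsq M f = 0")
  case True
  have "ip M f g = 0"
  proof (rule ip_zero_of_minimal)
    fix c
    have *: "0 <= nsq M g + t * (2 * Re (c * ip M f g))" for t :: real
    proof -
      have "0 <= nsq M (%z. (of_real t * c) * f z + g z)" by (rule nsq_nonneg)
      also have "... = nsq M g + 2 * Re (of_real t * (c * ip M f g))"
        using True nsq_lin[OF f g, of "of_real t * c"] by (simp only: mult.assoc mult_zero_right add_0_left)
      finally show ?thesis by (simp only: Re_complex_of_real times_complex.sel Im_complex_of_real) (simp add: algebra_simps)
    qed
    have "2 * Re (c * ip M f g) >= 0"
    proof (rule ccontr)
      assume neg: "\<not> 2 * Re (c * ip M f g) >= 0"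
      define s where "s = 2 * Re (c * ip M f g)"
      have "s < 0" using neg by (simp add: s_def)
      then have "((nsq M g + 1) / (- s)) * s = - (nsq M g + 1)" by simp
      then show False using *[of "(nsq M g + 1) / (- s)"] by (simp add: s_def)
    qed
    then show "0 <= (norm c)\<^sup>2 * 0 + 2 * Re (c * ip M f g)" by simp
  qed simp
  then show ?thesis by simp
next
  case False
  then have a: "nsq M f > 0" using nsq_nonneg[of M f] by linarith
  define w where "w = ip M f g"
  \<comment> \<open>The minimiser of the squared seminorm of \<open>c f + g\<close>.\<close>
  define c where "c = - (cnj w / of_real (nsq M f))"
  have "c * w = of_real (- (norm w)\<^sup>2 / nsq M f)"
    using complex_norm_square[of w] by (simp add: c_def algebra_simps)
  then have re: "Re (c * w) = - (norm w)\<^sup>2 / nsq M f" by (simp only: Re_complex_of_real)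
  have nc: "(norm c)\<^sup>2 = (norm w)\<^sup>2 / (nsq M f)\<^sup>2"
    using a by (simp add: c_def norm_divide power_divide)
  have "0 <= nsq M (%z. c * f z + g z)" by simp
  also have "... = nsq M g - (norm w)\<^sup>2 / nsq M f"
    unfolding nsq_lin[OF f g] w_def[symmetric] re nc using a by (simp add: field_simps power2_eq_square)
  finally have "(norm w)\<^sup>2 / nsq M f <= nsq M g" by simp
  then show ?thesis using a by (simp add: w_def field_simps)
qed

lemma cauchy_schwarz_sqrt:
  assumes f: "square_integrable M f" and g: "square_integrable M g"
  shows "norm (ip M f g) <= sqrt (nsq M f) * sqrt (nsq M g)"
  using real_le_rsqrt[OF cauchy_schwarz[OF assms]] by (simp add: real_sqrt_mult)

lemma nsq_triangle:
  assumes f: "square_integrable M f" and g: "square_integrable M g"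
  shows "sqrt (nsq M (%z. f z + g z)) <= sqrt (nsq M f) + sqrt (nsq M g)"
proof (rule real_le_lsqrt)
  have "nsq M (%z. f z + g z) = nsq M f + nsq M g + 2 * Re (ip M f g)"
    using nsq_lin[OF assms, of 1] by simp
  also have "... <= nsq M f + nsq M g + 2 * (sqrt (nsq M f) * sqrt (nsq M g))"
    using cauchy_schwarz_sqrt[OF assms] complex_Re_le_cmod[of "ip M f g"] by linarith
  also have "... = (sqrt (nsq M f) + sqrt (nsq M g))\<^sup>2"
    by (simp add: power2_sum)
  finally show "nsq M (%z. f z + g z) <= (sqrt (nsq M f) + sqrt (nsq M g))\<^sup>2" .
qed auto

lemma nsq_parallelogram:
  assumes f: "square_integrable M f" and g: "square_integrable M g"
  shows "nsq M (%z. f z - g z) = 2 * nsq M f + 2 * nsq M g - 4 * nsq M (%z. (f z + g z) / 2)"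
proof -
  have "nsq M (%z. f z - g z) = nsq M f + nsq M g - 2 * Re (ip M g f)"
    using nsq_lin[OF g f, of "-1"] by simp
  moreover have "nsq M (%z. f z + g z) = nsq M f + nsq M g + 2 * Re (ip M f g)"
    using nsq_lin[OF f g, of 1] by simp
  moreover have "nsq M (%z. (f z + g z) / 2) = nsq M (%z. f z + g z) / 4"
    using nsq_scale[of M "1/2" "%z. f z + g z"] by (simp add: power_divide field_simps norm_divide)
  moreover have "Re (ip M g f) = Re (ip M f g)" by (subst ip_commute) simp
  ultimately show ?thesis by simp
qed

definition l2_cauchy :: "'a measure => (nat => 'a => complex) => bool" where
  "l2_cauchy M X \<longleftrightarrow> (\<forall>e>0. \<exists>N. \<forall>m\<ge>N. \<forall>k\<ge>N. nsq M (%z. X m z - X k z) < e)"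

text \<open>Pairs are kept because an element and the function it stands for may live on different
  sets, as boundary values and their extension do. Completeness is a statement about the first
  components: the limit must have some partner, with no convergence asked of the second
  components.\<close>

locale function_hilbert =
  fixes M :: "'a measure" and H :: "(('a => complex) \<times> ('a => complex)) set"
  assumes ne: "H ~= {}"
    and sq: "(f, F) \<in> H ==> square_integrable M f"
    and lin: "(f, F) \<in> H ==> (g, G) \<in> H ==> (%z. c * f z + g z, %z. c * F z + G z) \<in> H"
    and complete: "(\<And>k. X k \<in> H) ==> l2_cauchy M (%k. fst (X k)) ==>
      \<exists>f F. (f, F) \<in> H \<and> (%k. nsq M (%z. fst (X k) z - f z)) \<longlonglongrightarrow> 0"
begin

lemma zero: "(%z. 0, %z. 0) \<in> H"
proof -
  obtain f F where "(f, F) \<in> H" using ne by auto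
  from lin[OF this this, of "-1"] show ?thesis by simp
qed

lemma scale: "(f, F) \<in> H ==> (%z. c * f z, %z. c * F z) \<in> H"
  using lin[OF _ zero, of f F c] by simp

lemma diff: "(f, F) \<in> H ==> (g, G) \<in> H ==> (%z. f z - g z, %z. F z - G z) \<in> H"
  using lin[of g G f F "-1"] by simp

text \<open>\<Lambda> acts on the second component and is bounded by the norm of the first. The
  representer is a multiple of the element of least norm on the affine hyperplane where \<Lambda> is
  1; that element is orthogonal to the kernel of \<Lambda>.\<close>

lemma riesz:
  assumes \<Lambda>lin: "\<And>f F g G c. (f, F) \<in> H ==> (g, G) \<in> H ==> \<Lambda> (%z. c * F z + G z) = c * \<Lambda> F + \<Lambda> G"
    and \<Lambda>bound: "\<And>f F. (f, F) \<in> H ==> norm (\<Lambda> F) <= C * sqrt (nsq M f)"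
  shows "\<exists>k \<kappa>. (k, \<kappa>) \<in> H \<and> (\<forall>(f, F)\<in>H. \<Lambda> F = ip M f k)"
proof (cases "\<exists>(f, F)\<in>H. \<Lambda> F = 1")
  \<comment> \<open>If 1 is not a value, then \<Lambda> vanishes identically, by scaling.\<close>
  case False
  have "\<Lambda> F = 0" if H: "(f, F) \<in> H" for f F
  proof (rule ccontr)
    assume nz: "\<Lambda> F ~= 0"
    have "\<Lambda> (%z. 0) = 0" using \<Lambda>lin[OF zero zero, of 1] by simp
    then have "\<Lambda> (%z. inverse (\<Lambda> F) * F z) = 1" using \<Lambda>lin[OF H zero, of "inverse (\<Lambda> F)"] nz by simp
    then show False using False scale[OF H, of "inverse (\<Lambda> F)"] by blast
  qed
  then show ?thesis using zero by (auto simp: ip_def intro!: exI[of _ "%z. 0"])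
next
  case True
  define A where "A = {nsq M f | f F. (f, F) \<in> H \<and> \<Lambda> F = 1}"
  define d where "d = Inf A"
  have Ane: "A ~= {}" using True by (auto simp: A_def)
  have Abdd: "bdd_below A" by (auto simp: A_def intro!: bdd_belowI[of _ 0])
  have dle: "d <= nsq M f" if "(f, F) \<in> H" "\<Lambda> F = 1" for f F
    unfolding d_def by (rule cInf_lower[OF _ Abdd]) (use that in \<open>auto simp: A_def\<close>)
  have "\<exists>f F. (f, F) \<in> H \<and> \<Lambda> F = 1 \<and> nsq M f < d + 1 / real (Suc k)" for k :: nat
  proof -
    have "\<exists>a\<in>A. a < d + 1 / real (Suc k)"
      unfolding d_def by (rule cInf_lessD[OF Ane]) simp
    then show ?thesis by (auto simp: A_def)
  qed
  then obtain x X where X: "\<And>k. (x k, X k) \<in> H" "\<And>k. \<Lambda> (X k) = 1"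
      "\<And>k :: nat. nsq M (x k) < d + 1 / real (Suc k)"
    by metis
  have sqx: "square_integrable M (x k)" for k using X(1) sq by blast
  \<comment> \<open>The midpoint of two elements of the hyperplane lies in it, so its squared norm
    is at least d; the parallelogram law then makes a minimising sequence Cauchy.\<close>
  have close: "nsq M (%z. x m z - x k z) <= 2 / real (Suc m) + 2 / real (Suc k)" for m k
  proof -
    have "(%z. (1/2) * x m z + (1/2) * x k z, %z. (1/2) * X m z + (1/2) * X k z) \<in> H"
      using lin[OF X(1)[of m] scale[OF X(1)[of k], of "1/2"], of "1/2"] .
    moreover have "\<Lambda> (%z. (1/2) * X m z + (1/2) * X k z) = 1"
    proof -
      have "\<Lambda> (%z. 0) = 0" using \<Lambda>lin[OF zero zero, of 1] by simp
      then have h: "\<Lambda> (%z. (1/2) * X k z) = 1/2"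
        using \<Lambda>lin[OF X(1)[of k] zero, of "1/2"] unfolding X(2) by (simp only: add_0_right mult_1_right)
      then show ?thesis
        unfolding \<Lambda>lin[OF X(1)[of m] scale[OF X(1)[of k], of "1/2"], of "1/2"] X(2) h by simp
    qed
    ultimately have "d <= nsq M (%z. (1/2) * x m z + (1/2) * x k z)" by (rule dle)
    also have "... = nsq M (%z. (x m z + x k z) / 2)" by (simp add: add_divide_distrib)
    finally have "d <= nsq M (%z. (x m z + x k z) / 2)" .
    moreover have "2 / real (Suc m) = 2 * (1 / real (Suc m))" "2 / real (Suc k) = 2 * (1 / real (Suc k))" by simp_all
    ultimately show ?thesis
      using nsq_parallelogram[OF sqx[of m] sqx[of k]] X(3)[of m] X(3)[of k] by linarith
  qed
  have "l2_cauchy M x"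
    unfolding l2_cauchy_def
  proof (intro allI impI)
    fix e :: real assume e: "e > 0"
    then obtain N where N: "1 / real (Suc N) < e / 4" using nat_approx_posE[of "e/4"] by auto
    have "nsq M (%z. x m z - x k z) < e" if mk: "m >= N" "k >= N" for m k
    proof -
      have "2 / real (Suc m) <= 2 / real (Suc N)" "2 / real (Suc k) <= 2 / real (Suc N)"
        using mk by (auto intro!: divide_left_mono)
      moreover have "2 / real (Suc N) < e / 2" using N by simp
      ultimately show ?thesis using close[of m k] by linarith
    qed
    then show "\<exists>N. \<forall>m\<ge>N. \<forall>k\<ge>N. nsq M (%z. x m z - x k z) < e" by blast
  qed
  then obtain f0 F0 where f0: "(f0, F0) \<in> H" and conv: "(%k. nsq M (%z. x k z - f0 z)) \<longlonglongrightarrow> 0"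
    using complete[of "%k. (x k, X k)"] X(1) by auto
  have sq0: "square_integrable M f0" using f0 sq by blast
  have conv': "(%k. sqrt (nsq M (%z. x k z - f0 z))) \<longlonglongrightarrow> 0"
    using tendsto_real_sqrt[OF conv] by simp
  have \<Lambda>0: "\<Lambda> F0 = 1"
  proof -
    have "norm (1 - \<Lambda> F0) <= C * sqrt (nsq M (%z. x k z - f0 z))" for k
    proof -
      have "\<Lambda> (%z. X k z - F0 z) = 1 - \<Lambda> F0"
        using \<Lambda>lin[OF f0 X(1)[of k], of "-1"] X(2)[of k] by simp
      then show ?thesis using \<Lambda>bound[OF diff[OF X(1)[of k] f0]] by simp
    qed
    moreover have "(%k. C * sqrt (nsq M (%z. x k z - f0 z))) \<longlonglongrightarrow> C * 0"
      by (intro tendsto_intros conv')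
    ultimately have "norm (1 - \<Lambda> F0) <= C * 0"
      by (intro LIMSEQ_le_const[where X = "%k. C * sqrt (nsq M (%z. x k z - f0 z))"]) auto
    then show ?thesis by simp
  qed
  have "sqrt (nsq M f0) <= sqrt d"
  proof -
    have "sqrt (nsq M f0) <= sqrt (d + 1 / real (Suc k)) + sqrt (nsq M (%z. x k z - f0 z))" for k
    proof -
      have "sqrt (nsq M f0) <= sqrt (nsq M (x k)) + sqrt (nsq M (%z. f0 z - x k z))"
        using nsq_triangle[OF sqx[of k] square_integrable_diff[OF sq0 sqx[of k]]] by simp
      moreover have "sqrt (nsq M (x k)) <= sqrt (d + 1 / real (Suc k))"
        using X(3)[of k] by (intro real_sqrt_le_mono) simp
      ultimately show ?thesis unfolding nsq_minus_commute[of M "x k" f0] by linarith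
    qed
    moreover have "(%k. sqrt (d + 1 / real (Suc k)) + sqrt (nsq M (%z. x k z - f0 z))) \<longlonglongrightarrow> sqrt (d + 0) + 0"
      by (intro tendsto_intros conv' LIMSEQ_Suc[OF lim_1_over_n])
    ultimately have "sqrt (nsq M f0) <= sqrt (d + 0) + 0"
      by (intro LIMSEQ_le_const[where X = "%k. sqrt (d + 1 / real (Suc k)) + sqrt (nsq M (%z. x k z - f0 z))"]) auto
    then show ?thesis by simp
  qed
  then have min: "nsq M f0 <= d" by simp
  \<comment> \<open>Moving \<open>f0\<close> along the kernel of \<Lambda> stays in the hyperplane,
    where \<open>f0\<close> is minimal.\<close>
  have orth: "ip M h f0 = 0" if h: "(h, G) \<in> H" and \<Lambda>h: "\<Lambda> G = 0" for h G
  proof (rule ip_zero_of_minimal)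
    fix c
    have "d <= nsq M (%z. c * h z + f0 z)"
      using \<Lambda>lin[OF h f0, of c] by (intro dle[OF lin[OF h f0]]) (simp add: \<Lambda>h \<Lambda>0)
    then show "0 <= (norm c)\<^sup>2 * nsq M h + 2 * Re (c * ip M h f0)"
      using min nsq_lin[OF sq[OF h] sq0, of c] by simp
  qed simp
  have pos: "nsq M f0 > 0"
  proof -
    have "1 <= C * sqrt (nsq M f0)" using \<Lambda>bound[OF f0] \<Lambda>0 by simp
    then have "nsq M f0 ~= 0" by auto
    then show ?thesis using nsq_nonneg[of M f0] by linarith
  qed
  \<comment> \<open>Normalised so that the inner product of \<open>f0\<close> with its multiple by c
    is 1, the value of \<Lambda> at \<open>F0\<close>.\<close>
  define c where "c = complex_of_real (1 / nsq M f0)"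
  have "\<Lambda> F = ip M f (%z. c * f0 z)" if f: "(f, F) \<in> H" for f F
  proof -
    have "\<Lambda> (%z. (- \<Lambda> F) * F0 z + F z) = 0" using \<Lambda>lin[OF f0 f, of "- \<Lambda> F"] \<Lambda>0 by simp
    then have "ip M (%z. (- \<Lambda> F) * f0 z + f z) f0 = 0" by (rule orth[OF lin[OF f0 f]])
    then have "- \<Lambda> F * ip M f0 f0 + ip M f f0 = 0"
      using ip_lin_left[OF sq0 sq[OF f] sq0, of "- \<Lambda> F"] by (simp only:)
    then have "ip M f f0 = \<Lambda> F * nsq M f0"
      by (simp add: ip_self algebra_simps)
    moreover have "ip M f (%z. c * f0 z) = cnj c * ip M f f0"
      using ip_lin_right[OF sq0 sq[OF zero] sq[OF f], of c] by (simp add: ip_def)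
    ultimately show ?thesis using pos by (simp add: c_def)
  qed
  then show ?thesis using scale[OF f0, of c] by blast
qed

lemma reproducing_kernel_exists:
  assumes "\<And>w. w \<in> \<Omega> ==> \<exists>C. \<forall>(f, F)\<in>H. norm (F w) <= C * sqrt (nsq M f)"
  shows "is_reproducing_kernel M H \<Omega> (reproducing_kernel M H \<Omega>)"
proof -
  have "\<exists>k \<kappa>. (k, \<kappa>) \<in> H \<and> (\<forall>(f, F)\<in>H. F w = ip M f k)" if "w \<in> \<Omega>" for w
  proof -
    obtain C where C: "\<forall>(f, F)\<in>H. norm (F w) <= C * sqrt (nsq M f)" using assms \<open>w \<in> \<Omega>\<close> by blast
    show ?thesis by (rule riesz[where \<Lambda> = "%F. F w" and C = C]) (use C in auto)
  qed
  then obtain k \<kappa> where k: "\<And>w. w \<in> \<Omega> ==> (k w, \<kappa> w) \<in> H \<and> (\<forall>(f, F)\<in>H. F w = ip M f (k w))"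
    by metis
  have "is_reproducing_kernel M H \<Omega> (%z w. \<kappa> w z)"
    unfolding is_reproducing_kernel_def
  proof
    fix w assume "w \<in> \<Omega>"
    then show "\<exists>k. (k, %z. \<kappa> w z) \<in> H \<and> (\<forall>(f, F)\<in>H. F w = (\<integral>z. f z * cnj (k z) \<partial>M))"
      using k[of w] by (intro exI[of _ "k w"]) (auto simp: ip_def)
  qed
  then show ?thesis
    unfolding reproducing_kernel_def by (rule someI[of "is_reproducing_kernel M H \<Omega>"])
qed

end

text \<open>Fatou's lemma for \<open>X k - X (r l)\<close> with k fixed. Pointwise convergence along
  a subsequence suffices, since the Cauchy condition controls the whole sequence.\<close>

lemma l2_limit:
  assumes X: "\<And>k. square_integrable M (X k)" and cauchy: "l2_cauchy M X" and r: "strict_mono r"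
    and f [measurable]: "f \<in> borel_measurable M" and lim: "AE z in M. (%j. X (r j) z) \<longlonglongrightarrow> f z"
  shows "square_integrable M f" "(%k. nsq M (%z. X k z - f z)) \<longlonglongrightarrow> 0"
proof -
  have [measurable]: "X k \<in> borel_measurable M" for k using X by (auto simp: square_integrable_def)
  have nn: "(\<integral>\<^sup>+z. ennreal ((norm (f z))\<^sup>2) \<partial>M) = ennreal (nsq M f)" if "square_integrable M f" for f
    using that unfolding square_integrable_def nsq_def by (subst nn_integral_eq_integral) auto
  have bound: "\<exists>N. \<forall>k\<ge>N. (\<integral>\<^sup>+z. ennreal ((norm (X k z - f z))\<^sup>2) \<partial>M) <= ennreal e" if e: "e > 0" for e
  proof -
    obtain N where N: "\<And>m k. m >= N ==> k >= N ==> nsq M (%z. X m z - X k z) < e"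
      using cauchy e unfolding l2_cauchy_def by blast
    have "(\<integral>\<^sup>+z. ennreal ((norm (X k z - f z))\<^sup>2) \<partial>M) <= ennreal e" if k: "k >= N" for k
    proof -
      have "(\<integral>\<^sup>+z. ennreal ((norm (X k z - f z))\<^sup>2) \<partial>M) = (\<integral>\<^sup>+z. liminf (%l. ennreal ((norm (X k z - X (r l) z))\<^sup>2)) \<partial>M)"
      proof (rule nn_integral_cong_AE)
        show "AE z in M. ennreal ((norm (X k z - f z))\<^sup>2) = liminf (%l. ennreal ((norm (X k z - X (r l) z))\<^sup>2))"
          using lim
        proof eventually_elim
          case (elim z)
          have "(%l. ennreal ((norm (X k z - X (r l) z))\<^sup>2)) \<longlonglongrightarrow> ennreal ((norm (X k z - f z))\<^sup>2)"
            by (intro tendsto_ennrealI tendsto_intros elim)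
          from lim_imp_Liminf[OF _ this] show ?case by (simp only: trivial_limit_sequentially not_False_eq_True)
        qed
      qed
      also have "... <= liminf (%l. \<integral>\<^sup>+z. ennreal ((norm (X k z - X (r l) z))\<^sup>2) \<partial>M)"
        by (rule nn_integral_liminf) measurable
      also have "... <= liminf (%l. ennreal e)"
      proof (rule Liminf_mono)
        have "\<forall>l\<ge>N. (\<integral>\<^sup>+z. ennreal ((norm (X k z - X (r l) z))\<^sup>2) \<partial>M) <= ennreal e"
        proof (intro allI impI)
          fix l assume "l >= N"
          then have "r l >= N" using seq_suble[OF r, of l] by linarith
          then show "(\<integral>\<^sup>+z. ennreal ((norm (X k z - X (r l) z))\<^sup>2) \<partial>M) <= ennreal e"
            unfolding nn[OF square_integrable_diff[OF X X]] by (intro ennreal_leI less_imp_le N[OF k \<open>r l >= N\<close>])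
        qed
        then show "\<forall>\<^sub>F l in sequentially. (\<integral>\<^sup>+z. ennreal ((norm (X k z - X (r l) z))\<^sup>2) \<partial>M) <= ennreal e"
          by (auto simp: eventually_sequentially)
      qed
      also have "... = ennreal e" by (simp add: Liminf_const)
      finally show ?thesis .
    qed
    then show ?thesis by blast
  qed
  obtain N where N: "(\<integral>\<^sup>+z. ennreal ((norm (X N z - f z))\<^sup>2) \<partial>M) <= ennreal 1"
    using bound[of 1] by auto
  have sqd: "square_integrable M (%z. X N z - f z)"
    unfolding square_integrable_def
  proof
    show "integrable M (%z. (norm (X N z - f z))\<^sup>2)"
      by (rule integrableI_bounded) (use N in \<open>auto intro: order.strict_trans1\<close>)
  qed measurable
  show sqf: "square_integrable M f"
    using square_integrable_diff[OF X[of N] sqd] by simp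
  show "(%k. nsq M (%z. X k z - f z)) \<longlonglongrightarrow> 0"
  proof (rule LIMSEQ_I)
    fix e :: real assume e: "e > 0"
    then obtain N where N: "\<forall>k\<ge>N. (\<integral>\<^sup>+z. ennreal ((norm (X k z - f z))\<^sup>2) \<partial>M) <= ennreal (e/2)"
      using bound[of "e/2"] by auto
    have "nsq M (%z. X k z - f z) <= e/2" if "k >= N" for k
      using N that e nn[OF square_integrable_diff[OF X sqf]] by simp
    then have "nsq M (%z. X k z - f z) < e" if "k >= N" for k using that e by fastforce
    then show "\<exists>no. \<forall>k\<ge>no. norm (nsq M (%z. X k z - f z) - 0) < e"
      by (intro exI[of _ N]) simp
  qed
qed

text \<open>The Riesz--Fischer theorem, via a subsequence that converges almost everywhere.\<close>

lemma l2_complete: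
  assumes X: "\<And>k. square_integrable M (X k)" and cauchy: "l2_cauchy M X"
  shows "\<exists>f. square_integrable M f \<and> (%k. nsq M (%z. X k z - f z)) \<longlonglongrightarrow> 0"
proof -
  have [measurable]: "X k \<in> borel_measurable M" for k using X by (auto simp: square_integrable_def)
  have nn: "(\<integral>\<^sup>+z. ennreal ((norm (f z))\<^sup>2) \<partial>M) = ennreal (nsq M f)" if "square_integrable M f" for f
    using that unfolding square_integrable_def nsq_def by (subst nn_integral_eq_integral) auto
  have "\<exists>N. \<forall>m\<ge>N. \<forall>k\<ge>N. nsq M (%z. X m z - X k z) < (1/8)^j" for j
    using cauchy unfolding l2_cauchy_def by (metis zero_less_divide_1_iff zero_less_numeral zero_less_power)
  then obtain N where N: "\<And>j m k. m >= N j ==> k >= N j ==> nsq M (%z. X m z - X k z) < (1/8)^j"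
    by metis
  define r where "r = rec_nat (N 0) (%j p. max (Suc p) (N (Suc j)))"
  have r: "r (Suc j) > r j" "r j >= N j" for j
    by (auto simp: r_def less_Suc_eq_le) (cases j; simp)
  have mono: "strict_mono r" using r(1) by (rule strict_monoI_Suc)
  define Y where "Y j = X (r j)" for j
  have [measurable]: "Y j \<in> borel_measurable M" for j by (simp add: Y_def)
  have sqY: "square_integrable M (Y j)" for j using X by (simp add: Y_def)
  have Ysmall: "nsq M (%z. Y (Suc j) z - Y j z) < (1/8)^j" for j
    unfolding Y_def by (rule N) (use r[of j] in linarith)+
  \<comment> \<open>The weights 2^j are absorbed by the bounds 8^(-j) on the squared norms. Where S
    is finite, the increments are at most a multiple of 2^(-j/2), hence summable.\<close>
  define S where "S z = (\<Sum>j. ennreal (2^j * (norm (Y (Suc j) z - Y j z))\<^sup>2))" for z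
  have "(\<integral>\<^sup>+z. S z \<partial>M) = (\<Sum>j. \<integral>\<^sup>+z. ennreal (2^j * (norm (Y (Suc j) z - Y j z))\<^sup>2) \<partial>M)"
    unfolding S_def by (rule nn_integral_suminf) measurable
  also have "... <= (\<Sum>j. ennreal ((1/4)^j))"
  proof (rule suminf_le)
    fix j
    have "(\<integral>\<^sup>+z. ennreal (2^j * (norm (Y (Suc j) z - Y j z))\<^sup>2) \<partial>M) = ennreal (2^j) * ennreal (nsq M (%z. Y (Suc j) z - Y j z))"
      by (simp add: ennreal_mult' nn_integral_cmult nn[OF square_integrable_diff[OF sqY sqY], symmetric])
    also have "... = ennreal (2^j * nsq M (%z. Y (Suc j) z - Y j z))" by (simp add: ennreal_mult')
    also have "... <= ennreal (2^j * (1/8)^j)"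
      using Ysmall[of j] by (intro ennreal_leI mult_left_mono) auto
    also have "(2::real)^j * (1/8)^j = (1/4)^j" by (simp flip: power_mult_distrib)
    finally show "(\<integral>\<^sup>+z. ennreal (2^j * (norm (Y (Suc j) z - Y j z))\<^sup>2) \<partial>M) <= ennreal ((1/4)^j)" .
  qed auto
  also have "... < \<infinity>"
  proof -
    have "summable (%j. (1/4::real)^j)" by (rule summable_geometric) simp
    then have "(\<Sum>j. ennreal ((1/4)^j)) = ennreal (\<Sum>j. (1/4)^j)" by (intro suminf_ennreal2) auto
    then show ?thesis by simp
  qed
  finally have "AE z in M. S z ~= \<infinity>"
    by (intro nn_integral_PInf_AE) (auto simp: S_def)
  then have AEconv: "AE z in M. convergent (%j. Y j z)"
  proof eventually_elim
    fix z assume "S z ~= \<infinity>"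
    then have Sfin: "S z ~= top" by simp
    have b: "norm (Y (Suc j) z - Y j z) <= sqrt (enn2real (S z)) * (sqrt (1/2))^j" for j
    proof -
      have "(\<Sum>j\<in>{j}. ennreal (2^j * (norm (Y (Suc j) z - Y j z))\<^sup>2)) <= S z"
        unfolding S_def by (rule sum_le_suminf) auto
      then have "2^j * (norm (Y (Suc j) z - Y j z))\<^sup>2 <= enn2real (S z)"
        using Sfin ennreal_le_iff[OF enn2real_nonneg[of "S z"], of "2^j * (norm (Y (Suc j) z - Y j z))\<^sup>2"]
        by (simp add: less_top)
      then have "(norm (Y (Suc j) z - Y j z))\<^sup>2 <= enn2real (S z) * (1/2)^j"
        by (simp add: field_simps power_divide)
      then have "norm (Y (Suc j) z - Y j z) <= sqrt (enn2real (S z) * (1/2)^j)" by (rule real_le_rsqrt)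
      then show ?thesis by (simp add: real_sqrt_mult real_sqrt_power)
    qed
    have "summable (%j. sqrt (enn2real (S z)) * (sqrt (1/2))^j)"
      by (intro summable_mult summable_geometric) (simp add: real_sqrt_lt_1_iff)
    then have "summable (%j. Y (Suc j) z - Y j z)"
      by (rule summable_comparison_test'[where N = 0]) (use b in auto)
    then have "convergent (%n. \<Sum>j<n. Y (Suc j) z - Y j z)" by (simp add: summable_iff_convergent)
    then have "convergent (%n. Y n z - Y 0 z)" using sum_lessThan_telescope[of "%j. Y j z"] by simp
    then have "convergent (%n. (Y n z - Y 0 z) + Y 0 z)" by (intro convergent_add convergent_const)
    then show "convergent (%n. Y n z)" by simp
  qed
  define f where "f z = lim (%j. Y j z)" for z
  have [measurable]: "f \<in> borel_measurable M" unfolding f_def[abs_def] by (rule borel_measurable_lim_metric) measurable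
  have "AE z in M. (%j. X (r j) z) \<longlonglongrightarrow> f z"
    using AEconv by eventually_elim (simp add: f_def Y_def convergent_LIMSEQ_iff)
  from l2_limit[OF X cauchy mono _ this] show ?thesis by auto
qed

section \<open>Circle averages of holomorphic functions and Cauchy formulas on closed annuli\<close>

section \<open>Circle averages\<close>

text \<open>Differentiation under the integral gives the average of
  \<open>deriv F (x * cis \<theta>) * cis \<theta>\<close>, which is the \<theta>-derivative of
  \<open>F (x * cis \<theta>) / (\<i> * x)\<close> and integrates to 0 over a period. At
  \<open>x = 0\<close> the average of \<open>cis\<close> itself vanishes. Averages are used instead
  of contour integrals because rotations later act on the whole space.\<close>

lemma circle_integral_derivative:
  fixes F :: "complex => complex"
  assumes S: "open S" and rot: "\<And>x \<theta>. x \<in> S ==> x * cis \<theta> \<in> S" and F: "F holomorphic_on S" and x: "x \<in> S"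
  shows "((%x. integral {0..2*pi} (%\<theta>. F (x * cis \<theta>))) has_field_derivative 0) (at x)"
proof -
  obtain e where e: "e > 0" "ball x e \<subseteq> S" using S x openE by blast
  have dF: "(F has_field_derivative deriv F y) (at y)" if "y \<in> S" for y
    using F S that holomorphic_derivI by blast
  have contF: "continuous_on S F" using F holomorphic_on_imp_continuous_on by blast
  have contF': "continuous_on S (deriv F)"
    using F S holomorphic_deriv holomorphic_on_imp_continuous_on by blast
  have "((%x. integral (cbox 0 (2*pi)) (%\<theta>. F (x * cis \<theta>))) has_field_derivative
      integral (cbox 0 (2*pi)) (%\<theta>. deriv F (x * cis \<theta>) * cis \<theta>)) (at x within ball x e)"
  proof (rule leibniz_rule_field_derivative)
    fix y \<theta> assume y: "y \<in> ball x e"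
    then have "y * cis \<theta> \<in> S" using e rot by blast
    moreover have "((%y. y * cis \<theta>) has_field_derivative cis \<theta>) (at y)" by (auto intro!: derivative_eq_intros)
    ultimately have "((%y. F (y * cis \<theta>)) has_field_derivative deriv F (y * cis \<theta>) * cis \<theta>) (at y)"
      using DERIV_chain'[of "%y. y * cis \<theta>" "cis \<theta>" y UNIV F "deriv F (y * cis \<theta>)"] dF by simp
    then show "((%y. F (y * cis \<theta>)) has_field_derivative deriv F (y * cis \<theta>) * cis \<theta>) (at y within ball x e)"
      by (rule has_field_derivative_at_within)
  next
    fix y assume "y \<in> ball x e"
    then have "(%\<theta>. y * cis \<theta>) ` cbox 0 (2*pi) \<subseteq> S" using e rot by blast
    then show "(%\<theta>. F (y * cis \<theta>)) integrable_on cbox 0 (2*pi)"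
      by (intro integrable_continuous continuous_on_compose2[OF contF] continuous_intros) auto
  next
    have "(%z. fst z * cis (snd z)) ` (ball x e \<times> cbox 0 (2*pi)) \<subseteq> S" using e rot by auto
    then show "continuous_on (ball x e \<times> cbox 0 (2*pi)) (%(y, \<theta>). deriv F (y * cis \<theta>) * cis \<theta>)"
      unfolding split_beta by (intro continuous_intros continuous_on_compose2[OF contF']) auto
  qed (use e in auto)
  moreover have "integral (cbox 0 (2*pi)) (%\<theta>. deriv F (x * cis \<theta>) * cis \<theta>) = 0"
  proof (cases "x = 0")
    case True
    have "(cis has_integral (exp (\<i> * of_real (2*pi)) / \<i> - exp (\<i> * of_real 0) / \<i>)) {0..2*pi}"
    proof (rule fundamental_theorem_of_calculus)
      fix \<theta> :: real
      have "((%t. exp (\<i> * t) / \<i>) has_field_derivative exp (\<i> * of_real \<theta>)) (at (of_real \<theta>))"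
        by (auto intro!: derivative_eq_intros simp: mult.assoc)
      then have "((%t. exp (\<i> * of_real t) / \<i>) has_vector_derivative exp (\<i> * of_real \<theta>)) (at \<theta> within {0..2*pi})"
        by (rule has_vector_derivative_real_field)
      then show "((%t. exp (\<i> * of_real t) / \<i>) has_vector_derivative cis \<theta>) (at \<theta> within {0..2*pi})"
        by (simp add: cis_conv_exp)
    qed simp
    moreover have "exp (\<i> * complex_of_real (2*pi)) = 1" by (metis cis_conv_exp cis_2pi)
    ultimately have "(cis has_integral 0) {0..2*pi}" by (simp only: of_real_0 mult_zero_right exp_zero diff_self)
    then have "integral {0..2*pi} cis = 0" by (simp add: integral_unique)
    then show ?thesis using True by simp
  next
    case False
    have "((%\<theta>. deriv F (x * cis \<theta>) * cis \<theta>) has_integral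
        (F (x * cis (2*pi)) / (\<i> * x) - F (x * cis 0) / (\<i> * x))) {0..2*pi}"
    proof (rule fundamental_theorem_of_calculus)
      fix \<theta> :: real
      have "((%t. F (x * exp (\<i> * t)) / (\<i> * x)) has_field_derivative
          deriv F (x * exp (\<i> * of_real \<theta>)) * (x * (exp (\<i> * of_real \<theta>) * \<i>)) / (\<i> * x)) (at (of_real \<theta>))"
        using rot[OF x, of \<theta>]
        by (intro DERIV_cdivide DERIV_chain'[OF _ dF, of _ _ "of_real \<theta>"]) (auto intro!: derivative_eq_intros simp: cis_conv_exp)
      then have "((%t. F (x * exp (\<i> * of_real t)) / (\<i> * x)) has_vector_derivative
          deriv F (x * exp (\<i> * of_real \<theta>)) * (x * (exp (\<i> * of_real \<theta>) * \<i>)) / (\<i> * x)) (at \<theta> within {0..2*pi})"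
        by (rule has_vector_derivative_real_field)
      then show "((%\<theta>. F (x * cis \<theta>) / (\<i> * x)) has_vector_derivative deriv F (x * cis \<theta>) * cis \<theta>) (at \<theta> within {0..2*pi})"
        using False by (simp add: cis_conv_exp mult_ac)
    qed simp
    then show ?thesis by (simp add: integral_unique)
  qed
  ultimately show ?thesis
    using e by (simp add: at_within_open[of x "ball x e"] cbox_interval)
qed

lemma circle_integral_constant:
  fixes F :: "complex => complex"
  assumes S: "open S" "connected S" and rot: "\<And>x \<theta>. x \<in> S ==> x * cis \<theta> \<in> S" and F: "F holomorphic_on S"
    and x: "x \<in> S" "y \<in> S"
  shows "integral {0..2*pi} (%\<theta>. F (x * cis \<theta>)) = integral {0..2*pi} (%\<theta>. F (y * cis \<theta>))"
proof -
  have "(%x. integral {0..2*pi} (%\<theta>. F (x * cis \<theta>))) constant_on S"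
    by (rule has_field_derivative_0_imp_constant_on) (use circle_integral_derivative[OF S(1) rot F] S in auto)
  then show ?thesis using x by (auto simp: constant_on_def)
qed

lemma circle_mean_value:
  fixes F :: "complex => complex"
  assumes F: "F holomorphic_on ball 0 R" and x: "norm x < R"
  shows "integral {0..2*pi} (%\<theta>. F (x * cis \<theta>)) = 2 * pi * F 0"
proof -
  have "integral {0..2*pi} (%\<theta>. F (x * cis \<theta>)) = integral {0..2*pi} (%\<theta>. F (0 * cis \<theta>))"
    using x norm_ge_zero[of x] by (intro circle_integral_constant[OF _ _ _ F]) (auto simp: norm_mult simp del: norm_ge_zero)
  then show ?thesis by (simp add: scaleR_conv_of_real)
qed

text \<open>On the unit circle conjugation is inversion, so this is the mean value property at
  infinity for functions holomorphic outside a smaller disc, such as a Cauchy kernel with its pole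
  inside.\<close>

lemma integral_cis_minus:
  fixes H :: "complex => complex"
  assumes H: "H holomorphic_on ball 0 R" and R: "R > 1"
  shows "integral {0..2*pi} (%\<theta>. cnj (H (cis \<theta>))) = 2 * pi * cnj (H 0)"
proof -
  have "integral {0..2*pi} (%\<theta>. cnj (H (cis \<theta>))) = cnj (integral {0..2*pi} (%\<theta>. H (cis \<theta>)))"
    by (rule integral_cnj[symmetric])
  also have "integral {0..2*pi} (%\<theta>. H (cis \<theta>)) = 2 * pi * H 0"
    using circle_mean_value[OF H, of 1] R by simp
  finally show ?thesis by simp
qed

lemma cauchy_kernel_outer:
  fixes w x :: complex
  assumes "norm w < norm x"
  shows "integral {0..2*pi} (%\<theta>. x * cis \<theta> / (x * cis \<theta> - w)) = 2 * pi"
    and "integral {0..2*pi} (%\<theta>. x * cis \<theta> / (x * cis \<theta> - w)\<^sup>2) = 0"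
proof -
  have x0: "x ~= 0" using assms by auto
  define a where "a = cnj (w / x)"
  have na: "norm a < 1" using assms x0 by (simp add: a_def norm_divide)
  \<comment> \<open>A radius above 1 with \<open>norm a * R < 1\<close>, which keeps the pole out of
    the disc; the formula also covers \<open>a = 0\<close>.\<close>
  define R where "R = 2 / (1 + norm a)"
  have "1 + norm a > 0" "1 + norm a < 2" using na by (auto intro: add_pos_nonneg)
  then have R: "R > 1" unfolding R_def by (simp add: less_divide_eq_1_pos)
  have nz: "1 - a * \<tau> ~= 0" if "\<tau> \<in> ball 0 R" for \<tau>
  proof
    assume "1 - a * \<tau> = 0"
    then have "norm a * norm \<tau> = 1" by (metis eq_iff_diff_eq_0 norm_mult norm_one)
    moreover have "norm a * norm \<tau> <= norm a * R" using that by (intro mult_left_mono) auto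
    moreover have "norm a * R < 1" using na \<open>1 + norm a > 0\<close> by (simp add: R_def pos_divide_less_eq)
    ultimately show False by linarith
  qed
  have hol1: "(%\<tau>. 1 / (1 - a * \<tau>)) holomorphic_on ball 0 R"
    by (intro holomorphic_intros) (use nz in blast)
  have hol2: "(%\<tau>. \<tau> / (1 - a * \<tau>)\<^sup>2) holomorphic_on ball 0 R"
    by (intro holomorphic_intros) (use nz in \<open>simp only: power_eq_0_iff, blast\<close>)
  have c1: "cis \<theta> * cnj (cis \<theta>) = 1" for \<theta> by (simp add: cis_cnj cis_mult)
  have ca: "cnj a = w / x" by (simp add: a_def)
  have e1: "x * cis \<theta> / (x * cis \<theta> - w) = cnj (1 / (1 - a * cis \<theta>))" for \<theta>
  proof -
    have "x * cis \<theta> - w = x * cis \<theta> * (1 - w / x * cnj (cis \<theta>))"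
      using x0 c1[of \<theta>] by (simp add: algebra_simps)
    then show ?thesis using x0 by (simp add: ca)
  qed
  have e2: "x * cis \<theta> / (x * cis \<theta> - w)\<^sup>2 = (1 / x) * cnj (cis \<theta> / (1 - a * cis \<theta>)\<^sup>2)" for \<theta>
  proof -
    have "x * cis \<theta> - w = x * cis \<theta> * (1 - w / x * cnj (cis \<theta>))"
      using x0 c1[of \<theta>] by (simp add: algebra_simps)
    then have "x * cis \<theta> / (x * cis \<theta> - w)\<^sup>2 = 1 / (x * cis \<theta>) / (1 - w / x * cnj (cis \<theta>))\<^sup>2"
      using x0 by (simp add: power_mult_distrib power2_eq_square)
    also have "1 / (x * cis \<theta>) = (1 / x) * cnj (cis \<theta>)" using c1[of \<theta>] x0 by (simp add: field_simps)
    finally show ?thesis by (simp add: ca)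
  qed
  show "integral {0..2*pi} (%\<theta>. x * cis \<theta> / (x * cis \<theta> - w)) = 2 * pi"
    unfolding e1 using integral_cis_minus[OF hol1 R] by simp
  have "integral {0..2*pi} (%\<theta>. cnj (cis \<theta> / (1 - a * cis \<theta>)\<^sup>2)) = 0"
    using integral_cis_minus[OF hol2 R] by simp
  then show "integral {0..2*pi} (%\<theta>. x * cis \<theta> / (x * cis \<theta> - w)\<^sup>2) = 0"
    unfolding e2 by (simp only: integral_mult_right mult_zero_right)
qed

lemma cauchy_kernel_inner:
  fixes w y :: complex
  assumes "norm y < norm w"
  shows "integral {0..2*pi} (%\<theta>. y * cis \<theta> / (y * cis \<theta> - w)) = 0"
    and "integral {0..2*pi} (%\<theta>. y * cis \<theta> / (y * cis \<theta> - w)\<^sup>2) = 0"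
proof -
  have nz: "t - w ~= 0" if "t \<in> ball 0 (norm w)" for t using that by auto
  have "(%t. t / (t - w)) holomorphic_on ball 0 (norm w)"
    by (intro holomorphic_intros) (use nz in blast)
  from circle_mean_value[OF this assms]
  show "integral {0..2*pi} (%\<theta>. y * cis \<theta> / (y * cis \<theta> - w)) = 0" by simp
  have "(%t. t / (t - w)\<^sup>2) holomorphic_on ball 0 (norm w)"
    by (intro holomorphic_intros) (use nz in \<open>simp only: power_eq_0_iff, blast\<close>)
  from circle_mean_value[OF this assms]
  show "integral {0..2*pi} (%\<theta>. y * cis \<theta> / (y * cis \<theta> - w)\<^sup>2) = 0" by simp
qed

definition annulus :: "real => real => complex set" where
  "annulus r R = {t. r < norm t \<and> norm t < R}"

lemma annulus_props: "open (annulus r R)" "connected (annulus r R)" "x \<in> annulus r R ==> x * cis \<theta> \<in> annulus r R"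
proof -
  have eq: "annulus r R = {x. r < norm (x - 0) \<and> norm (x - 0) < R}" by (simp add: annulus_def)
  show "open (annulus r R)"
    unfolding annulus_def by (intro open_Collect_conj open_Collect_less continuous_intros)
  show "connected (annulus r R)" unfolding eq by (rule connected_annulus) simp
qed (simp add: annulus_def norm_mult)

text \<open>A point of the closed annulus is a limit along its own ray, coming from the middle
  radius m.\<close>

lemma closure_annulus:
  assumes "r < R" "r > 0"
  shows "{t. r <= norm t \<and> norm t <= R} \<subseteq> closure (annulus r R)"
proof clarify
  fix t :: complex assume t: "r <= norm t" "norm t <= R"
  define m where "m = (r + R) / 2"
  have m: "r < m" "m < R" using assms by (auto simp: m_def)
  have t0: "norm t > 0" using t assms by linarith
  define u where "u s = ((1 - s) * norm t + s * m) / norm t" for s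
  have u: "norm (of_real (u s) * t) = (1 - s) * norm t + s * m" if "0 <= s" "s <= 1" for s
  proof -
    have "u s >= 0" using that t0 m assms by (auto simp: u_def)
    then have "norm (of_real (u s) * t) = u s * norm t" by (simp add: norm_mult)
    also have "... = (1 - s) * norm t + s * m" using t0 by (simp add: u_def)
    finally show ?thesis .
  qed
  have "of_real (u (1 / real (Suc (Suc k)))) * t \<in> annulus r R" for k
  proof -
    define s where "s = 1 / real (Suc (Suc k))"
    have s: "0 < s" "s < 1" by (auto simp: s_def)
    have "(1 - s) * r + s * r < (1 - s) * norm t + s * m"
      using s t m by (intro add_le_less_mono mult_left_mono mult_strict_left_mono) auto
    moreover have "(1 - s) * norm t + s * m < (1 - s) * R + s * R"
      using s t m by (intro add_le_less_mono mult_left_mono mult_strict_left_mono) auto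
    ultimately show ?thesis using u[of s] s unfolding annulus_def s_def[symmetric] by (simp add: algebra_simps)
  qed
  moreover have "(%k. of_real (u (1 / real (Suc (Suc k)))) * t) \<longlonglongrightarrow> of_real (u 0) * t"
  proof -
    have "(%k. 1 / real (Suc (Suc k))) \<longlonglongrightarrow> 0" using LIMSEQ_Suc[OF LIMSEQ_Suc[OF lim_1_over_n]] .
    then have "(%k. u (1 / real (Suc (Suc k)))) \<longlonglongrightarrow> ((1 - 0) * norm t + 0 * m) / norm t"
      unfolding u_def by (intro tendsto_intros) (use t0 in auto)
    then show ?thesis by (intro tendsto_intros) (simp add: u_def)
  qed
  moreover have "of_real (u 0) * t = t" using t0 by (simp add: u_def)
  ultimately show "t \<in> closure (annulus r R)"
    unfolding closure_sequential by (intro exI[of _ "%k. of_real (u (1 / real (Suc (Suc k)))) * t"]) auto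
qed

text \<open>The average is continuous in its radius, so its constancy extends to the two boundary
  circles. This form serves functions that are merely continuous up to the boundary.\<close>

lemma circle_integral_annulus_closed:
  fixes F :: "complex => complex"
  assumes r: "0 < r" "r < R"
    and F: "F holomorphic_on annulus r R" and cont: "continuous_on {t. r <= norm t \<and> norm t <= R} F"
    and x: "norm x = R" and y: "norm y = r"
  shows "integral {0..2*pi} (%\<theta>. F (x * cis \<theta>)) = integral {0..2*pi} (%\<theta>. F (y * cis \<theta>))"
proof -
  let ?K = "{t. r <= norm t \<and> norm t <= R} :: complex set"
  let ?A = "%x. integral (cbox 0 (2*pi)) (%\<theta>. F (x * cis \<theta>))"
  have cA: "continuous_on ?K ?A"
  proof (rule integral_continuous_on_param)
    have "(%(x, \<theta>). x * cis \<theta>) ` (?K \<times> cbox 0 (2*pi)) \<subseteq> ?K" by (auto simp: norm_mult)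
    then show "continuous_on (?K \<times> cbox 0 (2*pi)) (%(x, \<theta>). F (x * cis \<theta>))"
      unfolding split_beta by (intro continuous_on_compose2[OF cont] continuous_intros) auto
  qed
  have "closed ?K" by (intro closed_Collect_conj closed_Collect_le continuous_intros)
  then have clo: "closure (annulus r R) = ?K"
    using closure_annulus[OF r(2,1)] by (intro antisym closure_minimal) (auto simp: annulus_def)
  obtain z where z: "z \<in> annulus r R"
    using closure_annulus[OF r(2,1)] x r by (metis (mono_tags, lifting) closure_empty empty_iff less_imp_le mem_Collect_eq order_refl subsetD ex_in_conv)
  have const: "?A t = ?A z" if "t \<in> annulus r R" for t
    using circle_integral_constant[OF annulus_props(1,2,3) F that z] by (simp add: cbox_interval)
  have "?A t = ?A z" if "t \<in> ?K" for t
    using continuous_constant_on_closure[of "annulus r R" ?A "?A z" t] cA const that by (simp add: clo)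
  from this[of x] this[of y] show ?thesis using x y r by (simp add: cbox_interval)
qed

lemma difference_quotient_holomorphic:
  fixes F :: "complex => complex"
  assumes F: "F holomorphic_on annulus r R" and cont: "continuous_on {t. r <= norm t \<and> norm t <= R} F"
    and w: "w \<in> annulus r R"
  defines "\<phi> \<equiv> %t. if t = w then deriv F w else (F t - F w) / (t - w)"
  shows "\<phi> holomorphic_on annulus r R" "continuous_on {t. r <= norm t \<and> norm t <= R} \<phi>"
proof -
  show h: "\<phi> holomorphic_on annulus r R"
    unfolding \<phi>_def by (rule pole_lemma_open[OF F annulus_props(1)])
  let ?K = "{t. r <= norm t \<and> norm t <= R} :: complex set"
  show "continuous_on ?K \<phi>"
    unfolding continuous_on_eq_continuous_within
  proof
    fix x assume x: "x \<in> ?K"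
    show "continuous (at x within ?K) \<phi>"
    proof (cases "x = w")
      case True
      have "continuous_on (annulus r R) \<phi>" using h holomorphic_on_imp_continuous_on by blast
      then have "isCont \<phi> w" using annulus_props(1) w by (simp add: continuous_on_eq_continuous_at)
      then show ?thesis using True continuous_at_imp_continuous_at_within by blast
    next
      case False
      have "continuous (at x within ?K) (%t. (F t - F w) / (t - w))"
        using cont x False by (intro continuous_intros) (auto simp: continuous_on_eq_continuous_within)
      then show ?thesis
      proof (rule continuous_transform_within[where \<delta> = "dist x w"])
        fix t assume "t \<in> ?K" "dist t x < dist x w"
        then have "t ~= w" by (auto simp: dist_commute)
        then show "(F t - F w) / (t - w) = \<phi> t" by (simp add: \<phi>_def)
      qed (use False x in auto)
    qed
  qed
qed

text \<open>With the value at w subtracted, the quotient \<phi> has a removable singularity, so the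
  averages of \<open>\<phi> t * t\<close> over both circles agree. What remains is
  \<open>F w\<close> times the averages of the kernel, 2 pi outside and 0 inside. The factor t in
  the integrand comes from dt = i t d\<theta>.\<close>

lemma annulus_cauchy_formula:
  fixes F :: "complex => complex"
  assumes r: "0 < r" and F: "F holomorphic_on annulus r R" and cont: "continuous_on {t. r <= norm t \<and> norm t <= R} F"
    and w: "r < norm w" "norm w < R" and x: "norm x = R" and y: "norm y = r"
  shows "integral {0..2*pi} (%\<theta>. F (x * cis \<theta>) * (x * cis \<theta>) / (x * cis \<theta> - w))
       - integral {0..2*pi} (%\<theta>. F (y * cis \<theta>) * (y * cis \<theta>) / (y * cis \<theta> - w)) = 2 * pi * F w"
proof -
  define \<phi> where "\<phi> t = (if t = w then deriv F w else (F t - F w) / (t - w))" for t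
  have wA: "w \<in> annulus r R" using w by (simp add: annulus_def)
  let ?K = "{t. r <= norm t \<and> norm t <= R} :: complex set"
  have \<phi>: "\<phi> holomorphic_on annulus r R" "continuous_on ?K \<phi>"
    using difference_quotient_holomorphic[OF F cont wA] by (simp_all add: \<phi>_def[abs_def])
  have eq: "integral {0..2*pi} (%\<theta>. \<phi> (x * cis \<theta>) * (x * cis \<theta>)) = integral {0..2*pi} (%\<theta>. \<phi> (y * cis \<theta>) * (y * cis \<theta>))"
    by (rule circle_integral_annulus_closed[where F = "%t. \<phi> t * t", OF r _ _ _ x y])
       (use w \<phi> in \<open>auto intro!: holomorphic_intros continuous_intros\<close>)
  have dec: "integral {0..2*pi} (%\<theta>. F (v * cis \<theta>) * (v * cis \<theta>) / (v * cis \<theta> - w)) =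
      integral {0..2*pi} (%\<theta>. \<phi> (v * cis \<theta>) * (v * cis \<theta>)) + F w * integral {0..2*pi} (%\<theta>. v * cis \<theta> / (v * cis \<theta> - w))"
    if v: "norm v = r \<or> norm v = R" for v
  proof -
    have nw: "v * cis \<theta> ~= w" for \<theta> using v w by (auto simp: norm_mult)
    have vK: "(%\<theta>. v * cis \<theta>) ` {0..2*pi} \<subseteq> ?K" using v w by (auto simp: norm_mult)
    have "F (v * cis \<theta>) * (v * cis \<theta>) / (v * cis \<theta> - w) =
        \<phi> (v * cis \<theta>) * (v * cis \<theta>) + F w * (v * cis \<theta> / (v * cis \<theta> - w))" for \<theta>
    proof -
      define t where "t = v * cis \<theta>"
      have tw: "t - w ~= 0" using nw[of \<theta>] by (simp add: t_def)
      have "\<phi> t * (t - w) = F t - F w" using tw by (simp add: \<phi>_def)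
      then have F: "F t = \<phi> t * (t - w) + F w" by simp
      show ?thesis unfolding t_def[symmetric] F using tw
        by (simp add: add_divide_distrib distrib_right)
    qed
    moreover have "(%\<theta>. \<phi> (v * cis \<theta>) * (v * cis \<theta>)) integrable_on {0..2*pi}"
      by (intro integrable_continuous_interval continuous_intros continuous_on_compose2[OF \<phi>(2)] vK)
    moreover have "(%\<theta>. F w * (v * cis \<theta> / (v * cis \<theta> - w))) integrable_on {0..2*pi}"
      using nw by (intro integrable_continuous_interval continuous_intros) auto
    ultimately show ?thesis by (simp only: integral_add integral_mult_right)
  qed
  show ?thesis
    using dec[of x] dec[of y] eq x y w cauchy_kernel_outer(1)[of w x] cauchy_kernel_inner(1)[of y w] by simp
qed

text \<open>The Cauchy formula applied to the difference quotient \<phi>, whose value at w is the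
  derivative; the squared kernel averages to 0 on both circles.\<close>

lemma annulus_cauchy_derivative:
  fixes F :: "complex => complex"
  assumes r: "0 < r" and F: "F holomorphic_on annulus r R" and cont: "continuous_on {t. r <= norm t \<and> norm t <= R} F"
    and w: "r < norm w" "norm w < R" and x: "norm x = R" and y: "norm y = r"
  shows "integral {0..2*pi} (%\<theta>. F (x * cis \<theta>) * (x * cis \<theta>) / (x * cis \<theta> - w)\<^sup>2)
       - integral {0..2*pi} (%\<theta>. F (y * cis \<theta>) * (y * cis \<theta>) / (y * cis \<theta> - w)\<^sup>2) = 2 * pi * deriv F w"
proof -
  define \<phi> where "\<phi> t = (if t = w then deriv F w else (F t - F w) / (t - w))" for t
  have wA: "w \<in> annulus r R" using w by (simp add: annulus_def)
  let ?K = "{t. r <= norm t \<and> norm t <= R} :: complex set"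
  have \<phi>: "\<phi> holomorphic_on annulus r R" "continuous_on ?K \<phi>"
    using difference_quotient_holomorphic[OF F cont wA] by (simp_all add: \<phi>_def[abs_def])
  have dec: "integral {0..2*pi} (%\<theta>. F (v * cis \<theta>) * (v * cis \<theta>) / (v * cis \<theta> - w)\<^sup>2) =
      integral {0..2*pi} (%\<theta>. \<phi> (v * cis \<theta>) * (v * cis \<theta>) / (v * cis \<theta> - w)) + F w * integral {0..2*pi} (%\<theta>. v * cis \<theta> / (v * cis \<theta> - w)\<^sup>2)"
    if v: "norm v = r \<or> norm v = R" for v
  proof -
    have nw: "v * cis \<theta> ~= w" for \<theta> using v w by (auto simp: norm_mult)
    have vK: "(%\<theta>. v * cis \<theta>) ` {0..2*pi} \<subseteq> ?K" using v w by (auto simp: norm_mult)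
    have "F (v * cis \<theta>) * (v * cis \<theta>) / (v * cis \<theta> - w)\<^sup>2 =
        \<phi> (v * cis \<theta>) * (v * cis \<theta>) / (v * cis \<theta> - w) + F w * (v * cis \<theta> / (v * cis \<theta> - w)\<^sup>2)" for \<theta>
    proof -
      define t where "t = v * cis \<theta>"
      have tw: "t - w ~= 0" using nw[of \<theta>] by (simp add: t_def)
      have "\<phi> t * (t - w) = F t - F w" using tw by (simp add: \<phi>_def)
      then have F: "F t = \<phi> t * (t - w) + F w" by simp
      show ?thesis unfolding t_def[symmetric] F using tw
        by (simp add: add_divide_distrib distrib_right power2_eq_square)
    qed
    moreover have "(%\<theta>. \<phi> (v * cis \<theta>) * (v * cis \<theta>) / (v * cis \<theta> - w)) integrable_on {0..2*pi}"
      using nw by (intro integrable_continuous_interval continuous_intros continuous_on_compose2[OF \<phi>(2)] vK) auto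
    moreover have "(%\<theta>. F w * (v * cis \<theta> / (v * cis \<theta> - w)\<^sup>2)) integrable_on {0..2*pi}"
      using nw by (intro integrable_continuous_interval continuous_intros) auto
    ultimately show ?thesis by (simp only: integral_add integral_mult_right)
  qed
  have "\<phi> w = deriv F w" by (simp add: \<phi>_def)
  then show ?thesis
    using annulus_cauchy_formula[OF r \<phi> w x y] dec[of x] dec[of y] x y w
      cauchy_kernel_outer(2)[of w x] cauchy_kernel_inner(2)[of y w] by simp
qed

section \<open>Rotations, anisotropic scalings and averaging for Lebesgue measure\<close>

section \<open>Lebesgue measure on complex n-space\<close>

lemma nn_integral_lborel_translate:
  fixes c :: "'a::euclidean_space"
  assumes [measurable]: "h \<in> borel_measurable borel"
  shows "(\<integral>\<^sup>+x. h (x + c) \<partial>lborel) = (\<integral>\<^sup>+x. h x \<partial>lborel)"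
proof -
  have "(\<integral>\<^sup>+x. h x \<partial>lborel) = (\<integral>\<^sup>+x. h x \<partial>distr lborel borel ((+) c))"
    by (simp add: lborel_distr_plus)
  also have "... = (\<integral>\<^sup>+x. h (c + x) \<partial>lborel)" by (simp add: nn_integral_distr)
  finally show ?thesis by (simp add: add.commute)
qed

text \<open>Uniqueness of translation invariant measures, applied to the image measure; the constant is
  identified on the unit ball, which is invariant.\<close>

lemma lborel_distr_orthogonal:
  fixes f :: "'a::euclidean_space => 'a"
  assumes f: "orthogonal_transformation f"
  shows "distr lborel borel f = lborel"
proof -
  have lin: "linear f" and nrm: "\<And>v. norm (f v) = norm v"
    using f by (auto simp: orthogonal_transformation)
  interpret linear f by (rule lin)
  have surj: "surj f" using f orthogonal_transformation_surj by blast
  have [measurable]: "f \<in> borel_measurable borel"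
    by (intro borel_measurable_continuous_onI linear_continuous_on) (simp add: lin linear_conv_bounded_linear[symmetric])
  obtain g where g: "\<And>y. f (g y) = y" using surj by (metis surjD)
  have main: "emeasure (distr lborel borel f) A = emeasure lborel A" if A [measurable]: "A \<in> sets borel" for A
  proof -
  define B :: "'a set" where "B = ball 0 1"
  have [measurable]: "B \<in> sets borel" by (simp add: B_def)
  let ?A = "indicator A :: 'a => ennreal" and ?B = "indicator B :: 'a => ennreal"
  \<comment> \<open>Translating the image measure by y amounts to translating the original one by
    the preimage \<open>g y\<close>.\<close>
  have A1: "emeasure (distr lborel borel f) A = (\<integral>\<^sup>+x. ?A (f x + y) \<partial>lborel)" for y
  proof -
    have "emeasure (distr lborel borel f) A = (\<integral>\<^sup>+x. ?A (f x) \<partial>lborel)"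
      by (simp add: emeasure_distr nn_integral_distr flip: nn_integral_indicator)
    also have "... = (\<integral>\<^sup>+x. ?A (f (x + g y)) \<partial>lborel)"
      by (subst nn_integral_lborel_translate) auto
    finally show ?thesis by (simp add: add g)
  qed
  have B1: "(\<integral>\<^sup>+x. ?B (y - f x) \<partial>lborel) = emeasure lborel B" for y
  proof -
    have "?B (y - f x) = ?B (x + (- g y))" for x
    proof -
      have "norm (y - f x) = norm (f (x - g y))" by (simp add: diff g norm_minus_commute)
      then show ?thesis by (simp add: B_def indicator_def nrm)
    qed
    then have "(\<integral>\<^sup>+x. ?B (y - f x) \<partial>lborel) = (\<integral>\<^sup>+x. ?B (x + (- g y)) \<partial>lborel)" by simp
    also have "... = (\<integral>\<^sup>+x. ?B x \<partial>lborel)" by (rule nn_integral_lborel_translate) simp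
    finally show ?thesis by simp
  qed
  have "emeasure (distr lborel borel f) A * emeasure lborel B =
      (\<integral>\<^sup>+y. ?B y * emeasure (distr lborel borel f) A \<partial>lborel)"
    by (simp add: nn_integral_multc mult.commute)
  also have "... = (\<integral>\<^sup>+y. ?B y * (\<integral>\<^sup>+x. ?A (f x + y) \<partial>lborel) \<partial>lborel)"
    by (intro nn_integral_cong) (simp add: A1[symmetric])
  also have "... = (\<integral>\<^sup>+y. (\<integral>\<^sup>+x. ?B y * ?A (f x + y) \<partial>lborel) \<partial>lborel)"
    by (intro nn_integral_cong nn_integral_cmult[symmetric]) measurable
  also have "... = (\<integral>\<^sup>+x. (\<integral>\<^sup>+y. ?B y * ?A (f x + y) \<partial>lborel) \<partial>lborel)"
    by (rule lborel_pair.Fubini') measurable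
  also have "... = (\<integral>\<^sup>+x. (\<integral>\<^sup>+y. ?B (y - f x) * ?A y \<partial>lborel) \<partial>lborel)"
  proof (rule nn_integral_cong)
    fix x
    show "(\<integral>\<^sup>+y. ?B y * ?A (f x + y) \<partial>lborel) = (\<integral>\<^sup>+y. ?B (y - f x) * ?A y \<partial>lborel)"
      using nn_integral_lborel_translate[of "%y. ?B y * ?A (f x + y)" "- f x"] by simp
  qed
  also have "... = (\<integral>\<^sup>+y. (\<integral>\<^sup>+x. ?B (y - f x) * ?A y \<partial>lborel) \<partial>lborel)"
    by (rule lborel_pair.Fubini') measurable
  also have "... = (\<integral>\<^sup>+y. emeasure lborel B * ?A y \<partial>lborel)"
    by (subst nn_integral_multc) (auto simp: B1)
  also have "... = emeasure lborel A * emeasure lborel B"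
    by (subst nn_integral_cmult) (simp_all add: mult.commute)
  finally have eq: "emeasure (distr lborel borel f) A * emeasure lborel B = emeasure lborel A * emeasure lborel B" .
  have "emeasure lborel B ~= 0" "emeasure lborel B < \<infinity>"
    using emeasure_lborel_ball_finite[of "0::'a" 1] content_ball_pos[of 1 "0::'a"]
    by (auto simp: B_def measure_def enn2real_positive_iff zero_less_iff_neq_zero)
  then show ?thesis
    using eq by (metis infinity_ennreal_def less_irrefl mult_divide_eq_ennreal)
  qed
  show ?thesis by (rule measure_eqI) (auto simp: main)
qed

text \<open>As a function of t this parametrises the slice through z in direction i.
  \<open>ins i 0 z\<close> stands for the remaining n - 1 coordinates, kept in the same space; for n
  = 1 it is 0.\<close>

definition ins :: "'n => complex => complex ^ 'n => complex ^ 'n" where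
  "ins i t z = (\<chi> j. if j = i then t else z $ j)"

lemma ins_nth [simp]: "ins i t z $ j = (if j = i then t else z $ j)"
  by (simp add: ins_def)

lemma ins_same [simp]: "ins i (z $ i) z = z"
  by (simp add: vec_eq_iff)

lemma ins_ins [simp]: "ins i t (ins i s z) = ins i t z"
  by (simp add: vec_eq_iff)

lemma ins_eq: "ins i t z = axis i t + ins i 0 z"
  by (simp add: vec_eq_iff axis_def)

lemma norm_vec_sq: "(norm (z :: complex ^ 'n))\<^sup>2 = (\<Sum>j\<in>UNIV. (norm (z $ j))\<^sup>2)"
  by (simp add: norm_vec_def L2_set_def sum_nonneg)

lemma norm_ins_sq: "(norm (ins i t z))\<^sup>2 = (norm t)\<^sup>2 + (norm (ins i 0 z))\<^sup>2"
proof -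
  have "(norm (ins i t z))\<^sup>2 = (\<Sum>j\<in>UNIV. (norm (ins i t z $ j))\<^sup>2)" for t by (rule norm_vec_sq)
  also have "... t = (norm t)\<^sup>2 + (\<Sum>j\<in>UNIV-{i}. (norm (z $ j))\<^sup>2)" for t
    by (subst sum.remove[of _ i]) (auto intro!: sum.cong)
  finally show ?thesis by simp
qed

lemma norm_sq_split: "(norm z)\<^sup>2 = (norm (z $ i))\<^sup>2 + (norm (ins i 0 z))\<^sup>2"
  using norm_ins_sq[of i "z $ i" z] by simp

lemma norm_ins0_le: "norm (ins i 0 z) <= norm z"
  using norm_sq_split[of z i] by (metis le_add_same_cancel2 norm_ge_zero power2_le_imp_le zero_le_power2)

lemma norm_ins_le: "norm (ins i t z) <= norm t + norm (ins i 0 z)"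
proof -
  have "ins i t 0 = (axis i t :: complex ^ 'a)" "ins i 0 0 = (0 :: complex ^ 'a)"
    by (simp_all add: vec_eq_iff axis_def)
  then have "norm (axis i t :: complex ^ 'a) = norm t"
    using norm_ins_sq[of i t "0 :: complex ^ 'a"] by simp
  then show ?thesis by (metis ins_eq norm_triangle_ineq)
qed

lemma continuous_on_ins [continuous_intros]:
  assumes "continuous_on S f" "continuous_on S g"
  shows "continuous_on S (%x. ins i (f x) (g x))"
  unfolding ins_def
proof (rule continuous_on_vec_lambda)
  fix j show "continuous_on S (%x. if j = i then f x else g x $ j)"
    by (cases "j = i") (auto intro: assms continuous_intros)
qed

text \<open>For unimodular factors: the rotation of each coordinate about the corresponding
  coordinate of w.\<close>

definition torus_map :: "complex ^ 'n => ('n => complex) => complex ^ 'n => complex ^ 'n" where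
  "torus_map w u z = (\<chi> j. w $ j + u j * (z $ j - w $ j))"

lemma lborel_distr_torus_map:
  fixes w :: "complex ^ 'n"
  assumes u: "\<And>j. norm (u j) = 1"
  shows "distr lborel borel (torus_map w u) = lborel"
proof -
  define f :: "complex ^ 'n => complex ^ 'n" where "f z = (\<chi> j. u j * z $ j)" for z
  have "linear f" by (rule linearI) (auto simp: f_def vec_eq_iff algebra_simps)
  moreover have "norm (f z) = norm z" for z
    by (simp add: f_def norm_vec_def norm_mult u)
  ultimately have f: "orthogonal_transformation f" by (simp add: orthogonal_transformation)
  have "linear f" by fact
  then have [measurable]: "f \<in> borel_measurable borel"
    by (intro borel_measurable_continuous_onI linear_continuous_on) (simp add: linear_conv_bounded_linear[symmetric])
  have "torus_map w u = (+) (w - f w) \<circ> f"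
    by (auto simp: fun_eq_iff torus_map_def f_def vec_eq_iff algebra_simps)
  then have "distr lborel borel (torus_map w u) = distr (distr lborel borel f) borel ((+) (w - f w))"
    by (simp add: distr_distr)
  then show ?thesis by (simp add: lborel_distr_orthogonal[OF f] lborel_distr_plus)
qed

definition scale_map :: "'n => real => real => complex ^ 'n => complex ^ 'n" where
  "scale_map i A B z = (\<chi> j. (if j = i then A else B) *\<^sub>R z $ j)"

text \<open>Each complex coordinate counts twice in the Jacobian: one is scaled by A, the n - 1
  others by B.\<close>

lemma lborel_scale_map:
  fixes i :: "'n::finite"
  assumes AB: "A > 0" "B > 0"
  shows "lborel = density (distr lborel borel (scale_map i A B)) (%_. ennreal (A\<^sup>2 * B ^ (2 * (CARD('n) - 1))))"
proof -
  define c :: "complex ^ 'n => real" where "c b = (if b $ i = 0 then B else A)" for b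
  have Basis: "(Basis :: (complex ^ 'n) set) = (\<Union>j. {axis j 1, axis j \<i>})"
    by (auto simp: Basis_vec_def Basis_complex_def)
  have cax: "c (axis j 1) = (if j = i then A else B)" "c (axis j \<i>) = (if j = i then A else B)" for j
    by (auto simp: c_def axis_def)
  have disj: "{axis j 1, axis j \<i>} \<inter> {axis k 1, axis k \<i>} = ({} :: (complex ^ 'n) set)" if "j ~= k" for j k :: 'n
    using that by (auto simp: axis_eq_axis)
  have one_i: "axis j 1 ~= (axis j \<i> :: complex ^ 'n)" for j
    by (auto simp: axis_eq_axis)
  have "(\<Prod>b\<in>Basis. \<bar>c b\<bar>) = (\<Prod>j\<in>UNIV. \<Prod>b\<in>{axis j 1, axis j \<i>}. \<bar>c b\<bar>)"
    unfolding Basis by (rule prod.UNION_disjoint) (use disj in auto)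
  also have "... = (\<Prod>j\<in>UNIV. (if j = i then A\<^sup>2 else B\<^sup>2))"
    using one_i AB by (intro prod.cong) (auto simp: cax power2_eq_square)
  also have "... = A\<^sup>2 * (\<Prod>j\<in>UNIV-{i}. B\<^sup>2)"
    by (subst prod.remove[of _ i]) (auto intro!: prod.cong)
  also have "... = A\<^sup>2 * B ^ (2 * (CARD('n) - 1))"
    by (simp add: power_mult[symmetric] card_Diff_singleton)
  finally have prod: "(\<Prod>b\<in>Basis. \<bar>c b\<bar>) = A\<^sup>2 * B ^ (2 * (CARD('n) - 1))" .
  have "(\<Sum>b\<in>Basis. (c b * (z \<bullet> b)) *\<^sub>R b) = scale_map i A B z" for z
  proof -
    have "(\<Sum>b\<in>Basis. (c b * (z \<bullet> b)) *\<^sub>R b) = (\<Sum>j\<in>UNIV. \<Sum>b\<in>{axis j 1, axis j \<i>}. (c b * (z \<bullet> b)) *\<^sub>R b)"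
      unfolding Basis by (rule sum.UNION_disjoint) (use disj in auto)
    also have "... = (\<Sum>j\<in>UNIV. axis j ((if j = i then A else B) *\<^sub>R z $ j))"
    proof (intro sum.cong refl)
      fix j
      have "(\<Sum>b\<in>{axis j 1, axis j \<i>}. (c b * (z \<bullet> b)) *\<^sub>R b) =
          ((if j = i then A else B) * Re (z $ j)) *\<^sub>R axis j 1 + ((if j = i then A else B) * Im (z $ j)) *\<^sub>R axis j \<i>"
        using one_i[of j] by (simp add: cax inner_axis inner_complex_def)
      also have "... = axis j ((if j = i then A else B) *\<^sub>R z $ j)"
        by (auto simp: vec_eq_iff axis_def complex_eq_iff)
      finally show "(\<Sum>b\<in>{axis j 1, axis j \<i>}. (c b * (z \<bullet> b)) *\<^sub>R b) = axis j ((if j = i then A else B) *\<^sub>R z $ j)" .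
    qed
    also have "... = scale_map i A B z"
      by (simp add: vec_eq_iff scale_map_def axis_def sum.delta)
    finally show ?thesis .
  qed
  moreover have "c j ~= 0" for j using AB by (simp add: c_def)
  ultimately show ?thesis
    using lborel_affine_euclidean[of c 0] by (simp add: prod)
qed

lemma measurable_scale_map [measurable]: "scale_map i A B \<in> borel_measurable borel"
  by (intro borel_measurable_continuous_onI) (auto simp: scale_map_def intro!: continuous_intros)

lemma nn_integral_scale_map:
  fixes i :: "'n::finite"
  assumes "A > 0" "B > 0" and [measurable]: "h \<in> borel_measurable borel"
  shows "(\<integral>\<^sup>+z. h z \<partial>lborel) = ennreal (A\<^sup>2 * B ^ (2 * (CARD('n) - 1))) * (\<integral>\<^sup>+z. h (scale_map i A B z) \<partial>lborel)"
  by (subst lborel_scale_map[OF assms(1,2), of i])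
     (simp add: nn_integral_density nn_integral_distr nn_integral_cmult)

text \<open>A disc in coordinate i times a ball in the others; for n = 1 the second condition reads
  \<open>0 <= B\<close>.\<close>

definition polycyl :: "'n => complex ^ 'n => real => real => (complex ^ 'n) set" where
  "polycyl i w A B = {z. norm (z $ i - w $ i) <= A \<and> norm (ins i 0 (z - w)) <= B}"

definition polycyl_vol :: "'n::finite itself => 'n => real" where
  "polycyl_vol _ i = measure lborel (polycyl i 0 1 1 :: (complex ^ 'n) set)"

lemma closed_polycyl: "closed (polycyl i w A B)"
  unfolding polycyl_def by (intro closed_Collect_conj closed_Collect_le continuous_intros)

lemma polycyl_subset_cball: "polycyl i w A B \<subseteq> cball w (A + B)"
proof
  fix z assume z: "z \<in> polycyl i w A B"
  have "norm (z - w) <= norm ((z - w) $ i) + norm (ins i 0 (z - w))"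
    using norm_ins_le[of i "(z - w) $ i" "z - w"] unfolding ins_same .
  then show "z \<in> cball w (A + B)" using z by (simp add: polycyl_def dist_norm norm_minus_commute)
qed

lemma emeasure_polycyl_finite: "emeasure lborel (polycyl i w A B) < \<infinity>"
  using emeasure_mono[OF polycyl_subset_cball[of i w A B], of lborel] emeasure_lborel_cball_finite
  by (metis borel_closed closed_cball sets_lborel order.strict_trans1)

lemma sets_polycyl [measurable]: "polycyl i w A B \<in> sets borel"
  using closed_polycyl by (rule borel_closed)

lemma emeasure_polycyl:
  fixes i :: "'n::finite"
  assumes "A > 0" "B > 0"
  shows "emeasure lborel (polycyl i w A B) = ennreal (A\<^sup>2 * B ^ (2 * (CARD('n) - 1)) * polycyl_vol TYPE('n) i)"
proof -
  have "emeasure lborel (polycyl i w A B) = (\<integral>\<^sup>+z. indicator (polycyl i w A B) (z + w) \<partial>lborel)"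
    by (subst nn_integral_lborel_translate) auto
  also have "... = (\<integral>\<^sup>+z. indicator (polycyl i 0 A B) z \<partial>lborel)"
    by (intro nn_integral_cong) (simp add: indicator_def polycyl_def)
  also have "... = ennreal (A\<^sup>2 * B ^ (2 * (CARD('n) - 1))) * (\<integral>\<^sup>+z. indicator (polycyl i 0 A B) (scale_map i A B z) \<partial>lborel)"
    by (rule nn_integral_scale_map) (use assms in auto)
  also have "(\<integral>\<^sup>+z. indicator (polycyl i 0 A B) (scale_map i A B z) \<partial>lborel) = (\<integral>\<^sup>+z. indicator (polycyl i 0 1 1) z \<partial>lborel)"
  proof (intro nn_integral_cong)
    fix z :: "complex ^ 'n"
    have "ins i 0 (scale_map i A B z) = B *\<^sub>R ins i 0 z" by (auto simp: vec_eq_iff scale_map_def)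
    then have "scale_map i A B z \<in> polycyl i 0 A B \<longleftrightarrow> z \<in> polycyl i 0 1 1"
      using assms by (simp add: polycyl_def scale_map_def)
    then show "indicator (polycyl i 0 A B) (scale_map i A B z) = (indicator (polycyl i 0 1 1) z :: ennreal)"
      by (simp add: indicator_def)
  qed
  also have "... = ennreal (polycyl_vol TYPE('n) i)"
    using emeasure_polycyl_finite[of i 0 1 1] by (simp add: polycyl_vol_def emeasure_eq_ennreal_measure less_top)
  finally show ?thesis using assms by (simp add: ennreal_mult polycyl_vol_def)
qed

lemma polycyl_vol_pos: "polycyl_vol TYPE('n::finite) i > 0"
proof -
  have "ball 0 1 \<subseteq> (polycyl i 0 1 1 :: (complex ^ 'n) set)"
  proof
    fix z :: "complex ^ 'n" assume "z \<in> ball 0 1"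
    then show "z \<in> polycyl i 0 1 1"
      using norm_ins0_le[of i z] norm_coord_le[of z i]
      by (simp add: polycyl_def)
  qed
  then have "measure lborel (ball (0 :: complex ^ 'n) 1) <= polycyl_vol TYPE('n) i"
    unfolding polycyl_vol_def
    using emeasure_polycyl_finite[of i "0::complex^'n" 1 1]
    by (intro measure_mono_fmeasurable) (auto simp: fmeasurable_def)
  moreover have "measure lborel (ball (0 :: complex ^ 'n) 1) > 0" by (rule content_ball_pos) simp
  ultimately show ?thesis by linarith
qed

text \<open>Every \<open>R \<theta>\<close> preserves the measure and U, so the integral equals its
  mean over \<theta>; Fubini moves that mean inside, where it is g. A bounded integrand on a set of
  finite measure is jointly integrable.\<close>

lemma set_integral_average:
  fixes \<Phi> g :: "complex ^ 'n => complex" and R :: "real => complex ^ 'n => complex ^ 'n"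
  assumes U [measurable]: "U \<in> sets borel" and fin: "emeasure lborel U < \<infinity>"
    and \<Phi>: "(%z. indicator U z *\<^sub>R \<Phi> z) \<in> borel_measurable borel"
    and bound: "\<And>z. z \<in> U ==> norm (\<Phi> z) <= B"
    and R [measurable]: "(%(\<theta>, z). R \<theta> z) \<in> borel_measurable (borel \<Otimes>\<^sub>M borel)"
    and inv: "\<And>\<theta>. distr lborel borel (R \<theta>) = lborel" "\<And>\<theta> z. R \<theta> z \<in> U \<longleftrightarrow> z \<in> U"
    and avg: "\<And>z. z \<in> U ==> (LINT \<theta>:{0..2*pi}|lborel. \<Phi> (R \<theta> z)) = (2 * pi) *\<^sub>R g z"
  shows "(LINT z:U|lborel. \<Phi> z) = (LINT z:U|lborel. g z)"
proof -
  define \<Psi> where "\<Psi> z = indicator U z *\<^sub>R \<Phi> z" for z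
  have [measurable]: "\<Psi> \<in> borel_measurable borel" using \<Phi> by (simp add: \<Psi>_def[abs_def])
  have R1 [measurable]: "R \<theta> \<in> borel_measurable borel" for \<theta>
    using measurable_compose[OF measurable_Pair1' R, of \<theta>] by simp
  have B0: "norm (\<Psi> z) <= \<bar>B\<bar>" for z
    using bound[of z] by (auto simp: \<Psi>_def indicator_def)
  have int: "integrable (lborel \<Otimes>\<^sub>M lborel) (%(\<theta>, z). indicator {0..2*pi} \<theta> *\<^sub>R \<Psi> (R \<theta> z))"
  proof (rule Bochner_Integration.integrable_bound)
    show "integrable (lborel \<Otimes>\<^sub>M lborel) (%x. indicator ({0..2*pi} \<times> U) x * \<bar>B\<bar>)"
    proof (intro integrable_mult_left integrable_real_indicator)
      show "emeasure (lborel \<Otimes>\<^sub>M lborel) ({0..2*pi} \<times> U) < \<infinity>"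
        using fin by (subst lborel.emeasure_pair_measure_Times) (auto simp: ennreal_mult_less_top)
    qed auto
    show "AE x in lborel \<Otimes>\<^sub>M lborel. norm (case x of (\<theta>, z) => indicator {0..2*pi} \<theta> *\<^sub>R \<Psi> (R \<theta> z)) \<le>
        norm (indicator ({0..2*pi} \<times> U) x * \<bar>B\<bar>)"
    proof (intro AE_I2, clarify)
      fix \<theta> z
      have "\<Psi> (R \<theta> z) = 0" if "z \<notin> U" using that inv(2) by (simp add: \<Psi>_def)
      then show "norm (indicator {0..2*pi} \<theta> *\<^sub>R \<Psi> (R \<theta> z)) <= norm (indicator ({0..2*pi} \<times> U) (\<theta>, z) * \<bar>B\<bar>)"
        using B0[of "R \<theta> z"] by (auto simp: indicator_def)
    qed
  qed measurable
  have eq: "(\<integral>z. \<Psi> (R \<theta> z) \<partial>lborel) = (\<integral>z. \<Psi> z \<partial>lborel)" for \<theta>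
    using integral_distr[of "R \<theta>" lborel borel \<Psi>] by (simp add: inv(1))
  have "(2 * pi) *\<^sub>R (\<integral>z. \<Psi> z \<partial>lborel) = (\<integral>\<theta>. indicator {0..2*pi} \<theta> *\<^sub>R (\<integral>z. \<Psi> z \<partial>lborel) \<partial>lborel)"
    by (subst integral_scaleR_left) (auto simp: measure_def)
  also have "... = (\<integral>\<theta>. (\<integral>z. indicator {0..2*pi} \<theta> *\<^sub>R \<Psi> (R \<theta> z) \<partial>lborel) \<partial>lborel)"
    by (intro Bochner_Integration.integral_cong refl) (simp add: eq)
  also have "... = (\<integral>z. (\<integral>\<theta>. indicator {0..2*pi} \<theta> *\<^sub>R \<Psi> (R \<theta> z) \<partial>lborel) \<partial>lborel)"
    using lborel_pair.Fubini_integral[OF int] by simp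
  also have "... = (\<integral>z. (2 * pi) *\<^sub>R (indicator U z *\<^sub>R g z) \<partial>lborel)"
  proof (intro Bochner_Integration.integral_cong refl)
    fix z
    show "(\<integral>\<theta>. indicator {0..2*pi} \<theta> *\<^sub>R \<Psi> (R \<theta> z) \<partial>lborel) = (2 * pi) *\<^sub>R (indicator U z *\<^sub>R g z)"
    proof (cases "z \<in> U")
      case True
      then show ?thesis using avg[OF True] inv(2) by (simp add: \<Psi>_def set_lebesgue_integral_def)
    next
      case False
      then show ?thesis using inv(2) by (simp add: \<Psi>_def)
    qed
  qed
  also have "... = (2 * pi) *\<^sub>R (\<integral>z. indicator U z *\<^sub>R g z \<partial>lborel)"
    by (rule integral_scaleR_right)
  finally show ?thesis by (simp add: \<Psi>_def set_lebesgue_integral_def)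
qed

section \<open>Cauchy estimates, Taylor remainders and pointwise limits, all by restriction to
  complex lines\<close>

section \<open>Holomorphic functions of several variables\<close>

lemma has_derivative_quadratic:
  fixes f :: "'a::real_normed_vector => 'b::real_normed_vector"
  assumes D: "bounded_linear D" and r: "r > 0"
    and bound: "\<And>h. norm h < r ==> norm (f (x + h) - f x - D h) <= C * (norm h)\<^sup>2"
  shows "(f has_derivative D) (at x)"
  unfolding has_derivative_at
proof
  show "(%h. norm (f (x + h) - f x - D h) / norm h) \<midarrow>0\<rightarrow> 0"
  proof (rule Lim_null_comparison[where g = "%h. C * norm h"])
    have "\<forall>\<^sub>F h in at 0. h \<in> ball 0 r - {0}"
      using r by (intro eventually_at_in_open) auto
    then show "\<forall>\<^sub>F h in at 0. norm (norm (f (x + h) - f x - D h) / norm h) <= C * norm h"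
    proof eventually_elim
      case (elim h)
      then have "norm (f (x + h) - f x - D h) <= C * norm h * norm h"
        using bound[of h] by (simp add: power2_eq_square mult.assoc)
      then show ?case using elim by (simp add: divide_le_eq)
    qed
    show "(%h. C * norm h) \<midarrow>0\<rightarrow> 0" by (auto intro!: tendsto_eq_intros)
  qed
qed (rule D)

abbreviation Dd :: "(complex ^ 'n => complex) => complex ^ 'n => complex ^ 'n => complex" where
  "Dd F z v \<equiv> frechet_derivative F (at z) v"

lemma bounded_linear_smult: "bounded_linear (%t. t *s (v :: complex ^ 'n))"
  by (rule linear_conv_bounded_linear[THEN iffD1], rule linearI)
     (auto simp: vec_eq_iff algebra_simps)

lemma norm_smult: "norm (t *s (v :: complex ^ 'n)) = norm t * norm v"
  by (simp add: norm_vec_def norm_mult L2_set_right_distrib)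

lemma scaleR_smult: "r *\<^sub>R (v :: complex ^ 'n) = of_real r *s v"
  by (simp add: vec_eq_iff complex_eq_iff)

lemma holomorphic_several_derivative:
  assumes "holomorphic_several F S" "z \<in> S"
  shows "(F has_derivative frechet_derivative F (at z)) (at z)" "Dd F z (a *s v) = a * Dd F z v"
proof -
  obtain D where D: "(F has_derivative D) (at z)" "\<And>a v. D (a *s v) = a * D v"
    using assms unfolding holomorphic_several_def by blast
  then have "D = frechet_derivative F (at z)" by (intro frechet_derivative_at)
  then show "(F has_derivative frechet_derivative F (at z)) (at z)" "Dd F z (a *s v) = a * Dd F z v"
    using D by auto
qed

lemma holomorphic_several_subset:
  "holomorphic_several F S ==> T \<subseteq> S ==> holomorphic_several F T"
  unfolding holomorphic_several_def by blast

lemma holomorphic_several_continuous_on: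
  assumes "holomorphic_several F S"
  shows "continuous_on S F"
  by (intro continuous_at_imp_continuous_on ballI has_derivative_continuous[OF holomorphic_several_derivative(1)[OF assms]])

lemma holomorphic_several_line:
  assumes "holomorphic_several F S" "z + t *s v \<in> S"
  shows "((%t. F (z + t *s v)) has_field_derivative Dd F (z + t *s v) v) (at t)"
proof -
  have "((%t. z + t *s v) has_derivative (%t. t *s v)) (at t)"
    using has_derivative_add[OF has_derivative_const bounded_linear_imp_has_derivative[OF bounded_linear_smult[of v]], of z]
    by simp
  from has_derivative_compose[OF this holomorphic_several_derivative(1)[OF assms]]
  have "((%t. F (z + t *s v)) has_derivative (%s. Dd F (z + t *s v) (s *s v))) (at t)" .
  moreover have "(%s. Dd F (z + t *s v) (s *s v)) = (*) (Dd F (z + t *s v) v)"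
    using holomorphic_several_derivative(2)[OF assms] by (auto simp: mult.commute)
  ultimately show ?thesis by (simp add: has_field_derivative_def)
qed

lemma holomorphic_several_line_holomorphic:
  assumes F: "holomorphic_several F S" and T: "\<And>t. t \<in> T ==> z + t *s v \<in> S"
  shows "(%t. F (z + t *s v)) holomorphic_on T"
  unfolding holomorphic_on_def field_differentiable_def
  by (intro ballI exI, rule has_field_derivative_at_within, rule holomorphic_several_line[OF F T])

text \<open>Cauchy's inequality on the complex line through z in direction v, taken at half the
  available radius so that the closed disc is inside; hence the factor 2.\<close>

lemma holomorphic_several_deriv_bound:
  assumes F: "holomorphic_several F (ball z r)" and r: "r > 0"
    and B: "\<And>w. w \<in> ball z r ==> norm (F w) <= B"
  shows "norm (Dd F z v) <= 2 * B / r * norm v"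
proof (cases "v = 0")
  case True
  have "Dd F z (0 *s v) = 0 * Dd F z v" using F r by (intro holomorphic_several_derivative(2)) auto
  then show ?thesis using True by simp
next
  case False
  define \<phi> where "\<phi> t = F (z + t *s v)" for t
  define R where "R = r / norm v"
  have R: "R > 0" using False r by (simp add: R_def)
  have in_ball: "z + t *s v \<in> ball z r" if "t \<in> ball 0 R" for t
    using that False by (simp add: dist_norm norm_smult R_def field_simps)
  have hol: "\<phi> holomorphic_on ball 0 R"
    unfolding \<phi>_def by (rule holomorphic_several_line_holomorphic[OF F in_ball])
  have "norm ((deriv ^^ 1) \<phi> 0) <= fact 1 * B / (R/2)^1"
  proof (rule Cauchy_inequality)
    show "\<phi> holomorphic_on ball 0 (R/2)" using hol R by (rule_tac holomorphic_on_subset) auto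
    show "continuous_on (cball 0 (R/2)) \<phi>"
      using hol R by (intro holomorphic_on_imp_continuous_on holomorphic_on_subset[OF hol]) auto
    show "norm (\<phi> x) <= B" if "norm (0 - x) = R/2" for x
      unfolding \<phi>_def by (intro B in_ball) (use that R in auto)
  qed (use R in auto)
  moreover have "(\<phi> has_field_derivative Dd F z v) (at 0)"
    using holomorphic_several_line[OF F, of z 0 v] r by (simp add: \<phi>_def[abs_def])
  ultimately show ?thesis
    by (simp add: DERIV_imp_deriv R_def field_simps)
qed

text \<open>Points of \<open>ball w r\<close> have balls of radius r inside
  \<open>ball w (2 * r)\<close>, where the derivative estimate applies.\<close>

lemma holomorphic_several_lipschitz:
  assumes F: "holomorphic_several F (ball w (2 * r))" and r: "r > 0"
    and B: "\<And>z. z \<in> ball w (2 * r) ==> norm (F z) <= B"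
    and z: "z \<in> ball w r" "z' \<in> ball w r"
  shows "norm (F z - F z') <= 2 * B / r * norm (z - z')"
proof (rule differentiable_bound[where S = "ball w r" and f' = "%x. frechet_derivative F (at x)"])
  fix x assume x: "x \<in> ball w r"
  have sub: "ball x r \<subseteq> ball w (2 * r)"
  proof
    fix y assume "y \<in> ball x r"
    then show "y \<in> ball w (2 * r)" using x dist_triangle[of w y x] by simp
  qed
  show "(F has_derivative frechet_derivative F (at x)) (at x within ball w r)"
    using holomorphic_several_derivative(1)[OF F, of x] x r has_derivative_at_withinI by fastforce
  show "onorm (frechet_derivative F (at x)) <= 2 * B / r"
    by (rule onorm_le) (rule holomorphic_several_deriv_bound[OF holomorphic_several_subset[OF F sub] r], use B sub in blast)
qed (use z in auto)

text \<open>One-variable Taylor on the line through w in direction h, where the disc has radius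
  \<open>R = r / norm h >= 2\<close>. Discs of radius R/4 about points of the closed unit disc stay
  inside, and Cauchy's inequality there gives \<open>2 * B / (R/4)^2 = 32 * B / R^2\<close>.\<close>

lemma holomorphic_several_taylor2:
  assumes F: "holomorphic_several F (ball w r)" and r: "r > 0"
    and B: "\<And>z. z \<in> ball w r ==> norm (F z) <= B"
    and h: "norm h <= r / 2"
  shows "norm (F (w + h) - F w - Dd F w h) <= 32 * B / r\<^sup>2 * (norm h)\<^sup>2"
proof (cases "h = 0")
  case True
  have "Dd F w (0 *s h) = 0 * Dd F w h" using F r by (intro holomorphic_several_derivative(2)) auto
  then show ?thesis using True by simp
next
  case False
  define \<phi> where "\<phi> t = F (w + t *s h)" for t
  define R where "R = r / norm h"
  have R: "R >= 2" using False h by (simp add: R_def field_simps)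
  have in_ball: "w + t *s h \<in> ball w r" if "t \<in> ball 0 R" for t
    using that False by (simp add: dist_norm norm_smult R_def field_simps)
  have hol: "\<phi> holomorphic_on ball 0 R"
    unfolding \<phi>_def by (rule holomorphic_several_line_holomorphic[OF F in_ball])
  have d0: "deriv \<phi> 0 = Dd F w h"
    using holomorphic_several_line[OF F, of w 0 h] r by (intro DERIV_imp_deriv) (simp add: \<phi>_def[abs_def])
  have "norm ((deriv ^^ 0) \<phi> 1 - (\<Sum>i\<le>1. (deriv ^^ i) \<phi> 0 * (1 - 0) ^ i / fact i)) <= (32 * B / R\<^sup>2) * norm (1 - 0 :: complex) ^ Suc 1 / fact 1"
  proof (rule complex_Taylor[where S = "cball 0 1"])
    fix i :: nat and x :: complex assume x: "x \<in> cball 0 1"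
    have hi: "(deriv ^^ i) \<phi> holomorphic_on ball 0 R" by (rule holomorphic_higher_deriv[OF hol]) auto
    have "x \<in> ball 0 R" using x R by auto
    then have "((deriv ^^ i) \<phi> has_field_derivative deriv ((deriv ^^ i) \<phi>) x) (at x)"
      using hi holomorphic_derivI by blast
    then show "((deriv ^^ i) \<phi> has_field_derivative (deriv ^^ Suc i) \<phi> x) (at x within cball 0 1)"
      by (simp add: has_field_derivative_at_within)
  next
    fix x :: complex assume x: "x \<in> cball 0 1"
    have sub: "cball x (R/4) \<subseteq> ball 0 R"
    proof
      fix y assume "y \<in> cball x (R/4)"
      then have "norm y <= norm x + R/4" using norm_triangle_sub[of y x] by (simp add: dist_norm norm_minus_commute)
      also have "... < R" using x R by simp
      finally show "y \<in> ball 0 R" by simp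
    qed
    have "norm ((deriv ^^ 2) \<phi> x) <= fact 2 * B / (R/4)^2"
    proof (rule Cauchy_inequality)
      show "\<phi> holomorphic_on ball x (R/4)" using sub by (intro holomorphic_on_subset[OF hol]) auto
      show "continuous_on (cball x (R/4)) \<phi>"
        using sub by (intro holomorphic_on_imp_continuous_on holomorphic_on_subset[OF hol]) auto
      show "norm (\<phi> y) <= B" if "norm (x - y) = R/4" for y
        unfolding \<phi>_def by (intro B in_ball subsetD[OF sub]) (use that in \<open>auto simp: dist_norm\<close>)
    qed (use R in auto)
    then show "norm ((deriv ^^ Suc 1) \<phi> x) <= 32 * B / R\<^sup>2"
      by (simp add: numeral_2_eq_2 power_divide field_simps)
  qed auto
  then have "norm (\<phi> 1 - (\<phi> 0 + deriv \<phi> 0)) <= 32 * B / R\<^sup>2" by simp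
  then show ?thesis using False unfolding d0
    by (simp add: \<phi>_def R_def power_divide field_simps)
qed

text \<open>A sequence uniformly close to convergent ones is Cauchy. This interchanges the limit of
  the functions with that of their difference quotients.\<close>

lemma convergent_of_approx:
  fixes X :: "nat => complex"
  assumes "\<And>e. e > 0 ==> \<exists>Y. convergent Y \<and> (\<forall>k. norm (X k - Y k) <= e)"
  shows "convergent X"
proof -
  have "Cauchy X"
  proof (rule metric_CauchyI)
    fix e :: real assume e: "e > 0"
    then obtain Y where Y: "convergent Y" "\<And>k. norm (X k - Y k) <= e/4"
      using assms[of "e/4"] by auto
    then obtain N where N: "\<And>m k. m >= N ==> k >= N ==> dist (Y m) (Y k) < e/4"
      using metric_CauchyD[OF convergent_Cauchy[OF Y(1)], of "e/4"] e by auto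
    have "dist (X m) (X k) < e" if "m >= N" "k >= N" for m k
    proof -
      have "dist (X m) (X k) <= dist (X m) (Y m) + dist (Y m) (Y k) + dist (Y k) (X k)"
        using dist_triangle[of "X m" "X k" "Y m"] dist_triangle[of "Y m" "X k" "Y k"] by linarith
      then show ?thesis using Y(2)[of m] Y(2)[of k] N[OF that] e by (simp add: dist_norm norm_minus_commute)
    qed
    then show "\<exists>N. \<forall>m\<ge>N. \<forall>k\<ge>N. dist (X m) (X k) < e" by blast
  qed
  then show ?thesis by (rule Cauchy_convergent)
qed

text \<open>The Taylor remainder is quadratic with a constant independent of k. Hence the
  derivatives at w converge, being uniformly approximated by difference quotients that converge, and
  the remainder estimate passes to the limit.\<close>

lemma holomorphic_several_limit_at:
  assumes F: "\<And>k::nat. holomorphic_several (F k) (ball w r)" and r: "r > 0"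
    and B: "\<And>k z. z \<in> ball w r ==> norm (F k z) <= B"
    and lim: "\<And>z. z \<in> ball w r ==> (%k. F k z) \<longlonglongrightarrow> G z"
  shows "\<exists>D. (G has_derivative D) (at w) \<and> (\<forall>a v. D (a *s v) = a * D v)"
proof -
  have wr: "w \<in> ball w r" using r by simp
  have B0: "B >= 0" using B[OF wr] norm_ge_zero order_trans by blast
  define C where "C = 32 * B / r\<^sup>2"
  have C0: "C >= 0" using B0 by (simp add: C_def)
  note D = holomorphic_several_derivative[OF F wr]
  have lin: "linear (frechet_derivative (F k) (at w))" for k
    using D(1)[of k] has_derivative_linear by blast
  have conv: "convergent (%k. Dd (F k) w h)" for h
  proof (cases "h = 0")
    case True
    then show ?thesis by (simp add: linear_0[OF lin] convergent_const)
  next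
    case False
    show ?thesis
    proof (rule convergent_of_approx)
      fix e :: real assume e: "e > 0"
      \<comment> \<open>The first bound keeps \<open>s *\<^sub>R h\<close> within half the radius,
        the second makes the error of the difference quotient at most e.\<close>
      define s where "s = min (r / (2 * norm h)) (e / ((C + 1) * (norm h)\<^sup>2))"
      have s: "s > 0" "s * norm h <= r / 2" "C * s * (norm h)\<^sup>2 <= e"
      proof -
        show "s > 0" using False r e C0 by (simp add: s_def)
        have "s <= r / (2 * norm h)" by (simp add: s_def)
        then show "s * norm h <= r / 2" using False by (simp add: field_simps)
        have "s <= e / ((C + 1) * (norm h)\<^sup>2)" by (simp add: s_def)
        moreover have "(C + 1) * (norm h)\<^sup>2 > 0" using False C0 by simp
        ultimately have "s * ((C + 1) * (norm h)\<^sup>2) <= e" by (simp only: pos_le_divide_eq)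
        then have "(C + 1) * s * (norm h)\<^sup>2 <= e" by (simp only: mult_ac)
        moreover have "C * s * (norm h)\<^sup>2 <= (C + 1) * s * (norm h)\<^sup>2" using \<open>s > 0\<close> by (intro mult_right_mono) auto
        ultimately show "C * s * (norm h)\<^sup>2 <= e" by linarith
      qed
      define Y where "Y k = (F k (w + s *\<^sub>R h) - F k w) / of_real s" for k
      have "w + s *\<^sub>R h \<in> ball w r" using s r by (simp add: dist_norm)
      from convergentI[OF tendsto_divide[OF tendsto_diff[OF lim[OF this] lim[OF wr]] tendsto_const, of "of_real s"]]
      have "convergent Y" using s by (simp add: Y_def[abs_def])
      moreover have "norm (Dd (F k) w h - Y k) <= e" for k
      proof -
        have "norm (F k (w + s *\<^sub>R h) - F k w - Dd (F k) w (s *\<^sub>R h)) <= C * (norm (s *\<^sub>R h))\<^sup>2"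
          unfolding C_def by (rule holomorphic_several_taylor2[OF F r B]) (use s in auto)
        moreover have "Dd (F k) w (s *\<^sub>R h) = of_real s * Dd (F k) w h" by (simp add: scaleR_smult D(2))
        moreover have "Dd (F k) w h - Y k = - (F k (w + s *\<^sub>R h) - F k w - of_real s * Dd (F k) w h) / of_real s"
          using s by (simp add: Y_def field_simps)
        ultimately have "norm (Dd (F k) w h - Y k) <= C * (norm (s *\<^sub>R h))\<^sup>2 / s"
          using s by (simp add: norm_divide divide_right_mono norm_minus_commute)
        also have "... = C * s * (norm h)\<^sup>2" using s by (simp add: power_mult_distrib power2_eq_square)
        finally show ?thesis using s by linarith
      qed
      ultimately show "\<exists>Y. convergent Y \<and> (\<forall>k. norm (Dd (F k) w h - Y k) <= e)" by blast
    qed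
  qed
  define L where "L h = lim (%k. Dd (F k) w h)" for h
  have L: "(%k. Dd (F k) w h) \<longlonglongrightarrow> L h" for h
    using conv[of h] by (simp add: L_def convergent_LIMSEQ_iff)
  have Ls: "L (a *s v) = a * L v" for a v
  proof (rule LIMSEQ_unique[OF L])
    show "(%k. Dd (F k) w (a *s v)) \<longlonglongrightarrow> a * L v" unfolding D(2) by (intro tendsto_intros L)
  qed
  have La: "L (u + v) = L u + L v" for u v
  proof (rule LIMSEQ_unique[OF L])
    show "(%k. Dd (F k) w (u + v)) \<longlonglongrightarrow> L u + L v" unfolding linear_add[OF lin] by (intro tendsto_intros L)
  qed
  have Lb: "norm (L v) <= norm v * (2 * B / r)" for v
  proof (rule LIMSEQ_le_const2[OF tendsto_norm[OF L]])
    show "\<exists>N. \<forall>k\<ge>N. norm (Dd (F k) w v) <= norm v * (2 * B / r)"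
      using holomorphic_several_deriv_bound[OF F r B, of _ v] by (auto simp: mult.commute)
  qed
  have bl: "bounded_linear L"
    by (rule bounded_linear_intro[OF La _ Lb]) (simp add: scaleR_smult Ls scaleR_conv_of_real)
  have "(G has_derivative L) (at w)"
  proof (rule has_derivative_quadratic[OF bl])
    show "r / 2 > 0" using r by simp
    fix h :: "complex ^ 'a" assume h: "norm h < r / 2"
    then have "w + h \<in> ball w r" using r by (simp add: dist_norm)
    then have "(%k. norm (F k (w + h) - F k w - Dd (F k) w h)) \<longlonglongrightarrow> norm (G (w + h) - G w - L h)"
      by (intro tendsto_intros lim L wr)
    then show "norm (G (w + h) - G w - L h) <= C * (norm h)\<^sup>2"
      by (rule LIMSEQ_le_const2)
         (use holomorphic_several_taylor2[OF F r B less_imp_le[OF h]] in \<open>auto simp: C_def\<close>)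
  qed
  then show ?thesis using Ls by blast
qed

text \<open>A directional derivative is the pointwise limit of difference quotients, which are
  holomorphic and locally bounded by a Lipschitz constant.\<close>

lemma holomorphic_several_deriv:
  assumes F: "holomorphic_several F S" and S: "open S"
  shows "holomorphic_several (%z. Dd F z v) S"
  unfolding holomorphic_several_def
proof
  fix w assume w: "w \<in> S"
  obtain e where e: "e > 0" "cball w e \<subseteq> S" using S w open_contains_cball by blast
  define r where "r = e / 4"
  have r: "r > 0" "ball w (4 * r) \<subseteq> S" using e by (auto simp: r_def)
  have "compact (F ` cball w e)"
    by (intro compact_continuous_image continuous_on_subset[OF holomorphic_several_continuous_on[OF F] e(2)]) auto
  then have "bounded (F ` cball w e)" by (rule compact_imp_bounded)
  then obtain B where "\<forall>x\<in>F ` cball w e. norm x <= B" by (auto simp only: bounded_iff)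
  then have B: "norm (F z) <= B" if "z \<in> cball w e" for z using that by (simp only: ball_simps)
  \<comment> \<open>Starting the steps late enough keeps the translates of \<open>ball w r\<close>
    inside \<open>ball w (2 * r)\<close>.\<close>
  obtain N :: nat where N: "norm v / r < real N" using reals_Archimedean2 by blast
  define t where "t k = 1 / real (Suc (N + k))" for k
  have t: "t k > 0" "t k * norm v < r" for k
  proof -
    show "t k > 0" by (simp add: t_def)
    have "norm v < r * real N" using N r by (simp add: pos_divide_less_eq mult.commute)
    also have "... <= r * real (Suc (N + k))" using r by (intro mult_left_mono) auto
    finally have "norm v < r * real (Suc (N + k))" .
    then have "norm v / real (Suc (N + k)) < r" by (simp only: pos_divide_less_eq of_nat_0_less_iff zero_less_Suc)
    then show "t k * norm v < r" by (simp add: t_def)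
  qed
  define G where "G k z = (F (z + of_real (t k) *s v) - F z) / of_real (t k)" for k z
  have in_ball: "z + of_real (t k) *s v \<in> ball w (2 * r)" if "z \<in> ball w r" for z k
  proof -
    have "norm (of_real (t k) *s v) < r" using t[of k] by (simp add: norm_smult)
    then show ?thesis using that norm_triangle_ineq[of "z - w" "of_real (t k) *s v"]
      by (simp add: dist_norm norm_minus_commute[of w] algebra_simps)
  qed
  have r24: "ball w r \<subseteq> ball w (2 * r)" "ball w (2*r) \<subseteq> S" using r by auto
  show "\<exists>D. ((%z. Dd F z v) has_derivative D) (at w) \<and> (\<forall>a u. D (a *s u) = a * D u)"
  proof (rule holomorphic_several_limit_at[OF _ r(1), of G])
    fix k
    show "holomorphic_several (G k) (ball w r)"
      unfolding holomorphic_several_def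
    proof
      fix z assume z: "z \<in> ball w r"
      let ?z = "z + of_real (t k) *s v"
      have zS: "z \<in> S" "?z \<in> S" using in_ball[OF z, of k] z r24 by blast+
      have "((%z. z + of_real (t k) *s v) has_derivative (%h. h)) (at z)" by (auto intro!: derivative_eq_intros)
      from has_derivative_compose[OF this holomorphic_several_derivative(1)[OF F zS(2)]]
      have 1: "((%z. F (z + of_real (t k) *s v)) has_derivative (%h. Dd F ?z h)) (at z)" by simp
      have "(G k has_derivative (%h. (Dd F ?z h - Dd F z h) / of_real (t k))) (at z)"
        unfolding G_def[abs_def]
        by (rule bounded_linear.has_derivative[OF bounded_linear_divide has_derivative_diff[OF 1 holomorphic_several_derivative(1)[OF F zS(1)]]])
      then show "\<exists>D. (G k has_derivative D) (at z) \<and> (\<forall>a u. D (a *s u) = a * D u)"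
        using holomorphic_several_derivative(2)[OF F zS(1)] holomorphic_several_derivative(2)[OF F zS(2)]
        by (intro exI conjI) (auto simp: algebra_simps diff_divide_distrib)
    qed
  next
    fix k z assume z: "z \<in> ball w r"
    have "norm (F (z + of_real (t k) *s v) - F z) <= 2 * B / (2 * r) * norm (z + of_real (t k) *s v - z)"
    proof (rule holomorphic_several_lipschitz[where w = w])
      show "holomorphic_several F (ball w (2 * (2 * r)))" using F r by (intro holomorphic_several_subset[OF F]) auto
      show "norm (F z) <= B" if "z \<in> ball w (2 * (2 * r))" for z using B that by (simp add: r_def)
    qed (use r in_ball[OF z] z in auto)
    also have "... = B / r * t k * norm v" using t[of k] by (simp add: norm_smult)
    finally show "norm (G k z) <= B / r * norm v"
      using t[of k] by (simp add: G_def norm_divide field_simps)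
  next
    fix z assume z: "z \<in> ball w r"
    then have "z + 0 *s v \<in> S" using r24 by auto
    then have "((%t. F (z + t *s v)) has_field_derivative Dd F z v) (at 0)"
      using holomorphic_several_line[OF F, of z 0 v] by simp
    then have "(%h. (F (z + h *s v) - F z) / h) \<midarrow>0\<rightarrow> Dd F z v" by (simp add: DERIV_def)
    moreover have "filterlim (%k. complex_of_real (t k)) (at 0) sequentially"
    proof -
      have "(%k. 1 / real (Suc k)) \<longlonglongrightarrow> 0" by (rule LIMSEQ_Suc[OF lim_1_over_n])
      then have "t \<longlonglongrightarrow> 0" unfolding t_def[abs_def]
        using LIMSEQ_ignore_initial_segment[of "%k. 1 / real (Suc k)" 0 N] by (simp add: add.commute)
      then have "(%k. complex_of_real (t k)) \<longlonglongrightarrow> complex_of_real 0" by (rule tendsto_of_real)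
      then show ?thesis using t(1) by (auto simp: filterlim_at less_imp_neq[symmetric])
    qed
    ultimately show "(%k. G k z) \<longlonglongrightarrow> Dd F z v"
      unfolding G_def by (rule filterlim_compose)
  qed
qed

section \<open>Kernels, derivative representers and the Levi form of the logarithm of the
  kernel\<close>

section \<open>The metric of a reproducing kernel\<close>

text \<open>Evaluation bounds that are uniform near each point are what the two spaces have to
  supply. They yield the kernel, the representers of derivatives and the regularity of the kernel on
  the diagonal.\<close>

locale kernel_space = function_hilbert M H
  for M :: "(complex ^ 'n) measure" and H +
  fixes \<Omega> :: "(complex ^ 'n) set"
  assumes open_domain: "open \<Omega>"
    and holo: "(f, F) \<in> H ==> holomorphic_several F \<Omega>"
    and locally_bounded: "w \<in> \<Omega> ==> \<exists>r>0. \<exists>C\<ge>0. ball w r \<subseteq> \<Omega> \<and>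
      (\<forall>f F z. (f, F) \<in> H --> z \<in> ball w r --> norm (F z) <= C * sqrt (nsq M f))"
begin

lemma kernel: "is_reproducing_kernel M H \<Omega> (reproducing_kernel M H \<Omega>)"
proof (rule reproducing_kernel_exists)
  fix w assume "w \<in> \<Omega>"
  from locally_bounded[OF this] obtain r C where r: "r > 0"
    and C: "\<forall>f F z. (f, F) \<in> H --> z \<in> ball w r --> norm (F z) <= C * sqrt (nsq M f)"
    by (elim exE conjE)
  show "\<exists>C. \<forall>(f, F)\<in>H. norm (F w) <= C * sqrt (nsq M f)"
    by (intro exI[of _ C] ballI, clarify) (use r C in auto)
qed

definition K :: "complex ^ 'n => complex ^ 'n => complex" where
  "K = reproducing_kernel M H \<Omega>"

text \<open>The square integrable partner of the kernel function at w; for the Hardy space it is a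
  function on the boundary, while \<open>K\<close> gives the values inside.\<close>

definition kf :: "complex ^ 'n => complex ^ 'n => complex" where
  "kf w = (SOME k. (k, %z. K z w) \<in> H \<and> (\<forall>(f, F)\<in>H. F w = ip M f k))"

lemma kf:
  assumes "w \<in> \<Omega>"
  shows "(kf w, %z. K z w) \<in> H" "(f, F) \<in> H ==> F w = ip M f (kf w)"
proof -
  have "\<exists>k. (k, %z. K z w) \<in> H \<and> (\<forall>(f, F)\<in>H. F w = ip M f k)"
    using kernel assms unfolding is_reproducing_kernel_def K_def ip_def by blast
  then have "(kf w, %z. K z w) \<in> H \<and> (\<forall>(f, F)\<in>H. F w = ip M f (kf w))"
    unfolding kf_def by (rule someI_ex)
  then show "(kf w, %z. K z w) \<in> H" "(f, F) \<in> H ==> F w = ip M f (kf w)" by auto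
qed

lemma sq_kf: "w \<in> \<Omega> ==> square_integrable M (kf w)"
  using kf(1) sq by blast

lemma K_eq: "z \<in> \<Omega> ==> w \<in> \<Omega> ==> K z w = ip M (kf w) (kf z)"
  using kf(1)[of w] kf(2)[of z] by blast

lemma K_diag: "w \<in> \<Omega> ==> K w w = of_real (nsq M (kf w))"
  by (simp add: K_eq ip_self)

lemma eval_le:
  assumes "w \<in> \<Omega>" "(f, F) \<in> H"
  shows "(norm (F w))\<^sup>2 <= nsq M f * nsq M (kf w)"
  using kf(2)[OF assms] cauchy_schwarz[OF sq[OF assms(2)] sq_kf[OF assms(1)]] by simp

text \<open>The kernel function is extremal for evaluation at w, since its value there is its own
  squared norm; so the bound is tested on it.\<close>

lemma nsq_kf_le:
  assumes w: "w \<in> \<Omega>" and C: "C >= 0" and bound: "\<And>f F. (f, F) \<in> H ==> (norm (F w))\<^sup>2 <= C * nsq M f"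
  shows "nsq M (kf w) <= C"
proof (cases "nsq M (kf w) = 0")
  case False
  then have pos: "nsq M (kf w) > 0" using nsq_nonneg[of M "kf w"] by linarith
  have "(nsq M (kf w))\<^sup>2 <= C * nsq M (kf w)"
    using bound[OF kf(1)[OF w]] by (simp add: K_diag[OF w])
  then show ?thesis using pos by (simp add: power2_eq_square)
qed (use C in simp)

text \<open>Cancels one factor \<open>sqrt (nsq M f)\<close>. With f a difference of representers, a
  bound for the functional it represents becomes a bound for its norm.\<close>

lemma nsq_le_of_ip:
  assumes f: "square_integrable M f" and le: "norm (ip M f f) <= L * sqrt (nsq M f)" and L: "L >= 0"
  shows "nsq M f <= L\<^sup>2"
proof (cases "nsq M f = 0")
  case False
  then have pos: "nsq M f > 0" using nsq_nonneg[of M f] by linarith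
  have "sqrt (nsq M f) * sqrt (nsq M f) <= L * sqrt (nsq M f)" using le by (simp add: ip_self)
  then have "sqrt (nsq M f) <= L" using pos by (simp only: mult_le_cancel_right) auto
  then show ?thesis using real_sqrt_le_iff by (metis L abs_of_nonneg real_sqrt_abs)
qed simp

text \<open>The Cauchy estimate bounds the derivative functional by the local bound on evaluations,
  so the Riesz theorem applies.\<close>

lemma derivative_representer:
  assumes w: "w \<in> \<Omega>"
  shows "\<exists>e E. (e, E) \<in> H \<and> (\<forall>(f, F)\<in>H. Dd F w v = ip M f e)"
proof -
  from locally_bounded[OF w] obtain r C where r: "r > 0" and r2: "ball w r \<subseteq> \<Omega>"
    and "\<forall>f F z. (f, F) \<in> H --> z \<in> ball w r --> norm (F z) <= C * sqrt (nsq M f)"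
    by (elim exE conjE)
  then have C: "norm (F z) <= C * sqrt (nsq M f)" if "(f, F) \<in> H" "z \<in> ball w r" for f F z
    using that by blast
  show ?thesis
  proof (rule riesz[where \<Lambda> = "%F. Dd F w v" and C = "2 * C / r * norm v"])
    fix f F g G c assume f: "(f, F) \<in> H" and g: "(g, G) \<in> H"
    have "((%z. c * F z + G z) has_derivative (%v. c * Dd F w v + Dd G w v)) (at w)"
      by (intro derivative_intros holomorphic_several_derivative(1)[OF holo[OF f] w]
          holomorphic_several_derivative(1)[OF holo[OF g] w])
    from frechet_derivative_at[OF this]
    show "Dd (%z. c * F z + G z) w v = c * Dd F w v + Dd G w v" using fun_cong by metis
  next
    fix f F assume f: "(f, F) \<in> H"
    have "norm (Dd F w v) <= 2 * (C * sqrt (nsq M f)) / r * norm v"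
      by (rule holomorphic_several_deriv_bound[OF holomorphic_several_subset[OF holo[OF f] r2] r]) (rule C[OF f])
    then show "norm (Dd F w v) <= 2 * C / r * norm v * sqrt (nsq M f)" by (simp add: field_simps)
  qed
qed

text \<open>With \<phi> the squared norm of \<open>kf w\<close> and \<psi> the inner product of the
  derivative representer with \<open>kf w\<close>, the antiholomorphic derivative of
  \<open>ln \<phi>\<close> is \<open>\<psi> / \<phi>\<close>. Both \<phi> and \<psi> are
  differentiated through their increments: \<open>kf\<close> and \<open>ev\<close> are Lipschitz in
  norm, so products of two increments are quadratic errors, and what is left are derivatives of
  fixed holomorphic functions.\<close>

lemma levi_form_log_kernel:
  assumes p: "p \<in> \<Omega>" and pos: "nsq M (kf p) > 0" and e0: "(e, E) \<in> H"
    and rep: "\<And>f F. (f, F) \<in> H ==> Dd F p (axis i 1) = ip M f e"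
  shows "levi_form (%w. ln (Re (reproducing_kernel M H \<Omega> w w))) p (axis i 1) =
    (nsq M e * nsq M (kf p) - (norm (ip M e (kf p)))\<^sup>2) / (nsq M (kf p))\<^sup>2"
proof -
  define v :: "complex ^ 'n" where "v = axis i 1"
  have vi: "axis i \<i> = \<i> *s v" by (simp add: v_def vec_eq_iff axis_def)
  have nv: "norm v = 1"
    using norm_Basis[of "axis i 1 :: complex ^ 'n"] by (simp add: v_def Basis_complex_def)
  from locally_bounded[OF p] obtain r C where r1: "r > 0" and C0: "C >= 0" and r2: "ball p r \<subseteq> \<Omega>"
    and "\<forall>f F z. (f, F) \<in> H --> z \<in> ball p r --> norm (F z) <= C * sqrt (nsq M f)"
    by (elim exE conjE)
  then have C: "norm (F z) <= C * sqrt (nsq M f)" if "(f, F) \<in> H" "z \<in> ball p r" for f F z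
    using that by blast
  note r = r1 r2
  define L where "L = 4 * C / r"
  define L' where "L' = 32 * C / r\<^sup>2"
  have L0: "L >= 0" "L' >= 0" using C0 r by (auto simp: L_def L'_def)
  have lip: "norm (F z - F z') <= L * norm (z - z') * sqrt (nsq M f)"
    if f: "(f, F) \<in> H" and z: "z \<in> ball p (r/2)" "z' \<in> ball p (r/2)" for f F z z'
  proof -
    have "norm (F z - F z') <= 2 * (C * sqrt (nsq M f)) / (r/2) * norm (z - z')"
      by (rule holomorphic_several_lipschitz[where w = p])
         (use r z C[OF f] holomorphic_several_subset[OF holo[OF f] r(2)] in auto)
    then show ?thesis by (simp add: L_def field_simps)
  qed
  have dbound: "norm (Dd F z v) <= 4 * C / r * sqrt (nsq M f)" if f: "(f, F) \<in> H" and z: "z \<in> ball p (r/2)" for f F z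
  proof -
    have sub: "ball z (r/2) \<subseteq> ball p r"
    proof
      fix y assume "y \<in> ball z (r/2)"
      then show "y \<in> ball p r" using z dist_triangle[of p y z] by simp
    qed
    have "norm (Dd F z v) <= 2 * (C * sqrt (nsq M f)) / (r/2) * norm v"
      by (rule holomorphic_several_deriv_bound) (use r sub C[OF f] holomorphic_several_subset[OF holo[OF f]] in auto)
    then show ?thesis by (simp add: nv field_simps)
  qed
  have dlip: "norm (Dd F z v - Dd F z' v) <= L' * norm (z - z') * sqrt (nsq M f)"
    if f: "(f, F) \<in> H" and z: "z \<in> ball p (r/4)" "z' \<in> ball p (r/4)" for f F z z'
  proof -
    have "holomorphic_several (%z. Dd F z v) (ball p (2 * (r/4)))"
      by (rule holomorphic_several_subset[OF holomorphic_several_deriv[OF holo[OF f] open_domain]]) (use r in auto)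
    then have "norm (Dd F z v - Dd F z' v) <= 2 * (4 * C / r * sqrt (nsq M f)) / (r/4) * norm (z - z')"
      by (rule holomorphic_several_lipschitz[where w = p]) (use r z dbound[OF f] in auto)
    also have "... = L' * norm (z - z') * sqrt (nsq M f)" by (simp add: L'_def power2_eq_square)
    finally show ?thesis .
  qed
  have in_\<Omega>: "z \<in> \<Omega>" if "z \<in> ball p (r/2)" for z using r that by auto
  \<comment> \<open>Any representer serves, as its inner products with elements of H do not depend
    on the choice.\<close>
  define ev where "ev w = (SOME e. \<exists>E. (e, E) \<in> H \<and> (\<forall>(f, F)\<in>H. Dd F w v = ip M f e))" for w
  define Ev where "Ev w = (SOME E. (ev w, E) \<in> H \<and> (\<forall>(f, F)\<in>H. Dd F w v = ip M f (ev w)))" for w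
  have evH: "(ev w, Ev w) \<in> H" and evrep: "\<And>f F. (f, F) \<in> H ==> Dd F w v = ip M f (ev w)" if "w \<in> \<Omega>" for w
  proof -
    have "\<exists>E. (ev w, E) \<in> H \<and> (\<forall>(f, F)\<in>H. Dd F w v = ip M f (ev w))"
      unfolding ev_def
      by (rule someI_ex[where P = "%e. \<exists>E. (e, E) \<in> H \<and> (\<forall>(f, F)\<in>H. Dd F w v = ip M f e)"])
         (rule derivative_representer[OF that])
    then have "(ev w, Ev w) \<in> H \<and> (\<forall>(f, F)\<in>H. Dd F w v = ip M f (ev w))"
      unfolding Ev_def by (rule someI_ex)
    then show "(ev w, Ev w) \<in> H" "\<And>f F. (f, F) \<in> H ==> Dd F w v = ip M f (ev w)" by auto
  qed
  have sqe: "square_integrable M (ev w)" if "w \<in> \<Omega>" for w using evH[OF that] sq by blast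
  \<comment> \<open>Duality: the inner product of the difference with itself is the difference of
    its own values at w and w', to which the Lipschitz bound applies.\<close>
  have kdiff: "nsq M (%z. kf w z - kf w' z) <= (L * norm (w - w'))\<^sup>2"
    if w: "w \<in> ball p (r/2)" "w' \<in> ball p (r/2)" for w w'
  proof (rule nsq_le_of_ip)
    note \<Omega> = in_\<Omega>[OF w(1)] in_\<Omega>[OF w(2)]
    let ?d = "%z. kf w z - kf w' z"
    show d: "square_integrable M ?d" by (rule square_integrable_diff[OF sq_kf[OF \<Omega>(1)] sq_kf[OF \<Omega>(2)]])
    have dH: "(?d, %z. K z w - K z w') \<in> H" by (rule diff[OF kf(1)[OF \<Omega>(1)] kf(1)[OF \<Omega>(2)]])
    have "ip M ?d ?d = (K w w - K w w') - (K w' w - K w' w')"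
      using ip_diff_right[OF sq_kf[OF \<Omega>(1)] sq_kf[OF \<Omega>(2)] d] kf(2)[OF \<Omega>(1) dH] kf(2)[OF \<Omega>(2) dH] by simp
    then show "norm (ip M ?d ?d) <= L * norm (w - w') * sqrt (nsq M ?d)" using lip[OF dH w] by simp
  qed (use L0 in auto)
  have ediff: "nsq M (%z. ev w z - ev w' z) <= (L' * norm (w - w'))\<^sup>2"
    if w: "w \<in> ball p (r/4)" "w' \<in> ball p (r/4)" for w w'
  proof (rule nsq_le_of_ip)
    have \<Omega>: "w \<in> \<Omega>" "w' \<in> \<Omega>" using w r by auto
    let ?d = "%z. ev w z - ev w' z" and ?D = "%z. Ev w z - Ev w' z"
    show d: "square_integrable M ?d" by (rule square_integrable_diff[OF sqe[OF \<Omega>(1)] sqe[OF \<Omega>(2)]])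
    have dH: "(?d, ?D) \<in> H" by (rule diff[OF evH[OF \<Omega>(1)] evH[OF \<Omega>(2)]])
    have "ip M ?d ?d = Dd ?D w v - Dd ?D w' v"
      using ip_diff_right[OF sqe[OF \<Omega>(1)] sqe[OF \<Omega>(2)] d] evrep[OF \<Omega>(1) dH] evrep[OF \<Omega>(2) dH] by simp
    then show "norm (ip M ?d ?d) <= L' * norm (w - w') * sqrt (nsq M ?d)" using dlip[OF dH w] by simp
  qed (use L0 in auto)
  define \<phi> where "\<phi> w = nsq M (kf w)" for w
  define \<psi> where "\<psi> w = ip M (ev w) (kf w)" for w
  define a where "a w = Dd (%z. K z w) w v" for w
  have a\<psi>: "\<psi> w = cnj (a w)" if "w \<in> \<Omega>" for w
    using evrep[OF that kf(1)[OF that]] by (simp add: \<psi>_def a_def ip_commute[of M "ev w"])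
  have d\<phi>: "(\<phi> has_derivative (%h. 2 * Re (Dd (%z. K z w) w h))) (at w)" if w: "w \<in> ball p (r/4)" for w
  proof -
    have w\<Omega>: "w \<in> \<Omega>" and w2: "w \<in> ball p (r/2)" using w r by auto
    let ?\<kappa> = "%z. K z w"
    note \<kappa>H = kf(1)[OF w\<Omega>]
    have sub: "ball w (r/4) \<subseteq> ball p (r/2)"
    proof
      fix y assume "y \<in> ball w (r/4)"
      then show "y \<in> ball p (r/2)" using w dist_triangle[of p y w] by simp
    qed
    have Dk: "(?\<kappa> has_derivative frechet_derivative ?\<kappa> (at w)) (at w)"
      by (rule holomorphic_several_derivative(1)[OF holo[OF \<kappa>H] w\<Omega>])
    define B where "B = C * sqrt (nsq M (kf w))"
    show ?thesis
    proof (rule has_derivative_quadratic[where r = "r/8" and C = "2 * (32 * B / (r/4)\<^sup>2) + L\<^sup>2"])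
      show "bounded_linear (%h. 2 * Re (Dd ?\<kappa> w h))"
        by (intro bounded_linear_mult_right[THEN bounded_linear_compose] bounded_linear_Re[THEN bounded_linear_compose] has_derivative_bounded_linear[OF Dk])
      fix h :: "complex ^ 'n" assume h: "norm h < r/8"
      have wh: "w + h \<in> ball w (r/4)" using h r by (simp add: dist_norm)
      then have wh2: "w + h \<in> ball p (r/2)" using sub by blast
      then have wh\<Omega>: "w + h \<in> \<Omega>" by (rule in_\<Omega>)
      let ?\<delta> = "%z. kf (w + h) z - kf w z"
      have sqd: "square_integrable M ?\<delta>" by (rule square_integrable_diff[OF sq_kf[OF wh\<Omega>] sq_kf[OF w\<Omega>]])
      have "\<phi> (w + h) = \<phi> w + nsq M ?\<delta> + 2 * Re (ip M ?\<delta> (kf w))"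
        using nsq_lin[OF sqd sq_kf[OF w\<Omega>], of 1] by (simp add: \<phi>_def)
      moreover have "ip M ?\<delta> (kf w) = cnj (K (w + h) w - K w w)"
      proof -
        have "ip M ?\<delta> (kf w) = ip M (kf (w + h)) (kf w) - ip M (kf w) (kf w)"
          by (rule ip_diff_left[OF sq_kf[OF wh\<Omega>] sq_kf[OF w\<Omega>] sq_kf[OF w\<Omega>]])
        then show ?thesis using K_eq[OF wh\<Omega> w\<Omega>] K_eq[OF w\<Omega> w\<Omega>]
          by (simp add: ip_commute[of M "kf (w + h)"] ip_self)
      qed
      ultimately have eq: "\<phi> (w + h) - \<phi> w - 2 * Re (Dd ?\<kappa> w h) =
          2 * Re (K (w + h) w - K w w - Dd ?\<kappa> w h) + nsq M ?\<delta>"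
        by simp
      have "norm (?\<kappa> (w + h) - ?\<kappa> w - Dd ?\<kappa> w h) <= 32 * B / (r/4)\<^sup>2 * (norm h)\<^sup>2"
      proof (rule holomorphic_several_taylor2)
        show "holomorphic_several ?\<kappa> (ball w (r/4))"
          using sub in_\<Omega> by (intro holomorphic_several_subset[OF holo[OF \<kappa>H]]) blast
        have "ball w (r/4) \<subseteq> ball p r" using sub r by force
        then show "norm (K z w) <= B" if "z \<in> ball w (r/4)" for z
          unfolding B_def using C[OF \<kappa>H] that by blast
      qed (use r h in auto)
      then have "\<bar>Re (K (w + h) w - K w w - Dd ?\<kappa> w h)\<bar> <= 32 * B / (r/4)\<^sup>2 * (norm h)\<^sup>2"
        using abs_Re_le_cmod order_trans by blast
      moreover have "nsq M ?\<delta> <= L\<^sup>2 * (norm h)\<^sup>2" using kdiff[OF wh2 w2] by (simp add: power_mult_distrib)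
      ultimately show "norm (\<phi> (w + h) - \<phi> w - 2 * Re (Dd ?\<kappa> w h)) <= (2 * (32 * B / (r/4)\<^sup>2) + L\<^sup>2) * (norm h)\<^sup>2"
        unfolding eq using nsq_nonneg[of M ?\<delta>] by (simp only: real_norm_def distrib_right)
    qed (use r in auto)
  qed
  define \<kappa> where "\<kappa> z = K z p" for z
  have \<kappa>H: "(kf p, \<kappa>) \<in> H" using kf(1)[OF p] by (simp add: \<kappa>_def[abs_def])
  define d\<kappa> where "d\<kappa> z = Dd \<kappa> z v" for z
  have d\<kappa>_hol: "holomorphic_several d\<kappa> \<Omega>"
    unfolding d\<kappa>_def by (rule holomorphic_several_deriv[OF holo[OF \<kappa>H] open_domain])
  note EpH = evH[OF p]
  have DE: "(Ev p has_derivative frechet_derivative (Ev p) (at p)) (at p)"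
    by (rule holomorphic_several_derivative(1)[OF holo[OF EpH] p])
  have Dd\<kappa>: "(d\<kappa> has_derivative frechet_derivative d\<kappa> (at p)) (at p)"
    by (rule holomorphic_several_derivative(1)[OF d\<kappa>_hol p])
  \<comment> \<open>The complex linear part differentiates the fixed function \<open>Ev p\<close>,
    the conjugate linear part the derivative of the fixed kernel function at p.\<close>
  define Bd where "Bd h = Dd (Ev p) p h + cnj (Dd d\<kappa> p h)" for h
  have d\<psi>: "(\<psi> has_derivative Bd) (at p)"
  proof -
    define B1 where "B1 = C * sqrt (nsq M (ev p))"
    define B2 where "B2 = 4 * C / r * sqrt (nsq M (kf p))"
    show ?thesis
    proof (rule has_derivative_quadratic[where r = "r/8" and C = "32 * B1 / (r/4)\<^sup>2 + 32 * B2 / (r/4)\<^sup>2 + L' * L"])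
      show "bounded_linear Bd"
        unfolding Bd_def
        by (intro bounded_linear_add bounded_linear_cnj[THEN bounded_linear_compose] has_derivative_bounded_linear[OF DE] has_derivative_bounded_linear[OF Dd\<kappa>])
      fix h :: "complex ^ 'n" assume h: "norm h < r/8"
      have ph: "p + h \<in> ball p (r/4)" "p \<in> ball p (r/4)" using h r by (auto simp: dist_norm)
      then have ph2: "p + h \<in> ball p (r/2)" "p \<in> ball p (r/2)" using r by auto
      then have ph\<Omega>: "p + h \<in> \<Omega>" by (intro in_\<Omega>)
      let ?\<delta> = "%z. kf (p + h) z - kf p z" and ?\<epsilon> = "%z. ev (p + h) z - ev p z"
      have sqd: "square_integrable M ?\<delta>" by (rule square_integrable_diff[OF sq_kf[OF ph\<Omega>] sq_kf[OF p]])
      have sqh: "square_integrable M ?\<epsilon>" by (rule square_integrable_diff[OF sqe[OF ph\<Omega>] sqe[OF p]])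
      have "ip M (ev p) ?\<delta> = Ev p (p + h) - Ev p p"
        using ip_diff_right[OF sq_kf[OF ph\<Omega>] sq_kf[OF p] sqe[OF p]] kf(2)[OF ph\<Omega> EpH] kf(2)[OF p EpH] by simp
      moreover have "ip M ?\<epsilon> (kf p) = cnj (d\<kappa> (p + h) - d\<kappa> p)"
        using ip_diff_left[OF sqe[OF ph\<Omega>] sqe[OF p] sq_kf[OF p]] evrep[OF ph\<Omega> \<kappa>H] evrep[OF p \<kappa>H]
        by (simp add: d\<kappa>_def ip_commute[of M "kf p"])
      \<comment> \<open>Product rule with remainder; the last summand, a product of two increments,
        is the quadratic error.\<close>
      moreover have "\<psi> (p + h) - \<psi> p = ip M ?\<epsilon> (kf p) + ip M (ev p) ?\<delta> + ip M ?\<epsilon> ?\<delta>"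
        unfolding \<psi>_def ip_diff_left[OF sqe[OF ph\<Omega>] sqe[OF p] sq_kf[OF p]]
          ip_diff_right[OF sq_kf[OF ph\<Omega>] sq_kf[OF p] sqe[OF p]]
          ip_diff_right[OF sq_kf[OF ph\<Omega>] sq_kf[OF p] sqh]
          ip_diff_left[OF sqe[OF ph\<Omega>] sqe[OF p] sq_kf[OF p]] ip_diff_left[OF sqe[OF ph\<Omega>] sqe[OF p] sq_kf[OF ph\<Omega>]]
        by simp
      ultimately have eq: "\<psi> (p + h) - \<psi> p - Bd h =
          (Ev p (p + h) - Ev p p - Dd (Ev p) p h) + cnj (d\<kappa> (p + h) - d\<kappa> p - Dd d\<kappa> p h) + ip M ?\<epsilon> ?\<delta>"
        by (simp add: Bd_def)
      have "norm (Ev p (p + h) - Ev p p - Dd (Ev p) p h) <= 32 * B1 / (r/4)\<^sup>2 * (norm h)\<^sup>2"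
      proof (rule holomorphic_several_taylor2)
        show "holomorphic_several (Ev p) (ball p (r/4))"
          using r by (intro holomorphic_several_subset[OF holo[OF EpH]]) auto
        show "norm (Ev p z) <= B1" if "z \<in> ball p (r/4)" for z
          unfolding B1_def using C[OF EpH] that r by auto
      qed (use r h in auto)
      moreover have "norm (d\<kappa> (p + h) - d\<kappa> p - Dd d\<kappa> p h) <= 32 * B2 / (r/4)\<^sup>2 * (norm h)\<^sup>2"
      proof (rule holomorphic_several_taylor2)
        show "holomorphic_several d\<kappa> (ball p (r/4))"
          using r by (intro holomorphic_several_subset[OF d\<kappa>_hol]) auto
        show "norm (d\<kappa> z) <= B2" if "z \<in> ball p (r/4)" for z
          unfolding B2_def d\<kappa>_def using dbound[OF \<kappa>H, of z] that r by auto
      qed (use r h in auto)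
      moreover have "norm (ip M ?\<epsilon> ?\<delta>) <= L' * L * (norm h)\<^sup>2"
      proof -
        have "norm (ip M ?\<epsilon> ?\<delta>) <= sqrt (nsq M ?\<epsilon>) * sqrt (nsq M ?\<delta>)" by (rule cauchy_schwarz_sqrt[OF sqh sqd])
        also have "... <= (L' * norm h) * (L * norm h)"
        proof (rule mult_mono)
          show "sqrt (nsq M ?\<epsilon>) <= L' * norm h"
            using ediff[OF ph] L0 by (intro real_le_lsqrt) auto
          show "sqrt (nsq M ?\<delta>) <= L * norm h"
            using kdiff[OF ph2] L0 by (intro real_le_lsqrt) auto
        qed (use L0 in auto)
        finally show ?thesis by (simp add: power2_eq_square mult_ac)
      qed
      ultimately show "norm (\<psi> (p + h) - \<psi> p - Bd h) <= (32 * B1 / (r/4)\<^sup>2 + 32 * B2 / (r/4)\<^sup>2 + L' * L) * (norm h)\<^sup>2"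
        unfolding eq distrib_right
        by (intro order_trans[OF norm_triangle_ineq] add_mono) (simp_all only: complex_mod_cnj)
    qed (use r in auto)
  qed
  define u where "u w = ln (Re (reproducing_kernel M H \<Omega> w w))" for w
  have u\<phi>: "u w = ln (\<phi> w)" if "w \<in> \<Omega>" for w
    using K_diag[OF that] by (simp add: u_def \<phi>_def K_def)
  have "isCont \<phi> p" using d\<phi>[of p] r has_derivative_continuous by auto
  then have "(\<phi> \<longlongrightarrow> \<phi> p) (nhds p)" by (simp only: isCont_def tendsto_at_iff_tendsto_nhds)
  then have "\<forall>\<^sub>F w in nhds p. \<phi> w > 0"
    by (rule order_tendstoD(1)) (use pos in \<open>simp add: \<phi>_def\<close>)
  then obtain S where S: "open S" "p \<in> S" "\<And>w. w \<in> S ==> \<phi> w > 0"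
    unfolding eventually_nhds by blast
  \<comment> \<open>The outer derivative needs the formula for the inner one on a whole
    neighbourhood of p, and there \<phi> must be positive for the logarithm.\<close>
  define U where "U = S \<inter> ball p (r/4)"
  have U: "open U" "p \<in> U" "\<And>w. w \<in> U ==> \<phi> w > 0" "\<And>w. w \<in> U ==> w \<in> ball p (r/4)" "U \<subseteq> \<Omega>"
    using S r by (auto simp: U_def)
  have dzbar: "d_zbar i (%z. complex_of_real (u z)) w = \<psi> w / of_real (\<phi> w)" if w: "w \<in> U" for w
  proof -
    have w\<Omega>: "w \<in> \<Omega>" using w U by blast
    let ?A = "Dd (%z. K z w) w"
    have "((%w. complex_of_real (ln (\<phi> w))) has_derivative (%h. complex_of_real (2 * Re (?A h) * inverse (\<phi> w)))) (at w)"
      by (intro has_derivative_of_real has_derivative_ln d\<phi> U w)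
    then have "((%w. complex_of_real (u w)) has_derivative (%h. complex_of_real (2 * Re (?A h) * inverse (\<phi> w)))) (at w)"
      by (rule has_derivative_transform_within_open[OF _ U(1) w]) (use u\<phi> U(5) in auto)
    from frechet_derivative_at[OF this]
    have fd: "frechet_derivative (%w. complex_of_real (u w)) (at w) = (%h. complex_of_real (2 * Re (?A h) * inverse (\<phi> w)))"
      by simp
    have "?A (\<i> *s v) = \<i> * a w"
      unfolding a_def by (rule holomorphic_several_derivative(2)[OF holo[OF kf(1)[OF w\<Omega>]] w\<Omega>])
    then show ?thesis
      unfolding d_zbar_def fd vi v_def[symmetric] a\<psi>[OF w\<Omega>]
      by (simp add: a_def[symmetric] complex_eq_iff field_simps)
  qed
  have \<phi>0: "\<phi> p > 0" using pos by (simp add: \<phi>_def)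
  have d\<phi>p: "(\<phi> has_derivative (%h. 2 * Re (Dd \<kappa> p h))) (at p)"
    using d\<phi>[of p] r by (simp add: \<kappa>_def[abs_def])
  have "((%w. \<psi> w / of_real (\<phi> w)) has_derivative
      (%h. - \<psi> p * (inverse (of_real (\<phi> p)) * complex_of_real (2 * Re (Dd \<kappa> p h)) * inverse (of_real (\<phi> p))) + Bd h / of_real (\<phi> p))) (at p)"
    by (rule has_derivative_divide[OF d\<psi> has_derivative_of_real[OF d\<phi>p]]) (use \<phi>0 in simp)
  then have "(d_zbar i (%z. complex_of_real (u z)) has_derivative
      (%h. - \<psi> p * (inverse (of_real (\<phi> p)) * complex_of_real (2 * Re (Dd \<kappa> p h)) * inverse (of_real (\<phi> p))) + Bd h / of_real (\<phi> p))) (at p)"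
    by (rule has_derivative_transform_within_open[OF _ U(1,2)]) (simp add: dzbar)
  from frechet_derivative_at[OF this]
  have fd: "frechet_derivative (d_zbar i (%z. complex_of_real (u z))) (at p) =
      (%h. - \<psi> p * (inverse (of_real (\<phi> p)) * complex_of_real (2 * Re (Dd \<kappa> p h)) * inverse (of_real (\<phi> p))) + Bd h / of_real (\<phi> p))"
    by simp
  have k1: "Dd \<kappa> p (\<i> *s v) = \<i> * Dd \<kappa> p v"
    by (rule holomorphic_several_derivative(2)[OF holo[OF \<kappa>H] p])
  have k2: "Dd (Ev p) p (\<i> *s v) = \<i> * Dd (Ev p) p v"
    by (rule holomorphic_several_derivative(2)[OF holo[OF EpH] p])
  have k3: "Dd d\<kappa> p (\<i> *s v) = \<i> * Dd d\<kappa> p v"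
    by (rule holomorphic_several_derivative(2)[OF d\<kappa>_hol p])
  have k4: "Dd (Ev p) p v = of_real (nsq M (ev p))" using evrep[OF p EpH] by (simp add: ip_self)
  have k5: "Dd \<kappa> p v = cnj (\<psi> p)" using a\<psi>[OF p] by (simp add: a_def \<kappa>_def[abs_def])
  \<comment> \<open>The combination that defines \<open>d_z\<close> doubles the complex linear part
    and cancels the conjugate linear one.\<close>
  have Bv: "Bd v - \<i> * Bd (\<i> *s v) = 2 * of_real (nsq M (ev p))"
    unfolding Bd_def k2 k3 k4 by (simp add: algebra_simps)
  have re2: "complex_of_real (2 * Re w) - \<i> * complex_of_real (2 * Re (\<i> * w)) = 2 * w" for w
    by (simp add: complex_eq_iff)
  have dz: "d_z i (d_zbar i (%z. complex_of_real (u z))) p =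
      (of_real (nsq M (ev p)) * of_real (\<phi> p) - \<psi> p * cnj (\<psi> p)) / (of_real (\<phi> p))\<^sup>2"
  proof -
    define P where "P = complex_of_real (\<phi> p)"
    have P0: "P ~= 0" using \<phi>0 by (simp add: P_def)
    have "d_z i (d_zbar i (%z. complex_of_real (u z))) p =
      (- \<psi> p * (complex_of_real (2 * Re (Dd \<kappa> p v)) - \<i> * complex_of_real (2 * Re (\<i> * Dd \<kappa> p v))) / P\<^sup>2
        + (Bd v - \<i> * Bd (\<i> *s v)) / P) / 2"
      unfolding d_z_def fd vi v_def[symmetric] k1 P_def[symmetric] using P0
      by (simp add: divide_simps power2_eq_square) (simp add: algebra_simps)
    also have "... = (- \<psi> p * cnj (\<psi> p)) / P\<^sup>2 + of_real (nsq M (ev p)) / P"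
      unfolding re2 Bv k5 by (simp add: add_divide_distrib diff_divide_distrib mult_ac)
    also have "... = (of_real (nsq M (ev p)) * P - \<psi> p * cnj (\<psi> p)) / P\<^sup>2"
      using P0 by (simp add: field_simps power2_eq_square)
    finally show ?thesis by (simp add: P_def)
  qed
  have lf: "levi_form u p v = Re (d_z i (d_zbar i (%z. complex_of_real (u z))) p)"
  proof -
    define T where "T j k = d_z j (d_zbar k (%z. complex_of_real (u z))) p" for j k
    have vk: "v $ k = (if k = i then 1 else 0)" for k by (auto simp: v_def axis_def)
    have 1: "(\<Sum>k\<in>UNIV. T j k * v $ j * cnj (v $ k)) = T j i * v $ j" for j
      by (subst sum.remove[of UNIV i]) (auto simp: vk intro!: sum.neutral)
    have "(\<Sum>j\<in>UNIV. T j i * v $ j) = T i i"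
      by (subst sum.remove[of UNIV i]) (auto simp: vk intro!: sum.neutral)
    then show ?thesis unfolding levi_form_def T_def[symmetric] 1 by simp
  qed
  \<comment> \<open>The given e and the chosen \<open>ev p\<close> represent the same functional and
    both belong to H, so testing each against the other identifies their norms.\<close>
  have same: "nsq M (ev p) = nsq M e" "ip M e (kf p) = \<psi> p"
  proof -
    have e1: "ip M f (ev p) = ip M f e" if "(f, F) \<in> H" for f F
      using evrep[OF p that] rep[OF that] by (simp add: v_def)
    have "complex_of_real (nsq M (ev p)) = ip M (ev p) e" using e1[OF EpH] by (simp add: ip_self)
    also have "... = cnj (ip M e (ev p))" by (rule ip_commute)
    also have "... = complex_of_real (nsq M e)" using e1[OF e0] by (simp add: ip_self)
    finally show "nsq M (ev p) = nsq M e" by (simp only: of_real_eq_iff)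
    show "ip M e (kf p) = \<psi> p" using e1[OF \<kappa>H] by (simp add: \<psi>_def ip_commute[of M _ "kf p"])
  qed
  have "levi_form u p v = (nsq M e * \<phi> p - (norm (\<psi> p))\<^sup>2) / (\<phi> p)\<^sup>2"
  proof -
    have "d_z i (d_zbar i (%z. complex_of_real (u z))) p = complex_of_real ((nsq M e * \<phi> p - (norm (\<psi> p))\<^sup>2) / (\<phi> p)\<^sup>2)"
      unfolding dz same(1) using complex_norm_square[of "\<psi> p"] by simp
    then show ?thesis unfolding lf by (simp only: Re_complex_of_real)
  qed
  then show ?thesis by (simp add: u_def[abs_def] v_def \<phi>_def same(2))
qed

text \<open>Removing from e its component along \<open>kf p\<close> does not change its inner
  product with functions that vanish at p. The squared norm of what remains is the Levi form times
  the kernel at p, and Cauchy-Schwarz gives the inequality.\<close>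

lemma levi_form_log_kernel_ge:
  assumes p: "p \<in> \<Omega>" and pos: "nsq M (kf p) > 0" and f: "(f, F) \<in> H" "F p = 0"
  shows "(norm (Dd F p (axis i 1)))\<^sup>2 \<le>
    levi_form (%w. ln (Re (reproducing_kernel M H \<Omega> w w))) p (axis i 1) * nsq M (kf p) * nsq M f"
proof -
  obtain e E where e: "(e, E) \<in> H" and rep: "\<And>f F. (f, F) \<in> H ==> Dd F p (axis i 1) = ip M f e"
    using derivative_representer[OF p, of "axis i 1"] by blast
  define k where "k = kf p"
  have sqs: "square_integrable M e" "square_integrable M k" "square_integrable M f"
    using sq e f sq_kf[OF p] by (auto simp: k_def)
  define c where "c = - ip M e k / of_real (nsq M k)"
  have "ip M f (%z. c * k z + e z) = cnj c * ip M f k + ip M f e" by (rule ip_lin_right[OF sqs(2,1,3)])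
  also have "... = Dd F p (axis i 1)" using kf(2)[OF p f(1)] f(2) rep[OF f(1)] by (simp add: k_def)
  finally have "(norm (Dd F p (axis i 1)))\<^sup>2 <= nsq M f * nsq M (%z. c * k z + e z)"
    using cauchy_schwarz[OF sqs(3) square_integrable_lin[OF sqs(2,1)], of c] by simp
  also have "nsq M (%z. c * k z + e z) = nsq M e - (norm (ip M e k))\<^sup>2 / nsq M k"
  proof -
    have kpos: "nsq M k > 0" using pos by (simp add: k_def)
    have "c * ip M k e = of_real (- (norm (ip M e k))\<^sup>2 / nsq M k)"
      using complex_norm_square[of "ip M e k"] by (simp add: c_def ip_commute[of M k e])
    then have "Re (c * ip M k e) = - (norm (ip M e k))\<^sup>2 / nsq M k" by (simp only: Re_complex_of_real)
    moreover have "(norm c)\<^sup>2 * nsq M k = (norm (ip M e k))\<^sup>2 / nsq M k"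
      using kpos by (simp add: c_def norm_divide power_divide power2_eq_square)
    ultimately show ?thesis unfolding nsq_lin[OF sqs(2,1)] by simp
  qed
  also have "... = levi_form (%w. ln (Re (reproducing_kernel M H \<Omega> w w))) p (axis i 1) * nsq M k"
    using levi_form_log_kernel[OF p pos e rep] pos by (simp add: k_def power2_eq_square field_simps)
  finally show ?thesis by (simp add: k_def mult_ac)
qed

text \<open>The part g of e orthogonal to \<open>kf p\<close> is itself extremal: its partner
  function vanishes at p and has derivative \<open>nsq M g\<close> there, so the hypothesis can be
  tested on it.\<close>

lemma levi_form_log_kernel_le:
  assumes p: "p \<in> \<Omega>" and pos: "nsq M (kf p) > 0" and B: "B >= 0"
    and bound: "\<And>f F. (f, F) \<in> H ==> F p = 0 ==> (norm (Dd F p (axis i 1)))\<^sup>2 <= B * nsq M f"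
  shows "levi_form (%w. ln (Re (reproducing_kernel M H \<Omega> w w))) p (axis i 1) <= B / nsq M (kf p)"
proof -
  obtain e E where e: "(e, E) \<in> H" and rep: "\<And>f F. (f, F) \<in> H ==> Dd F p (axis i 1) = ip M f e"
    using derivative_representer[OF p, of "axis i 1"] by blast
  define k where "k = kf p"
  have kpos: "nsq M k > 0" using pos by (simp add: k_def)
  have sqs: "square_integrable M e" "square_integrable M k"
    using sq e sq_kf[OF p] by (auto simp: k_def)
  define c where "c = - ip M e k / of_real (nsq M k)"
  define g where "g = (%z. c * k z + e z)"
  have gH: "(g, %z. c * K z p + E z) \<in> H" unfolding g_def k_def by (rule lin[OF kf(1)[OF p] e])
  have sqg: "square_integrable M g" using gH sq by blast
  have gk: "ip M g k = 0"
    unfolding g_def ip_lin_left[OF sqs(2,1,2)] using kpos by (simp add: c_def ip_self)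
  then have g0: "c * K p p + E p = 0" using kf(2)[OF p gH] by (simp add: k_def)
  have ge: "ip M g e = of_real (nsq M g)"
  proof -
    have "ip M g g = cnj c * ip M g k + ip M g e"
      using ip_lin_right[OF sqs(2,1) sqg, of c] by (simp add: g_def)
    then show ?thesis using gk by (simp add: ip_self)
  qed
  have "(nsq M g)\<^sup>2 <= B * nsq M g"
    using bound[OF gH g0] rep[OF gH] ge by simp
  then have gB: "nsq M g <= B" using B
    by (cases "nsq M g = 0") (auto simp: power2_eq_square mult_le_cancel_right dest: order_antisym[OF nsq_nonneg])
  have "nsq M g = nsq M e - (norm (ip M e k))\<^sup>2 / nsq M k"
  proof -
    have "c * ip M k e = of_real (- (norm (ip M e k))\<^sup>2 / nsq M k)"
      using complex_norm_square[of "ip M e k"] by (simp add: c_def ip_commute[of M k e])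
    then have "Re (c * ip M k e) = - (norm (ip M e k))\<^sup>2 / nsq M k" by (simp only: Re_complex_of_real)
    moreover have "(norm c)\<^sup>2 * nsq M k = (norm (ip M e k))\<^sup>2 / nsq M k"
      using kpos by (simp add: c_def norm_divide power_divide power2_eq_square)
    ultimately show ?thesis unfolding g_def nsq_lin[OF sqs(2,1)] by simp
  qed
  then have "levi_form (%w. ln (Re (reproducing_kernel M H \<Omega> w w))) p (axis i 1) = nsq M g / nsq M k"
    using levi_form_log_kernel[OF p pos e rep] kpos
    by (simp add: k_def[symmetric] power2_eq_square diff_divide_distrib)
  then show ?thesis using gB kpos by (simp add: k_def divide_right_mono)
qed

end

section \<open>Smoothness of real polynomials in squared moduli\<close>

section \<open>Smoothness\<close>

lemma times_differentiable_Suc_imp: "times_differentiable (Suc k) f ==> times_differentiable k f"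
proof (induction k arbitrary: f)
  case 0
  then show ?case by (simp add: differentiable_imp_continuous_on)
next
  case (Suc k)
  then show ?case unfolding times_differentiable.simps(2)[of "Suc k"] times_differentiable.simps(2)[of k f] by blast
qed

lemma times_differentiable_const: "times_differentiable k (%x. c)"
proof (induction k arbitrary: c)
  case (Suc k)
  then show ?case by (simp add: frechet_derivative_const)
qed simp

lemma times_differentiable_bounded_linear:
  assumes "bounded_linear f"
  shows "times_differentiable k f"
proof (cases k)
  case 0
  then show ?thesis using assms by (simp add: linear_continuous_on)
next
  case (Suc m)
  have "f differentiable_on UNIV" using assms bounded_linear_imp_differentiable_on by blast
  moreover have "frechet_derivative f (at x) = f" for x
    using frechet_derivative_at[OF bounded_linear_imp_has_derivative[OF assms]] by simp
  ultimately show ?thesis by (simp add: Suc times_differentiable_const)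
qed

lemma times_differentiable_add:
  "times_differentiable k f ==> times_differentiable k g ==> times_differentiable k (%x. f x + g x)"
proof (induction k arbitrary: f g)
  case (Suc k)
  have d: "f differentiable at x" "g differentiable at x" for x
    using Suc.prems by (auto simp: differentiable_on_def)
  note D = d[unfolded frechet_derivative_works]
  have "frechet_derivative (%x. f x + g x) (at x) v = frechet_derivative f (at x) v + frechet_derivative g (at x) v" for x v
    using fun_cong[OF frechet_derivative_at[OF has_derivative_add[OF D]]] by simp
  then show ?case using Suc by (auto simp: differentiable_on_def)
qed (auto intro: continuous_intros)

lemma times_differentiable_mult:
  fixes f g :: "'a::real_normed_vector => real"
  shows "times_differentiable k f ==> times_differentiable k g ==> times_differentiable k (%x. f x * g x)"
proof (induction k arbitrary: f g)
  case (Suc k)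
  have d: "f differentiable at x" "g differentiable at x" for x
    using Suc.prems by (auto simp: differentiable_on_def)
  note D = d[unfolded frechet_derivative_works]
  have "frechet_derivative (%x. f x * g x) (at x) v = f x * frechet_derivative g (at x) v + frechet_derivative f (at x) v * g x" for x v
    using fun_cong[OF frechet_derivative_at[OF has_derivative_mult[OF D]]] by simp
  moreover have "times_differentiable k (%x. f x * frechet_derivative g (at x) v + frechet_derivative f (at x) v * g x)" for v
    using Suc by (intro times_differentiable_add Suc.IH) (auto intro: times_differentiable_Suc_imp)
  ultimately show ?case using d by (auto simp: differentiable_on_def)
qed (auto intro: continuous_intros)

lemma times_differentiable_norm_coord:
  "times_differentiable k (%z :: complex ^ 'n. (norm (z $ j))\<^sup>2)"
proof -
  have "bounded_linear (%z :: complex ^ 'n. Re (z $ j))" "bounded_linear (%z :: complex ^ 'n. Im (z $ j))"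
    by (intro bounded_linear_compose[OF bounded_linear_Re] bounded_linear_compose[OF bounded_linear_Im] bounded_linear_vec_nth)+
  then have "times_differentiable k (%z :: complex ^ 'n. Re (z $ j) * Re (z $ j) + Im (z $ j) * Im (z $ j))"
    by (intro times_differentiable_add times_differentiable_mult times_differentiable_bounded_linear)
  then show ?thesis unfolding cmod_power2 unfolding power2_eq_square .
qed

lemma times_differentiable_norm: "times_differentiable k (%z :: complex ^ 'n. (norm z)\<^sup>2)"
proof -
  have "times_differentiable k (%z :: complex ^ 'n. \<Sum>j\<in>J. (norm (z $ j))\<^sup>2)" if "finite J" for J
    using that by (induction J) (auto intro: times_differentiable_const times_differentiable_add times_differentiable_norm_coord)
  then show ?thesis by (simp add: norm_vec_sq)
qed

section \<open>Gradient, boundary, slices, connectedness and strong pseudoconvexity of the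
  domain\<close>

section \<open>The domain\<close>

definition rho :: "'n => real => complex ^ 'n => real" where
  "rho i \<epsilon> z = (norm (z $ i))\<^sup>2 * ((norm z)\<^sup>2 - 1) + \<epsilon>"

definition annular_domain :: "'n => real => (complex ^ 'n) set" where
  "annular_domain i \<epsilon> = {z. rho i \<epsilon> z < 0}"

lemma smooth_rho: "smooth (rho i \<epsilon>)"
proof -
  have "times_differentiable k (%z :: complex ^ 'a. (norm (z $ i))\<^sup>2 * ((norm z)\<^sup>2 + (- 1)) + \<epsilon>)" for k
    by (intro times_differentiable_add times_differentiable_mult times_differentiable_const
        times_differentiable_norm times_differentiable_norm_coord)
  then show ?thesis by (simp add: smooth_def rho_def[abs_def])
qed

lemma continuous_on_rho: "continuous_on S (rho i \<epsilon>)"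
  unfolding rho_def[abs_def] by (intro continuous_intros)

lemma open_dom: "open (annular_domain i \<epsilon>)"
  unfolding annular_domain_def by (intro open_Collect_less continuous_on_rho continuous_intros)

text \<open>Half the real gradient of \<open>rho i \<epsilon>\<close>; as a complex vector it
  consists of the derivatives with respect to the conjugate coordinates.\<close>

definition grad :: "'n => complex ^ 'n => complex ^ 'n" where
  "grad i z = (norm (z $ i))\<^sup>2 *\<^sub>R z + ((norm z)\<^sup>2 - 1) *\<^sub>R axis i (z $ i)"

lemma grad_nth:
  "grad i z $ k = of_real ((norm (z $ i))\<^sup>2) * z $ k + (if k = i then of_real ((norm z)\<^sup>2 - 1) * z $ i else 0)"
  by (simp add: grad_def axis_def scaleR_conv_of_real[where 'a = complex])

lemma norm_sq_inner: "(norm (x :: 'a::real_inner))\<^sup>2 = x \<bullet> x"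
  by (simp add: power2_norm_eq_inner)

lemma inner_grad: "grad i z \<bullet> h = (norm (z $ i))\<^sup>2 * (z \<bullet> h) + ((norm z)\<^sup>2 - 1) * (z $ i \<bullet> h $ i)"
  by (simp add: grad_def inner_add_left inner_axis')

lemma rho_has_derivative: "(rho i \<epsilon> has_derivative (%h. 2 * (grad i z \<bullet> h))) (at z)"
proof -
  have "((%z. (z $ i \<bullet> z $ i) * (z \<bullet> z - 1) + \<epsilon>) has_derivative
      (%h. (z $ i \<bullet> z $ i) * (z \<bullet> h + h \<bullet> z) + (z $ i \<bullet> h $ i + h $ i \<bullet> z $ i) * (z \<bullet> z - 1))) (at z)"
    by (auto intro!: derivative_eq_intros bounded_linear.has_derivative[OF bounded_linear_vec_nth])
  then show ?thesis
    unfolding rho_def[abs_def] norm_sq_inner inner_grad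
    by (simp add: inner_commute algebra_simps)
qed

lemma frechet_rho: "frechet_derivative (rho i \<epsilon>) (at z) = (%h. 2 * (grad i z \<bullet> h))"
  by (rule frechet_derivative_at[OF rho_has_derivative, symmetric])

text \<open>The i-th component of the gradient is \<open>(norm (z $ i))\<^sup>2 - s z\<close> times
  \<open>z $ i\<close>; the other components are those of z times
  \<open>(norm (z $ i))\<^sup>2\<close>.\<close>

lemma norm_grad_sq:
  defines "s z \<equiv> 1 - (norm z)\<^sup>2"
  shows "(norm (grad i z))\<^sup>2 = (norm (z $ i))\<^sup>2 * (((norm (z $ i))\<^sup>2 - s z)\<^sup>2 + (norm (z $ i))\<^sup>2 * (norm (ins i 0 z))\<^sup>2)"
proof -
  define a where "a = (norm (z $ i))\<^sup>2"
  have "grad i z = ins i (of_real (a - s z) * z $ i) (a *\<^sub>R z)"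
    by (simp add: grad_nth vec_eq_iff a_def s_def scaleR_conv_of_real[where 'a = complex] algebra_simps)
  moreover have "ins i 0 (a *\<^sub>R z) = a *\<^sub>R ins i 0 z" by (simp add: vec_eq_iff)
  ultimately have "(norm (grad i z))\<^sup>2 = (norm (of_real (a - s z) * z $ i))\<^sup>2 + (norm (a *\<^sub>R ins i 0 z))\<^sup>2"
    using norm_ins_sq[of i "of_real (a - s z) * z $ i" "a *\<^sub>R z"] by simp
  also have "norm (of_real (a - s z) * z $ i) = \<bar>a - s z\<bar> * norm (z $ i)"
    by (simp only: norm_mult norm_of_real)
  finally show ?thesis
    by (simp add: a_def[symmetric] power_mult_distrib) (simp add: a_def algebra_simps power2_eq_square)
qed

lemma onorm_frechet_rho: "onorm (frechet_derivative (rho i \<epsilon>) (at z)) = 2 * norm (grad i z)"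
proof (rule antisym)
  have bl: "bounded_linear (%h. 2 * (grad i z \<bullet> h))" by (intro bounded_linear_intros)
  show "onorm (frechet_derivative (rho i \<epsilon>) (at z)) <= 2 * norm (grad i z)"
    unfolding frechet_rho
    by (rule onorm_le) (use Cauchy_Schwarz_ineq2[of "grad i z"] in \<open>simp add: abs_mult\<close>)
  show "2 * norm (grad i z) <= onorm (frechet_derivative (rho i \<epsilon>) (at z))"
  proof (cases "grad i z = 0")
    case False
    have "norm (2 * (grad i z \<bullet> grad i z)) / norm (grad i z) <= onorm (%h. 2 * (grad i z \<bullet> h))"
      by (rule le_onorm[OF bl])
    then show ?thesis unfolding frechet_rho using False
      by (simp add: power2_norm_eq_inner[symmetric] power2_eq_square)
  qed (use onorm_pos_le[OF bl] in \<open>simp add: frechet_rho\<close>)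
qed

text \<open>With \<open>a + q + s = 1\<close>, a zero of the gradient on the boundary forces
  \<open>q = 0\<close> and \<open>a = s = 1/2\<close>, hence
  \<open>\<epsilon> = a * s = 1/4\<close>. This is the excluded value, at which the domain has
  become empty.\<close>

lemma grad_nonzero:
  assumes "rho i \<epsilon> z = 0" "0 < \<epsilon>" "\<epsilon> < 1/4"
  shows "grad i z ~= 0"
proof
  assume g: "grad i z = 0"
  define a where "a = (norm (z $ i))\<^sup>2"
  define s where "s = 1 - (norm z)\<^sup>2"
  define q where "q = (norm (ins i 0 z))\<^sup>2"
  have as: "a * s = \<epsilon>" using assms(1) by (simp add: rho_def a_def s_def algebra_simps)
  have sum: "a + q + s = 1" using norm_sq_split[of z i] by (simp add: a_def q_def s_def)
  have a0: "a > 0" using as assms by (auto simp: a_def)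
  have q0: "q >= 0" by (simp add: q_def)
  have "a * ((a - s)\<^sup>2 + a * q) = 0"
    using norm_grad_sq[of i z] g by (simp add: a_def s_def q_def)
  then have "(a - s)\<^sup>2 + a * q = 0" using a0 by simp
  moreover have "(a - s)\<^sup>2 >= 0" "a * q >= 0" using a0 q0 by auto
  ultimately have "(a - s)\<^sup>2 = 0" "a * q = 0" by linarith+
  then have "a = s" "q = 0" using a0 by auto
  then have "a = 1/2" "s = 1/2" using sum by simp_all
  then have "\<epsilon> = 1/2 * (1/2)" using as by metis
  then show False using assms by simp
qed

text \<open>A zero of \<open>rho\<close> is a limit of points of the domain because the function
  decreases strictly along the negative gradient.\<close>

lemma frontier_dom:
  assumes "0 < \<epsilon>" "\<epsilon> < 1/4"
  shows "frontier (annular_domain i \<epsilon>) = {z. rho i \<epsilon> z = 0}"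
proof
  have "closed {z. rho i \<epsilon> z <= 0}" by (intro closed_Collect_le continuous_on_rho continuous_intros)
  then have "closure (annular_domain i \<epsilon>) \<subseteq> {z. rho i \<epsilon> z <= 0}"
    by (intro closure_minimal) (auto simp: annular_domain_def)
  then show "frontier (annular_domain i \<epsilon>) \<subseteq> {z. rho i \<epsilon> z = 0}"
    unfolding frontier_def interior_open[OF open_dom] by (auto simp: annular_domain_def subset_iff order.antisym not_less)
  show "{z. rho i \<epsilon> z = 0} \<subseteq> frontier (annular_domain i \<epsilon>)"
  proof clarify
    fix z assume z: "rho i \<epsilon> z = 0"
    let ?g = "grad i z"
    have g: "?g ~= 0" by (rule grad_nonzero[OF z assms])
    have "((%t. z + t *\<^sub>R (- ?g)) has_derivative (%t. t *\<^sub>R (- ?g))) (at 0)"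
      by (auto intro!: derivative_eq_intros)
    moreover have "(rho i \<epsilon> has_derivative (%h. 2 * (?g \<bullet> h))) (at (z + 0 *\<^sub>R (- ?g)))"
      using rho_has_derivative[of i \<epsilon> z] by simp
    ultimately
    have "((%t. rho i \<epsilon> (z + t *\<^sub>R (- ?g))) has_derivative (%t. 2 * (?g \<bullet> (t *\<^sub>R (- ?g))))) (at 0)"
      by (rule has_derivative_compose)
    then have "((%t. rho i \<epsilon> (z + t *\<^sub>R (- ?g))) has_real_derivative - (2 * (?g \<bullet> ?g))) (at 0)"
      unfolding has_field_derivative_def by (rule has_derivative_eq_rhs) (simp add: fun_eq_iff)
    from DERIV_neg_dec_right[OF this] obtain d where d: "d > 0"
        "\<forall>h>0. h < d --> rho i \<epsilon> (z + (0 + h) *\<^sub>R (- ?g)) < rho i \<epsilon> (z + 0 *\<^sub>R (- ?g))"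
      using g by (auto simp only: inner_gt_zero_iff neg_less_0_iff_less zero_less_mult_iff zero_less_numeral)
    have "z \<in> closure (annular_domain i \<epsilon>)"
      unfolding closure_approachable
    proof (intro allI impI)
      fix e :: real assume e: "e > 0"
      define h where "h = min (d/2) (e / (2 * norm ?g))"
      have h: "0 < h" "h < d" using d e g by (auto simp: h_def)
      have "h * norm ?g <= e / (2 * norm ?g) * norm ?g" by (intro mult_right_mono) (auto simp: h_def)
      then have "h * norm ?g < e" using g e by simp
      then show "\<exists>y\<in>annular_domain i \<epsilon>. dist y z < e"
        using d(2)[rule_format, OF h] z h by (intro bexI[of _ "z + h *\<^sub>R (- ?g)"]) (auto simp: annular_domain_def dist_norm)
    qed
    then show "z \<in> frontier (annular_domain i \<epsilon>)"
      unfolding frontier_def interior_open[OF open_dom] using z by (simp add: annular_domain_def)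
  qed
qed

lemma dom_iff: "z \<in> annular_domain i \<epsilon> \<longleftrightarrow> \<epsilon> < (norm (z $ i))\<^sup>2 * (1 - (norm z)\<^sup>2)"
  by (simp add: annular_domain_def rho_def algebra_simps)

lemma dom_norm_less:
  assumes "z \<in> annular_domain i \<epsilon>" "\<epsilon> > 0"
  shows "norm z < 1"
proof -
  have "0 < (norm (z $ i))\<^sup>2 * (1 - (norm z)\<^sup>2)" using assms by (simp add: dom_iff)
  then have "(norm z)\<^sup>2 < 1\<^sup>2" by (auto simp: zero_less_mult_iff)
  then show ?thesis by (rule power2_less_imp_less) simp
qed

text \<open>For a fixed i-th coordinate the remaining coordinates range over a ball about 0.\<close>

lemma dom_ins_mono:
  assumes z: "ins i t z \<in> annular_domain i \<epsilon>" and w: "norm (ins i 0 w) <= norm (ins i 0 z)"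
  shows "ins i t w \<in> annular_domain i \<epsilon>"
proof -
  have "(norm (ins i t w))\<^sup>2 <= (norm (ins i t z))\<^sup>2"
    using w by (simp add: norm_ins_sq[of i t] power_mono)
  then have "(norm t)\<^sup>2 * (1 - (norm (ins i t z))\<^sup>2) <= (norm t)\<^sup>2 * (1 - (norm (ins i t w))\<^sup>2)"
    by (intro mult_left_mono) auto
  then show ?thesis using z by (simp add: dom_iff)
qed

text \<open>The endpoints of the slices of the domain in the direction \<^term>\<open>i\<close>; the parameter is
  \<^term>\<open>b = 1 - (norm (ins i 0 z))\<^sup>2\<close>.\<close>

definition a_plus :: "real => real => real" where
  "a_plus \<epsilon> b = (b + sqrt (b\<^sup>2 - 4 * \<epsilon>)) / 2"

definition a_minus :: "real => real => real" where
  "a_minus \<epsilon> b = (b - sqrt (b\<^sup>2 - 4 * \<epsilon>)) / 2"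

text \<open>The two values are the roots of \<open>x * (b - x) = \<epsilon>\<close>; sum and product
  are Vieta's, and the quadratic is positive exactly between its roots.\<close>

lemma a_pm:
  assumes "b > 0" "\<epsilon> > 0" "b\<^sup>2 > 4 * \<epsilon>"
  shows "a_plus \<epsilon> b + a_minus \<epsilon> b = b" "a_plus \<epsilon> b * a_minus \<epsilon> b = \<epsilon>"
    "0 < a_minus \<epsilon> b" "a_minus \<epsilon> b < a_plus \<epsilon> b" "a_plus \<epsilon> b < b"
    "x * (b - x) > \<epsilon> \<longleftrightarrow> a_minus \<epsilon> b < x \<and> x < a_plus \<epsilon> b"
proof -
  define d where "d = sqrt (b\<^sup>2 - 4 * \<epsilon>)"
  have d: "d > 0" "d\<^sup>2 = b\<^sup>2 - 4 * \<epsilon>" using assms(3) by (simp_all add: d_def)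
  have "d\<^sup>2 < b\<^sup>2" using d(2) assms(2) by linarith
  then have db: "d < b" using assms(1) by (rule power2_less_imp_less[OF _ less_imp_le])
  have p: "a_plus \<epsilon> b = (b + d) / 2" "a_minus \<epsilon> b = (b - d) / 2" by (auto simp: a_plus_def a_minus_def d_def)
  show sum: "a_plus \<epsilon> b + a_minus \<epsilon> b = b" unfolding p by (simp add: field_simps)
  have "a_plus \<epsilon> b * a_minus \<epsilon> b = (b\<^sup>2 - d\<^sup>2) / 4" unfolding p by (simp add: power2_eq_square algebra_simps)
  then show prod: "a_plus \<epsilon> b * a_minus \<epsilon> b = \<epsilon>" using d by simp
  show "0 < a_minus \<epsilon> b" and lt: "a_minus \<epsilon> b < a_plus \<epsilon> b" "a_plus \<epsilon> b < b" using d db unfolding p by auto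
  have "x * (b - x) - \<epsilon> = (x - a_minus \<epsilon> b) * (a_plus \<epsilon> b - x)"
  proof -
    have "x * (b - x) - \<epsilon> = x * (a_plus \<epsilon> b + a_minus \<epsilon> b - x) - a_plus \<epsilon> b * a_minus \<epsilon> b"
      by (simp add: sum prod)
    then show ?thesis by (simp add: algebra_simps)
  qed
  then have "x * (b - x) > \<epsilon> \<longleftrightarrow> (x - a_minus \<epsilon> b) * (a_plus \<epsilon> b - x) > 0" by linarith
  also have "... \<longleftrightarrow> a_minus \<epsilon> b < x \<and> x < a_plus \<epsilon> b"
    using lt by (auto simp: zero_less_mult_iff)
  finally show "x * (b - x) > \<epsilon> \<longleftrightarrow> a_minus \<epsilon> b < x \<and> x < a_plus \<epsilon> b" .
qed

lemma dom_ins_iff: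
  assumes "1 - (norm (ins i 0 z))\<^sup>2 > 0" "\<epsilon> > 0" "(1 - (norm (ins i 0 z))\<^sup>2)\<^sup>2 > 4 * \<epsilon>"
  shows "ins i t z \<in> annular_domain i \<epsilon> \<longleftrightarrow>
    t \<in> annulus (sqrt (a_minus \<epsilon> (1 - (norm (ins i 0 z))\<^sup>2))) (sqrt (a_plus \<epsilon> (1 - (norm (ins i 0 z))\<^sup>2)))"
proof -
  define b where "b = 1 - (norm (ins i 0 z))\<^sup>2"
  note a = a_pm[OF assms[folded b_def]]
  have "ins i t z \<in> annular_domain i \<epsilon> \<longleftrightarrow> (norm t)\<^sup>2 * (b - (norm t)\<^sup>2) > \<epsilon>"
    by (simp add: dom_iff norm_ins_sq[of i t] b_def algebra_simps)
  also have "... \<longleftrightarrow> a_minus \<epsilon> b < (norm t)\<^sup>2 \<and> (norm t)\<^sup>2 < a_plus \<epsilon> b" by (rule a(6))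
  also have "... \<longleftrightarrow> sqrt (a_minus \<epsilon> b) < norm t \<and> norm t < sqrt (a_plus \<epsilon> b)"
    using a(3,4) real_sqrt_less_iff[of "a_minus \<epsilon> b" "(norm t)\<^sup>2"] real_sqrt_less_iff[of "(norm t)\<^sup>2" "a_plus \<epsilon> b"] by simp
  finally show ?thesis by (simp add: annulus_def b_def)
qed

text \<open>A point of the slice makes the quadratic \<open>x * (b - x) - \<epsilon>\<close>
  positive somewhere, so its discriminant is positive.\<close>

lemma dom_slice:
  assumes "z \<in> annular_domain i \<epsilon>" "\<epsilon> > 0"
  shows "1 - (norm (ins i 0 z))\<^sup>2 > 0" "(1 - (norm (ins i 0 z))\<^sup>2)\<^sup>2 > 4 * \<epsilon>"
proof -
  define b where "b = 1 - (norm (ins i 0 z))\<^sup>2"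
  define a where "a = (norm (z $ i))\<^sup>2"
  have ab: "\<epsilon> < a * (b - a)" using assms norm_sq_split[of z i] by (simp add: dom_iff a_def b_def algebra_simps)
  have "4 * (a * (b - a)) <= b\<^sup>2" using zero_le_power2[of "b - 2 * a"] by (simp add: power2_eq_square algebra_simps)
  then show "b\<^sup>2 > 4 * \<epsilon>" using ab by linarith
  have "a * (b - a) > 0" using ab assms by linarith
  moreover have "a >= 0" by (simp add: a_def)
  ultimately have "b - a > 0" by (simp add: zero_less_mult_iff)
  then show "b > 0" using \<open>a >= 0\<close> by linarith
qed

text \<open>Shrinking the other coordinates joins each point by a segment to the annulus B cut out
  by the coordinate line in direction i through 0.\<close>

lemma connected_dom:
  fixes i :: "'n::finite"
  assumes "0 < \<epsilon>" "\<epsilon> < 1/4"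
  shows "connected (annular_domain i \<epsilon> :: (complex ^ 'n) set)" "annular_domain i \<epsilon> ~= ({} :: (complex ^ 'n) set)"
proof -
  have i0: "ins i 0 0 = (0 :: complex ^ 'n)" by (simp add: vec_eq_iff)
  have b: "1 - (norm (ins i 0 (0 :: complex ^ 'n)))\<^sup>2 > 0" "(1 - (norm (ins i 0 (0 :: complex ^ 'n)))\<^sup>2)\<^sup>2 > 4 * \<epsilon>"
    using assms by (auto simp: i0)
  define A where "A = annulus (sqrt (a_minus \<epsilon> 1)) (sqrt (a_plus \<epsilon> 1))"
  have A: "ins i t 0 \<in> annular_domain i \<epsilon> \<longleftrightarrow> t \<in> A" for t
    using dom_ins_iff[OF b(1) assms(1) b(2), of t] by (simp add: A_def i0)
  define B where "B = (%t. ins i t 0 :: complex ^ 'n) ` A"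
  have B: "connected B" "B \<subseteq> annular_domain i \<epsilon>"
    unfolding B_def using A
    by (auto intro!: connected_continuous_image continuous_intros annulus_props(2) simp: A_def)
  have "sqrt (1/2) \<in> {t. \<epsilon> < t\<^sup>2 * (1 - t\<^sup>2)}" using assms by simp
  then have "ins i (of_real (sqrt (1/2))) 0 \<in> (annular_domain i \<epsilon> :: (complex ^ 'n) set)"
    using assms by (simp add: dom_iff norm_ins_sq i0)
  then have Bne: "B ~= {}" using A by (auto simp: B_def)
  define S where "S z = closed_segment (ins i (z $ i) 0) z \<union> B" for z
  have S: "connected (S z)" "S z \<subseteq> annular_domain i \<epsilon>" if z: "z \<in> annular_domain i \<epsilon>" for z
  proof -
    have seg: "closed_segment (ins i (z $ i) 0) z \<subseteq> annular_domain i \<epsilon>"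
    proof
      fix w assume "w \<in> closed_segment (ins i (z $ i) 0) z"
      then obtain u where u: "0 <= u" "u <= 1" "w = (1 - u) *\<^sub>R ins i (z $ i) 0 + u *\<^sub>R z"
        by (auto simp: closed_segment_def)
      have w: "w = ins i (z $ i) (u *\<^sub>R z)"
        unfolding u(3) by (simp add: vec_eq_iff scaleR_left_diff_distrib)
      have "ins i 0 (u *\<^sub>R z) = u *\<^sub>R ins i 0 z" by (simp add: vec_eq_iff)
      then have "norm (ins i 0 (u *\<^sub>R z)) <= norm (ins i 0 z)"
        using u by (simp add: mult_left_le_one_le)
      then show "w \<in> annular_domain i \<epsilon>" unfolding w by (rule dom_ins_mono[rotated]) (use z in simp)
    qed
    then have "ins i (z $ i) 0 \<in> annular_domain i \<epsilon>" by auto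
    then have "ins i (z $ i) 0 \<in> B" using A by (simp add: B_def)
    then show "connected (S z)" unfolding S_def by (intro connected_Un B) auto
    show "S z \<subseteq> annular_domain i \<epsilon>" using seg B by (simp add: S_def)
  qed
  have eq: "annular_domain i \<epsilon> = \<Union> (S ` annular_domain i \<epsilon>)" using S(2) by (auto simp: S_def)
  show "annular_domain i \<epsilon> ~= ({} :: (complex ^ 'n) set)" using B Bne by blast
  then have "\<Inter> (S ` annular_domain i \<epsilon>) ~= ({} :: (complex ^ 'n) set)" using Bne by (auto simp: S_def)
  then have "connected (\<Union> (S ` annular_domain i \<epsilon>))" using S(1) by (intro connected_Union) auto
  then show "connected (annular_domain i \<epsilon> :: (complex ^ 'n) set)" using eq by simp
qed

lemma bounded_dom: "\<epsilon> > 0 ==> bounded (annular_domain i \<epsilon>)"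
  by (rule bounded_subset[OF bounded_ball[of 0 1]]) (simp add: subset_iff dom_norm_less)

lemma inner_complex_parts: "x \<bullet> 1 = Re x" "x \<bullet> \<i> = Im x"
  by (auto simp: inner_complex_def)

lemma d_zbar_rho: "d_zbar k (%z. complex_of_real (rho i \<epsilon> z)) z = grad i z $ k"
  and d_z_rho: "d_z k (%z. complex_of_real (rho i \<epsilon> z)) z = cnj (grad i z $ k)"
proof -
  have "((%z. complex_of_real (rho i \<epsilon> z)) has_derivative (%h. complex_of_real (2 * (grad i z \<bullet> h)))) (at z)"
    by (rule has_derivative_of_real[OF rho_has_derivative])
  from frechet_derivative_at[OF this]
  have fd: "frechet_derivative (%z. complex_of_real (rho i \<epsilon> z)) (at z) = (%h. complex_of_real (2 * (grad i z \<bullet> h)))"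
    by simp
  show "d_zbar k (%z. complex_of_real (rho i \<epsilon> z)) z = grad i z $ k"
    "d_z k (%z. complex_of_real (rho i \<epsilon> z)) z = cnj (grad i z $ k)"
    unfolding d_zbar_def d_z_def fd by (simp_all add: inner_axis inner_complex_parts complex_eq_iff)
qed

lemma hessian_rho:
  "d_z j (d_zbar k (%z. complex_of_real (rho i \<epsilon> z))) z =
    (if j = i then cnj (z $ i) * z $ k else 0) + (if j = k then of_real ((norm (z $ i))\<^sup>2) else 0)
    + (if k = i then cnj (z $ j) * z $ i else 0) + (if k = i \<and> j = i then of_real ((norm z)\<^sup>2 - 1) else 0)"
proof -
  have cj: "((%z. z $ l) has_derivative (%h. h $ l)) (at z)" for l
    by (rule bounded_linear_imp_has_derivative[OF bounded_linear_vec_nth])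
  have D1: "((%z. complex_of_real (z $ i \<bullet> z $ i) * z $ k) has_derivative
      (%h. complex_of_real (z $ i \<bullet> z $ i) * h $ k + of_real (z $ i \<bullet> h $ i + h $ i \<bullet> z $ i) * z $ k)) (at z)"
    by (intro has_derivative_mult has_derivative_of_real has_derivative_inner cj)
  have D2: "((%z. complex_of_real (z \<bullet> z - 1) * z $ i) has_derivative
      (%h. complex_of_real (z \<bullet> z - 1) * h $ i + of_real (z \<bullet> h + h \<bullet> z - 0) * z $ i)) (at z)"
    by (intro has_derivative_mult has_derivative_of_real has_derivative_diff has_derivative_inner
        has_derivative_ident has_derivative_const cj)
  have "((%z. complex_of_real (z $ i \<bullet> z $ i) * z $ k + (if k = i then of_real (z \<bullet> z - 1) * z $ i else 0)) has_derivative
      (%h. complex_of_real (z $ i \<bullet> z $ i) * h $ k + of_real (z $ i \<bullet> h $ i + h $ i \<bullet> z $ i) * z $ k +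
        (if k = i then of_real (z \<bullet> z - 1) * h $ i + of_real (z \<bullet> h + h \<bullet> z) * z $ i else 0))) (at z)"
  proof (cases "k = i")
    case True
    have "((%z. complex_of_real (z $ i \<bullet> z $ i) * z $ k + of_real (z \<bullet> z - 1) * z $ i) has_derivative
      (%h. complex_of_real (z $ i \<bullet> z $ i) * h $ k + of_real (z $ i \<bullet> h $ i + h $ i \<bullet> z $ i) * z $ k +
        (of_real (z \<bullet> z - 1) * h $ i + of_real (z \<bullet> h + h \<bullet> z - 0) * z $ i))) (at z)"
      by (rule has_derivative_add[OF D1 D2])
    then show ?thesis using True by (simp only: if_True diff_zero simp_thms)
  next
    case False
    then show ?thesis using D1 by (simp only: if_False add_0_right)
  qed
  then have "(d_zbar k (%z. complex_of_real (rho i \<epsilon> z)) has_derivative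
      (%h. complex_of_real (z $ i \<bullet> z $ i) * h $ k + of_real (z $ i \<bullet> h $ i + h $ i \<bullet> z $ i) * z $ k +
        (if k = i then of_real (z \<bullet> z - 1) * h $ i + of_real (z \<bullet> h + h \<bullet> z) * z $ i else 0))) (at z)"
    by (simp add: d_zbar_rho[abs_def] grad_nth norm_sq_inner cong: if_cong)
  from frechet_derivative_at[OF this]
  have fd: "frechet_derivative (d_zbar k (%z. complex_of_real (rho i \<epsilon> z))) (at z) =
      (%h. complex_of_real (z $ i \<bullet> z $ i) * h $ k + of_real (z $ i \<bullet> h $ i + h $ i \<bullet> z $ i) * z $ k +
        (if k = i then of_real (z \<bullet> z - 1) * h $ i + of_real (z \<bullet> h + h \<bullet> z) * z $ i else 0))"
    by simp
  have ax: "z \<bullet> axis j 1 = Re (z $ j)" "z \<bullet> axis j \<i> = Im (z $ j)"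
    by (simp_all add: inner_axis inner_complex_parts)
  have ax': "z $ i \<bullet> axis j 1 $ i = (if j = i then Re (z $ i) else 0)" "z $ i \<bullet> axis j \<i> $ i = (if j = i then Im (z $ i) else 0)"
    by (auto simp: inner_complex_parts axis_def)
  have ax2: "axis j (1::complex) $ l = (if l = j then 1 else 0)" "axis j \<i> $ l = (if l = j then \<i> else 0)" for l
    by (auto simp: axis_def)
  show ?thesis
    unfolding d_z_def fd inner_commute[of "axis j _"] inner_commute[of "axis j _ $ i"] ax ax'
    by (auto simp: ax2 norm_sq_inner complex_eq_iff)
qed

text \<open>Tangency reads \<open>a W = s x\<close>, where W is the Hermitian product of \<xi> with
  z and x its i-th summand. The mixed terms of the Levi form therefore add up to
  \<open>2 * s * (norm (\<xi> $ i))\<^sup>2\<close>, which outweighs the only negative term.\<close>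

lemma strongly_pseudoconvex_dom:
  assumes \<epsilon>: "0 < \<epsilon>" "\<epsilon> < 1/4"
  shows "strongly_pseudoconvex (annular_domain i \<epsilon>) (rho i \<epsilon>)"
  unfolding strongly_pseudoconvex_def frontier_dom[OF \<epsilon>]
proof (intro conjI ballI allI impI)
  fix z assume z: "z \<in> {z. rho i \<epsilon> z = 0}"
  show "frechet_derivative (rho i \<epsilon>) (at z) ~= (%v. 0)"
  proof
    assume "frechet_derivative (rho i \<epsilon>) (at z) = (%v. 0)"
    then have "grad i z \<bullet> grad i z = 0" unfolding frechet_rho by (metis mult_eq_0_iff zero_neq_numeral)
    then show False using grad_nonzero[of i \<epsilon> z, OF _ \<epsilon>] z by simp
  qed
next
  fix z \<xi> :: "complex ^ 'a"
  assume z: "z \<in> {z. rho i \<epsilon> z = 0}"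
    and \<xi>: "\<xi> ~= 0 \<and> (\<Sum>j\<in>UNIV. d_z j (%z. complex_of_real (rho i \<epsilon> z)) z * \<xi> $ j) = 0"
  define a where "a = (norm (z $ i))\<^sup>2"
  define s where "s = 1 - (norm z)\<^sup>2"
  have as: "a * s = \<epsilon>" using z by (simp add: rho_def a_def s_def algebra_simps)
  have a0: "a > 0" and s0: "s > 0" using as \<epsilon> zero_le_power2[of "norm (z $ i)"]
    by (auto simp: a_def zero_less_mult_iff)
  define W where "W = (\<Sum>j\<in>UNIV. cnj (z $ j) * \<xi> $ j)"
  define x where "x = cnj (z $ i) * \<xi> $ i"
  have "(\<Sum>j\<in>UNIV. d_z j (%z. complex_of_real (rho i \<epsilon> z)) z * \<xi> $ j) = of_real a * W - of_real s * x"
  proof -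
    have "d_z j (%z. complex_of_real (rho i \<epsilon> z)) z * \<xi> $ j =
        of_real a * (cnj (z $ j) * \<xi> $ j) + (if j = i then - of_real s * x else 0)" for j
      by (simp add: d_z_rho grad_nth a_def s_def x_def algebra_simps)
    then show ?thesis by (simp add: sum.distrib W_def sum_distrib_left)
  qed
  then have W: "of_real a * W = of_real s * x" using \<xi> by simp
  have "(\<Sum>j\<in>UNIV. \<Sum>k\<in>UNIV. d_z j (d_zbar k (%z. complex_of_real (rho i \<epsilon> z))) z * \<xi> $ j * cnj (\<xi> $ k)) =
      x * cnj W + of_real a * of_real ((norm \<xi>)\<^sup>2) + W * cnj x - of_real s * of_real ((norm (\<xi> $ i))\<^sup>2)"
  proof -
    let ?A = "%j k. if j = i then x * cnj (cnj (z $ k) * \<xi> $ k) else 0"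
    let ?B = "%j k. if k = j then of_real a * (\<xi> $ j * cnj (\<xi> $ j)) else 0"
    let ?C = "%j k. if k = i then (cnj (z $ j) * \<xi> $ j) * cnj x else 0"
    let ?D = "%j k. if k = i then if j = i then of_real s * (\<xi> $ i * cnj (\<xi> $ i)) else 0 else 0"
    have "d_z j (d_zbar k (%z. complex_of_real (rho i \<epsilon> z))) z * \<xi> $ j * cnj (\<xi> $ k) =
        ?A j k + ?B j k + ?C j k - ?D j k" for j k
      unfolding hessian_rho a_def[symmetric] by (auto simp: x_def s_def algebra_simps)
    then have "(\<Sum>j\<in>UNIV. \<Sum>k\<in>UNIV. d_z j (d_zbar k (%z. complex_of_real (rho i \<epsilon> z))) z * \<xi> $ j * cnj (\<xi> $ k)) =
        (\<Sum>j\<in>UNIV. \<Sum>k\<in>UNIV. ?A j k + ?B j k + ?C j k - ?D j k)"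
      by (intro sum.cong refl)
    also have "... = (\<Sum>j\<in>UNIV. \<Sum>k\<in>UNIV. ?A j k) + (\<Sum>j\<in>UNIV. \<Sum>k\<in>UNIV. ?B j k)
        + (\<Sum>j\<in>UNIV. \<Sum>k\<in>UNIV. ?C j k) - (\<Sum>j\<in>UNIV. \<Sum>k\<in>UNIV. ?D j k)"
      by (simp only: sum.distrib sum_subtractf)
    finally have "(\<Sum>j\<in>UNIV. \<Sum>k\<in>UNIV. d_z j (d_zbar k (%z. complex_of_real (rho i \<epsilon> z))) z * \<xi> $ j * cnj (\<xi> $ k)) =
        (\<Sum>j\<in>UNIV. \<Sum>k\<in>UNIV. ?A j k) + (\<Sum>j\<in>UNIV. \<Sum>k\<in>UNIV. ?B j k)
        + (\<Sum>j\<in>UNIV. \<Sum>k\<in>UNIV. ?C j k) - (\<Sum>j\<in>UNIV. \<Sum>k\<in>UNIV. ?D j k)" .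
    moreover have "(\<Sum>j\<in>UNIV. \<Sum>k\<in>UNIV. (if k = j then of_real a * (\<xi> $ j * cnj (\<xi> $ j)) else 0)) =
        (\<Sum>j\<in>UNIV. complex_of_real a * (\<xi> $ j * cnj (\<xi> $ j)))" by simp
    moreover have "(\<Sum>j\<in>UNIV. \<Sum>k\<in>UNIV. (if k = i then (cnj (z $ j) * \<xi> $ j) * cnj x else 0)) =
        (\<Sum>j\<in>UNIV. (cnj (z $ j) * \<xi> $ j) * cnj x)" by simp
    moreover have "(\<Sum>j\<in>UNIV. \<Sum>k\<in>UNIV. (if k = i then if j = i then of_real s * (\<xi> $ i * cnj (\<xi> $ i)) else 0 else 0)) =
        complex_of_real s * (\<xi> $ i * cnj (\<xi> $ i))" by simp
    moreover have "(\<Sum>j\<in>UNIV. \<Sum>k\<in>UNIV. (if j = i then x * cnj (cnj (z $ k) * \<xi> $ k) else 0)) = x * cnj W"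
    proof -
      have "(\<Sum>j\<in>UNIV. \<Sum>k\<in>UNIV. (if j = i then x * cnj (cnj (z $ k) * \<xi> $ k) else 0)) =
          (\<Sum>k\<in>UNIV. \<Sum>j\<in>UNIV. (if j = i then x * cnj (cnj (z $ k) * \<xi> $ k) else 0))"
        by (rule sum.swap)
      then show ?thesis by (simp add: W_def sum_distrib_left)
    qed
    moreover have "(\<Sum>j\<in>UNIV. of_real a * (\<xi> $ j * cnj (\<xi> $ j))) = complex_of_real a * of_real ((norm \<xi>)\<^sup>2)"
      unfolding norm_vec_sq of_real_sum sum_distrib_left by (simp only: complex_norm_square)
    moreover have "(\<Sum>j\<in>UNIV. (cnj (z $ j) * \<xi> $ j) * cnj x) = W * cnj x"
      by (simp add: W_def sum_distrib_right)
    ultimately show ?thesis by (simp only: complex_norm_square)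
  qed
  then have "levi_form (rho i \<epsilon>) z \<xi> = 2 * Re (x * cnj W) + a * (norm \<xi>)\<^sup>2 - s * (norm (\<xi> $ i))\<^sup>2"
    by (simp add: levi_form_def)
  moreover have "Re (x * cnj W) = s * (norm (\<xi> $ i))\<^sup>2"
  proof -
    have "W = of_real (s / a) * x" using W a0 by (simp add: field_simps)
    then have "x * cnj W = of_real (s / a) * of_real ((norm x)\<^sup>2)"
      unfolding complex_norm_square by (simp add: mult_ac)
    also have "... = of_real (s / a * (norm x)\<^sup>2)" by (rule of_real_mult[symmetric])
    finally have "Re (x * cnj W) = s / a * (norm x)\<^sup>2" by (simp only: Re_complex_of_real)
    then show ?thesis using a0 by (simp add: x_def norm_mult power_mult_distrib a_def)
  qed
  moreover have "a * (norm \<xi>)\<^sup>2 > 0" "s * (norm (\<xi> $ i))\<^sup>2 >= 0" using a0 s0 \<xi> by auto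
  ultimately show "levi_form (rho i \<epsilon>) z \<xi> > 0" by linarith
qed (use connected_dom[OF \<epsilon>] bounded_dom[OF \<epsilon>(1)] smooth_rho in \<open>auto simp: annular_domain_def\<close>)

section \<open>The bordered Hessian determinant and the density in closed form\<close>

section \<open>The Fefferman density\<close>

lemma det_row_add:
  fixes A :: "'a::field ^ 'n ^ 'n"
  assumes J: "m \<notin> J"
  shows "det (\<chi> r. if r = m then row m A + (\<Sum>j\<in>J. c j *s row j A) else row r A) = det A"
proof (rule det_row_span)
  show "(\<Sum>j\<in>J. c j *s row j A) \<in> vec.span {row j A |j. j ~= m}"
    by (intro vec.span_sum vec.span_scale vec.span_base) (use J in auto)
qed

lemma det_row_add_nth:
  fixes A B :: "'a::field ^ 'n ^ 'n"
  assumes J: "m \<notin> J" and B: "\<And>r l. B $ r $ l = (if r = m then A $ m $ l + (\<Sum>j\<in>J. c j * A $ j $ l) else A $ r $ l)"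
  shows "det B = det A"
proof -
  have "B = (\<chi> r. if r = m then row m A + (\<Sum>j\<in>J. c j *s row j A) else row r A)"
    by (simp add: vec_eq_iff B row_def sum_component)
  then show ?thesis using det_row_add[OF J, of A c] by simp
qed

lemma det_column_add_nth:
  fixes A B :: "'a::field ^ 'n ^ 'n"
  assumes J: "m \<notin> J" and B: "\<And>r l. B $ r $ l = (if l = m then A $ r $ m + (\<Sum>j\<in>J. c j * A $ r $ j) else A $ r $ l)"
  shows "det B = det A"
proof -
  have "det (transpose B) = det (transpose A)"
    by (rule det_row_add_nth[OF J, where c = c]) (simp add: transpose_def B)
  then show ?thesis by (simp add: det_transpose)
qed

text \<open>An arrow matrix is diagonalised by one row and one column operation.\<close>

lemma det_arrow:
  fixes d :: "'n::finite => 'a::field" and A :: "'a ^ ('n option) ^ ('n option)"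
  assumes d: "\<And>k. d k ~= 0"
    and A: "A $ None $ None = 0" "\<And>k. A $ None $ Some k = u k" "\<And>j. A $ Some j $ None = v j"
      "\<And>j k. A $ Some j $ Some k = (if j = k then d j else 0)"
  shows "det A = - (\<Sum>k\<in>UNIV. u k * v k / d k) * (\<Prod>k\<in>UNIV. d k)"
proof -
  define s where "s = (\<Sum>k\<in>UNIV. u k * v k / d k)"
  define B :: "'a ^ ('n option) ^ ('n option)" where
    "B = (\<chi> r l. case r of None => (case l of None => - s | Some k => 0) | Some j => A $ Some j $ l)"
  define C :: "'a ^ ('n option) ^ ('n option)" where
    "C = (\<chi> r l. case r of None => (case l of None => - s | Some k => 0) | Some j => (case l of None => 0 | Some k => A $ Some j $ Some k))"
  have sum_opt: "(\<Sum>j\<in>range Some. f j) = (\<Sum>k\<in>UNIV. f (Some k))" for f :: "'n option => 'a"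
    by (simp add: sum.reindex)
  have "det B = det A"
  proof (rule det_row_add_nth[where m = None and J = "range Some" and c = "%r. case r of None => 0 | Some k => - (u k / d k)"])
    fix r l
    show "B $ r $ l = (if r = None then A $ None $ l + (\<Sum>j\<in>range Some. (case j of None => 0 | Some k => - (u k / d k)) * A $ j $ l) else A $ r $ l)"
    proof (cases r)
      case None
      show ?thesis
      proof (cases l)
        case None
        then show ?thesis using \<open>r = None\<close> by (simp add: B_def A sum_opt s_def sum_negf)
      next
        case (Some k)
        have "(\<Sum>x\<in>UNIV. u x / d x * (if x = k then d x else 0)) = u k"
          using d[of k] by (subst sum.remove[of _ k]) (auto intro!: sum.neutral)
        then show ?thesis using Some \<open>r = None\<close> by (simp add: B_def A sum_opt sum_negf)
      qed
    qed (simp add: B_def)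
  qed auto
  moreover have "det C = det B"
  proof (rule det_column_add_nth[where m = None and J = "range Some" and c = "%r. case r of None => 0 | Some k => - (v k / d k)"])
    fix r l
    show "C $ r $ l = (if l = None then B $ r $ None + (\<Sum>j\<in>range Some. (case j of None => 0 | Some k => - (v k / d k)) * B $ r $ j) else B $ r $ l)"
    proof (cases r)
      case None
      then show ?thesis by (cases l) (simp_all add: C_def B_def sum_opt)
    next
      case (Some j)
      have "(\<Sum>x\<in>UNIV. v x / d x * (if j = x then d j else 0)) = v j"
        using d[of j] by (subst sum.remove[of _ j]) (auto intro!: sum.neutral)
      then show ?thesis using Some by (cases l) (simp_all add: C_def B_def A sum_opt sum_negf)
    qed
  qed auto
  moreover have "det C = (\<Prod>x\<in>UNIV. C $ x $ x)"
    by (rule det_diagonal) (auto simp: C_def A split: option.splits)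
  moreover have "(\<Prod>x\<in>UNIV. C $ x $ x) = - s * (\<Prod>k\<in>UNIV. d k)"
    by (simp add: UNIV_option_conv prod.reindex C_def A)
  ultimately show ?thesis by (simp add: s_def)
qed

text \<open>The off-diagonal entries of the Hessian sit in row and column i and are, up to the
  border, multiples of it; one row and one column operation with the border remove them. The result
  is an arrow matrix with diagonal a, except \<open>a + s\<close> at i.\<close>

lemma det_bordered_hessian:
  fixes z :: "complex ^ 'n" and i :: 'n
  defines "a \<equiv> (norm (z $ i))\<^sup>2" and "s \<equiv> 1 - (norm z)\<^sup>2" and "q \<equiv> (norm (ins i 0 z))\<^sup>2"
  assumes a0: "a > 0" and s0: "s > 0"
  shows "det (bordered_hessian (rho i \<epsilon>) z) = - of_real (a ^ CARD('n) * (q * (a + s) + (a - s)\<^sup>2))"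
proof -
  define A where "A = bordered_hessian (rho i \<epsilon>) z"
  let ?a = "complex_of_real a" and ?s = "complex_of_real s"
  define g where "g k = ?a * z $ k - (if k = i then ?s * z $ i else 0)" for k
  have a_ne: "?a ~= 0" and as_ne: "?a + ?s ~= 0" using a0 s0 by (auto simp flip: of_real_add)
  have g: "grad i z $ k = g k" for k by (simp add: grad_nth g_def a_def s_def algebra_simps)
  have A: "A $ None $ None = 0" "\<And>k. A $ None $ Some k = g k" "\<And>j. A $ Some j $ None = cnj (g j)"
    "\<And>j k. A $ Some j $ Some k = (if j = i then cnj (z $ i) * z $ k else 0) + (if j = k then ?a else 0)
      + (if k = i then cnj (z $ j) * z $ i else 0) - (if k = i \<and> j = i then ?s else 0)"
    by (simp_all add: A_def bordered_hessian_def Let_def d_zbar_rho d_z_rho hessian_rho g a_def s_def)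
  have zz: "z $ i * cnj (z $ i) = ?a" "cnj (z $ i) * z $ i = ?a" unfolding a_def complex_norm_square by (simp_all add: mult.commute)
  define B :: "complex ^ ('n option) ^ ('n option)" where
    "B = (\<chi> r l. A $ r $ l + (if r = Some i then - (cnj (z $ i) / ?a) * A $ None $ l else 0))"
  have "det B = det A"
    by (rule det_row_add_nth[where m = "Some i" and J = "{None}" and c = "%_. - (cnj (z $ i) / ?a)"])
       (auto simp: B_def)
  moreover
  define C :: "complex ^ ('n option) ^ ('n option)" where
    "C = (\<chi> r l. B $ r $ l + (if l = Some i then - (z $ i / ?a) * B $ r $ None else 0))"
  have "det C = det B"
    by (rule det_column_add_nth[where m = "Some i" and J = "{None}" and c = "%_. - (z $ i / ?a)"])
       (auto simp: C_def)
  moreover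
  define d where "d k = (if k = i then ?a + ?s else ?a)" for k
  have "det C = - (\<Sum>k\<in>UNIV. g k * cnj (g k) / d k) * (\<Prod>k\<in>UNIV. d k)"
  proof (rule det_arrow)
    show "d k ~= 0" for k using a_ne as_ne by (simp add: d_def)
    show "C $ None $ None = 0" "C $ None $ Some k = g k" for k by (simp_all add: C_def B_def A)
    show "C $ Some j $ None = cnj (g j)" for j by (simp add: C_def B_def A)
    show "C $ Some j $ Some k = (if j = k then d j else 0)" for j k
      using a_ne zz by (auto simp: C_def B_def A d_def g_def field_simps)
  qed
  moreover have "(\<Prod>k\<in>UNIV. d k) = (?a + ?s) * ?a ^ (CARD('n) - 1)"
    by (subst prod.remove[of _ i]) (auto simp: d_def card_Diff_singleton)
  moreover have "(\<Sum>k\<in>UNIV. g k * cnj (g k) / d k) = of_real ((a - s)\<^sup>2 * a / (a + s) + a * q)"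
  proof -
    have gi: "g i * cnj (g i) / d i = of_real ((a - s)\<^sup>2 * a / (a + s))"
    proof -
      have "g i = of_real (a - s) * z $ i" by (simp add: g_def algebra_simps)
      then have "g i * cnj (g i) = of_real (a - s) * of_real (a - s) * (z $ i * cnj (z $ i))" by (simp add: mult_ac)
      then have "g i * cnj (g i) = of_real ((a - s)\<^sup>2 * a)" by (simp only: zz power2_eq_square of_real_mult)
      then show ?thesis by (simp add: d_def)
    qed
    have gk: "g k * cnj (g k) / d k = of_real (a * (norm (z $ k))\<^sup>2)" if "k ~= i" for k
    proof -
      have "g k * cnj (g k) / d k = ?a * (z $ k * cnj (z $ k))" using that a_ne by (simp add: g_def d_def)
      then show ?thesis by (simp only: of_real_mult complex_norm_square)
    qed
    have "q = (\<Sum>k\<in>UNIV. (norm (ins i 0 z $ k))\<^sup>2)" unfolding q_def by (rule norm_vec_sq)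
    also have "... = (\<Sum>k\<in>UNIV-{i}. (norm (z $ k))\<^sup>2)"
      by (subst sum.remove[of _ i]) (auto intro!: sum.cong)
    finally have q: "q = (\<Sum>k\<in>UNIV-{i}. (norm (z $ k))\<^sup>2)" .
    have "(\<Sum>k\<in>UNIV. g k * cnj (g k) / d k) = g i * cnj (g i) / d i + (\<Sum>k\<in>UNIV-{i}. g k * cnj (g k) / d k)"
      by (rule sum.remove) auto
    also have "(\<Sum>k\<in>UNIV-{i}. g k * cnj (g k) / d k) = of_real (a * q)"
      unfolding q sum_distrib_left of_real_sum by (rule sum.cong) (use gk in auto)
    finally show ?thesis using gi by simp
  qed
  ultimately have "det A = - of_real ((a - s)\<^sup>2 * a / (a + s) + a * q) * ((?a + ?s) * ?a ^ (CARD('n) - 1))" by metis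
  also have "... = - of_real (((a - s)\<^sup>2 * a / (a + s) + a * q) * ((a + s) * a ^ (CARD('n) - 1)))"
    by (simp only: of_real_mult of_real_add of_real_power mult_minus_left)
  also have "((a - s)\<^sup>2 * a / (a + s) + a * q) * ((a + s) * a ^ (CARD('n) - 1)) = (a * a ^ (CARD('n) - 1)) * (q * (a + s) + (a - s)\<^sup>2)"
  proof -
    define x where "x = (a - s)\<^sup>2 * a / (a + s)"
    have x: "x * (a + s) = (a - s)\<^sup>2 * a" using a0 s0 by (simp add: x_def)
    have "(x + a * q) * ((a + s) * m) = (a * m) * (q * (a + s) + (a - s)\<^sup>2)" for m
    proof -
      have "(x + a * q) * ((a + s) * m) = (x * (a + s)) * m + a * q * (a + s) * m" by (simp add: algebra_simps)
      also have "... = (a * m) * (q * (a + s) + (a - s)\<^sup>2)" unfolding x by (simp add: algebra_simps)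
      finally show ?thesis .
    qed
    then show ?thesis by (simp only: x_def)
  qed
  also have "a * a ^ (CARD('n) - 1) = a ^ CARD('n)" by (metis Suc_pred' power_Suc zero_less_card_finite)
  finally show ?thesis by (simp add: A_def)
qed

text \<open>The Fefferman density without the constant c: the power of the determinant divided by
  the norm \<open>2 * norm (grad i z)\<close> of the differential. As a formula on the whole space
  it is Borel measurable there.\<close>

definition fdens :: "'n::finite => complex ^ 'n => real" where
  "fdens i z = (let a = (norm (z $ i))\<^sup>2; s = 1 - (norm z)\<^sup>2; q = (norm (ins i 0 z))\<^sup>2 in
     (a ^ CARD('n) * (q * (a + s) + (a - s)\<^sup>2)) powr (1 / (real CARD('n) + 1)) / (2 * sqrt (a * ((a - s)\<^sup>2 + a * q))))"

lemma fefferman_density: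
  fixes z :: "complex ^ 'n"
  assumes "rho i \<epsilon> z = 0" "\<epsilon> > 0"
  shows "c * Re (- det (bordered_hessian (rho i \<epsilon>) z)) powr (1 / (real CARD('n) + 1))
      / onorm (frechet_derivative (rho i \<epsilon>) (at z)) = c * fdens i z"
proof -
  define a where "a = (norm (z $ i))\<^sup>2"
  define s where "s = 1 - (norm z)\<^sup>2"
  have as: "a * s = \<epsilon>" using assms by (simp add: rho_def a_def s_def algebra_simps)
  have a0: "a > 0" and s0: "s > 0" using as assms zero_le_power2[of "norm (z $ i)"]
    by (auto simp: a_def zero_less_mult_iff)
  have "norm (grad i z) = sqrt (a * ((a - s)\<^sup>2 + a * (norm (ins i 0 z))\<^sup>2))"
    using norm_grad_sq[of i z] by (intro real_sqrt_unique[symmetric]) (auto simp: a_def s_def)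
  moreover have "Re (- det (bordered_hessian (rho i \<epsilon>) z)) = a ^ CARD('n) * ((norm (ins i 0 z))\<^sup>2 * (a + s) + (a - s)\<^sup>2)"
    unfolding det_bordered_hessian[OF a0[unfolded a_def] s0[unfolded s_def]] a_def[symmetric] s_def[symmetric] minus_minus
    by (rule Re_complex_of_real)
  ultimately show ?thesis
    unfolding onorm_frechet_rho fdens_def Let_def a_def[symmetric] s_def[symmetric] by simp
qed

section \<open>Mean values over rotation invariant sets\<close>

section \<open>Averages\<close>

lemma set_integral_eq_circle_integral:
  fixes h :: "real => complex"
  assumes "continuous_on {0..2*pi} h"
  shows "(LINT \<theta>:{0..2*pi}|lborel. h \<theta>) = integral {0..2*pi} h"
  using borel_integrable_atLeastAtMost'[OF assms] by (rule set_borel_integral_eq_integral)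

lemma set_integral_cauchy_schwarz:
  fixes \<Phi> :: "complex ^ 'n => complex"
  assumes U: "U \<in> sets borel" "emeasure lborel U < \<infinity>"
    and \<Phi>: "(%z. indicator U z *\<^sub>R \<Phi> z) \<in> borel_measurable borel"
    and int: "set_integrable lborel U (%z. (norm (\<Phi> z))\<^sup>2)"
  shows "(norm (LINT z:U|lborel. \<Phi> z))\<^sup>2 <= measure lborel U * (LINT z:U|lborel. (norm (\<Phi> z))\<^sup>2)"
proof -
  define N where "N = restrict_space lborel U"
  have UU: "U \<inter> space lborel \<in> sets lborel" using U by simp
  have m: "\<Phi> \<in> borel_measurable N"
    unfolding N_def using \<Phi> U(1) by (subst borel_measurable_restrict_space_iff) auto
  have sq1: "square_integrable N \<Phi>"
    unfolding square_integrable_def using m int U(1)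
    by (simp add: N_def integrable_restrict_space[OF UU] set_integrable_def)
  have sq2: "square_integrable N (%z. 1)"
    unfolding square_integrable_def N_def using U
    by (simp add: integrable_restrict_space[OF UU])
  have "ip N \<Phi> (%z. 1) = (LINT z:U|lborel. \<Phi> z)"
    by (simp add: ip_def N_def integral_restrict_space[OF UU] set_lebesgue_integral_def)
  moreover have "nsq N \<Phi> = (LINT z:U|lborel. (norm (\<Phi> z))\<^sup>2)"
    by (simp add: nsq_def N_def integral_restrict_space[OF UU] set_lebesgue_integral_def)
  moreover have "nsq N (%z. 1) = measure lborel U"
    using U by (simp add: nsq_def N_def measure_restrict_space space_restrict_space)
  ultimately show ?thesis using cauchy_schwarz[OF sq1 sq2] by (simp add: mult.commute)
qed

lemma torus_map_measurable:
  fixes w :: "complex ^ 'n" and u :: "real => 'n => complex"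
  assumes "\<And>j. continuous_on UNIV (%\<theta>. u \<theta> j)"
  shows "(%(\<theta>, z). torus_map w (u \<theta>) z) \<in> borel_measurable (borel \<Otimes>\<^sub>M borel)"
proof -
  have "continuous_on UNIV (%x :: real \<times> (complex ^ 'n). torus_map w (u (fst x)) (snd x))"
    unfolding torus_map_def
    by (intro continuous_intros continuous_on_vec_lambda continuous_on_compose2[OF assms]) auto
  then show ?thesis
    unfolding split_beta borel_prod by (rule borel_measurable_continuous_onI)
qed

text \<open>The rotations used for averaging: \<^term>\<open>J\<close> is the set of the coordinates that are rotated.\<close>

definition rot :: "'n set => complex ^ 'n => real => complex ^ 'n => complex ^ 'n" where
  "rot J w \<theta> = torus_map w (%j. if j \<in> J then cis \<theta> else 1)"

lemma rot_nth: "rot J w \<theta> z $ j = (if j \<in> J then w $ j + cis \<theta> * (z $ j - w $ j) else z $ j)"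
  by (simp add: rot_def torus_map_def)

text \<open>Rotations of the coordinates in J about w preserve Lebesgue measure, so integrals over
  invariant sets are replaced by those of one-variable circle averages.\<close>

lemma set_integral_rot_average:
  fixes \<Phi> g :: "complex ^ 'n => complex"
  assumes U: "U \<in> sets borel" "emeasure lborel U < \<infinity>"
    and \<Phi>: "continuous_on U \<Phi>" and bound: "\<And>z. z \<in> U ==> norm (\<Phi> z) <= B"
    and inv: "\<And>\<theta> z. rot J w \<theta> z \<in> U \<longleftrightarrow> z \<in> U"
    and avg: "\<And>z. z \<in> U ==> integral {0..2*pi} (%\<theta>. \<Phi> (rot J w \<theta> z)) = 2 * pi * g z"
  shows "(LINT z:U|lborel. \<Phi> z) = (LINT z:U|lborel. g z)"
proof (rule set_integral_average[OF U _ bound _ _ inv])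
  show "(%z. indicator U z *\<^sub>R \<Phi> z) \<in> borel_measurable borel"
    by (rule borel_measurable_continuous_on_indicator[OF U(1) \<Phi>])
  show "(%(\<theta>, z). rot J w \<theta> z) \<in> borel_measurable (borel \<Otimes>\<^sub>M borel)"
    unfolding rot_def
  proof (rule torus_map_measurable)
    fix j show "continuous_on UNIV (%\<theta>. if j \<in> J then cis \<theta> else 1)"
      by (cases "j \<in> J") (auto intro!: continuous_intros)
  qed
  show "distr lborel borel (rot J w \<theta>) = lborel" for \<theta>
    unfolding rot_def by (rule lborel_distr_torus_map) auto
  fix z assume z: "z \<in> U"
  have "continuous_on {0..2*pi} (%\<theta>. rot J w \<theta> z)"
    unfolding rot_def torus_map_def
  proof (rule continuous_on_vec_lambda)
    fix j show "continuous_on {0..2*pi} (%\<theta>. w $ j + (if j \<in> J then cis \<theta> else 1) * (z $ j - w $ j))"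
      by (cases "j \<in> J") (auto intro!: continuous_intros)
  qed
  then have "continuous_on {0..2*pi} (%\<theta>. \<Phi> (rot J w \<theta> z))"
    by (rule continuous_on_compose2[OF \<Phi>]) (use inv z in auto)
  then show "(LINT \<theta>:{0..2*pi}|lborel. \<Phi> (rot J w \<theta> z)) = (2 * pi) *\<^sub>R g z"
    using avg[OF z] by (simp add: set_integral_eq_circle_integral scaleR_conv_of_real)
qed

text \<open>Rotating all coordinates simultaneously about w turns the average into that over a
  circle in the complex line through w and z.\<close>

lemma holomorphic_several_ball_mean:
  assumes F: "holomorphic_several F S" and w: "cball w \<eta> \<subseteq> S" "\<eta> > 0"
  shows "(LINT z:ball w \<eta>|lborel. F z) = measure lborel (ball w \<eta>) *\<^sub>R F w"
proof -
  have cont: "continuous_on (cball w \<eta>) F"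
    by (rule continuous_on_subset[OF holomorphic_several_continuous_on[OF F] w(1)])
  then have "compact (F ` cball w \<eta>)" by (intro compact_continuous_image) auto
  then have "bounded (F ` cball w \<eta>)" by (rule compact_imp_bounded)
  then obtain B where "\<forall>x\<in>F ` cball w \<eta>. norm x <= B" by (auto simp only: bounded_iff)
  then have B: "norm (F z) <= B" if "z \<in> cball w \<eta>" for z using that by (simp only: ball_simps)
  have rot: "rot UNIV w \<theta> z = w + cis \<theta> *s (z - w)" for \<theta> z
    by (simp add: vec_eq_iff rot_nth algebra_simps)
  have "(LINT z:ball w \<eta>|lborel. F z) = (LINT z:ball w \<eta>|lborel. F w)"
  proof (rule set_integral_rot_average[where J = UNIV and w = w and B = B])
    show "emeasure lborel (ball w \<eta>) < \<infinity>" by (rule emeasure_lborel_ball_finite)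
    show "continuous_on (ball w \<eta>) F" using cont by (rule continuous_on_subset) auto
    show "norm (F z) <= B" if "z \<in> ball w \<eta>" for z using B that by simp
    show "rot UNIV w \<theta> z \<in> ball w \<eta> \<longleftrightarrow> z \<in> ball w \<eta>" for \<theta> z
    proof -
      have "dist w (w + x) = norm x" for x by (simp add: dist_norm)
      then show ?thesis
        by (simp only: rot mem_ball norm_smult norm_cis mult_1_left dist_norm norm_minus_commute[of w z])
    qed
    fix z assume z: "z \<in> ball w \<eta>"
    \<comment> \<open>For \<open>z = w\<close> the line degenerates and any radius above 1
      serves.\<close>
    define R where "R = (if z = w then 2 else \<eta> / norm (z - w))"
    have R: "R > 1" using z by (auto simp: R_def dist_norm norm_minus_commute field_simps)
    have "(%t. F (w + t *s (z - w))) holomorphic_on ball 0 R"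
    proof (rule holomorphic_several_line_holomorphic[OF F])
      fix t :: complex assume "t \<in> ball 0 R"
      then have "norm t * norm (z - w) <= \<eta>"
        using w(2) by (cases "z = w") (auto simp: R_def field_simps)
      moreover have "dist w (w + x) = norm x" for x by (simp add: dist_norm)
      ultimately have "w + t *s (z - w) \<in> cball w \<eta>" by (simp only: mem_cball norm_smult)
      then show "w + t *s (z - w) \<in> S" using w by blast
    qed
    from circle_mean_value[OF this, of 1] R
    show "integral {0..2*pi} (%\<theta>. F (rot UNIV w \<theta> z)) = 2 * pi * F w" by (simp add: rot)
  qed auto
  then show ?thesis
    using emeasure_lborel_ball_finite[of w \<eta>] by (simp add: set_lebesgue_integral_def)
qed

section \<open>Evaluation bounds and completeness for the Bergman space\<close>

section \<open>The Bergman space\<close>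

text \<open>Holomorphic functions are continuous on the open set \<Omega>, so cut off outside it
  they are Borel; completing the measure then changes neither integrability nor integrals.\<close>

lemma square_integrable_lebesgue_on:
  assumes \<Omega>: "open \<Omega>" and F: "holomorphic_several F \<Omega>"
  shows "F \<in> borel_measurable (lebesgue_on \<Omega>)"
    "square_integrable (lebesgue_on \<Omega>) F \<longleftrightarrow> set_integrable lborel \<Omega> (%z. (norm (F z))\<^sup>2)"
    "nsq (lebesgue_on \<Omega>) F = (LINT z:\<Omega>|lborel. (norm (F z))\<^sup>2)"
proof -
  have cont: "continuous_on \<Omega> F" by (rule holomorphic_several_continuous_on[OF F])
  show m: "F \<in> borel_measurable (lebesgue_on \<Omega>)"
    using cont \<Omega> by (intro continuous_imp_measurable_on_sets_lebesgue) auto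
  have "(%z. indicator \<Omega> z *\<^sub>R (norm (F z))\<^sup>2) \<in> borel_measurable borel"
    by (intro borel_measurable_continuous_on_indicator continuous_intros cont) (use \<Omega> in simp)
  then have [measurable]: "(%z. indicator \<Omega> z *\<^sub>R (norm (F z))\<^sup>2) \<in> borel_measurable lborel"
    by simp
  have ic: "integrable lebesgue (%z. indicator \<Omega> z *\<^sub>R (norm (F z))\<^sup>2) = integrable lborel (%z. indicator \<Omega> z *\<^sub>R (norm (F z))\<^sup>2)"
    "integral\<^sup>L lebesgue (%z. indicator \<Omega> z *\<^sub>R (norm (F z))\<^sup>2) = integral\<^sup>L lborel (%z. indicator \<Omega> z *\<^sub>R (norm (F z))\<^sup>2)"
    by (rule integrable_completion integral_completion, measurable)+
  have OO: "\<Omega> \<inter> space lebesgue \<in> sets lebesgue" using \<Omega> by auto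
  show "square_integrable (lebesgue_on \<Omega>) F \<longleftrightarrow> set_integrable lborel \<Omega> (%z. (norm (F z))\<^sup>2)"
    unfolding square_integrable_def integrable_restrict_space[OF OO] set_integrable_def ic using m by simp
  show "nsq (lebesgue_on \<Omega>) F = (LINT z:\<Omega>|lborel. (norm (F z))\<^sup>2)"
    unfolding nsq_def integral_restrict_space[OF OO] set_lebesgue_integral_def ic ..
qed

text \<open>The mean value property on the ball of radius \<eta> about w, followed by
  Cauchy-Schwarz.\<close>

lemma bergman_evaluation:
  fixes w :: "complex ^ 'n"
  assumes \<Omega>: "open \<Omega>" and F: "holomorphic_several F \<Omega>" and sq: "square_integrable (lebesgue_on \<Omega>) F"
    and w: "cball w \<eta> \<subseteq> \<Omega>" "\<eta> > 0"
  shows "(norm (F w))\<^sup>2 <= nsq (lebesgue_on \<Omega>) F / measure lborel (ball (0 :: complex ^ 'n) \<eta>)"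
proof -
  let ?B = "ball w \<eta>" and ?m = "measure lborel (ball w \<eta>)"
  have mp: "?m > 0" using w(2) by (rule content_ball_pos)
  have int: "set_integrable lborel \<Omega> (%z. (norm (F z))\<^sup>2)"
    using sq square_integrable_lebesgue_on(2)[OF \<Omega> F] by simp
  have sub: "?B \<subseteq> \<Omega>" using w by auto
  have intB: "set_integrable lborel ?B (%z. (norm (F z))\<^sup>2)"
    by (rule set_integrable_subset[OF int _ sub]) simp
  have "(?m * norm (F w))\<^sup>2 = (norm (LINT z:?B|lborel. F z))\<^sup>2"
    unfolding holomorphic_several_ball_mean[OF F w] by simp
  also have "... <= ?m * (LINT z:?B|lborel. (norm (F z))\<^sup>2)"
    by (rule set_integral_cauchy_schwarz)
       (use intB emeasure_lborel_ball_finite[of w \<eta>] borel_measurable_continuous_on_indicator[of ?B F]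
         continuous_on_subset[OF holomorphic_several_continuous_on[OF F] sub] in auto)
  also have "... <= ?m * (LINT z:\<Omega>|lborel. (norm (F z))\<^sup>2)"
  proof (intro mult_left_mono)
    show "(LINT z:?B|lborel. (norm (F z))\<^sup>2) <= (LINT z:\<Omega>|lborel. (norm (F z))\<^sup>2)"
      unfolding set_lebesgue_integral_def
      by (rule integral_mono) (use int intB sub in \<open>auto simp: set_integrable_def indicator_def\<close>)
  qed auto
  finally have "?m * (?m * (norm (F w))\<^sup>2) <= ?m * nsq (lebesgue_on \<Omega>) F"
    by (simp add: square_integrable_lebesgue_on(3)[OF \<Omega> F] power_mult_distrib power2_eq_square mult_ac)
  then have "?m * (norm (F w))\<^sup>2 <= nsq (lebesgue_on \<Omega>) F" using mp by simp
  moreover have "?m = measure lborel (ball (0 :: complex ^ 'n) \<eta>)"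
    using w(2) by (simp add: content_ball)
  ultimately show ?thesis using mp by (simp add: field_simps)
qed

lemma holomorphic_several_lin:
  assumes "holomorphic_several F S" "holomorphic_several G S"
  shows "holomorphic_several (%z. c * F z + G z) S"
  unfolding holomorphic_several_def
proof
  fix z assume z: "z \<in> S"
  note F = holomorphic_several_derivative[OF assms(1) z] and G = holomorphic_several_derivative[OF assms(2) z]
  have "((%z. c * F z + G z) has_derivative (%h. c * Dd F z h + Dd G z h)) (at z)"
    by (intro derivative_intros F(1) G(1))
  then show "\<exists>D. ((%z. c * F z + G z) has_derivative D) (at z) \<and> (\<forall>a v. D (a *s v) = a * D v)"
    by (intro exI conjI) (auto simp: F(2) G(2) algebra_simps)
qed

lemma holomorphic_several_const: "holomorphic_several (%z. c) S"
  unfolding holomorphic_several_def by (intro ballI exI[of _ "%h. 0"]) auto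

lemma bergman_local_bound:
  assumes \<Omega>: "open \<Omega>" and w: "w \<in> \<Omega>"
  shows "\<exists>r>0. \<exists>C\<ge>0. ball w r \<subseteq> \<Omega> \<and> (\<forall>f F z. (f, F) \<in> bergman_space \<Omega> --> z \<in> ball w r -->
    norm (F z) <= C * sqrt (nsq (lebesgue_on \<Omega>) f))"
proof -
  obtain e where e: "e > 0" "cball w e \<subseteq> \<Omega>" using \<Omega> w open_contains_cball by blast
  define V where "V = measure lborel (ball (0 :: complex ^ 'a) (e/2))"
  have V: "V > 0" unfolding V_def using e by (intro content_ball_pos) simp
  show ?thesis
  proof (intro exI conjI allI impI)
    show "e / 2 > 0" "sqrt (1 / V) >= 0" "ball w (e/2) \<subseteq> \<Omega>" using e V by auto
    fix f F z assume f: "(f, F) \<in> bergman_space \<Omega>" and z: "z \<in> ball w (e/2)"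
    have sub: "cball z (e/2) \<subseteq> \<Omega>"
    proof
      fix y assume "y \<in> cball z (e/2)"
      then have "dist w y <= e" using z dist_triangle[of w y z] by simp
      then show "y \<in> \<Omega>" using e by auto
    qed
    have F: "f = F" "holomorphic_several F \<Omega>" "square_integrable (lebesgue_on \<Omega>) F"
      using f by (auto simp: bergman_space_def)
    have "(norm (F z))\<^sup>2 <= nsq (lebesgue_on \<Omega>) F / V"
      unfolding V_def by (rule bergman_evaluation[OF \<Omega> F(2,3) sub]) (use e in simp)
    then have "norm (F z) <= sqrt (nsq (lebesgue_on \<Omega>) F / V)" by (rule real_le_rsqrt)
    then show "norm (F z) <= sqrt (1 / V) * sqrt (nsq (lebesgue_on \<Omega>) f)"
      by (simp add: F(1) real_sqrt_divide)
  qed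
qed

lemma nsq_bounded_of_cauchy:
  assumes X: "\<And>k. square_integrable M (X k)" and c: "l2_cauchy M X"
  shows "\<exists>B\<ge>0. \<forall>k. sqrt (nsq M (X k)) <= B"
proof -
  obtain N where N: "\<And>m k. m >= N ==> k >= N ==> nsq M (%z. X m z - X k z) < 1"
    using c unfolding l2_cauchy_def by (metis zero_less_one)
  define B where "B = Max ((%k. sqrt (nsq M (X k))) ` {..N}) + 1"
  have m: "sqrt (nsq M (X k)) <= B - 1" if "k <= N" for k
    unfolding B_def using that by (auto intro!: Max_ge)
  have "sqrt (nsq M (X k)) <= B" for k
  proof (cases "k <= N")
    case False
    have "sqrt (nsq M (%z. (X k z - X N z) + X N z)) <= sqrt (nsq M (%z. X k z - X N z)) + sqrt (nsq M (X N))"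
      by (rule nsq_triangle[OF square_integrable_diff[OF X X] X])
    moreover have "sqrt (nsq M (%z. X k z - X N z)) <= 1" using N[of k N] False by (simp add: less_imp_le)
    moreover have "sqrt (nsq M (X N)) <= B - 1" by (rule m) simp
    moreover have "(%z. (X k z - X N z) + X N z) = X k" by simp
    ultimately show ?thesis by (simp only:)
  qed (use m in fastforce)
  moreover have "B >= 0" using m[of 0] real_sqrt_ge_zero[OF nsq_nonneg[of M "X 0"]] by linarith
  ultimately show ?thesis by blast
qed

lemma locally_uniform_limit:
  assumes \<Omega>: "open \<Omega>" and F: "\<And>k::nat. holomorphic_several (F k) \<Omega>"
    and bound: "\<And>w. w \<in> \<Omega> ==> \<exists>r>0. \<exists>B. ball w r \<subseteq> \<Omega> \<and> (\<forall>k. \<forall>z\<in>ball w r. norm (F k z) <= B)"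
    and lim: "\<And>z. z \<in> \<Omega> ==> (%k. F k z) \<longlonglongrightarrow> G z"
  shows "holomorphic_several G \<Omega>"
  unfolding holomorphic_several_def
proof
  fix w assume "w \<in> \<Omega>"
  from bound[OF this] obtain r B where r: "r > 0" "ball w r \<subseteq> \<Omega>" and B: "\<forall>k. \<forall>z\<in>ball w r. norm (F k z) <= B"
    by (elim exE conjE)
  show "\<exists>D. (G has_derivative D) (at w) \<and> (\<forall>a v. D (a *s v) = a * D v)"
  proof (rule holomorphic_several_limit_at[where F = F, OF holomorphic_several_subset[OF F r(2)] r(1)])
    show "norm (F k z) <= B" if "z \<in> ball w r" for k z using B that by blast
    show "(%k. F k z) \<longlonglongrightarrow> G z" if "z \<in> ball w r" for z using lim r that by blast
  qed
qed

text \<open>The evaluation bounds turn a Cauchy sequence in the mean into a pointwise convergent and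
  locally bounded one, so its limit is holomorphic. That it is also the limit in the mean is Fatou's
  lemma, with the identity as subsequence.\<close>

lemma bergman_function_hilbert:
  assumes \<Omega>: "open \<Omega>"
  shows "kernel_space (lebesgue_on \<Omega>) (bergman_space \<Omega>) \<Omega>"
proof unfold_locales
  let ?M = "lebesgue_on \<Omega>" and ?H = "bergman_space \<Omega>"
  show "?H ~= {}"
  proof -
    have "((%z. 0), (%z. 0)) \<in> ?H"
      using holomorphic_several_const[of 0 \<Omega>] by (simp add: bergman_space_def square_integrable_def)
    then show ?thesis by blast
  qed
  show "square_integrable ?M f" if "(f, F) \<in> ?H" for f F using that by (auto simp: bergman_space_def)
  show "(%z. c * f z + g z, %z. c * F z + G z) \<in> ?H" if "(f, F) \<in> ?H" "(g, G) \<in> ?H" for f F g G c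
    using that by (auto simp: bergman_space_def intro: holomorphic_several_lin square_integrable_lin)
  show "open \<Omega>" by fact
  show "holomorphic_several F \<Omega>" if "(f, F) \<in> ?H" for f F using that by (auto simp: bergman_space_def)
  show "\<exists>r>0. \<exists>C\<ge>0. ball w r \<subseteq> \<Omega> \<and> (\<forall>f F z. (f, F) \<in> ?H --> z \<in> ball w r --> norm (F z) <= C * sqrt (nsq ?M f))"
    if "w \<in> \<Omega>" for w using bergman_local_bound[OF \<Omega> that] .
  fix X assume X: "\<And>k. X k \<in> ?H" and cauchy: "l2_cauchy ?M (%k. fst (X k))"
  define f where "f k = fst (X k)" for k
  have f: "holomorphic_several (f k) \<Omega>" "square_integrable ?M (f k)" for k
    using X[of k] by (auto simp: bergman_space_def f_def)
  have fH: "(%z. f m z - f k z, %z. f m z - f k z) \<in> ?H" for m k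
    using holomorphic_several_lin[OF f(1)[of k] f(1)[of m], of "-1"] square_integrable_diff[OF f(2)[of m] f(2)[of k]]
    by (simp add: bergman_space_def)
  have fH1: "(f k, f k) \<in> ?H" for k using f by (auto simp: bergman_space_def)
  have c: "l2_cauchy ?M f" using cauchy by (simp add: f_def[abs_def])
  have conv: "convergent (%k. f k z)" if z: "z \<in> \<Omega>" for z
  proof -
    from bergman_local_bound[OF \<Omega> z] obtain r C where r: "r > 0" "C >= 0"
      and C: "\<forall>f F y. (f, F) \<in> ?H --> y \<in> ball z r --> norm (F y) <= C * sqrt (nsq ?M f)" by (elim exE conjE)
    have b: "norm (f m z - f k z) <= C * sqrt (nsq ?M (%z. f m z - f k z))" for m k
      using C[rule_format, OF fH, of z] r by simp
    have "Cauchy (%k. f k z)"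
    proof (rule metric_CauchyI)
      fix e :: real assume e: "e > 0"
      then have "(e / (C + 1))\<^sup>2 > 0" using r by simp
      then obtain N where N: "\<And>m k. m >= N ==> k >= N ==> nsq ?M (%z. f m z - f k z) < (e / (C + 1))\<^sup>2"
        using c unfolding l2_cauchy_def by blast
      have "dist (f m z) (f k z) < e" if "m >= N" "k >= N" for m k
      proof -
        have "sqrt (nsq ?M (%z. f m z - f k z)) <= e / (C + 1)"
          using N[OF that] e r by (intro real_le_lsqrt) auto
        then have "C * sqrt (nsq ?M (%z. f m z - f k z)) <= C * (e / (C + 1))" using r by (intro mult_left_mono)
        also have "... < e" using e r by (simp add: field_simps)
        finally show ?thesis using b[of m k] by (simp add: dist_norm)
      qed
      then show "\<exists>N. \<forall>m\<ge>N. \<forall>k\<ge>N. dist (f m z) (f k z) < e" by blast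
    qed
    then show ?thesis by (rule Cauchy_convergent)
  qed
  define g where "g z = lim (%k. f k z)" for z
  have lim: "(%k. f k z) \<longlonglongrightarrow> g z" if "z \<in> \<Omega>" for z
    using conv[OF that] by (simp add: g_def convergent_LIMSEQ_iff)
  obtain B where B: "B >= 0" "\<forall>k. sqrt (nsq ?M (f k)) <= B" using nsq_bounded_of_cauchy[OF f(2) c] by blast
  have hol: "holomorphic_several g \<Omega>"
  proof (rule locally_uniform_limit[OF \<Omega> f(1) _ lim])
    fix w assume w: "w \<in> \<Omega>"
    from bergman_local_bound[OF \<Omega> w] obtain r C where r: "r > 0" "C >= 0" "ball w r \<subseteq> \<Omega>"
      and C: "\<forall>f F y. (f, F) \<in> ?H --> y \<in> ball w r --> norm (F y) <= C * sqrt (nsq ?M f)" by (elim exE conjE)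
    have "norm (f k z) <= C * B" if "z \<in> ball w r" for k z
      using C[rule_format, OF fH1 that, of k] mult_left_mono[OF B(2)[rule_format, of k] r(2)] by linarith
    then show "\<exists>r>0. \<exists>B. ball w r \<subseteq> \<Omega> \<and> (\<forall>k. \<forall>z\<in>ball w r. norm (f k z) <= B)" using r by blast
  qed
  have "AE z in ?M. (%j. f (id j) z) \<longlonglongrightarrow> g z" using lim by (intro AE_I2) auto
  from l2_limit[OF f(2) c strict_mono_id square_integrable_lebesgue_on(1)[OF \<Omega> hol] this]
  show "\<exists>f F. (f, F) \<in> ?H \<and> (%k. nsq ?M (%z. fst (X k) z - f z)) \<longlonglongrightarrow> 0"
    using hol by (intro exI[of _ g]) (auto simp: bergman_space_def f_def)
qed

lemma continuous_bounded_on_compact: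
  fixes F :: "'a::t2_space => complex"
  assumes "compact K" "continuous_on K F"
  shows "\<exists>B. \<forall>z\<in>K. norm (F z) <= B"
proof -
  have "bounded (F ` K)" using compact_continuous_image[OF assms(2,1)] by (rule compact_imp_bounded)
  then show ?thesis by (auto simp: bounded_iff)
qed

section \<open>The product sets over which slice formulas are averaged\<close>

section \<open>Averages over rings\<close>

text \<open>An annulus about 0 in coordinate i times a ball about w in the others: invariant under
  rotating \<open>z $ i\<close> about 0 and, separately, the other coordinates about w.\<close>

definition ring :: "'n => complex ^ 'n => real => real => real => (complex ^ 'n) set" where
  "ring i w A B \<eta> = {z. A < norm (z $ i) \<and> norm (z $ i) < B \<and> norm (ins i 0 (z - w)) < \<eta>}"

lemma open_ring: "open (ring i w A B \<eta>)"
  unfolding ring_def by (intro open_Collect_conj open_Collect_less continuous_intros)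

lemma ring_borel [measurable]: "ring i w A B \<eta> \<in> sets borel"
  using open_ring by (rule borel_open)

lemma ring_subset_polycyl: "ring i w A B \<eta> \<subseteq> polycyl i (ins i 0 w) B \<eta>"
proof -
  have "ins i 0 (z - ins i 0 w) = ins i 0 (z - w)" for z by (simp add: vec_eq_iff)
  then show ?thesis by (auto simp: ring_def polycyl_def)
qed

lemma emeasure_ring_finite: "emeasure lborel (ring i w A B \<eta>) < \<infinity>"
  using emeasure_mono[OF ring_subset_polycyl[of i w A B \<eta>], of lborel]
    emeasure_polycyl_finite[of i "ins i 0 w" B \<eta>] by (metis sets_polycyl sets_lborel order.strict_trans1)

lemma measure_ring_pos:
  fixes i :: "'n::finite"
  assumes "0 <= A" "A < B" "\<eta> > 0"
  shows "measure lborel (ring i w A B \<eta>) > 0"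
proof -
  have "ins i (of_real ((A + B) / 2)) w \<in> ring i w A B \<eta>"
  proof -
    have e: "ins i 0 (ins i (of_real ((A + B) / 2)) w - w) = (0 :: complex ^ 'n)" by (simp add: vec_eq_iff)
    have n: "norm (complex_of_real ((A + B) / 2)) = (A + B) / 2"
      unfolding norm_of_real using assms by (simp add: abs_of_nonneg)
    show ?thesis unfolding ring_def mem_Collect_eq e ins_nth using assms n by simp
  qed
  then obtain r where r: "r > 0" "ball (ins i (of_real ((A + B) / 2)) w) r \<subseteq> ring i w A B \<eta>"
    using open_ring open_contains_ball by blast
  have "0 < measure lborel (ball (ins i (of_real ((A + B) / 2)) w) r)" using r by (intro content_ball_pos)
  also have "... <= measure lborel (ring i w A B \<eta>)"
    using r emeasure_ring_finite[of i w A B \<eta>]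
    by (intro measure_mono_fmeasurable) (auto simp: fmeasurable_def)
  finally show ?thesis .
qed

lemma measure_ring_translate:
  fixes i :: "'n::finite"
  shows "measure lborel (ring i w A B \<eta>) = measure lborel (ring i 0 A B \<eta>)"
proof -
  let ?w = "ins i 0 w"
  have s: "ins i 0 (z + ?w - w) = ins i 0 z" "(z + ?w) $ i = z $ i" for z by (simp_all add: vec_eq_iff)
  have "emeasure lborel (ring i w A B \<eta>) = (\<integral>\<^sup>+z. indicator (ring i w A B \<eta>) (z + ?w) \<partial>lborel)"
    by (subst nn_integral_lborel_translate) auto
  also have "... = (\<integral>\<^sup>+z. indicator (ring i 0 A B \<eta>) z \<partial>lborel)"
    by (intro nn_integral_cong) (simp add: indicator_def ring_def s)
  finally show ?thesis by (simp add: measure_def)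
qed

lemma rot_ring:
  "rot {i} 0 \<theta> z \<in> ring i w A B \<eta> \<longleftrightarrow> z \<in> ring i w A B \<eta>"
  "rot (UNIV - {i}) w \<theta> z \<in> ring i w A B \<eta> \<longleftrightarrow> z \<in> ring i w A B \<eta>"
proof -
  have 1: "ins i 0 (rot {i} 0 \<theta> z - w) = ins i 0 (z - w)" by (simp add: vec_eq_iff rot_nth)
  have 2: "ins i 0 (rot (UNIV - {i}) w \<theta> z - w) = cis \<theta> *s ins i 0 (z - w)" by (simp add: vec_eq_iff rot_nth)
  show "rot {i} 0 \<theta> z \<in> ring i w A B \<eta> \<longleftrightarrow> z \<in> ring i w A B \<eta>"
    unfolding ring_def mem_Collect_eq 1 by (simp add: rot_nth norm_mult)
  show "rot (UNIV - {i}) w \<theta> z \<in> ring i w A B \<eta> \<longleftrightarrow> z \<in> ring i w A B \<eta>"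
    unfolding ring_def mem_Collect_eq 2 by (simp add: rot_nth norm_mult norm_smult)
qed

text \<open>With the i-th coordinate frozen at c, rotating the others about w averages F to its
  value at the centre; for n = 1 the integrand is constant.\<close>

lemma ring_mean:
  fixes i :: "'n::finite" and w :: "complex ^ 'n"
  assumes F: "holomorphic_several F \<Omega>" and \<eta>: "\<eta> > 0"
    and sub: "\<And>z. norm (ins i 0 (z - w)) < \<eta> ==> ins i c z \<in> \<Omega>"
    and bound: "\<And>z. norm (ins i 0 (z - w)) < \<eta> ==> norm (F (ins i c z)) <= B0"
  shows "(LINT z:ring i w A B \<eta>|lborel. F (ins i c z)) = measure lborel (ring i w A B \<eta>) *\<^sub>R F (ins i c w)"
proof -
  let ?U = "ring i w A B \<eta>"
  have "(LINT z:?U|lborel. F (ins i c z)) = (LINT z:?U|lborel. F (ins i c w))"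
  proof (rule set_integral_rot_average[where J = "UNIV - {i}" and w = w and B = B0])
    show "emeasure lborel ?U < \<infinity>" by (rule emeasure_ring_finite)
    show "continuous_on ?U (%z. F (ins i c z))"
      by (rule continuous_on_compose2[OF holomorphic_several_continuous_on[OF F]])
         (use sub in \<open>auto simp: ring_def intro!: continuous_intros\<close>)
    show "norm (F (ins i c z)) <= B0" if "z \<in> ?U" for z using bound that by (simp add: ring_def)
    show "rot (UNIV - {i}) w \<theta> z \<in> ?U \<longleftrightarrow> z \<in> ?U" for \<theta> z by (rule rot_ring)
    fix z assume z: "z \<in> ?U"
    define v where "v = ins i 0 (z - w)"
    have v: "norm v < \<eta>" using z by (simp add: v_def ring_def)
    define R where "R = (if v = 0 then 2 else \<eta> / norm v)"
    have R: "R > 1" using v by (auto simp: R_def)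
    have "(%t. F (ins i c w + t *s v)) holomorphic_on ball 0 R"
    proof (rule holomorphic_several_line_holomorphic[OF F])
      fix t :: complex assume "t \<in> ball 0 R"
      then have n: "norm (t *s v) < \<eta>"
        using \<eta> by (cases "v = 0") (auto simp: R_def norm_smult field_simps)
      have e: "ins i c w + t *s v = ins i c (w + t *s v)" "ins i 0 (w + t *s v - w) = t *s v"
        by (simp_all add: vec_eq_iff v_def)
      show "ins i c w + t *s v \<in> \<Omega>" unfolding e(1) by (rule sub) (use n e(2) in simp)
    qed
    from circle_mean_value[OF this, of 1] R
    have "integral {0..2*pi} (%\<theta>. F (ins i c w + cis \<theta> *s v)) = 2 * pi * F (ins i c w)" by simp
    moreover have "ins i c (rot (UNIV - {i}) w \<theta> z) = ins i c w + cis \<theta> *s v" for \<theta>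
      by (simp add: vec_eq_iff rot_nth v_def)
    ultimately show "integral {0..2*pi} (%\<theta>. F (ins i c (rot (UNIV - {i}) w \<theta> z))) = 2 * pi * F (ins i c w)"
      by simp
  qed simp
  then show ?thesis using emeasure_ring_finite[of i w A B \<eta>] by (simp add: set_lebesgue_integral_def)
qed

section \<open>Upper bound for the Bergman metric at the base point\<close>

section \<open>The Bergman metric\<close>

text \<open>The hole has radius about \<alpha>, and \<open>p1 = sqrt \<alpha>\<close> is the
  geometric mean of that radius and 1. The bound 1/8 leaves room for circles of radius
  \<open>4 * \<alpha> < p1\<close> and \<open>1/4 > p1\<close> on both sides of p.\<close>

locale thin =
  fixes i :: "'n::finite" and \<alpha> p1 :: real
  assumes p1: "0 < p1" "p1 <= 1/8" and \<alpha>: "\<alpha> = p1\<^sup>2"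
begin

definition \<epsilon> where "\<epsilon> = \<alpha>\<^sup>2"
definition \<Omega> :: "(complex ^ 'n) set" where "\<Omega> = annular_domain i \<epsilon>"
definition p :: "complex ^ 'n" where "p = ins i (of_real p1) 0"

lemma params: "0 < \<alpha>" "\<alpha> <= p1 / 8" "\<alpha> <= 1/64" "0 < \<epsilon>" "\<epsilon> < 1/4" "\<epsilon> <= \<alpha> / 64"
proof -
  show a: "0 < \<alpha>" and b: "\<alpha> <= p1 / 8" using p1 by (auto simp: \<alpha> power2_eq_square field_simps)
  then show c: "\<alpha> <= 1/64" using p1 by simp
  show "0 < \<epsilon>" using a by (simp add: \<epsilon>_def)
  have "\<alpha> * \<alpha> <= \<alpha> * (1/64)" using a c by (intro mult_left_mono) auto
  then show "\<epsilon> <= \<alpha> / 64" by (simp add: \<epsilon>_def power2_eq_square)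
  then show "\<epsilon> < 1/4" using c by simp
qed

lemma open_\<Omega>: "open \<Omega>" unfolding \<Omega>_def by (rule open_dom)

lemma slab_subset:
  assumes "2 * \<alpha> <= norm t" "norm t <= 1/2" "norm (ins i 0 z) <= 1/4"
  shows "ins i t z \<in> \<Omega>"
proof -
  let ?b = "(norm t)\<^sup>2"
  have "(2 * \<alpha>)\<^sup>2 <= ?b" using assms params by (intro power_mono) auto
  then have b: "4 * \<epsilon> <= ?b" by (simp add: \<epsilon>_def power_mult_distrib)
  have "?b <= (1/2)\<^sup>2" "(norm (ins i 0 z))\<^sup>2 <= (1/4)\<^sup>2" using assms by (intro power_mono; simp)+
  then have "?b <= 1/4" "(norm (ins i 0 z))\<^sup>2 <= 1/16" by (simp_all add: power2_eq_square)
  then have "1 - (norm (ins i t z))\<^sup>2 >= 1/2" using norm_ins_sq[of i t z] by linarith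
  then have "?b * (1/2) <= ?b * (1 - (norm (ins i t z))\<^sup>2)" by (intro mult_left_mono) auto
  then show ?thesis unfolding \<Omega>_def dom_iff using b params(4) by simp
qed

lemma p_in: "p \<in> \<Omega>"
proof -
  have "ins i 0 0 = (0 :: complex ^ 'n)" by (simp add: vec_eq_iff)
  then show ?thesis unfolding p_def by (intro slab_subset) (use p1 params in auto)
qed

definition U :: "(complex ^ 'n) set" where "U = ring i 0 (1/4) (1/2) (1/4)"

text \<open>The Cauchy formula for the derivative of \<open>t * F\<close>, between circles of radius
  \<open>norm (z $ i)\<close> in [1/4, 1/2] and \<open>8 * \<alpha> * norm (z $ i)\<close>, averaged
  over the ring U. The extra factor t makes the integrand on the small circle of order \<alpha>, and
  its square pays for the Jacobian of the scaling L, of order \<alpha>^2. At p the factor is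
  harmless, since \<open>F p = 0\<close> leaves \<open>p1\<close> times the derivative of F.\<close>

lemma bergman_derivative_bound:
  assumes F: "holomorphic_several F \<Omega>" and sq: "square_integrable (lebesgue_on \<Omega>) F" and F0: "F p = 0"
  shows "(norm (Dd F p (axis i 1)))\<^sup>2 <= 160 / (measure lborel U * \<alpha>) * nsq (lebesgue_on \<Omega>) F"
proof -
  let ?P = "complex_of_real p1" and ?e = "axis i 1 :: complex ^ 'n"
  \<comment> \<open>The factor 8 takes the radii of U to [2 \<alpha>, 4 \<alpha>], which lies in the
    domain by \<open>slab_subset\<close> and below p1.\<close>
  define l where "l = 8 * \<alpha>"
  have l: "l > 0" using params by (simp add: l_def)
  define L where "L = (scale_map i l 1 :: complex ^ 'n => complex ^ 'n)"
  have L: "L z = ins i (of_real l * z $ i) z" for z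
    by (simp add: L_def scale_map_def vec_eq_iff scaleR_conv_of_real)
  define \<Phi> where "\<Phi> z = (z $ i)\<^sup>2 * F z / (z $ i - ?P)\<^sup>2" for z
  define K where "K = {z :: complex ^ 'n. 1/4 <= norm (z $ i) \<and> norm (z $ i) <= 1/2 \<and> norm (ins i 0 z) <= 1/4}"
  have UK: "U \<subseteq> K" by (auto simp: U_def K_def ring_def)
  have "closed K" unfolding K_def by (intro closed_Collect_conj closed_Collect_le continuous_intros)
  moreover have "K \<subseteq> cball 0 (1/2 + 1/4)"
    using polycyl_subset_cball[of i 0 "1/2" "1/4"] by (auto simp: K_def polycyl_def)
  ultimately have cK: "compact K" by (meson bounded_cball bounded_subset compact_eq_bounded_closed)
  have ringO: "ins i t z \<in> \<Omega>" "t ~= 0" if "2 * \<alpha> <= norm t" "norm t <= 1/2" "z \<in> K" for t z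
    using slab_subset[OF that(1,2)] that params by (auto simp: K_def)
  have nl: "norm (of_real l * z $ i) = 8 * \<alpha> * norm (z $ i)" for z :: "complex ^ 'n"
    using params by (simp add: norm_mult l_def)
  have lb: "2 * \<alpha> <= norm (of_real l * z $ i)" "norm (of_real l * z $ i) <= 4 * \<alpha>" "4 * \<alpha> < p1" if "z \<in> K" for z
    using that params(1,2) p1 unfolding nl K_def by (auto simp: mult_left_mono[of "norm (z $ i)" "1/2" "8 * \<alpha>"]
        mult_left_mono[of "1/4" "norm (z $ i)" "8 * \<alpha>"])
  have ub: "2 * \<alpha> <= norm (z $ i)" "norm (z $ i) <= 1/2" "p1 < norm (z $ i)" if "z \<in> K" for z
    using that params p1 unfolding K_def by auto
  have KO: "z \<in> \<Omega>" if "z \<in> K" for z using ringO[OF ub(1,2)[OF that] that] by simp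
  have LO: "L z \<in> \<Omega>" if "z \<in> K" for z
    unfolding L by (rule ringO[OF lb(1)[OF that] _ that]) (use lb[OF that] params in linarith)
  have ne: "z $ i ~= ?P" "L z $ i ~= ?P" if "z \<in> K" for z
  proof -
    have "norm ?P = p1" using p1 by simp
    then show "z $ i ~= ?P" "L z $ i ~= ?P" using ub[OF that] lb[OF that] unfolding L by auto
  qed
  have FL: "continuous_on \<Omega> F" by (rule holomorphic_several_continuous_on[OF F])
  have cF: "continuous_on K F" by (rule continuous_on_subset[OF FL]) (use KO in auto)
  have cL: "continuous_on K L" unfolding L_def scale_map_def
    by (intro continuous_on_vec_lambda continuous_intros)
  have cFL: "continuous_on K (%z. F (L z))" by (rule continuous_on_compose2[OF FL cL]) (use LO in auto)
  have c\<Phi>: "continuous_on K \<Phi>" "continuous_on K (%z. \<Phi> (L z))"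
    unfolding \<Phi>_def by (intro continuous_intros cF; use ne in force)
      (intro continuous_intros cFL cL; use ne in force)
  have cd: "continuous_on K (%z. \<Phi> z - \<Phi> (L z))" by (intro continuous_intros c\<Phi>)
  \<comment> \<open>The derivative of \<open>t * F\<close> along the slice at
    \<open>of_real p1\<close>. Its second term vanishes at p but not nearby, so the mean over the
    other coordinates is taken of the whole sum.\<close>
  define D where "D \<zeta> = ?P * Dd F \<zeta> ?e + F \<zeta>" for \<zeta>
  have D: "holomorphic_several D \<Omega>" unfolding D_def
    by (intro holomorphic_several_lin holomorphic_several_deriv F open_\<Omega>)
  have Ub: "U \<in> sets borel" "emeasure lborel U < \<infinity>" unfolding U_def
    by (rule ring_borel, rule emeasure_ring_finite)
  obtain B1 where B1: "\<forall>z\<in>K. norm (\<Phi> z - \<Phi> (L z)) <= B1" using continuous_bounded_on_compact[OF cK cd] by blast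
  have "(LINT z:U|lborel. \<Phi> z - \<Phi> (L z)) = (LINT z:U|lborel. D (ins i ?P z))"
  proof (rule set_integral_rot_average[OF Ub, where J = "{i}" and w = 0 and B = B1])
    show "continuous_on U (%z. \<Phi> z - \<Phi> (L z))" by (rule continuous_on_subset[OF cd UK])
    show "norm (\<Phi> z - \<Phi> (L z)) <= B1" if "z \<in> U" for z using B1 that UK by auto
    show "rot {i} 0 \<theta> z \<in> U \<longleftrightarrow> z \<in> U" for \<theta> z unfolding U_def by (rule rot_ring)
    fix z assume "z \<in> U"
    then have z: "z \<in> K" using UK by blast
    let ?x = "z $ i" let ?y = "of_real l * z $ i"
    define G where "G = (%t. t * F (ins i t z))"
    have line: "ins i t z = ins i 0 z + t *s ?e" for t by (simp add: vec_eq_iff axis_def)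
    have der: "((%t. F (ins i t z)) has_field_derivative Dd F (ins i t z) ?e) (at t)" if "ins i t z \<in> \<Omega>" for t
    proof -
      have fl: "(%t. F (ins i t z)) = (%t. F (ins i 0 z + t *s ?e))" by (rule ext) (simp only: line[symmetric])
      show ?thesis unfolding fl using holomorphic_several_line[OF F, of "ins i 0 z" t ?e] that
        by (simp only: line[symmetric])
    qed
    have Gd: "(G has_field_derivative F (ins i t z) + Dd F (ins i t z) ?e * t) (at t)" if "ins i t z \<in> \<Omega>" for t
      using DERIV_mult[OF DERIV_ident der[OF that]] unfolding G_def mult_1_left .
    have inO: "ins i t z \<in> \<Omega>" if "norm ?y <= norm t" "norm t <= norm ?x" for t
      by (rule ringO(1)[OF _ _ z]) (use that ub[OF z] lb[OF z] in linarith)+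
    have Ghol: "G holomorphic_on annulus (norm ?y) (norm ?x)"
      unfolding holomorphic_on_def
    proof
      fix t assume "t \<in> annulus (norm ?y) (norm ?x)"
      then have "ins i t z \<in> \<Omega>" using inO by (auto simp: annulus_def)
      from Gd[OF this] have "G field_differentiable at t" unfolding field_differentiable_def by (rule exI)
      then show "G field_differentiable at t within annulus (norm ?y) (norm ?x)"
        by (rule field_differentiable_at_within)
    qed
    have Gcont: "continuous_on {t. norm ?y <= norm t \<and> norm t <= norm ?x} G"
      by (intro continuous_at_imp_continuous_on ballI DERIV_isCont[OF Gd] inO) auto
    have PO: "ins i ?P z \<in> \<Omega>" by (rule inO) (use p1 lb[OF z] ub[OF z] in auto)
    have dG: "deriv G ?P = D (ins i ?P z)"
      using DERIV_imp_deriv[OF Gd[OF PO]] by (simp add: D_def)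
    have rz: "rot {i} 0 \<theta> z = ins i (?x * cis \<theta>) z" "L (rot {i} 0 \<theta> z) = ins i (?y * cis \<theta>) z" for \<theta>
      by (simp_all add: vec_eq_iff rot_nth L)
    have rK: "rot {i} 0 \<theta> z \<in> K" for \<theta>
    proof -
      have e: "ins i 0 (rot {i} 0 \<theta> z) = ins i 0 z" by (simp add: vec_eq_iff rot_nth)
      show ?thesis using z unfolding K_def mem_Collect_eq e by (simp add: rot_nth norm_mult)
    qed
    have cr: "continuous_on {0..2*pi} (%\<theta>. rot {i} 0 \<theta> z)" unfolding rz
      by (intro continuous_intros)
    have i1: "(%\<theta>. \<Phi> (rot {i} 0 \<theta> z)) integrable_on {0..2*pi}" "(%\<theta>. \<Phi> (L (rot {i} 0 \<theta> z))) integrable_on {0..2*pi}"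
      by (intro integrable_continuous_real continuous_on_compose2[OF c\<Phi>(1) cr] continuous_on_compose2[OF c\<Phi>(2) cr]; use rK in blast)+
    have "integral {0..2*pi} (%\<theta>. \<Phi> (rot {i} 0 \<theta> z) - \<Phi> (L (rot {i} 0 \<theta> z)))
      = integral {0..2*pi} (%\<theta>. G (?x * cis \<theta>) * (?x * cis \<theta>) / (?x * cis \<theta> - ?P)\<^sup>2)
       - integral {0..2*pi} (%\<theta>. G (?y * cis \<theta>) * (?y * cis \<theta>) / (?y * cis \<theta> - ?P)\<^sup>2)"
      unfolding integral_diff[OF i1]
      by (simp add: rz(1) L G_def \<Phi>_def power2_eq_square mult_ac)
    also have "... = 2 * pi * deriv G ?P"
      by (rule annulus_cauchy_derivative[OF _ Ghol Gcont]) (use lb[OF z] ub[OF z] params p1 in auto)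
    finally show "integral {0..2*pi} (%\<theta>. \<Phi> (rot {i} 0 \<theta> z) - \<Phi> (L (rot {i} 0 \<theta> z))) = 2 * pi * D (ins i ?P z)"
      unfolding dG .
  qed
  also have "... = measure lborel U *\<^sub>R D (ins i ?P 0)"
  proof -
    have sub: "ins i ?P z \<in> \<Omega>" if "norm (ins i 0 z) <= 1/4" for z
      by (rule slab_subset) (use that p1 params in auto)
    have "compact ((%z. ins i ?P z) ` polycyl i 0 0 (1/4))"
      by (intro compact_continuous_image continuous_intros)
         (meson bounded_cball bounded_subset compact_eq_bounded_closed closed_polycyl polycyl_subset_cball)
    moreover have "continuous_on ((%z. ins i ?P z) ` polycyl i 0 0 (1/4)) D"
      by (rule continuous_on_subset[OF holomorphic_several_continuous_on[OF D]]) (use sub in \<open>auto simp: polycyl_def\<close>)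
    ultimately obtain B0 where B0: "\<forall>z\<in>(%z. ins i ?P z) ` polycyl i 0 0 (1/4). norm (D z) <= B0"
      using continuous_bounded_on_compact by blast
    have "norm (D (ins i ?P z)) <= B0" if "norm (ins i 0 z) < 1/4" for z
    proof -
      have "ins i ?P (ins i 0 z) \<in> (%z. ins i ?P z) ` polycyl i 0 0 (1/4)"
        by (intro imageI) (use that in \<open>simp add: polycyl_def\<close>)
      then show ?thesis using B0 by auto
    qed
    then show ?thesis unfolding U_def using sub
      by (intro ring_mean[OF D, where ?B0.0 = B0]) auto
  qed
  finally have int: "(LINT z:U|lborel. \<Phi> z - \<Phi> (L z)) = measure lborel U *\<^sub>R (?P * Dd F p ?e)"
    by (simp add: D_def p_def[symmetric] F0)
  have iO: "set_integrable lborel \<Omega> (%z. (norm (F z))\<^sup>2)"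
    using sq square_integrable_lebesgue_on(2)[OF open_\<Omega> F] by simp
  have nF: "nsq (lebesgue_on \<Omega>) F = (LINT z:\<Omega>|lborel. (norm (F z))\<^sup>2)"
    by (rule square_integrable_lebesgue_on(3)[OF open_\<Omega> F])
  have ci: "set_integrable lborel U h" if "continuous_on K h" for h :: "complex ^ 'n => real"
    by (rule set_integrable_subset[OF borel_integrable_compact[OF cK that, folded set_integrable_def]])
       (use UK Ub in auto)
  have i\<Phi>: "set_integrable lborel U (%z. (norm (\<Phi> z - \<Phi> (L z)))\<^sup>2)" "set_integrable lborel U (%z. (norm (F z))\<^sup>2)"
    "set_integrable lborel U (%z. (norm (F (L z)))\<^sup>2)"
    by (intro ci continuous_intros c\<Phi> cF cFL)+
  \<comment> \<open>The distance to \<open>of_real p1\<close> is at least half of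
    \<open>norm (z $ i)\<close> on the outer circle and at least \<open>p1 / 2\<close> on the inner
    one.\<close>
  have q1: "norm (\<Phi> z) <= 4 * norm (F z)" "norm (\<Phi> (L z)) <= 64 * \<alpha> * norm (F (L z))" if z: "z \<in> U" for z
  proof -
    have zK: "z \<in> K" using z UK by blast
    have a: "norm (z $ i - ?P) >= norm (z $ i) - p1" using norm_triangle_ineq2[of "z $ i" ?P] p1 by simp
    have "norm (z $ i) > 1/4" using z by (simp add: U_def ring_def)
    then have "norm (z $ i) <= 2 * norm (z $ i - ?P)" using a p1 by linarith
    then have "(norm (z $ i))\<^sup>2 <= (2 * norm (z $ i - ?P))\<^sup>2" by (intro power_mono) auto
    then have "(norm (z $ i))\<^sup>2 * norm (F z) <= (2 * norm (z $ i - ?P))\<^sup>2 * norm (F z)" by (intro mult_right_mono) auto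
    then show "norm (\<Phi> z) <= 4 * norm (F z)" using ne[OF zK]
      by (simp add: \<Phi>_def norm_mult norm_divide norm_power divide_simps power_mult_distrib mult_ac)
    have b: "norm (L z $ i - ?P) >= p1 - norm (L z $ i)" using norm_triangle_ineq3[of "L z $ i" ?P] p1 by simp
    have c: "norm (L z $ i) <= 4 * \<alpha>" using lb[OF zK] by (simp add: L)
    have "p1 / 2 <= norm (L z $ i - ?P)" using b c params by linarith
    then have "(p1 / 2)\<^sup>2 <= (norm (L z $ i - ?P))\<^sup>2" using p1 by (intro power_mono) auto
    then have d: "\<alpha> / 4 <= (norm (L z $ i - ?P))\<^sup>2" by (simp add: \<alpha> power_divide)
    have "(norm (L z $ i))\<^sup>2 <= (4 * \<alpha>)\<^sup>2" using c by (intro power_mono) auto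
    also have "... = 64 * \<alpha> * (\<alpha> / 4)" by (simp add: power2_eq_square)
    also have "... <= 64 * \<alpha> * (norm (L z $ i - ?P))\<^sup>2" using d params by (intro mult_left_mono) auto
    finally have "(norm (L z $ i))\<^sup>2 * norm (F (L z)) <= 64 * \<alpha> * (norm (L z $ i - ?P))\<^sup>2 * norm (F (L z))"
      by (intro mult_right_mono) auto
    then show "norm (\<Phi> (L z)) <= 64 * \<alpha> * norm (F (L z))" using ne[OF zK]
      by (simp add: \<Phi>_def norm_mult norm_divide norm_power divide_simps mult_ac)
  qed
  have q2: "(norm (\<Phi> z - \<Phi> (L z)))\<^sup>2 <= 32 * (norm (F z))\<^sup>2 + 8192 * \<alpha>\<^sup>2 * (norm (F (L z)))\<^sup>2" if z: "z \<in> U" for z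
  proof -
    have "(norm (\<Phi> z))\<^sup>2 <= (4 * norm (F z))\<^sup>2" "(norm (\<Phi> (L z)))\<^sup>2 <= (64 * \<alpha> * norm (F (L z)))\<^sup>2"
      using q1[OF z] by (intro power_mono; simp)+
    then show ?thesis using norm_add_sq_le[of "\<Phi> z" "- \<Phi> (L z)"] by (simp add: power_mult_distrib)
  qed
  have fin1: "(LINT z:U|lborel. (norm (F z))\<^sup>2) <= nsq (lebesgue_on \<Omega>) F"
    unfolding nF set_lebesgue_integral_def
    by (rule integral_mono) (use i\<Phi>(2) iO UK KO in \<open>auto simp: set_integrable_def indicator_def\<close>)
  \<comment> \<open>Change of variables by L, whose Jacobian is
    \<open>(8 * \<alpha>)^2\<close>.\<close>
  have fin2: "64 * \<alpha>\<^sup>2 * (LINT z:U|lborel. (norm (F (L z)))\<^sup>2) <= nsq (lebesgue_on \<Omega>) F"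
  proof -
    have mO: "(%z. indicator \<Omega> z *\<^sub>R (norm (F z))\<^sup>2) \<in> borel_measurable borel"
      by (intro borel_measurable_continuous_on_indicator continuous_intros FL) (use open_\<Omega> in simp)
    have e1: "ennreal (64 * \<alpha>\<^sup>2) * (\<integral>\<^sup>+z. ennreal (indicator \<Omega> (L z) *\<^sub>R (norm (F (L z)))\<^sup>2) \<partial>lborel)
      = (\<integral>\<^sup>+z. ennreal (indicator \<Omega> z *\<^sub>R (norm (F z))\<^sup>2) \<partial>lborel)"
      unfolding L_def
      by (subst (2) nn_integral_scale_map[of l 1 _ i]) (use l mO in \<open>auto simp: l_def power_mult_distrib\<close>)
    also have "... = ennreal (nsq (lebesgue_on \<Omega>) F)"
      unfolding nF set_lebesgue_integral_def using iO
      by (intro nn_integral_eq_integral) (auto simp: set_integrable_def)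
    finally have e2: "ennreal (64 * \<alpha>\<^sup>2) * (\<integral>\<^sup>+z. ennreal (indicator \<Omega> (L z) *\<^sub>R (norm (F (L z)))\<^sup>2) \<partial>lborel)
      = ennreal (nsq (lebesgue_on \<Omega>) F)" .
    have "ennreal (LINT z:U|lborel. (norm (F (L z)))\<^sup>2) = (\<integral>\<^sup>+z. ennreal (indicator U z *\<^sub>R (norm (F (L z)))\<^sup>2) \<partial>lborel)"
      unfolding set_lebesgue_integral_def using i\<Phi>(3)
      by (intro nn_integral_eq_integral[symmetric]) (auto simp: set_integrable_def)
    also have "... <= (\<integral>\<^sup>+z. ennreal (indicator \<Omega> (L z) *\<^sub>R (norm (F (L z)))\<^sup>2) \<partial>lborel)"
      by (intro nn_integral_mono ennreal_leI) (use UK LO in \<open>auto simp: indicator_def\<close>)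
    finally have "ennreal (64 * \<alpha>\<^sup>2) * ennreal (LINT z:U|lborel. (norm (F (L z)))\<^sup>2) <= ennreal (nsq (lebesgue_on \<Omega>) F)"
      unfolding e2[symmetric] by (intro mult_left_mono) auto
    then have "ennreal (64 * \<alpha>\<^sup>2 * (LINT z:U|lborel. (norm (F (L z)))\<^sup>2)) <= ennreal (nsq (lebesgue_on \<Omega>) F)"
      by (simp add: ennreal_mult')
    then show ?thesis by (simp add: ennreal_le_iff)
  qed
  have "(measure lborel U * p1 * norm (Dd F p ?e))\<^sup>2 = (norm (LINT z:U|lborel. \<Phi> z - \<Phi> (L z)))\<^sup>2"
    unfolding int using p1 by (simp add: norm_mult mult_ac)
  also have "... <= measure lborel U * (LINT z:U|lborel. (norm (\<Phi> z - \<Phi> (L z)))\<^sup>2)"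
  proof (rule set_integral_cauchy_schwarz[OF Ub _ i\<Phi>(1)])
    show "(%z. indicator U z *\<^sub>R (\<Phi> z - \<Phi> (L z))) \<in> borel_measurable borel"
      by (rule borel_measurable_continuous_on_indicator[OF Ub(1) continuous_on_subset[OF cd UK]])
  qed
  also have "(LINT z:U|lborel. (norm (\<Phi> z - \<Phi> (L z)))\<^sup>2)
      <= (LINT z:U|lborel. 32 * (norm (F z))\<^sup>2 + 8192 * \<alpha>\<^sup>2 * (norm (F (L z)))\<^sup>2)"
    by (rule set_integral_mono[OF i\<Phi>(1)]) (use i\<Phi>(2,3) q2 in auto)
  also have "... = 32 * (LINT z:U|lborel. (norm (F z))\<^sup>2) + 128 * (64 * \<alpha>\<^sup>2 * (LINT z:U|lborel. (norm (F (L z)))\<^sup>2))"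
    using i\<Phi>(2,3) by (subst set_integral_add) auto
  \<comment> \<open>160 = 32 + 128, the second summand from 8192 = 128 * 64.\<close>
  also have "... <= 160 * nsq (lebesgue_on \<Omega>) F" using fin1 fin2 by linarith
  finally have main: "(measure lborel U * p1 * norm (Dd F p ?e))\<^sup>2 <= measure lborel U * (160 * nsq (lebesgue_on \<Omega>) F)"
    by (simp add: mult_left_mono)
  have mp: "measure lborel U > 0" unfolding U_def by (rule measure_ring_pos) auto
  have "(measure lborel U * p1 * norm (Dd F p ?e))\<^sup>2 = measure lborel U * (measure lborel U * \<alpha> * (norm (Dd F p ?e))\<^sup>2)"
    by (simp add: \<alpha> power2_eq_square mult_ac)
  with main mp have "measure lborel U * \<alpha> * (norm (Dd F p ?e))\<^sup>2 <= 160 * nsq (lebesgue_on \<Omega>) F" by simp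
  then show ?thesis using mp params(1) by (simp add: field_simps)
qed

lemma holomorphic_inverse_coord:
  assumes "\<And>z. z \<in> S ==> z $ j ~= 0"
  shows "holomorphic_several (%z. 1 / z $ j) S" and
    "z \<in> S ==> ((%z. 1 / z $ j) has_derivative (%h. - (h $ j) / (z $ j)\<^sup>2)) (at z)"
proof -
  show d: "((%z. 1 / z $ j) has_derivative (%h. - (h $ j) / (z $ j)\<^sup>2)) (at z)" if "z \<in> S" for z
    by (rule derivative_eq_intros refl assms that bounded_linear_imp_has_derivative bounded_linear_vec_nth | simp add: field_simps power2_eq_square)+
  show "holomorphic_several (%z. 1 / z $ j) S"
    unfolding holomorphic_several_def by (intro ballI exI conjI allI, erule d) (simp add: mult_ac)
qed

lemma coord_bounds:
  assumes "z \<in> \<Omega>"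
  shows "norm z < 1" "\<alpha> < norm (z $ i)" "z $ i ~= 0"
proof -
  show n: "norm z < 1" by (rule dom_norm_less[OF assms[unfolded \<Omega>_def] params(4)])
  have "\<epsilon> < (norm (z $ i))\<^sup>2 * (1 - (norm z)\<^sup>2)" using assms unfolding \<Omega>_def dom_iff .
  also have "... <= (norm (z $ i))\<^sup>2 * 1" by (intro mult_left_mono) auto
  finally show "\<alpha> < norm (z $ i)" unfolding \<epsilon>_def by (simp add: power2_less_imp_less)
  then show "z $ i ~= 0" using params(1) by auto
qed

text \<open>Dyadic shells in \<open>norm (z $ i)\<close>: there are \<open>2 * N\<close> of them
  because this modulus exceeds \<open>\<alpha> = (1/2) ^ (2 * N)\<close>, and on each the bound
  \<open>4 ^ Suc j\<close> for the squared function cancels the area of the disc up to the factor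
  4.\<close>

lemma inverse_coord_bergman:
  assumes N: "p1 = (1/2) ^ N"
  shows "square_integrable (lebesgue_on \<Omega>) (%z. 1 / z $ i)"
    "nsq (lebesgue_on \<Omega>) (%z. 1 / z $ i) <= 8 * real N * polycyl_vol TYPE('n) i"
proof -
  let ?f = "%z :: complex ^ 'n. 1 / z $ i"
  let ?P = "%j::nat. polycyl i (0 :: complex ^ 'n) ((1/2) ^ j) 1"
  let ?B = "8 * real N * polycyl_vol TYPE('n) i"
  have F: "holomorphic_several ?f \<Omega>" by (rule holomorphic_inverse_coord) (rule coord_bounds)
  have aN: "\<alpha> = (1/2) ^ (2 * N)" unfolding \<alpha> N by (simp add: power_mult mult.commute flip: power_mult)
  have four: "(4::real) ^ j * ((1/2) ^ j)\<^sup>2 = 1" for j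
  proof -
    have "((1/2::real) ^ j)\<^sup>2 = (1/4) ^ j" by (simp add: power2_eq_square flip: power_mult_distrib)
    then have "(4::real) ^ j * ((1/2) ^ j)\<^sup>2 = (4 * (1/4)) ^ j" by (simp only: power_mult_distrib)
    then show ?thesis by simp
  qed
  have cover: "ennreal (indicator \<Omega> z *\<^sub>R (norm (?f z))\<^sup>2) <= (\<Sum>j<2 * N. ennreal (4 ^ Suc j) * indicator (?P j) z)" for z
  proof (cases "z \<in> \<Omega>")
    case True
    note b = coord_bounds[OF True]
    let ?x = "norm (z $ i)"
    have x1: "?x <= 1" using norm_coord_le[of z i] b by linarith
    define k where "k = (LEAST k. (1/2) ^ Suc k < ?x)"
    have ex: "\<exists>k. (1/2::real) ^ Suc k < ?x"
    proof -
      have "?x > 0" using b by simp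
      then obtain k where "(1/2::real) ^ k < ?x" using real_arch_pow_inv[of ?x "1/2"] by auto
      moreover have "(1/2::real) ^ Suc k <= (1/2) ^ k" by simp
      ultimately show ?thesis by (meson le_less_trans)
    qed
    have k: "(1/2) ^ Suc k < ?x" unfolding k_def by (rule LeastI_ex[OF ex])
    have k2: "?x <= (1/2) ^ k"
    proof (cases k)
      case 0 then show ?thesis using x1 by simp
    next
      case (Suc l)
      then have "\<not> (1/2) ^ Suc l < ?x" using not_less_Least[of l "%k. (1/2) ^ Suc k < ?x"] by (auto simp: k_def)
      then show ?thesis using Suc by simp
    qed
    have "(1/2::real) ^ (2 * N) < (1/2) ^ k" using b(2) k2 unfolding aN by linarith
    then have kN: "k < 2 * N" by (subst (asm) power_strict_decreasing_iff) auto
    have inP: "z \<in> ?P k"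
      using k2 norm_ins0_le[of i z] b(1) by (simp add: polycyl_def)
    have "((1/2) ^ Suc k)\<^sup>2 <= ?x\<^sup>2" using k by (intro power_mono) auto
    then have "4 ^ Suc k * ((1/2) ^ Suc k)\<^sup>2 <= 4 ^ Suc k * ?x\<^sup>2" by (intro mult_left_mono) auto
    then have "1 <= 4 ^ Suc k * ?x\<^sup>2" unfolding four .
    then have "(norm (?f z))\<^sup>2 <= 4 ^ Suc k" using b by (simp add: norm_divide power_divide field_simps)
    then have "ennreal (indicator \<Omega> z *\<^sub>R (norm (?f z))\<^sup>2) <= ennreal (4 ^ Suc k) * indicator (?P k) z"
      using True inP by (simp add: ennreal_leI)
    also have "... <= (\<Sum>j<2 * N. ennreal (4 ^ Suc j) * indicator (?P j) z)"
      using kN by (intro member_le_sum) auto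
    finally show ?thesis .
  qed simp
  have "(\<integral>\<^sup>+z. ennreal (indicator \<Omega> z *\<^sub>R (norm (?f z))\<^sup>2) \<partial>lborel) <= (\<integral>\<^sup>+z. (\<Sum>j<2 * N. ennreal (4 ^ Suc j) * indicator (?P j) z) \<partial>lborel)"
    by (intro nn_integral_mono cover)
  also have "... = (\<Sum>j<2 * N. ennreal (4 ^ Suc j) * emeasure lborel (?P j))"
    by (subst nn_integral_sum) (auto simp: nn_integral_cmult)
  also have "... = (\<Sum>j<2 * N. ennreal (4 * polycyl_vol TYPE('n) i))"
  proof (intro sum.cong refl)
    fix j
    have "4 ^ Suc j * (((1/2) ^ j)\<^sup>2 * 1 ^ (2 * (CARD('n) - 1)) * polycyl_vol TYPE('n) i)
      = 4 * (4 ^ j * ((1/2) ^ j)\<^sup>2) * polycyl_vol TYPE('n) i" by simp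
    also have "... = 4 * polycyl_vol TYPE('n) i" unfolding four by simp
    finally show "ennreal (4 ^ Suc j) * emeasure lborel (?P j) = ennreal (4 * polycyl_vol TYPE('n) i)"
      by (subst emeasure_polycyl) (simp_all only: ennreal_mult'[symmetric] zero_le_power zero_le_numeral, simp_all)
  qed
  also have "... = ennreal ?B"
    by (subst sum_ennreal) (use polycyl_vol_pos[where 'n = 'n, of i] in auto)
  finally have le: "(\<integral>\<^sup>+z. ennreal (indicator \<Omega> z *\<^sub>R (norm (?f z))\<^sup>2) \<partial>lborel) <= ennreal ?B" .
  have m: "(%z. indicator \<Omega> z *\<^sub>R (norm (?f z))\<^sup>2) \<in> borel_measurable borel"
    by (intro borel_measurable_continuous_on_indicator continuous_intros holomorphic_several_continuous_on[OF F])
       (use open_\<Omega> coord_bounds in auto)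
  have int: "integrable lborel (%z. indicator \<Omega> z *\<^sub>R (norm (?f z))\<^sup>2)"
    by (rule integrableI_nonneg) (use m le in \<open>auto simp: top.not_eq_extremum intro: le_less_trans\<close>)
  then show "square_integrable (lebesgue_on \<Omega>) ?f"
    using square_integrable_lebesgue_on(2)[OF open_\<Omega> F] by (simp add: set_integrable_def)
  have "ennreal (nsq (lebesgue_on \<Omega>) ?f) <= ennreal ?B"
    unfolding square_integrable_lebesgue_on(3)[OF open_\<Omega> F] set_lebesgue_integral_def
    using le nn_integral_eq_integral[OF int] by simp
  then show "nsq (lebesgue_on \<Omega>) ?f <= ?B"
    using polycyl_vol_pos[where 'n = 'n, of i] by (simp add: ennreal_le_iff)
qed

sublocale bergman: kernel_space "lebesgue_on \<Omega>" "bergman_space \<Omega>" \<Omega>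
  by (rule bergman_function_hilbert[OF open_\<Omega>])

text \<open>The kernel at p, tested with \<open>1 / z $ i\<close>, and the derivative bound both
  carry the factor \<open>1 / \<alpha>\<close>. It cancels and leaves the number of dyadic shells;
  1280 = 160 * 8.\<close>

lemma levi_form_bergman_le:
  assumes N: "p1 = (1/2) ^ N"
  shows "levi_form (%w. ln (Re (bergman_kernel \<Omega> w w))) p (axis i 1)
    <= 1280 * polycyl_vol TYPE('n) i / measure lborel U * real N"
proof -
  let ?k = "nsq (lebesgue_on \<Omega>) (bergman.kf p)" and ?f = "%z :: complex ^ 'n. 1 / z $ i"
  let ?V = "polycyl_vol TYPE('n) i" and ?m = "measure lborel U"
  have V: "?V > 0" by (rule polycyl_vol_pos)
  have m: "?m > 0" unfolding U_def by (rule measure_ring_pos) auto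
  have "(?f, ?f) \<in> bergman_space \<Omega>"
    using inverse_coord_bergman(1)[OF N] holomorphic_inverse_coord(1)[of \<Omega> i] coord_bounds(3)
    by (auto simp: bergman_space_def)
  from bergman.eval_le[OF p_in this]
  have "1 / \<alpha> <= nsq (lebesgue_on \<Omega>) ?f * ?k"
    using p1 by (simp add: p_def \<alpha> norm_divide power_divide)
  also have "... <= 8 * real N * ?V * ?k" by (intro mult_right_mono inverse_coord_bergman(2)[OF N]) simp
  finally have k: "1 <= 8 * real N * ?V * ?k * \<alpha>" using params(1) by (simp add: field_simps)
  have "?k ~= 0" using k by auto
  then have k0: "?k > 0" using nsq_nonneg[of "lebesgue_on \<Omega>" "bergman.kf p"] by linarith
  have "levi_form (%w. ln (Re (bergman_kernel \<Omega> w w))) p (axis i 1) <= 160 / (?m * \<alpha>) / ?k"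
    unfolding bergman_kernel_def
  proof (rule bergman.levi_form_log_kernel_le[OF p_in k0])
    show "160 / (?m * \<alpha>) >= 0" using m params(1) by simp
    show "(norm (Dd F p (axis i 1)))\<^sup>2 <= 160 / (?m * \<alpha>) * nsq (lebesgue_on \<Omega>) f"
      if "(f, F) \<in> bergman_space \<Omega>" "F p = 0" for f F
      using bergman_derivative_bound[of F] that by (auto simp: bergman_space_def)
  qed
  also have "... = 160 / ?m * (1 / (\<alpha> * ?k))" by simp
  also have "... <= 160 / ?m * (8 * real N * ?V)"
    using k k0 params(1) m by (intro mult_left_mono) (simp_all add: divide_le_eq mult_ac)
  finally show ?thesis by (simp add: mult_ac)
qed

end

section \<open>Radial projection onto boundary sheets and surface measure from below\<close>

section \<open>Boundary averages\<close>

text \<open>Projection along the slice: the i-th coordinate keeps its argument and gets the modulus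
  \<open>\<tau> z\<close>.\<close>

definition radial :: "'n => (complex ^ 'n => real) => complex ^ 'n => complex ^ 'n" where
  "radial i \<tau> z = ins i (of_real (\<tau> z) * (z $ i / of_real (norm (z $ i)))) z"

text \<open>Replacing \<tau> by \<open>norm e\<close> costs at most the same error again, by the
  reverse triangle inequality; the sum is then divided by \<open>norm e\<close>.\<close>

lemma unit_direction:
  fixes v e :: complex
  assumes "norm v = 1" "\<tau> >= 0" "norm (of_real \<tau> * v - e) <= x" "t <= norm e" "t > 0"
  shows "norm (v - e / of_real (norm e)) <= 2 * x / t"
proof -
  have e: "norm e > 0" using assms by linarith
  have "of_real (norm e) * v - e = (of_real (norm e) - of_real \<tau>) * v + (of_real \<tau> * v - e)"
    by (simp add: algebra_simps)
  then have "norm (of_real (norm e) * v - e) <= norm ((of_real (norm e) - of_real \<tau> :: complex) * v) + norm (of_real \<tau> * v - e)"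
    using norm_triangle_ineq by metis
  moreover have "norm ((of_real (norm e) - of_real \<tau> :: complex) * v) = \<bar>norm e - \<tau>\<bar>"
    using assms(1) by (simp add: norm_mult flip: of_real_diff)
  moreover have "\<bar>norm e - \<tau>\<bar> <= norm (of_real \<tau> * v - e)"
    using norm_triangle_ineq3[of e "of_real \<tau> * v"] assms(1,2) by (simp add: norm_mult norm_minus_commute)
  ultimately have *: "norm (of_real (norm e) * v - e) <= 2 * x" using assms(3) by linarith
  have "v - e / of_real (norm e) = (of_real (norm e) * v - e) / of_real (norm e)" using e by (simp add: field_simps)
  then have "norm (v - e / of_real (norm e)) = norm (of_real (norm e) * v - e) / norm e" by (simp add: norm_divide)
  also have "... <= 2 * x / t" using * assms by (intro frac_le) (auto intro: order_trans[OF norm_ge_zero])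
  finally show ?thesis .
qed

text \<open>Closeness of the image to e fixes the argument of \<open>z $ i\<close> up to
  \<open>\<kappa> = 2 * x / t\<close> and the other coordinates up to x, while the modulus of
  \<open>z $ i\<close> runs freely between 1 and 2. At most 3 / \<kappa> polycylinders of radii 3
  \<kappa> and x cover this set, so one power of x is lost: the growth is that of a measure of
  codimension one.\<close>

lemma emeasure_radial_preimage:
  fixes i :: "'n::finite" and e w :: "complex ^ 'n"
  assumes \<tau>: "\<And>z. z \<in> ring i w 1 2 \<eta> ==> \<tau> z >= 0" and e: "norm (e $ i) >= t" and t: "t > 0"
    and x: "0 < x" "x < t / 2" and G: "G \<in> sets borel"
    and sub: "\<And>z. z \<in> G ==> z \<in> ring i w 1 2 \<eta> \<and> radial i \<tau> z \<in> polycyl i e x x"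
  shows "emeasure lborel G <= ennreal (54 * polycyl_vol TYPE('n) i / t * x ^ (2 * CARD('n) - 1))"
proof -
  let ?V = "polycyl_vol TYPE('n) i"
  have V: "?V > 0" by (rule polycyl_vol_pos)
  define \<kappa> where "\<kappa> = 2 * x / t"
  have \<kappa>: "0 < \<kappa>" "\<kappa> < 1" using x t by (auto simp: \<kappa>_def field_simps)
  define u where "u = e $ i / of_real (norm (e $ i))"
  have "e $ i ~= 0" using e t by (metis norm_zero not_le)
  then have u: "norm u = 1" by (simp add: u_def norm_divide)
  define L where "L = nat \<lfloor>2 / \<kappa>\<rfloor>"
  define P where "P l = polycyl i (ins i (of_real (real l * \<kappa>) * u) e) (3 * \<kappa>) x" for l
  have sub2: "G \<subseteq> (\<Union>l\<le>L. P l)"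
  proof
    fix z assume "z \<in> G"
    note z = sub[OF this]
    let ?r = "norm (z $ i)" let ?v = "z $ i / of_real ?r"
    have r: "1 < ?r" "?r < 2" using z by (auto simp: ring_def)
    have z0: "z $ i ~= 0" using r by (metis norm_zero less_asym zero_less_one)
    have v: "norm ?v = 1" using z0 by (simp add: norm_divide)
    have d: "norm (of_real (\<tau> z) * ?v - e $ i) <= x" "norm (ins i 0 (z - e)) <= x"
    proof -
      have c: "ins i 0 (radial i \<tau> z - e) = ins i 0 (z - e)" by (simp add: vec_eq_iff radial_def)
      show "norm (of_real (\<tau> z) * ?v - e $ i) <= x" "norm (ins i 0 (z - e)) <= x"
        using z c by (auto simp: polycyl_def radial_def)
    qed
    have "\<tau> z >= 0" using \<tau> z by blast
    then have vu: "norm (?v - u) <= \<kappa>"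
      unfolding \<kappa>_def u_def by (rule unit_direction[OF v _ d(1) e t])
    define l where "l = nat \<lfloor>?r / \<kappa>\<rfloor>"
    have r0: "?r / \<kappa> >= 0" using \<kappa> by simp
    have l1: "real l <= ?r / \<kappa>" "?r / \<kappa> < real l + 1"
      unfolding l_def using r0 by (auto simp: of_nat_nat)
    have l2: "\<bar>?r - real l * \<kappa>\<bar> <= \<kappa>" using l1 \<kappa> by (auto simp: field_simps abs_le_iff)
    have "?r / \<kappa> <= 2 / \<kappa>" using r \<kappa> by (intro divide_right_mono) auto
    then have lL: "l <= L" unfolding l_def L_def by (intro nat_mono floor_mono)
    have "z $ i - of_real (real l * \<kappa>) * u = of_real ?r * (?v - u) + of_real (?r - real l * \<kappa>) * u"
      using z0 by (simp add: algebra_simps)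
    then have "norm (z $ i - of_real (real l * \<kappa>) * u) <= norm (of_real ?r * (?v - u)) + norm (of_real (?r - real l * \<kappa>) * u)"
      using norm_triangle_ineq by metis
    also have "... = ?r * norm (?v - u) + \<bar>?r - real l * \<kappa>\<bar>"
      by (simp add: norm_mult u del: of_real_diff)
    also have "... <= 2 * \<kappa> + \<kappa>" using l2 vu r by (intro add_mono mult_mono) auto
    finally have "norm (z $ i - of_real (real l * \<kappa>) * u) <= 3 * \<kappa>" by simp
    moreover have "ins i 0 (z - ins i (of_real (real l * \<kappa>) * u) e) = ins i 0 (z - e)" by (simp add: vec_eq_iff)
    ultimately have "z \<in> P l" using d(2) by (simp add: P_def polycyl_def)
    then show "z \<in> (\<Union>l\<le>L. P l)" using lL by blast
  qed
  have "emeasure lborel G <= emeasure lborel (\<Union>l\<le>L. P l)"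
    using sub2 by (intro emeasure_mono) (auto simp: P_def)
  also have "... <= (\<Sum>l\<le>L. emeasure lborel (P l))" by (rule emeasure_subadditive_finite) (auto simp: P_def)
  also have "... = (\<Sum>l\<le>L. ennreal ((3 * \<kappa>)\<^sup>2 * x ^ (2 * (CARD('n) - 1)) * ?V))"
    unfolding P_def using \<kappa> x by (intro sum.cong refl emeasure_polycyl) auto
  also have "... = ennreal (real (L + 1) * ((3 * \<kappa>)\<^sup>2 * x ^ (2 * (CARD('n) - 1)) * ?V))"
    using V x by (subst sum_ennreal) auto
  \<comment> \<open>The constant is (3 / \<kappa>) * (3 \<kappa>)^2 = 27 \<kappa> = 54 x /
    t.\<close>
  also have "... <= ennreal (54 * ?V / t * x ^ (2 * CARD('n) - 1))"
  proof (rule ennreal_leI)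
    have "real L <= 2 / \<kappa>" unfolding L_def using \<kappa> by (simp add: of_nat_nat)
    moreover have "1 <= 1 / \<kappa>" using \<kappa> by simp
    ultimately have "real (L + 1) <= 3 / \<kappa>" by simp
    then have "real (L + 1) * ((3 * \<kappa>)\<^sup>2 * x ^ (2 * (CARD('n) - 1)) * ?V) <= 3 / \<kappa> * ((3 * \<kappa>)\<^sup>2 * x ^ (2 * (CARD('n) - 1)) * ?V)"
      using V x by (intro mult_right_mono) auto
    also have "... = 27 * \<kappa> * x ^ (2 * (CARD('n) - 1)) * ?V" using \<kappa> by (simp add: power2_eq_square)
    also have "... = 54 * ?V / t * x ^ Suc (2 * (CARD('n) - 1))" by (simp add: \<kappa>_def)
    also have "Suc (2 * (CARD('n) - 1)) = 2 * CARD('n) - 1" using zero_less_card_finite[where 'a = 'n] by linarith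
    finally show "real (L + 1) * ((3 * \<kappa>)\<^sup>2 * x ^ (2 * (CARD('n) - 1)) * ?V) <= 54 * ?V / t * x ^ (2 * CARD('n) - 1)" .
  qed
  finally show ?thesis .
qed

lemma DIM_cvec: "DIM(complex ^ 'n::finite) = 2 * CARD('n)" "2 <= DIM(complex ^ 'n::finite)"
proof -
  show d: "DIM(complex ^ 'n::finite) = 2 * CARD('n)" by simp
  have "CARD('n) > 0" by (rule zero_less_card_finite)
  then show "2 <= DIM(complex ^ 'n::finite)" unfolding d by linarith
qed

text \<open>The growth constant of the preimage estimate after the mass distribution principle, with
  the factor \<open>1 / t\<close> left out.\<close>

definition hausdorff_const :: "'n::finite itself => 'n => real" where
  "hausdorff_const _ i = 54 * polycyl_vol TYPE('n) i * 2 ^ (2 * CARD('n) - 1) / unit_ball_vol (real (2 * CARD('n) - 1))"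

lemma hausdorff_const_pos: "hausdorff_const TYPE('n::finite) i > 0"
  unfolding hausdorff_const_def
  by (intro divide_pos_pos mult_pos_pos polycyl_vol_pos unit_ball_vol_pos)
    (simp_all only: of_nat_0_le_iff zero_less_power zero_less_numeral)

text \<open>The image of volume under the projection has the growth required by the mass
  distribution principle, so surface measure dominates it. Continuity of the projection takes the
  place of a smooth parametrisation of the sheet.\<close>

lemma emeasure_radial_le:
  fixes i :: "'n::finite" and w :: "complex ^ 'n" and \<eta> :: real
  defines "U \<equiv> ring i w 1 2 \<eta>"
  assumes \<tau>: "\<And>z. z \<in> U ==> \<tau> z >= 0" and cont: "continuous_on U (radial i \<tau>)" and t: "t > 0"
    and A: "A \<in> sets borel" "\<And>z. z \<in> A ==> norm (z $ i) >= t"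
  shows "emeasure (distr (restrict_space lborel U) borel (radial i \<tau>)) A
    <= ennreal (hausdorff_const TYPE('n) i / t) * emeasure surface_measure A"
proof -
  let ?T = "radial i \<tau>" let ?\<mu> = "distr (restrict_space lborel U) borel ?T"
  let ?d = "2 * CARD('n) - 1" let ?C = "54 * polycyl_vol TYPE('n) i / t"
  have V: "polycyl_vol TYPE('n) i > 0" by (rule polycyl_vol_pos)
  have U [measurable]: "U \<in> sets borel" unfolding U_def by measurable
  have T: "?T \<in> restrict_space lborel U \<rightarrow>\<^sub>M borel"
    using borel_measurable_continuous_on_restrict[OF cont] by (simp cong: measurable_cong_sets add: sets_restrict_space)
  have mu: "emeasure ?\<mu> G = emeasure lborel (?T -` G \<inter> U)" if "G \<in> sets borel" for G
    using that T U by (subst emeasure_distr) (auto simp: space_restrict_space emeasure_restrict_space)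
  have sG: "?T -` G \<inter> U \<in> sets borel" if "G \<in> sets borel" for G
    using measurable_sets[OF T that] U by (simp add: space_restrict_space sets_restrict_space_iff)
  have d1: "?d >= 1" using zero_less_card_finite[where 'a = 'n] by linarith
  have "emeasure ?\<mu> A <= ennreal (?C * 2 ^ ?d / unit_ball_vol (real ?d)) * hausdorff_outer_measure ?d A"
  proof (rule emeasure_le_hausdorff_outer_measure[where ?\<delta>0.0 = "t / 2"])
    show "?C > 0" "t / 2 > 0" "A \<in> sets ?\<mu>" "?d >= 1" using V t A d1 by auto
    fix E :: "(complex ^ 'n) set" assume E: "bounded E" "E ~= {}" "diameter E < t / 2"
    show "\<exists>G\<in>sets ?\<mu>. E \<inter> A \<subseteq> G \<and> emeasure ?\<mu> G <= ennreal (?C * diameter E ^ ?d)"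
    proof (cases "E \<inter> A = {}")
      case True then show ?thesis by (intro bexI[of _ "{}"]) auto
    next
      case False
      then obtain e where e: "e \<in> E" "e \<in> A" by blast
      let ?D = "diameter E" let ?G = "polycyl i e ?D ?D"
      have D0: "?D >= 0" using E by (simp add: diameter_ge_0)
      have sub: "E \<inter> A \<subseteq> ?G"
      proof
        fix z assume "z \<in> E \<inter> A"
        then have "dist z e <= ?D" using e E by (auto intro: diameter_bounded_bound)
        then have "norm (z - e) <= ?D" by (simp add: dist_norm)
        then show "z \<in> ?G" unfolding polycyl_def mem_Collect_eq
          using norm_ins0_le[of i "z - e"] norm_coord_le[of "z - e" i] by auto
      qed
      \<comment> \<open>The preimage estimate asks for a positive radius, while the diameter may be
        0; hence the limit from the right.\<close>
      have le: "emeasure ?\<mu> ?G <= ennreal (?C * x ^ ?d)" if x: "?D < x" "x < t / 2" for x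
        unfolding mu[OF sets_polycyl]
      proof (rule emeasure_radial_preimage[where e = e and \<tau> = \<tau> and w = w and \<eta> = \<eta>])
        show "\<tau> z >= 0" if "z \<in> ring i w 1 2 \<eta>" for z using \<tau> that by (simp add: U_def)
        show "z \<in> ring i w 1 2 \<eta> \<and> ?T z \<in> polycyl i e x x" if "z \<in> ?T -` ?G \<inter> U" for z
          using that x by (auto simp: U_def polycyl_def)
      qed (use A e t x D0 sG in auto)
      have "((%x. ennreal (?C * x ^ ?d)) \<longlongrightarrow> ennreal (?C * ?D ^ ?d)) (at_right ?D)"
        by (intro tendsto_ennrealI tendsto_intros)
      moreover have "eventually (%x. emeasure ?\<mu> ?G <= ennreal (?C * x ^ ?d)) (at_right ?D)"
        unfolding eventually_at_right[OF E(3)] using le E(3) by (intro exI[of _ "t/2"]) auto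
      ultimately have "emeasure ?\<mu> ?G <= ennreal (?C * ?D ^ ?d)" by (rule tendsto_lowerbound) simp
      then show ?thesis using sub by (intro bexI[of _ ?G]) auto
    qed
  qed
  also have "hausdorff_outer_measure ?d A = emeasure surface_measure A"
    unfolding emeasure_surface_measure[OF DIM_cvec(2) A(1)] DIM_cvec(1) ..
  finally show ?thesis by (simp add: hausdorff_const_def mult_ac)
qed

text \<open>The comparison concerns sets with \<open>norm (z $ i) >= t\<close>. Cutting down to Z,
  which contains the image, makes it an inequality between measures, and this integrates.\<close>

lemma nn_integral_radial_le:
  fixes i :: "'n::finite" and w :: "complex ^ 'n" and \<eta> :: real
  defines "U \<equiv> ring i w 1 2 \<eta>"
  assumes \<tau>: "\<And>z. z \<in> U ==> \<tau> z >= 0" and cont: "continuous_on U (radial i \<tau>)" and t: "t > 0"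
    and Z: "Z \<in> sets borel" "\<And>z. z \<in> Z ==> norm (z $ i) >= t" "\<And>z. z \<in> U ==> radial i \<tau> z \<in> Z"
    and h [measurable]: "h \<in> borel_measurable borel"
  shows "(\<integral>\<^sup>+z. h (radial i \<tau> z) * indicator U z \<partial>lborel)
    <= (\<integral>\<^sup>+z. ennreal (hausdorff_const TYPE('n) i / t) * indicator Z z * h z \<partial>surface_measure)"
proof -
  let ?T = "radial i \<tau>" let ?\<mu> = "distr (restrict_space lborel U) borel ?T"
  let ?k = "ennreal (hausdorff_const TYPE('n) i / t)"
  let ?\<nu> = "density surface_measure (%z. ?k * indicator Z z)"
  have [measurable]: "Z \<in> sets surface_measure" "h \<in> borel_measurable surface_measure"
    using Z h by (auto cong: measurable_cong_sets)
  have U [measurable]: "U \<in> sets borel" unfolding U_def by measurable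
  have T: "?T \<in> restrict_space lborel U \<rightarrow>\<^sub>M borel"
    using borel_measurable_continuous_on_restrict[OF cont] by (simp cong: measurable_cong_sets add: sets_restrict_space)
  have le: "emeasure ?\<mu> A <= emeasure ?\<nu> A" if A: "A \<in> sets borel" for A
  proof -
    have "emeasure ?\<mu> A = emeasure ?\<mu> (A \<inter> Z)"
      using A Z(1,3) T by (simp add: emeasure_distr space_restrict_space) (rule arg_cong[where f = "emeasure _"], auto)
    also have "... <= ?k * emeasure surface_measure (A \<inter> Z)"
      unfolding U_def by (rule emeasure_radial_le) (use \<tau> cont t A Z in \<open>auto simp: U_def\<close>)
    also have "... = emeasure ?\<nu> A"
    proof -
      have "emeasure ?\<nu> A = (\<integral>\<^sup>+z. ?k * indicator Z z * indicator A z \<partial>surface_measure)"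
        using A by (subst emeasure_density) auto
      also have "... = (\<integral>\<^sup>+z. ?k * indicator (A \<inter> Z) z \<partial>surface_measure)"
        by (intro nn_integral_cong) (auto simp: indicator_def)
      also have "... = ?k * emeasure surface_measure (A \<inter> Z)"
        using A Z(1) by (subst nn_integral_cmult_indicator) auto
      finally show ?thesis by simp
    qed
    finally show ?thesis .
  qed
  have "emeasure ?\<mu> A <= emeasure ?\<nu> A" for A
    using le by (cases "A \<in> sets borel") (auto simp: emeasure_notin_sets)
  then have "?\<mu> <= ?\<nu>" by (simp add: le_measure_iff le_fun_def)
  then have "(\<integral>\<^sup>+z. h z \<partial>?\<mu>) <= (\<integral>\<^sup>+z. h z \<partial>?\<nu>)" by (intro nn_integral_mono_measure) auto
  moreover have "(\<integral>\<^sup>+z. h z \<partial>?\<mu>) = (\<integral>\<^sup>+z. h (?T z) * indicator U z \<partial>lborel)"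
    using T by (simp add: nn_integral_distr nn_integral_restrict_space)
  moreover have "(\<integral>\<^sup>+z. h z \<partial>?\<nu>) = (\<integral>\<^sup>+z. ?k * indicator Z z * h z \<partial>surface_measure)"
    by (subst nn_integral_density) auto
  ultimately show ?thesis by simp
qed

section \<open>The Fefferman measure of the domain and the averaged Cauchy formula for boundary
  values\<close>

section \<open>The Hardy space\<close>

locale annular =
  fixes i :: "'n::finite" and \<epsilon> c :: real
  assumes eps: "0 < \<epsilon>" "\<epsilon> < 1/4" and c: "c > 0"
begin

definition \<Omega> :: "(complex ^ 'n) set" where "\<Omega> = annular_domain i \<epsilon>"
definition S :: "(complex ^ 'n) set" where "S = {z. rho i \<epsilon> z = 0}"
definition \<sigma> :: "(complex ^ 'n) measure" where "\<sigma> = fefferman_measure c \<Omega> (rho i \<epsilon>)"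

lemma open_\<Omega>: "open \<Omega>" unfolding \<Omega>_def by (rule open_dom)

lemma frontier_\<Omega>: "frontier \<Omega> = S" unfolding \<Omega>_def S_def by (rule frontier_dom[OF eps])

lemma closed_S: "closed S" unfolding frontier_\<Omega>[symmetric] by (rule frontier_closed)

lemma S_borel [measurable]: "S \<in> sets borel" using closed_S by (rule borel_closed)

lemma closure_\<Omega>: "closure \<Omega> = \<Omega> \<union> S"
  using closure_Un_frontier[of \<Omega>] frontier_\<Omega> by simp

lemma compact_closure: "compact (closure \<Omega>)"
  using bounded_dom[OF eps(1), of i] by (simp add: \<Omega>_def compact_closure)

lemma S_iff: "z \<in> S \<longleftrightarrow> (norm (z $ i))\<^sup>2 * (1 - (norm z)\<^sup>2) = \<epsilon>"
  by (auto simp: S_def rho_def algebra_simps)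

lemma S_props:
  assumes z: "z \<in> S"
  defines "a \<equiv> (norm (z $ i))\<^sup>2" and "s \<equiv> 1 - (norm z)\<^sup>2" and "q \<equiv> (norm (ins i 0 z))\<^sup>2"
  shows "a > 0" "s > 0" "a * s = \<epsilon>" "a + q + s = 1" "q >= 0" "\<epsilon> <= a" "a < 1"
proof -
  show as: "a * s = \<epsilon>" using z unfolding S_iff a_def s_def .
  have a0: "a >= 0" by (simp add: a_def)
  with as eps show a: "a > 0" by (cases "a = 0") auto
  show s: "s > 0" by (rule zero_less_mult_pos[OF _ a]) (use as eps in simp)
  show q: "q >= 0" by (simp add: q_def)
  show sum: "a + q + s = 1" using norm_sq_split[of z i] by (simp add: a_def q_def s_def)
  have "a * s <= a * 1" using a s q sum by (intro mult_left_mono) auto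
  then show "\<epsilon> <= a" using as by simp
  show "a < 1" using s q sum by linarith
qed

lemma fdens_measurable [measurable]: "fdens i \<in> borel_measurable borel"
proof -
  have [measurable]: "(%z :: complex ^ 'n. (norm (z $ i))\<^sup>2) \<in> borel_measurable borel"
    "(%z :: complex ^ 'n. (norm z)\<^sup>2) \<in> borel_measurable borel"
    "(%z :: complex ^ 'n. (norm (ins i 0 z))\<^sup>2) \<in> borel_measurable borel"
    by (intro borel_measurable_continuous_onI continuous_intros)+
  show ?thesis unfolding fdens_def[abs_def] Let_def by measurable
qed

lemma fdens_nonneg: "fdens i z >= 0"
  by (simp add: fdens_def Let_def)

lemma sets_\<sigma>: "sets \<sigma> = sets (restrict_space borel S)" and space_\<sigma>: "space \<sigma> = S"
  unfolding \<sigma>_def fefferman_measure_def frontier_\<Omega>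
  by (simp_all add: space_restrict_space) (rule sets_restrict_space_cong, simp)

lemma \<sigma>_eq: "\<sigma> = density (restrict_space surface_measure S) (%z. ennreal (c * fdens i z))"
proof -
  have "(\<integral>\<^sup>+p. ennreal (c * Re (- det (bordered_hessian (rho i \<epsilon>) p)) powr (1 / (real CARD('n) + 1))
      / onorm (frechet_derivative (rho i \<epsilon>) (at p))) * indicator A p \<partial>restrict_space surface_measure S)
    = (\<integral>\<^sup>+p. ennreal (c * fdens i p) * indicator A p \<partial>restrict_space surface_measure S)" for A
    by (intro nn_integral_cong, subst fefferman_density) (use eps in \<open>auto simp: space_restrict_space S_def\<close>)
  then show ?thesis unfolding \<sigma>_def fefferman_measure_def frontier_\<Omega> density_def by simp
qed

lemma nn_integral_\<sigma>:
  assumes h: "h \<in> borel_measurable borel"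
  shows "(\<integral>\<^sup>+z. h z \<partial>\<sigma>) = (\<integral>\<^sup>+z. ennreal (c * fdens i z) * h z * indicator S z \<partial>surface_measure)"
proof -
  have m: "f \<in> borel_measurable (restrict_space surface_measure S)" if "f \<in> borel_measurable borel" for f :: "complex ^ 'n => ennreal"
    using that by (intro measurable_restrict_space1) (simp cong: measurable_cong_sets)
  have "(\<integral>\<^sup>+z. h z \<partial>\<sigma>) = (\<integral>\<^sup>+z. ennreal (c * fdens i z) * h z \<partial>restrict_space surface_measure S)"
    unfolding \<sigma>_eq by (rule nn_integral_density) (use h in \<open>auto intro!: m\<close>)
  also have "... = (\<integral>\<^sup>+z. ennreal (c * fdens i z) * h z * indicator S z \<partial>surface_measure)"
    by (rule nn_integral_restrict_space) simp
  finally show ?thesis .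
qed

text \<open>On the boundary \<open>a + q + s = 1\<close> and \<open>a * s = \<epsilon>\<close>,
  which collapses \<open>q * (a + s) + (a - s)^2\<close> to
  \<open>a + s - 4 * \<epsilon>\<close>.\<close>

lemma fdens_on_S:
  assumes z: "z \<in> S"
  defines "a \<equiv> (norm (z $ i))\<^sup>2" and "s \<equiv> 1 - (norm z)\<^sup>2"
  shows "fdens i z = (a ^ CARD('n) * (a + s - 4 * \<epsilon>)) powr (1 / (real CARD('n) + 1))
      / (2 * sqrt (a * ((a - s)\<^sup>2 + a * (norm (ins i 0 z))\<^sup>2)))"
proof -
  note p = S_props[OF z, folded a_def s_def]
  have q: "(norm (ins i 0 z))\<^sup>2 = 1 - a - s" using p(4) by linarith
  have "(norm (ins i 0 z))\<^sup>2 * (a + s) + (a - s)\<^sup>2 = a + s - 4 * (a * s)"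
    unfolding q by (simp add: power2_eq_square algebra_simps)
  then have J: "(norm (ins i 0 z))\<^sup>2 * (a + s) + (a - s)\<^sup>2 = a + s - 4 * \<epsilon>" unfolding p(3) .
  show ?thesis unfolding fdens_def Let_def a_def[symmetric] s_def[symmetric] J ..
qed

lemma fdens_lower:
  assumes z: "z \<in> S" and a: "(norm (z $ i))\<^sup>2 <= A" and J: "0 <= J" "J <= ((norm (z $ i))\<^sup>2) ^ CARD('n) * ((norm (z $ i))\<^sup>2 + (1 - (norm z)\<^sup>2) - 4 * \<epsilon>)"
  shows "J powr (1 / (real CARD('n) + 1)) / (2 * sqrt (2 * A)) <= fdens i z"
proof -
  let ?a = "(norm (z $ i))\<^sup>2" and ?s = "1 - (norm z)\<^sup>2" and ?q = "(norm (ins i 0 z))\<^sup>2"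
  note p = S_props[OF z]
  have "\<bar>?a - ?s\<bar> <= 1" using p(1-7) by linarith
  then have "(?a - ?s)\<^sup>2 <= 1" by (simp add: abs_square_le_1)
  moreover have "?a * ?q <= 1 * 1" using p by (intro mult_mono) linarith+
  ultimately have "(?a - ?s)\<^sup>2 + ?a * ?q <= 2" by simp
  then have m: "?a * ((?a - ?s)\<^sup>2 + ?a * ?q) <= 2 * A" using mult_mono[OF a, of "(?a - ?s)\<^sup>2 + ?a * ?q" 2] p a by (simp add: mult.commute)
  \<comment> \<open>The denominator must be positive for the comparison of fractions. If
    \<open>a = s\<close>, then \<open>a < 1/2\<close> because \<open>\<epsilon> < 1/4\<close>, and
    so \<open>q > 0\<close>.\<close>
  have m0: "?a * ((?a - ?s)\<^sup>2 + ?a * ?q) > 0"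
  proof (rule mult_pos_pos[OF p(1)])
    show "(?a - ?s)\<^sup>2 + ?a * ?q > 0"
    proof (cases "?a = ?s")
      case True
      then have "?a * ?a = \<epsilon>" using p(3) by simp
      then have "?a * ?a < (1/2) * (1/2)" using eps by simp
      have "?a < 1/2"
      proof (rule ccontr)
        assume "\<not> ?a < 1/2"
        then have h: "1/2 <= ?a" by simp
        from mult_mono[OF h h] p(1) \<open>?a * ?a < (1/2) * (1/2)\<close> show False by linarith
      qed
      then have "?q > 0" using p(4) True by linarith
      then show ?thesis using p(1) by (intro add_nonneg_pos mult_pos_pos) auto
    next
      case False
      then show ?thesis using p(1,5) by (intro add_pos_nonneg mult_nonneg_nonneg) auto
    qed
  qed
  show ?thesis unfolding fdens_on_S[OF z]
    using J m m0 by (intro frac_le powr_mono2 mult_left_mono real_sqrt_le_mono) auto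
qed

text \<open>Arithmetic and geometric mean of a and s, whose product is \<epsilon>; the lower bound
  is positive because \<open>\<epsilon> < 1/4\<close>.\<close>

lemma S_sum_lower:
  assumes z: "z \<in> S"
  shows "2 * sqrt \<epsilon> - 4 * \<epsilon> <= (norm (z $ i))\<^sup>2 + (1 - (norm z)\<^sup>2) - 4 * \<epsilon>" "0 < 2 * sqrt \<epsilon> - 4 * \<epsilon>"
proof -
  let ?a = "(norm (z $ i))\<^sup>2" and ?s = "1 - (norm z)\<^sup>2"
  note p = S_props[OF z]
  have "sqrt \<epsilon> = sqrt ?a * sqrt ?s" unfolding p(3)[symmetric] real_sqrt_mult ..
  moreover have "(sqrt ?a - sqrt ?s)\<^sup>2 >= 0" by simp
  then have "2 * (sqrt ?a * sqrt ?s) <= ?a + ?s" using p(1,2) by (simp add: power2_diff)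
  ultimately show "2 * sqrt \<epsilon> - 4 * \<epsilon> <= ?a + ?s - 4 * \<epsilon>" by simp
  have "sqrt \<epsilon> < sqrt (1/4)" using eps by (intro real_sqrt_less_mono)
  also have "sqrt (1/4 :: real) = 1/2" by (simp add: real_sqrt_divide)
  finally have "sqrt \<epsilon> * sqrt \<epsilon> < sqrt \<epsilon> * (1/2)" using eps by (intro mult_strict_left_mono) auto
  then show "0 < 2 * sqrt \<epsilon> - 4 * \<epsilon>" using eps by simp
qed

text \<open>A crude constant that depends on \<epsilon>, sufficient for local boundedness of
  evaluations; at the base point sharper values are computed.\<close>

lemma fdens_bounded_below: "\<exists>d>0. \<forall>z\<in>S. d <= fdens i z"
proof (cases "S = {}")
  case True then show ?thesis by (intro exI[of _ 1]) auto
next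
  case False
  define J where "J = \<epsilon> ^ CARD('n) * (2 * sqrt \<epsilon> - 4 * \<epsilon>)"
  have J: "J > 0" using False S_sum_lower eps by (auto simp: J_def)
  have "J powr (1 / (real CARD('n) + 1)) / (2 * sqrt (2 * 1)) <= fdens i z" if z: "z \<in> S" for z
  proof (rule fdens_lower[OF z])
    note p = S_props[OF z]
    show "(norm (z $ i))\<^sup>2 <= 1" "0 <= J" using p J by auto
    show "J <= ((norm (z $ i))\<^sup>2) ^ CARD('n) * ((norm (z $ i))\<^sup>2 + (1 - (norm z)\<^sup>2) - 4 * \<epsilon>)"
      unfolding J_def using S_sum_lower[OF z] p eps by (intro mult_mono power_mono) auto
  qed
  moreover have "J powr (1 / (real CARD('n) + 1)) / (2 * sqrt (2 * 1)) > 0" using J by simp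
  ultimately show ?thesis by blast
qed

text \<open>The squared radius of the outer boundary circle of the slice through z;
  \<open>A_in\<close> is that of the inner one.\<close>

definition A_out :: "complex ^ 'n => real" where "A_out z = a_plus \<epsilon> (1 - (norm (ins i 0 z))\<^sup>2)"
definition A_in :: "complex ^ 'n => real" where "A_in z = a_minus \<epsilon> (1 - (norm (ins i 0 z))\<^sup>2)"

abbreviation T_out where "T_out \<equiv> radial i (%z. sqrt (A_out z))"
abbreviation T_in where "T_in \<equiv> radial i (%z. sqrt (A_in z))"

lemma slice:
  assumes z: "ins i t z \<in> \<Omega>"
  shows "A_out z + A_in z = 1 - (norm (ins i 0 z))\<^sup>2" "A_out z * A_in z = \<epsilon>" "0 < A_in z" "A_in z < A_out z"
    "sqrt (A_in z) < norm t" "norm t < sqrt (A_out z)"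
    "ins i t' z \<in> \<Omega> \<longleftrightarrow> sqrt (A_in z) < norm t' \<and> norm t' < sqrt (A_out z)"
    "norm t' = sqrt (A_in z) \<or> norm t' = sqrt (A_out z) ==> ins i t' z \<in> S"
proof -
  let ?b = "1 - (norm (ins i 0 z))\<^sup>2"
  have b: "?b > 0" "?b\<^sup>2 > 4 * \<epsilon>"
    using dom_slice[OF z[unfolded \<Omega>_def] eps(1)] by simp_all
  note pm = a_pm[OF b(1) eps(1) b(2), folded A_out_def A_in_def]
  show "A_out z + A_in z = ?b" "A_out z * A_in z = \<epsilon>" "0 < A_in z" "A_in z < A_out z" by (rule pm)+
  note it = dom_ins_iff[OF b(1) eps(1) b(2), folded A_out_def A_in_def \<Omega>_def, unfolded annulus_def mem_Collect_eq]
  show "ins i t' z \<in> \<Omega> \<longleftrightarrow> sqrt (A_in z) < norm t' \<and> norm t' < sqrt (A_out z)" by (rule it)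
  show "sqrt (A_in z) < norm t" "norm t < sqrt (A_out z)" using z unfolding it by simp_all
  assume "norm t' = sqrt (A_in z) \<or> norm t' = sqrt (A_out z)"
  then have "(norm t')\<^sup>2 = A_in z \<or> (norm t')\<^sup>2 = A_out z" using pm(3,4) by auto
  moreover have "1 - (norm (ins i t' z))\<^sup>2 = A_out z + A_in z - (norm t')\<^sup>2"
    using norm_ins_sq[of i t' z] pm(1) by simp
  ultimately show "ins i t' z \<in> S" unfolding S_iff using pm(2) by (auto simp: mult.commute)
qed

lemma radial_nth: "radial i \<tau> z $ i = of_real (\<tau> z) * (z $ i / of_real (norm (z $ i)))"
  by (simp add: radial_def)

text \<open>On the slice through z the Cauchy formula expresses \<open>g (ins i (w $ i) z)\<close>
  by values on two boundary circles. Rotating \<open>z $ i\<close> produces these circles, and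
  rotating the other coordinates about w leads to \<open>g w\<close>. The modulus of
  \<open>z $ i\<close> between 1 and 2 is a free parameter that the projections forget; it gives the
  ring full dimension.\<close>

lemma hardy_formula:
  fixes w :: "complex ^ 'n" and \<eta> :: real
  defines "U \<equiv> ring i w 1 2 \<eta>"
  assumes g: "holomorphic_several g \<Omega>" "continuous_on (closure \<Omega>) g" and \<eta>: "\<eta> > 0"
    and cyl: "\<And>z. norm (ins i 0 (z - w)) < \<eta> ==> ins i (w $ i) z \<in> \<Omega>"
    and m: "\<And>z. z \<in> U ==> norm (T_out z $ i) <= m * norm (T_out z $ i - w $ i)"
           "\<And>z. z \<in> U ==> norm (T_in z $ i) <= m' * norm (T_in z $ i - w $ i)"
  defines "\<Phi> \<equiv> %\<zeta>. g \<zeta> * (\<zeta> $ i) / (\<zeta> $ i - w $ i)"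
  shows "continuous_on U T_out" "continuous_on U T_in" "\<And>z. z \<in> U ==> T_out z \<in> S \<and> T_in z \<in> S"
    "continuous_on U (%z. \<Phi> (T_out z))" "continuous_on U (%z. \<Phi> (T_in z))"
    "\<exists>B. \<forall>z\<in>U. norm (\<Phi> (T_out z)) <= B \<and> norm (\<Phi> (T_in z)) <= B"
    "(LINT z:U|lborel. \<Phi> (T_out z) - \<Phi> (T_in z)) = measure lborel U *\<^sub>R g w"
proof -
  have U: "1 < norm (z $ i)" "z $ i ~= 0" "ins i (w $ i) z \<in> \<Omega>" if "z \<in> U" for z
    using that cyl by (auto simp: U_def ring_def)
  have cA: "continuous_on U A_out" "continuous_on U A_in"
    unfolding A_out_def[abs_def] A_in_def[abs_def] a_plus_def a_minus_def by (intro continuous_intros; simp)+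
  show cT: "continuous_on U T_out" "continuous_on U T_in"
    unfolding radial_def[abs_def] by (intro continuous_intros cA; use U in simp)+
  have nT: "norm (T_out z $ i) = sqrt (A_out z)" "norm (T_in z $ i) = sqrt (A_in z)" if "z \<in> U" for z
    using U[OF that] slice(3,4)[OF U(3)[OF that]] by (simp_all add: radial_nth norm_mult norm_divide)
  show TS: "T_out z \<in> S \<and> T_in z \<in> S" if z: "z \<in> U" for z
    using slice(8)[OF U(3)[OF z]] nT[OF z] by (simp add: radial_def)
  have ne: "T_out z $ i ~= w $ i" "T_in z $ i ~= w $ i" if z: "z \<in> U" for z
    using slice(5,6)[OF U(3)[OF z]] nT[OF z] by auto
  have gT: "continuous_on U (%z. g (T_out z))" "continuous_on U (%z. g (T_in z))"
    by (rule continuous_on_compose2[OF g(2) cT(1)] continuous_on_compose2[OF g(2) cT(2)], use TS closure_\<Omega> in auto)+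
  show c\<Phi>: "continuous_on U (%z. \<Phi> (T_out z))" "continuous_on U (%z. \<Phi> (T_in z))"
    unfolding \<Phi>_def by (intro continuous_intros gT cT; use ne in auto)+
  obtain B where B: "\<forall>z\<in>closure \<Omega>. norm (g z) <= B"
    using continuous_bounded_on_compact[OF compact_closure g(2)] by blast
  have \<Phi>b: "norm (\<Phi> \<zeta>) <= B * k" if "\<zeta> \<in> S" "\<zeta> $ i ~= w $ i" "norm (\<zeta> $ i) <= k * norm (\<zeta> $ i - w $ i)" for \<zeta> k
  proof -
    have "norm (\<Phi> \<zeta>) = norm (g \<zeta>) * (norm (\<zeta> $ i) / norm (\<zeta> $ i - w $ i))" by (simp add: \<Phi>_def norm_mult norm_divide)
    also have "... <= B * k" using that B closure_\<Omega>
      by (intro mult_mono) (auto simp: pos_divide_le_eq intro: order_trans[OF norm_ge_zero])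
    finally show ?thesis .
  qed
  have bd: "norm (\<Phi> (T_out z)) <= max (B * m) (B * m')" "norm (\<Phi> (T_in z)) <= max (B * m) (B * m')" if z: "z \<in> U" for z
    using \<Phi>b[OF _ ne(1)[OF z] m(1)[OF z]] \<Phi>b[OF _ ne(2)[OF z] m(2)[OF z]] TS[OF z] by auto
  then show "\<exists>B. \<forall>z\<in>U. norm (\<Phi> (T_out z)) <= B \<and> norm (\<Phi> (T_in z)) <= B" by blast
  have Ub: "U \<in> sets borel" "emeasure lborel U < \<infinity>" unfolding U_def by (rule ring_borel, rule emeasure_ring_finite)
  have "(LINT z:U|lborel. \<Phi> (T_out z) - \<Phi> (T_in z)) = (LINT z:U|lborel. g (ins i (w $ i) z))"
  proof (rule set_integral_rot_average[OF Ub, where J = "{i}" and w = 0 and B = "2 * max (B * m) (B * m')"])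
    show "continuous_on U (%z. \<Phi> (T_out z) - \<Phi> (T_in z))" by (intro continuous_intros c\<Phi>)
    show "norm (\<Phi> (T_out z) - \<Phi> (T_in z)) <= 2 * max (B * m) (B * m')" if "z \<in> U" for z
      using norm_triangle_ineq4[of "\<Phi> (T_out z)" "\<Phi> (T_in z)"] bd[OF that] by linarith
    show rU: "rot {i} 0 \<theta> z \<in> U \<longleftrightarrow> z \<in> U" for \<theta> z unfolding U_def by (rule rot_ring)
    fix z assume z: "z \<in> U"
    note sl = slice[OF U(3)[OF z]]
    define v where "v = z $ i / of_real (norm (z $ i))"
    have v: "norm v = 1" using U[OF z] by (simp add: v_def norm_divide)
    define x y where "x = of_real (sqrt (A_out z)) * v" and "y = of_real (sqrt (A_in z)) * v"
    have nx: "norm x = sqrt (A_out z)" "norm y = sqrt (A_in z)" using sl(3,4) v by (simp_all add: x_def y_def norm_mult)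
    define G where "G = (%t. g (ins i t z))"
    have line: "G = (%t. g (ins i 0 z + t *s axis i 1))"
      unfolding G_def by (intro ext arg_cong[where f = g]) (simp add: vec_eq_iff axis_def)
    have "G holomorphic_on annulus (norm y) (norm x)"
      unfolding line
    proof (rule holomorphic_several_line_holomorphic[OF g(1)])
      fix t assume t: "t \<in> annulus (norm y) (norm x)"
      have "ins i 0 z + t *s axis i 1 = ins i t z" by (simp add: vec_eq_iff axis_def)
      then show "ins i 0 z + t *s axis i 1 \<in> \<Omega>" using t sl(7)[of t] by (simp add: annulus_def nx)
    qed
    moreover have "continuous_on {t. norm y <= norm t \<and> norm t <= norm x} G"
      unfolding G_def
    proof (rule continuous_on_compose2[OF g(2)])
      show "(%t. ins i t z) ` {t. norm y <= norm t \<and> norm t <= norm x} \<subseteq> closure \<Omega>"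
        unfolding closure_\<Omega> nx using sl(7,8) by (auto simp: less_le)
    qed (intro continuous_intros)
    ultimately have "integral {0..2*pi} (%\<theta>. G (x * cis \<theta>) * (x * cis \<theta>) / (x * cis \<theta> - w $ i))
       - integral {0..2*pi} (%\<theta>. G (y * cis \<theta>) * (y * cis \<theta>) / (y * cis \<theta> - w $ i)) = 2 * pi * G (w $ i)"
      by (intro annulus_cauchy_formula[where r = "norm y" and R = "norm x"]) (use sl nx in auto)
    moreover have rT: "T_out (rot {i} 0 \<theta> z) = ins i (x * cis \<theta>) z" "T_in (rot {i} 0 \<theta> z) = ins i (y * cis \<theta>) z" for \<theta>
    proof -
      have "ins i 0 (rot {i} 0 \<theta> z) = ins i 0 z" by (simp add: vec_eq_iff rot_nth)
      then have "A_out (rot {i} 0 \<theta> z) = A_out z" "A_in (rot {i} 0 \<theta> z) = A_in z" by (simp_all add: A_out_def A_in_def)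
      then show "T_out (rot {i} 0 \<theta> z) = ins i (x * cis \<theta>) z" "T_in (rot {i} 0 \<theta> z) = ins i (y * cis \<theta>) z"
        by (simp_all add: vec_eq_iff radial_def rot_nth x_def y_def v_def norm_mult)
    qed
    have f: "\<Phi> (T_out (rot {i} 0 \<theta> z)) = G (x * cis \<theta>) * (x * cis \<theta>) / (x * cis \<theta> - w $ i)"
       "\<Phi> (T_in (rot {i} 0 \<theta> z)) = G (y * cis \<theta>) * (y * cis \<theta>) / (y * cis \<theta> - w $ i)" for \<theta>
      unfolding rT by (simp_all add: \<Phi>_def G_def)
    have rz: "continuous_on {0..2*pi} (%\<theta>. rot {i} 0 \<theta> z)"
    proof -
      have "rot {i} 0 \<theta> z = ins i (z $ i * cis \<theta>) z" for \<theta> by (simp add: vec_eq_iff rot_nth)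
      then show ?thesis by (simp only:) (intro continuous_intros)
    qed
    have "(%\<theta>. \<Phi> (T_out (rot {i} 0 \<theta> z))) integrable_on {0..2*pi}" "(%\<theta>. \<Phi> (T_in (rot {i} 0 \<theta> z))) integrable_on {0..2*pi}"
      by (intro integrable_continuous_real continuous_on_compose2[OF c\<Phi>(1) rz] continuous_on_compose2[OF c\<Phi>(2) rz];
          use z rU in blast)+
    from integral_diff[OF this] show "integral {0..2*pi} (%\<theta>. \<Phi> (T_out (rot {i} 0 \<theta> z)) - \<Phi> (T_in (rot {i} 0 \<theta> z))) = 2 * pi * g (ins i (w $ i) z)"
      using calculation unfolding f G_def by simp
  qed
  also have "... = measure lborel U *\<^sub>R g (ins i (w $ i) w)"
    unfolding U_def by (rule ring_mean[OF g(1) \<eta> cyl, where ?B0.0 = B]) (use B closure_\<Omega> cyl in auto)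
  finally show "(LINT z:U|lborel. \<Phi> (T_out z) - \<Phi> (T_in z)) = measure lborel U *\<^sub>R g w" by simp
qed

end

section \<open>Point evaluations and completeness for the Hardy space\<close>

lemma nn_integral_add_sq_le:
  fixes x y :: "'a => complex"
  assumes [measurable]: "x \<in> borel_measurable M" "y \<in> borel_measurable M"
  shows "(\<integral>\<^sup>+z. ennreal ((norm (x z + y z))\<^sup>2) \<partial>M) <= 2 * (\<integral>\<^sup>+z. ennreal ((norm (x z))\<^sup>2) \<partial>M) + 2 * (\<integral>\<^sup>+z. ennreal ((norm (y z))\<^sup>2) \<partial>M)"
proof -
  have "(\<integral>\<^sup>+z. ennreal ((norm (x z + y z))\<^sup>2) \<partial>M) <= (\<integral>\<^sup>+z. 2 * ennreal ((norm (x z))\<^sup>2) + 2 * ennreal ((norm (y z))\<^sup>2) \<partial>M)"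
  proof (rule nn_integral_mono)
    fix z
    have "ennreal ((norm (x z + y z))\<^sup>2) <= ennreal (2 * (norm (x z))\<^sup>2 + 2 * (norm (y z))\<^sup>2)"
      by (rule ennreal_leI[OF norm_add_sq_le])
    also have "... = 2 * ennreal ((norm (x z))\<^sup>2) + 2 * ennreal ((norm (y z))\<^sup>2)"
      by (simp add: ennreal_plus ennreal_mult')
    finally show "ennreal ((norm (x z + y z))\<^sup>2) <= 2 * ennreal ((norm (x z))\<^sup>2) + 2 * ennreal ((norm (y z))\<^sup>2)" .
  qed
  also have "... = 2 * (\<integral>\<^sup>+z. ennreal ((norm (x z))\<^sup>2) \<partial>M) + 2 * (\<integral>\<^sup>+z. ennreal ((norm (y z))\<^sup>2) \<partial>M)"
    by (subst nn_integral_add) (auto simp: nn_integral_cmult)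
  finally show ?thesis .
qed

lemma nn_integral_sq:
  assumes "square_integrable M f"
  shows "(\<integral>\<^sup>+z. ennreal ((norm (f z))\<^sup>2) \<partial>M) = ennreal (nsq M f)"
  using assms unfolding square_integrable_def nsq_def by (intro nn_integral_eq_integral) auto

context annular
begin

text \<open>The squared norm with values in \<open>ennreal\<close>, so that estimates can be stated
  before square integrability is known.\<close>

definition energy :: "(complex ^ 'n => complex) => ennreal" where
  "energy g = (\<integral>\<^sup>+z. ennreal ((norm (g z))\<^sup>2) \<partial>\<sigma>)"

text \<open>One boundary sheet: m bounds the Cauchy kernel, \<open>1 / t\<close> stems from the
  comparison with surface measure, and \<open>1 / (c * d)\<close> passes from surface measure to
  Fefferman measure.\<close>

lemma branch_estimate:
  fixes w :: "complex ^ 'n" and \<eta> :: real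
  defines "U \<equiv> ring i w 1 2 \<eta>"
  assumes cont: "continuous_on U (radial i \<tau>)" and pos: "t > 0" "d > 0" "m > 0"
    and br: "\<And>z. z \<in> U ==> 0 <= \<tau> z \<and> radial i \<tau> z \<in> S \<and> t <= norm (radial i \<tau> z $ i) \<and> d <= fdens i (radial i \<tau> z)
      \<and> norm (\<Psi> z) <= m * norm (g (radial i \<tau> z))"
    and g: "continuous_on (closure \<Omega>) g"
  shows "(\<integral>\<^sup>+z. ennreal ((norm (\<Psi> z))\<^sup>2) * indicator U z \<partial>lborel) <= ennreal (m\<^sup>2 * hausdorff_const TYPE('n) i / (t * c * d)) * energy g"
proof -
  let ?T = "radial i \<tau>" let ?k = "hausdorff_const TYPE('n) i"
  have k: "?k > 0" by (rule hausdorff_const_pos)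
  define Z where "Z = {z \<in> S. t <= norm (z $ i) \<and> d <= fdens i z}"
  have [measurable]: "(%z :: complex ^ 'n. norm (z $ i)) \<in> borel_measurable borel"
    by (intro borel_measurable_continuous_onI continuous_intros)
  have "S \<inter> {z. t <= norm (z $ i)} \<inter> {z. d <= fdens i z} \<in> sets borel" by measurable
  moreover have "Z = S \<inter> {z. t <= norm (z $ i)} \<inter> {z. d <= fdens i z}" by (auto simp: Z_def)
  ultimately have Z: "Z \<in> sets borel" by simp
  \<comment> \<open>g is controlled on the closed domain only; cut off there it is Borel on the
    whole space.\<close>
  define g' where "g' z = indicator (closure \<Omega>) z *\<^sub>R g z" for z
  have g'[measurable]: "g' \<in> borel_measurable borel"
    unfolding g'_def[abs_def] by (rule borel_measurable_continuous_on_indicator[OF _ g]) simp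
  define h where "h z = ennreal (m\<^sup>2 * (norm (g' z))\<^sup>2)" for z
  have h[measurable]: "h \<in> borel_measurable borel" unfolding h_def[abs_def] by measurable
  have g'S: "g' z = g z" if "z \<in> S" for z using that by (simp add: g'_def closure_\<Omega>)
  have "(\<integral>\<^sup>+z. ennreal ((norm (\<Psi> z))\<^sup>2) * indicator U z \<partial>lborel) <= (\<integral>\<^sup>+z. h (?T z) * indicator U z \<partial>lborel)"
  proof (rule nn_integral_mono)
    fix z show "ennreal ((norm (\<Psi> z))\<^sup>2) * indicator U z <= h (?T z) * indicator U z"
    proof (cases "z \<in> U")
      case True
      note b = br[OF True]
      have "(norm (\<Psi> z))\<^sup>2 <= (m * norm (g (?T z)))\<^sup>2" using b by (intro power_mono) auto
      then show ?thesis using True g'S[of "?T z"] b by (simp add: h_def power_mult_distrib ennreal_leI)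
    qed simp
  qed
  also have "... <= (\<integral>\<^sup>+z. ennreal (?k / t) * indicator Z z * h z \<partial>surface_measure)"
    unfolding U_def
  proof (rule nn_integral_radial_le[OF _ _ pos(1) Z])
    show "continuous_on (ring i w 1 2 \<eta>) ?T" using cont by (simp add: U_def)
  qed (use br in \<open>auto simp: Z_def U_def h\<close>)
  also have "... <= (\<integral>\<^sup>+z. ennreal (m\<^sup>2 * ?k / (t * c * d)) * (ennreal (c * fdens i z) * ennreal ((norm (g' z))\<^sup>2) * indicator S z) \<partial>surface_measure)"
  proof (rule nn_integral_mono)
    fix z show "ennreal (?k / t) * indicator Z z * h z
      <= ennreal (m\<^sup>2 * ?k / (t * c * d)) * (ennreal (c * fdens i z) * ennreal ((norm (g' z))\<^sup>2) * indicator S z)"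
    proof (cases "z \<in> Z")
      case True
      then have z: "z \<in> S" "d <= fdens i z" by (auto simp: Z_def)
      have "?k / t * (m\<^sup>2 * (norm (g' z))\<^sup>2) * 1 <= ?k / t * (m\<^sup>2 * (norm (g' z))\<^sup>2) * (fdens i z / d)"
        using z pos k by (intro mult_left_mono) auto
      also have "... = m\<^sup>2 * ?k / (t * c * d) * (c * fdens i z * (norm (g' z))\<^sup>2)" using pos c by (simp add: field_simps)
      finally have "ennreal (?k / t * (m\<^sup>2 * (norm (g' z))\<^sup>2)) <= ennreal (m\<^sup>2 * ?k / (t * c * d) * (c * fdens i z * (norm (g' z))\<^sup>2))"
        by (intro ennreal_leI) simp
      moreover have "ennreal (?k / t) * indicator Z z * h z = ennreal (?k / t * (m\<^sup>2 * (norm (g' z))\<^sup>2))"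
        using True k pos unfolding h_def by (subst ennreal_mult'') auto
      moreover have "ennreal (m\<^sup>2 * ?k / (t * c * d)) * (ennreal (c * fdens i z) * ennreal ((norm (g' z))\<^sup>2) * indicator S z)
        = ennreal (m\<^sup>2 * ?k / (t * c * d) * (c * fdens i z * (norm (g' z))\<^sup>2))"
      proof -
        have "ennreal (c * fdens i z) * ennreal ((norm (g' z))\<^sup>2) * indicator S z = ennreal (c * fdens i z * (norm (g' z))\<^sup>2)"
          unfolding indicator_simps(1)[OF z(1)] mult_1_right
          by (rule ennreal_mult[symmetric]) (use c fdens_nonneg[of z] in auto)
        moreover have "ennreal (m\<^sup>2 * ?k / (t * c * d)) * ennreal (c * fdens i z * (norm (g' z))\<^sup>2)
          = ennreal (m\<^sup>2 * ?k / (t * c * d) * (c * fdens i z * (norm (g' z))\<^sup>2))"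
          by (rule ennreal_mult[symmetric]) (use pos k c fdens_nonneg[of z] in auto)
        ultimately show ?thesis by (simp only:)
      qed
      ultimately show ?thesis by (simp only:)
    qed simp
  qed
  also have "... = ennreal (m\<^sup>2 * ?k / (t * c * d)) * (\<integral>\<^sup>+z. ennreal (c * fdens i z) * ennreal ((norm (g' z))\<^sup>2) * indicator S z \<partial>surface_measure)"
    by (rule nn_integral_cmult) (simp cong: measurable_cong_sets)
  also have "(\<integral>\<^sup>+z. ennreal (c * fdens i z) * ennreal ((norm (g' z))\<^sup>2) * indicator S z \<partial>surface_measure) = (\<integral>\<^sup>+z. ennreal ((norm (g' z))\<^sup>2) \<partial>\<sigma>)"
    by (rule nn_integral_\<sigma>[symmetric]) measurable
  also have "... = energy g" unfolding energy_def by (intro nn_integral_cong) (simp add: space_\<sigma> g'S)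
  finally show ?thesis .
qed

text \<open>The averaged Cauchy formula and Cauchy-Schwarz on the ring, with separate constants for
  the two sheets: at the base point their sizes differ by a power of \<epsilon>.\<close>

lemma hardy_evaluation:
  fixes w :: "complex ^ 'n" and \<eta> :: real
  defines "U \<equiv> ring i w 1 2 \<eta>"
  assumes g: "holomorphic_several g \<Omega>" "continuous_on (closure \<Omega>) g" and \<eta>: "\<eta> > 0"
    and cyl: "\<And>z. norm (ins i 0 (z - w)) < \<eta> ==> ins i (w $ i) z \<in> \<Omega>"
    and pos: "t > 0" "d > 0" "m > 0" "t' > 0" "d' > 0" "m' > 0"
    and out: "\<And>z. z \<in> U ==> t <= norm (T_out z $ i) \<and> d <= fdens i (T_out z) \<and> norm (T_out z $ i) <= m * norm (T_out z $ i - w $ i)"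
    and inn: "\<And>z. z \<in> U ==> t' <= norm (T_in z $ i) \<and> d' <= fdens i (T_in z) \<and> norm (T_in z $ i) <= m' * norm (T_in z $ i - w $ i)"
  shows "ennreal ((norm (g w))\<^sup>2) <= ennreal (2 * hausdorff_const TYPE('n) i / (measure lborel U * c) * (m\<^sup>2 / (t * d) + m'\<^sup>2 / (t' * d'))) * energy g"
proof -
  let ?k = "hausdorff_const TYPE('n) i" and ?V = "measure lborel U"
  define \<Phi> where "\<Phi> = (%\<zeta>. g \<zeta> * (\<zeta> $ i) / (\<zeta> $ i - w $ i))"
  have mo: "norm (T_out z $ i) <= m * norm (T_out z $ i - w $ i)" "norm (T_in z $ i) <= m' * norm (T_in z $ i - w $ i)"
    if "z \<in> ring i w 1 2 \<eta>" for z using out[of z] inn[of z] that by (auto simp: U_def)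
  have hf: "continuous_on U T_out" "continuous_on U T_in" "\<And>z. z \<in> U ==> T_out z \<in> S \<and> T_in z \<in> S"
    "continuous_on U (%z. \<Phi> (T_out z))" "continuous_on U (%z. \<Phi> (T_in z))"
    "\<exists>B. \<forall>z\<in>U. norm (\<Phi> (T_out z)) <= B \<and> norm (\<Phi> (T_in z)) <= B"
    "(LINT z:U|lborel. \<Phi> (T_out z) - \<Phi> (T_in z)) = measure lborel U *\<^sub>R g w"
    unfolding U_def \<Phi>_def
    by (rule hardy_formula[OF g \<eta>, where w = w and m = m and m' = m'], erule cyl, erule mo, erule mo, assumption?)+
  have Ub: "U \<in> sets borel" "emeasure lborel U < \<infinity>" unfolding U_def by (rule ring_borel, rule emeasure_ring_finite)
  have V: "?V > 0" unfolding U_def by (rule measure_ring_pos) (use \<eta> in auto)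
  have k: "?k > 0" by (rule hausdorff_const_pos)
  obtain B where B: "\<forall>z\<in>U. norm (\<Phi> (T_out z)) <= B \<and> norm (\<Phi> (T_in z)) <= B" using hf(6) by blast
  have si: "set_integrable lborel U \<Psi>" "set_integrable lborel U (%z. (norm (\<Psi> z))\<^sup>2)"
    "(norm (LINT z:U|lborel. \<Psi> z))\<^sup>2 <= ?V * (LINT z:U|lborel. (norm (\<Psi> z))\<^sup>2)"
    "ennreal (LINT z:U|lborel. (norm (\<Psi> z))\<^sup>2) = (\<integral>\<^sup>+z. ennreal ((norm (\<Psi> z))\<^sup>2) * indicator U z \<partial>lborel)"
    if ct: "continuous_on U \<Psi>" and bd: "\<forall>z\<in>U. norm (\<Psi> z) <= B" for \<Psi> :: "complex ^ 'n => complex"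
  proof -
    have m: "(%z. indicator U z *\<^sub>R \<Psi> z) \<in> borel_measurable borel" "(%z. indicator U z *\<^sub>R (norm (\<Psi> z))\<^sup>2) \<in> borel_measurable borel"
      by (intro borel_measurable_continuous_on_indicator Ub continuous_intros ct)+
    show "set_integrable lborel U \<Psi>" unfolding set_integrable_def
      by (rule integrableI_bounded_set[where A = U and B = B]) (use m Ub bd in auto)
    show s2: "set_integrable lborel U (%z. (norm (\<Psi> z))\<^sup>2)" unfolding set_integrable_def
      by (rule integrableI_bounded_set[where A = U and B = "B\<^sup>2"]) (use m Ub bd in \<open>auto intro!: AE_I2 power_mono\<close>)
    show "(norm (LINT z:U|lborel. \<Psi> z))\<^sup>2 <= ?V * (LINT z:U|lborel. (norm (\<Psi> z))\<^sup>2)"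
      by (rule set_integral_cauchy_schwarz[OF Ub m(1) s2])
    have "ennreal (LINT z:U|lborel. (norm (\<Psi> z))\<^sup>2) = (\<integral>\<^sup>+z. ennreal (indicator U z *\<^sub>R (norm (\<Psi> z))\<^sup>2) \<partial>lborel)"
      unfolding set_lebesgue_integral_def using s2
      by (intro nn_integral_eq_integral[symmetric]) (auto simp: set_integrable_def)
    also have "... = (\<integral>\<^sup>+z. ennreal ((norm (\<Psi> z))\<^sup>2) * indicator U z \<partial>lborel)"
      by (intro nn_integral_cong) (simp add: indicator_def)
    finally show "ennreal (LINT z:U|lborel. (norm (\<Psi> z))\<^sup>2) = (\<integral>\<^sup>+z. ennreal ((norm (\<Psi> z))\<^sup>2) * indicator U z \<partial>lborel)" .
  qed
  let ?o = "%z. \<Phi> (T_out z)" and ?n = "%z. \<Phi> (T_in z)"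
  note so = si[of ?o, OF hf(4)] and sn = si[of ?n, OF hf(5)]
  have Bo: "\<forall>z\<in>U. norm (?o z) <= B" "\<forall>z\<in>U. norm (?n z) <= B" using B by auto
  have \<Phi>le: "norm (\<Phi> \<zeta>) <= k * norm (g \<zeta>)" if "norm (\<zeta> $ i) <= k * norm (\<zeta> $ i - w $ i)" "k > 0" for \<zeta> k
  proof -
    have "norm (\<zeta> $ i) / norm (\<zeta> $ i - w $ i) <= k"
      using that by (cases "\<zeta> $ i = w $ i") (auto simp: pos_divide_le_eq)
    then have "norm (g \<zeta>) * (norm (\<zeta> $ i) / norm (\<zeta> $ i - w $ i)) <= norm (g \<zeta>) * k" by (intro mult_left_mono) auto
    then show ?thesis by (simp add: \<Phi>_def norm_mult norm_divide mult.commute)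
  qed
  have A: "A_out z >= 0" "A_in z >= 0" if "z \<in> U" for z
    using slice(3,4)[of "w $ i" z] cyl[of z] that by (simp_all add: U_def ring_def)
  let ?eo = "m\<^sup>2 * ?k / (t * c * d)" and ?en = "m'\<^sup>2 * ?k / (t' * c * d')"
  have eo: "ennreal (LINT z:U|lborel. (norm (?o z))\<^sup>2) <= ennreal ?eo * energy g"
    unfolding so(4)[OF Bo(1)] unfolding U_def
    by (rule branch_estimate[OF _ pos(1-3) _ g(2)])
       (use hf(1,3) out A(1) \<Phi>le pos in \<open>auto simp: U_def\<close>)
  have en: "ennreal (LINT z:U|lborel. (norm (?n z))\<^sup>2) <= ennreal ?en * energy g"
    unfolding sn(4)[OF Bo(2)] unfolding U_def
    by (rule branch_estimate[OF _ pos(4-6) _ g(2)])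
       (use hf(2,3) inn A(2) \<Phi>le pos in \<open>auto simp: U_def\<close>)
  have "?V\<^sup>2 * (norm (g w))\<^sup>2 = (norm ((LINT z:U|lborel. ?o z) + - (LINT z:U|lborel. ?n z)))\<^sup>2"
    using hf(7) set_integral_diff(2)[OF so(1)[OF Bo(1)] sn(1)[OF Bo(2)]] V by (simp add: power_mult_distrib)
  also have "... <= 2 * (norm (LINT z:U|lborel. ?o z))\<^sup>2 + 2 * (norm (- (LINT z:U|lborel. ?n z)))\<^sup>2"
    by (rule norm_add_sq_le)
  also have "... <= 2 * (?V * (LINT z:U|lborel. (norm (?o z))\<^sup>2)) + 2 * (?V * (LINT z:U|lborel. (norm (?n z))\<^sup>2))"
    unfolding norm_minus_cancel by (intro add_mono mult_left_mono so(3)[OF Bo(1)] sn(3)[OF Bo(2)]) auto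
  finally have "?V * (?V * (norm (g w))\<^sup>2) <= ?V * (2 * ((LINT z:U|lborel. (norm (?o z))\<^sup>2) + (LINT z:U|lborel. (norm (?n z))\<^sup>2)))"
    by (simp add: power2_eq_square algebra_simps)
  then have "?V * (norm (g w))\<^sup>2 <= 2 * ((LINT z:U|lborel. (norm (?o z))\<^sup>2) + (LINT z:U|lborel. (norm (?n z))\<^sup>2))"
    using V by simp
  then have "(norm (g w))\<^sup>2 <= 2 / ?V * ((LINT z:U|lborel. (norm (?o z))\<^sup>2) + (LINT z:U|lborel. (norm (?n z))\<^sup>2))"
    using V by (simp add: field_simps)
  then have "ennreal ((norm (g w))\<^sup>2) <= ennreal (2 / ?V * ((LINT z:U|lborel. (norm (?o z))\<^sup>2) + (LINT z:U|lborel. (norm (?n z))\<^sup>2)))"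
    by (rule ennreal_leI)
  also have "... = ennreal (2 / ?V) * (ennreal (LINT z:U|lborel. (norm (?o z))\<^sup>2) + ennreal (LINT z:U|lborel. (norm (?n z))\<^sup>2))"
  proof -
    have "(LINT z:U|lborel. (norm (?o z))\<^sup>2) >= 0" "(LINT z:U|lborel. (norm (?n z))\<^sup>2) >= 0"
      unfolding set_lebesgue_integral_def by (intro integral_nonneg_AE; simp)+
    then show ?thesis using V by (subst ennreal_mult') (simp_all only: ennreal_plus zero_le_divide_iff zero_le_numeral less_imp_le, simp)
  qed
  also have "... <= ennreal (2 / ?V) * (ennreal ?eo * energy g + ennreal ?en * energy g)"
    by (intro mult_left_mono add_mono eo en) auto
  also have "... = ennreal (2 / ?V * (?eo + ?en)) * energy g"
  proof -
    have "ennreal a * (ennreal x * G + ennreal y * G) = ennreal (a * (x + y)) * G" if "a >= 0" "x >= 0" "y >= 0" for a x y G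
      using that by (simp add: ennreal_mult ennreal_plus distrib_right mult.assoc)
    then show ?thesis using V k pos c by simp
  qed
  also have "2 / ?V * (?eo + ?en) = 2 * ?k / (?V * c) * (m\<^sup>2 / (t * d) + m'\<^sup>2 / (t' * d'))"
    using V pos c by (simp add: field_simps)
  finally show ?thesis .
qed

lemma S_disjoint: "S \<inter> \<Omega> = {}"
  using frontier_disjoint_eq[of \<Omega>] open_\<Omega> frontier_\<Omega> by auto

text \<open>Near w the slices stay in \<Omega> as long as the i-th coordinate moves by at most
  \<eta>. Boundary points on them therefore have \<open>norm (T $ i - w $ i) > \<eta>\<close>, which
  bounds the kernel by 1 / \<eta>.\<close>

lemma hardy_local_evaluation:
  assumes w0: "w0 \<in> \<Omega>"
  shows "\<exists>r>0. \<exists>K\<ge>0. ball w0 r \<subseteq> \<Omega> \<and> (\<forall>g w. holomorphic_several g \<Omega> --> continuous_on (closure \<Omega>) g --> w \<in> ball w0 r -->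
    ennreal ((norm (g w))\<^sup>2) <= ennreal K * energy g)"
proof -
  obtain e where e: "e > 0" "cball w0 e \<subseteq> \<Omega>" using open_\<Omega> w0 open_contains_cball by blast
  \<comment> \<open>One third of e for moving w, one for the i-th coordinate, one for the
    others.\<close>
  define \<eta> where "\<eta> = e / 3"
  have \<eta>: "\<eta> > 0" "cball w0 (3 * \<eta>) \<subseteq> \<Omega>" using e by (simp_all add: \<eta>_def)
  obtain d where d: "d > 0" "\<And>z. z \<in> S ==> d <= fdens i z" using fdens_bounded_below by blast
  let ?V = "measure lborel (ring i (0 :: complex ^ 'n) 1 2 \<eta>)"
  have V: "?V > 0" by (rule measure_ring_pos) (use \<eta> in auto)
  \<comment> \<open>The volume of the ring does not depend on its centre, so one K serves all w in
    the ball.\<close>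
  define K where "K = 2 * hausdorff_const TYPE('n) i / (?V * c) * ((1/\<eta>)\<^sup>2 / (sqrt \<epsilon> * d) + (1/\<eta>)\<^sup>2 / (sqrt \<epsilon> * d))"
  have K: "K >= 0" unfolding K_def using V c d eps hausdorff_const_pos[where 'n = 'n, of i] by simp
  have ev: "ennreal ((norm (g w))\<^sup>2) <= ennreal K * energy g"
    if g: "holomorphic_several g \<Omega>" "continuous_on (closure \<Omega>) g" and w: "w \<in> ball w0 \<eta>" for g w
    unfolding K_def measure_ring_translate[of i w 1 2 \<eta>, symmetric]
  proof (rule hardy_evaluation[OF g \<eta>(1)])
    have near: "ins i t z \<in> \<Omega>" if "norm (ins i 0 (z - w)) < \<eta>" "norm (t - w $ i) <= \<eta>" for z t
    proof -
      have "ins i t z - w = ins i (t - w $ i) (z - w)" by (simp add: vec_eq_iff)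
      then have "norm (ins i t z - w) <= 2 * \<eta>"
        using norm_ins_le[of i "t - w $ i" "z - w"] that by simp
      then have "dist w (ins i t z) <= 2 * \<eta>" by (simp only: dist_norm norm_minus_commute)
      then have "dist w0 (ins i t z) <= 3 * \<eta>" using w dist_triangle[of w0 "ins i t z" w] by simp
      then show ?thesis using \<eta> by auto
    qed
    show cyl: "ins i (w $ i) z \<in> \<Omega>" if "norm (ins i 0 (z - w)) < \<eta>" for z using near[OF that] \<eta> by simp
    show "sqrt \<epsilon> > 0" "d > 0" "1 / \<eta> > 0" "sqrt \<epsilon> > 0" "d > 0" "1 / \<eta> > 0" using eps d \<eta> by auto
    have sp: "sqrt \<epsilon> <= norm (T $ i) \<and> d <= fdens i T \<and> norm (T $ i) <= 1 / \<eta> * norm (T $ i - w $ i)"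
      if z: "z \<in> ring i w 1 2 \<eta>" and T: "T = ins i (T $ i) z" "T \<in> S" for z T
    proof (intro conjI)
      note p = S_props[OF T(2)]
      show "sqrt \<epsilon> <= norm (T $ i)" using real_sqrt_le_mono[OF p(6)] by simp
      show "d <= fdens i T" using d T by blast
      have "norm (T $ i) <= 1" using p(7) by (simp add: abs_square_less_1)
      moreover have "norm (T $ i - w $ i) > \<eta>"
      proof (rule ccontr)
        assume "\<not> norm (T $ i - w $ i) > \<eta>"
        then have "ins i (T $ i) z \<in> \<Omega>" by (intro near) (use z in \<open>auto simp: ring_def\<close>)
        then show False using T S_disjoint by auto
      qed
      moreover have "\<eta> * norm (T $ i) <= \<eta> * 1" if "norm (T $ i) <= 1" using that \<eta>(1) by (intro mult_left_mono) auto
      ultimately have "\<eta> * norm (T $ i) <= norm (T $ i - w $ i)" by linarith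
      then show "norm (T $ i) <= 1 / \<eta> * norm (T $ i - w $ i)" using \<eta> by (simp add: field_simps)
    qed
    have TS: "T_out z = ins i (T_out z $ i) z" "T_in z = ins i (T_in z $ i) z" "T_out z \<in> S" "T_in z \<in> S"
      if z: "z \<in> ring i w 1 2 \<eta>" for z
    proof -
      show "T_out z = ins i (T_out z $ i) z" "T_in z = ins i (T_in z $ i) z" by (simp_all add: radial_def vec_eq_iff)
      have z1: "ins i (w $ i) z \<in> \<Omega>" "norm (z $ i) ~= 0" using z cyl by (auto simp: ring_def)
      have "norm (T_out z $ i) = sqrt (A_out z)" "norm (T_in z $ i) = sqrt (A_in z)"
        using z1 slice(3,4)[OF z1(1)] by (simp_all add: radial_nth norm_mult norm_divide)
      then show "T_out z \<in> S" "T_in z \<in> S"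
        using slice(8)[OF z1(1), of "T_out z $ i"] slice(8)[OF z1(1), of "T_in z $ i"] by (auto simp: radial_def)
    qed
    show "sqrt \<epsilon> <= norm (T_out z $ i) \<and> d <= fdens i (T_out z) \<and> norm (T_out z $ i) <= 1 / \<eta> * norm (T_out z $ i - w $ i)"
      if z: "z \<in> ring i w 1 2 \<eta>" for z by (rule sp[OF z TS(1)[OF z] TS(3)[OF z]])
    show "sqrt \<epsilon> <= norm (T_in z $ i) \<and> d <= fdens i (T_in z) \<and> norm (T_in z $ i) <= 1 / \<eta> * norm (T_in z $ i - w $ i)"
      if z: "z \<in> ring i w 1 2 \<eta>" for z by (rule sp[OF z TS(2)[OF z] TS(4)[OF z]])
  qed
  have "ball w0 \<eta> \<subseteq> cball w0 (3 * \<eta>)" using \<eta>(1) by auto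
  then have "ball w0 \<eta> \<subseteq> \<Omega>" using \<eta>(2) by (rule order_trans)
  with ev K \<eta>(1) show ?thesis by blast
qed

abbreviation "H \<equiv> hardy_space \<sigma> \<Omega>"

lemma continuous_measurable_\<sigma>:
  assumes "continuous_on (closure \<Omega>) g"
  shows "g \<in> borel_measurable \<sigma>"
proof -
  have "continuous_on S g" by (rule continuous_on_subset[OF assms]) (simp add: closure_\<Omega>)
  then show ?thesis using borel_measurable_continuous_on_restrict sets_\<sigma> by (metis measurable_cong_sets)
qed

text \<open>Evaluation is bounded for the approximants, which are continuous up to the boundary. The
  factor 2 comes from comparing their energy with that of f before passing to the limit.\<close>

lemma hardy_point_bound:
  assumes f: "(f, F) \<in> H" and w: "w \<in> \<Omega>" and K: "K >= 0"
    and ev: "\<And>g. holomorphic_several g \<Omega> ==> continuous_on (closure \<Omega>) g ==> ennreal ((norm (g w))\<^sup>2) <= ennreal K * energy g"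
  shows "(norm (F w))\<^sup>2 <= 2 * K * nsq \<sigma> f"
proof -
  obtain g where g: "\<And>j::nat. holomorphic_several (g j) \<Omega>" "\<And>j. continuous_on (closure \<Omega>) (g j)"
    and conv: "(%j. \<integral>\<^sup>+ z. ennreal ((norm (g j z - f z))\<^sup>2) \<partial>\<sigma>) \<longlonglongrightarrow> 0"
    and lim: "\<forall>z\<in>\<Omega>. (%j. g j z) \<longlonglongrightarrow> F z" and sq: "square_integrable \<sigma> f"
    using f unfolding hardy_space_def by auto
  have m: "g j \<in> borel_measurable \<sigma>" "f \<in> borel_measurable \<sigma>" for j
    using continuous_measurable_\<sigma>[OF g(2)] sq by (auto simp: square_integrable_def)
  let ?I = "%j. \<integral>\<^sup>+ z. ennreal ((norm (g j z - f z))\<^sup>2) \<partial>\<sigma>"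
  have le: "ennreal ((norm (g j w))\<^sup>2) <= ennreal K * (2 * ?I j + 2 * ennreal (nsq \<sigma> f))" for j
  proof -
    have "energy (g j) <= 2 * ?I j + 2 * ennreal (nsq \<sigma> f)"
      using nn_integral_add_sq_le[of "%z. g j z - f z" \<sigma> f] m by (simp add: energy_def nn_integral_sq[OF sq])
    then show ?thesis using ev[OF g(1,2), of j] by (meson mult_left_mono order_trans zero_le)
  qed
  have "(%j. ennreal ((norm (g j w))\<^sup>2)) \<longlonglongrightarrow> ennreal ((norm (F w))\<^sup>2)"
    using lim w by (intro tendsto_ennrealI tendsto_intros) auto
  moreover have "(%j. ennreal K * (2 * ?I j + 2 * ennreal (nsq \<sigma> f))) \<longlonglongrightarrow> ennreal K * (2 * 0 + 2 * ennreal (nsq \<sigma> f))"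
    by (intro ennreal_tendsto_cmult tendsto_add tendsto_const conv) auto
  ultimately have "ennreal ((norm (F w))\<^sup>2) <= ennreal K * (2 * 0 + 2 * ennreal (nsq \<sigma> f))"
    by (rule LIMSEQ_le) (use le in auto)
  also have "... = ennreal (2 * K * nsq \<sigma> f)" using K by (simp add: ennreal_mult' mult_ac)
  finally show ?thesis using K by (simp add: ennreal_le_iff)
qed

lemma energy_lin:
  assumes [measurable]: "x \<in> borel_measurable \<sigma>" "y \<in> borel_measurable \<sigma>"
  shows "energy (%z. a * x z + y z) <= ennreal (2 * (norm a)\<^sup>2) * energy x + 2 * energy y"
proof -
  have "energy (%z. a * x z) = ennreal ((norm a)\<^sup>2) * energy x"
    unfolding energy_def by (subst nn_integral_cmult[symmetric]) (auto simp: norm_mult power_mult_distrib ennreal_mult)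
  then have "energy (%z. a * x z + y z) <= 2 * (ennreal ((norm a)\<^sup>2) * energy x) + 2 * energy y"
    using nn_integral_add_sq_le[of "%z. a * x z" \<sigma> y] by (simp add: energy_def)
  then show ?thesis by (simp add: ennreal_mult' mult.assoc)
qed

lemma tendsto_energy_lin:
  assumes m: "\<And>j. x j \<in> borel_measurable \<sigma>" "\<And>j. y j \<in> borel_measurable \<sigma>"
    and lim: "(%j::nat. energy (x j)) \<longlonglongrightarrow> 0" "(%j. energy (y j)) \<longlonglongrightarrow> 0"
  shows "(%j. energy (%z. a * x j z + y j z)) \<longlonglongrightarrow> 0"
proof (rule tendsto_sandwich[OF _ _ tendsto_const])
  show "\<forall>\<^sub>F j in sequentially. energy (%z. a * x j z + y j z) <= ennreal (2 * (norm a)\<^sup>2) * energy (x j) + 2 * energy (y j)"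
    by (intro always_eventually allI energy_lin m)
  have "(%j. ennreal (2 * (norm a)\<^sup>2) * energy (x j) + 2 * energy (y j)) \<longlonglongrightarrow> ennreal (2 * (norm a)\<^sup>2) * 0 + 2 * 0"
    by (intro tendsto_add ennreal_tendsto_cmult lim) auto
  then show "(%j. ennreal (2 * (norm a)\<^sup>2) * energy (x j) + 2 * energy (y j)) \<longlonglongrightarrow> 0" by simp
qed auto

lemma hardy_spaceI:
  assumes "square_integrable \<sigma> f" "\<And>j. holomorphic_several (g j) \<Omega>" "\<And>j. continuous_on (closure \<Omega>) (g j)"
    "(%j. energy (%z. g j z - f z)) \<longlonglongrightarrow> 0" "\<And>z. z \<in> \<Omega> ==> (%j::nat. g j z) \<longlonglongrightarrow> F z"
  shows "(f, F) \<in> H"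
  using assms unfolding hardy_space_def energy_def by blast

lemma hardy_spaceE:
  assumes "(f, F) \<in> H"
  obtains g where "square_integrable \<sigma> f" "\<And>j::nat. holomorphic_several (g j) \<Omega>" "\<And>j. continuous_on (closure \<Omega>) (g j)"
    "(%j. energy (%z. g j z - f z)) \<longlonglongrightarrow> 0" "\<And>z. z \<in> \<Omega> ==> (%j. g j z) \<longlonglongrightarrow> F z"
  using assms unfolding hardy_space_def energy_def by auto

lemma energy_nsq: "square_integrable \<sigma> f ==> energy f = ennreal (nsq \<sigma> f)"
  unfolding energy_def by (rule nn_integral_sq)

lemma hardy_lin:
  assumes f: "(f, F) \<in> H" and g: "(g, G) \<in> H"
  shows "(%z. a * f z + g z, %z. a * F z + G z) \<in> H"
proof -
  obtain x where x: "square_integrable \<sigma> f" "\<And>j::nat. holomorphic_several (x j) \<Omega>" "\<And>j. continuous_on (closure \<Omega>) (x j)"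
    "(%j. energy (%z. x j z - f z)) \<longlonglongrightarrow> 0" "\<And>z. z \<in> \<Omega> ==> (%j. x j z) \<longlonglongrightarrow> F z" using f by (rule hardy_spaceE) (rule that)
  obtain y where y: "square_integrable \<sigma> g" "\<And>j::nat. holomorphic_several (y j) \<Omega>" "\<And>j. continuous_on (closure \<Omega>) (y j)"
    "(%j. energy (%z. y j z - g z)) \<longlonglongrightarrow> 0" "\<And>z. z \<in> \<Omega> ==> (%j. y j z) \<longlonglongrightarrow> G z" using g by (rule hardy_spaceE) (rule that)
  have [measurable]: "f \<in> borel_measurable \<sigma>" "g \<in> borel_measurable \<sigma>" "x j \<in> borel_measurable \<sigma>" "y j \<in> borel_measurable \<sigma>" for j
    using x(1) y(1) continuous_measurable_\<sigma>[OF x(3)] continuous_measurable_\<sigma>[OF y(3)] by (auto simp: square_integrable_def)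
  show ?thesis
  proof (rule hardy_spaceI[where g = "%j z. a * x j z + y j z"])
    show "square_integrable \<sigma> (%z. a * f z + g z)" by (rule square_integrable_lin[OF x(1) y(1)])
    show "holomorphic_several (%z. a * x j z + y j z) \<Omega>" for j by (rule holomorphic_several_lin[OF x(2) y(2)])
    show "continuous_on (closure \<Omega>) (%z. a * x j z + y j z)" for j by (intro continuous_intros x(3) y(3))
    show "(%j. a * x j z + y j z) \<longlonglongrightarrow> a * F z + G z" if "z \<in> \<Omega>" for z by (intro tendsto_intros x(5) y(5) that)
    have "(%j. energy (%z. a * (x j z - f z) + (y j z - g z))) \<longlonglongrightarrow> 0"
      by (rule tendsto_energy_lin[OF _ _ x(4) y(4)]) measurable
    then show "(%j. energy (%z. a * x j z + y j z - (a * f z + g z))) \<longlonglongrightarrow> 0"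
      by (simp add: algebra_simps)
  qed
qed

text \<open>The approximants have bounded energy from some index on, so they are locally bounded,
  and they converge pointwise.\<close>

lemma hardy_holomorphic:
  assumes f: "(f, F) \<in> H"
  shows "holomorphic_several F \<Omega>"
proof -
  obtain x where x: "square_integrable \<sigma> f" "\<And>j::nat. holomorphic_several (x j) \<Omega>" "\<And>j. continuous_on (closure \<Omega>) (x j)"
    "(%j. energy (%z. x j z - f z)) \<longlonglongrightarrow> 0" "\<And>z. z \<in> \<Omega> ==> (%j. x j z) \<longlonglongrightarrow> F z" using f by (rule hardy_spaceE) (rule that)
  have m: "f \<in> borel_measurable \<sigma>" "x j \<in> borel_measurable \<sigma>" for j
    using x(1) continuous_measurable_\<sigma>[OF x(3)] by (auto simp: square_integrable_def)
  have "eventually (%j. energy (%z. x j z - f z) < 1) sequentially"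
    using x(4) by (rule order_tendstoD(2)) simp
  then obtain N where N: "\<And>j. j >= N ==> energy (%z. x j z - f z) < 1" unfolding eventually_sequentially by blast
  define B where "B = 2 * 1 + 2 * nsq \<sigma> f"
  have en: "energy (x (j + N)) <= ennreal B" for j
  proof -
    have "energy (x (j + N)) <= 2 * energy (%z. x (j + N) z - f z) + 2 * energy f"
      using nn_integral_add_sq_le[of "%z. x (j + N) z - f z" \<sigma> f] m by (simp add: energy_def)
    also have "... <= 2 * 1 + 2 * ennreal (nsq \<sigma> f)"
      unfolding energy_nsq[OF x(1)] using N[of "j + N"] by (intro add_mono mult_left_mono) auto
    also have "... = ennreal B" by (simp add: B_def ennreal_plus ennreal_mult')
    finally show ?thesis .
  qed
  show ?thesis
  proof (rule locally_uniform_limit[OF open_\<Omega>, where F = "%j. x (j + N)"])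
    show "holomorphic_several (x (j + N)) \<Omega>" for j by (rule x(2))
    show "(%j. x (j + N) z) \<longlonglongrightarrow> F z" if "z \<in> \<Omega>" for z by (rule LIMSEQ_ignore_initial_segment[OF x(5)[OF that]])
    fix w assume "w \<in> \<Omega>"
    from hardy_local_evaluation[OF this] obtain r K where r: "r > 0" "K >= 0" "ball w r \<subseteq> \<Omega>"
      and ev: "\<forall>g z. holomorphic_several g \<Omega> --> continuous_on (closure \<Omega>) g --> z \<in> ball w r -->
        ennreal ((norm (g z))\<^sup>2) <= ennreal K * energy g" by (elim exE conjE)
    have "norm (x (j + N) z) <= sqrt (K * B)" if z: "z \<in> ball w r" for j z
    proof -
      have "ennreal ((norm (x (j + N) z))\<^sup>2) <= ennreal K * energy (x (j + N))"
        using ev[rule_format, OF x(2) x(3) z] .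
      also have "... <= ennreal K * ennreal B" by (intro mult_left_mono en) auto
      also have "... = ennreal (K * B)" using r(2) by (simp add: ennreal_mult')
      finally have "(norm (x (j + N) z))\<^sup>2 <= K * B"
        using r(2) by (subst (asm) ennreal_le_iff) (auto simp: B_def)
      then show ?thesis by (rule real_le_rsqrt)
    qed
    then show "\<exists>r>0. \<exists>B. ball w r \<subseteq> \<Omega> \<and> (\<forall>j. \<forall>z\<in>ball w r. norm (x (j + N) z) <= B)" using r by blast
  qed
qed

text \<open>Completeness is a diagonal argument: \<open>g k\<close>, continuous up to the boundary,
  is taken within energy 1/(k+1) of the k-th element and so has the same limit h in the mean. The
  evaluation bounds make \<open>g k\<close> converge at each point of \<Omega>, which supplies the
  partner of h.\<close>

lemma hardy_kernel_space: "kernel_space \<sigma> H \<Omega>"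
proof unfold_locales
  have "((%z. 0), (%z. 0)) \<in> H"
    by (rule hardy_spaceI[where g = "%j z. 0"])
       (auto simp: square_integrable_def energy_def intro: holomorphic_several_const)
  then show "H ~= {}" by blast
  show "square_integrable \<sigma> f" if "(f, F) \<in> H" for f F using that by (auto simp: hardy_space_def)
  show "(%z. a * f z + g z, %z. a * F z + G z) \<in> H" if "(f, F) \<in> H" "(g, G) \<in> H" for f F g G a
    using that by (rule hardy_lin)
  show "open \<Omega>" by (rule open_\<Omega>)
  show "holomorphic_several F \<Omega>" if "(f, F) \<in> H" for f F using that by (rule hardy_holomorphic)
  show "\<exists>r>0. \<exists>C\<ge>0. ball w r \<subseteq> \<Omega> \<and> (\<forall>f F z. (f, F) \<in> H --> z \<in> ball w r --> norm (F z) <= C * sqrt (nsq \<sigma> f))"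
    if "w \<in> \<Omega>" for w
  proof -
    from hardy_local_evaluation[OF that] obtain r K where r: "r > 0" "K >= 0" "ball w r \<subseteq> \<Omega>"
      and ev: "\<forall>g z. holomorphic_several g \<Omega> --> continuous_on (closure \<Omega>) g --> z \<in> ball w r -->
        ennreal ((norm (g z))\<^sup>2) <= ennreal K * energy g" by (elim exE conjE)
    have "norm (F z) <= sqrt (2 * K) * sqrt (nsq \<sigma> f)" if "(f, F) \<in> H" "z \<in> ball w r" for f F z
    proof -
      have "(norm (F z))\<^sup>2 <= 2 * K * nsq \<sigma> f"
        by (rule hardy_point_bound[OF that(1) _ r(2)]) (use that r ev in auto)
      then have "norm (F z) <= sqrt (2 * K * nsq \<sigma> f)" by (rule real_le_rsqrt)
      then show ?thesis by (simp add: real_sqrt_mult)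
    qed
    moreover have "sqrt (2 * K) >= 0" using r by simp
    ultimately show ?thesis using r by blast
  qed
  fix X assume X: "\<And>k. X k \<in> H" and cauchy: "l2_cauchy \<sigma> (%k. fst (X k))"
  define f where "f k = fst (X k)" for k
  define G where "G k = snd (X k)" for k
  have fH: "(f k, G k) \<in> H" for k using X[of k] by (simp add: f_def G_def)
  have fs: "square_integrable \<sigma> (f k)" for k using fH[of k] by (auto simp: hardy_space_def)
  obtain h where h: "square_integrable \<sigma> h" "(%k. nsq \<sigma> (%z. f k z - h z)) \<longlonglongrightarrow> 0"
    using l2_complete[of \<sigma> f] fs cauchy by (auto simp: f_def[abs_def])
  have "\<exists>g. holomorphic_several g \<Omega> \<and> continuous_on (closure \<Omega>) g \<and> energy (%z. g z - f k z) < ennreal (1 / real (Suc k))" for k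
  proof -
    obtain x where x: "\<And>j::nat. holomorphic_several (x j) \<Omega>" "\<And>j. continuous_on (closure \<Omega>) (x j)"
      "(%j. energy (%z. x j z - f k z)) \<longlonglongrightarrow> 0" using fH[of k] by (rule hardy_spaceE) (rule that)
    have "eventually (%j. energy (%z. x j z - f k z) < ennreal (1 / real (Suc k))) sequentially"
      using x(3) by (rule order_tendstoD(2)) simp
    then obtain j where "energy (%z. x j z - f k z) < ennreal (1 / real (Suc k))" using eventually_happens' sequentially_bot by blast
    then show ?thesis using x by blast
  qed
  then obtain g where g: "\<And>k. holomorphic_several (g k) \<Omega>" "\<And>k. continuous_on (closure \<Omega>) (g k)"
    "\<And>k. energy (%z. g k z - f k z) < ennreal (1 / real (Suc k))" by metis
  have m[measurable]: "f k \<in> borel_measurable \<sigma>" "h \<in> borel_measurable \<sigma>" "g k \<in> borel_measurable \<sigma>" for k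
    using fs[of k] h(1) continuous_measurable_\<sigma>[OF g(2)] by (auto simp: square_integrable_def)
  have e1: "(%k. energy (%z. g k z - f k z)) \<longlonglongrightarrow> 0"
  proof (rule tendsto_sandwich[OF _ _ tendsto_const])
    show "\<forall>\<^sub>F k in sequentially. energy (%z. g k z - f k z) <= ennreal (1 / real (Suc k))"
      using g(3) by (intro always_eventually allI less_imp_le)
    have "(%k. 1 / real (Suc k)) \<longlonglongrightarrow> 0" using LIMSEQ_inverse_real_of_nat by (simp add: inverse_eq_divide)
    then have "(%k. ennreal (1 / real (Suc k))) \<longlonglongrightarrow> ennreal 0" by (rule tendsto_ennrealI)
    then show "(%k. ennreal (1 / real (Suc k))) \<longlonglongrightarrow> 0" by simp
  qed auto
  have "(%k. ennreal (nsq \<sigma> (%z. f k z - h z))) \<longlonglongrightarrow> ennreal 0" using h(2) by (rule tendsto_ennrealI)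
  then have e2: "(%k. energy (%z. f k z - h z)) \<longlonglongrightarrow> 0"
    by (simp add: energy_nsq[OF square_integrable_diff[OF fs h(1)]])
  have e3: "(%k. energy (%z. g k z - h z)) \<longlonglongrightarrow> 0"
    using tendsto_energy_lin[OF _ _ e1 e2, of 1] by simp
  have conv: "convergent (%k. g k w)" if w: "w \<in> \<Omega>" for w
  proof -
    from hardy_local_evaluation[OF w] obtain r K where r: "r > 0" "K >= 0" "ball w r \<subseteq> \<Omega>"
      and ev: "\<forall>g z. holomorphic_several g \<Omega> --> continuous_on (closure \<Omega>) g --> z \<in> ball w r -->
        ennreal ((norm (g z))\<^sup>2) <= ennreal K * energy g" by (elim exE conjE)
    have "Cauchy (%k. g k w)"
    proof (rule metric_CauchyI)
      fix e :: real assume e: "e > 0"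
      define M where "M = K + 1"
      have M: "M > 0" using r by (simp add: M_def)
      \<comment> \<open>Chosen so that \<open>M * (4 * \<delta>) = e^2 / 2\<close>; M exceeds K to
        be positive.\<close>
      define \<delta> where "\<delta> = e\<^sup>2 / (8 * M)"
      have \<delta>: "\<delta> > 0" using e M by (simp add: \<delta>_def)
      have "eventually (%k. energy (%z. g k z - h z) < ennreal \<delta>) sequentially"
        using e3 by (rule order_tendstoD(2)) (use \<delta> in simp)
      then obtain N where N: "\<And>k. k >= N ==> energy (%z. g k z - h z) < ennreal \<delta>" unfolding eventually_sequentially by blast
      have "dist (g k w) (g l w) < e" if kl: "k >= N" "l >= N" for k l
      proof -
        have hol: "holomorphic_several (%z. g k z - g l z) \<Omega>"
          using holomorphic_several_lin[OF g(1)[of l] g(1)[of k], of "-1"] by simp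
        have "energy (%z. g k z - g l z) <= 2 * energy (%z. g k z - h z) + 2 * energy (%z. h z - g l z)"
          using nn_integral_add_sq_le[of "%z. g k z - h z" \<sigma> "%z. h z - g l z"] by (simp add: energy_def)
        also have "energy (%z. h z - g l z) = energy (%z. g l z - h z)" by (simp add: energy_def norm_minus_commute)
        also have "2 * energy (%z. g k z - h z) + 2 * energy (%z. g l z - h z) <= 2 * ennreal \<delta> + 2 * ennreal \<delta>"
          using N[OF kl(1)] N[OF kl(2)] by (intro add_mono mult_left_mono) auto
        also have "... = ennreal (4 * \<delta>)" using \<delta> by (simp add: ennreal_mult' flip: distrib_right)
        finally have en: "energy (%z. g k z - g l z) <= ennreal (4 * \<delta>)" .
        have "ennreal ((norm (g k w - g l w))\<^sup>2) <= ennreal K * energy (%z. g k z - g l z)"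
          by (rule ev[rule_format, OF hol]) (use g(2) r in \<open>auto intro!: continuous_intros\<close>)
        also have "... <= ennreal K * ennreal (4 * \<delta>)" by (intro mult_left_mono en) auto
        also have "... = ennreal (K * (4 * \<delta>))" using r(2) by (rule ennreal_mult'[symmetric])
        finally have "(norm (g k w - g l w))\<^sup>2 <= K * (4 * \<delta>)"
          using r(2) \<delta> by (subst (asm) ennreal_le_iff) auto
        also have "... <= M * (4 * \<delta>)" using \<delta> by (intro mult_right_mono) (auto simp: M_def)
        also have "... = e\<^sup>2 / 2" using M by (simp add: \<delta>_def)
        also have "... < e\<^sup>2" using e by simp
        finally show ?thesis using e by (simp add: dist_norm power2_less_imp_less)
      qed
      then show "\<exists>N. \<forall>k\<ge>N. \<forall>l\<ge>N. dist (g k w) (g l w) < e" by blast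
    qed
    then show ?thesis by (rule Cauchy_convergent)
  qed
  have "(h, %w. lim (%k. g k w)) \<in> H"
    by (rule hardy_spaceI[OF h(1) g(1,2) e3]) (use conv in \<open>simp add: convergent_LIMSEQ_iff\<close>)
  then show "\<exists>h F. (h, F) \<in> H \<and> (%k. nsq \<sigma> (%z. fst (X k) z - h z)) \<longlonglongrightarrow> 0"
    using h(2) by (auto simp: f_def)
qed

end

section \<open>Upper bound for the Szegoe kernel at the base point\<close>

section \<open>The Szegoe kernel at the base point\<close>

locale thin_szego = thin i \<alpha> p1 for i :: "'n::finite" and \<alpha> p1 :: real +
  fixes c :: real
  assumes c0: "c > 0"
begin

sublocale sz: annular i "\<alpha>\<^sup>2" c
  using params(4,5) c0 by unfold_locales (auto simp: \<epsilon>_def)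

lemma sz_\<Omega>: "sz.\<Omega> = \<Omega>" by (simp add: sz.\<Omega>_def \<Omega>_def \<epsilon>_def)

sublocale hardy: kernel_space sz.\<sigma> sz.H sz.\<Omega> by (rule sz.hardy_kernel_space)

text \<open>On the inner sheet near the base point a is of order \<epsilon>, so that the power
  1/(n+1) in the Fefferman density turns \<open>a ^ n\<close> into something of order \<epsilon> /
  Y.\<close>

definition Y where "Y = \<epsilon> powr (1 / (real CARD('n) + 1))"

lemma Y: "Y > 0" "\<alpha> <= Y" "(\<epsilon> ^ CARD('n)) powr (1 / (real CARD('n) + 1)) = \<epsilon> / Y"
proof -
  show "Y > 0" using params(4) by (simp add: Y_def)
  have "CARD('n) >= 1" using zero_less_card_finite[where 'a = 'n] by linarith
  then have n: "1 / (real CARD('n) + 1) <= 1/2" by (simp add: field_simps)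
  have "\<alpha> = \<epsilon> powr (1/2)" using params(1) by (simp add: \<epsilon>_def powr_half_sqrt)
  also have "... <= Y" unfolding Y_def using params(4,5) n by (intro powr_mono') auto
  finally show "\<alpha> <= Y" .
  have "(\<epsilon> ^ CARD('n)) powr (1 / (real CARD('n) + 1)) = \<epsilon> powr (real CARD('n) * (1 / (real CARD('n) + 1)))"
    using params(4) by (simp add: powr_powr flip: powr_realpow)
  also have "real CARD('n) * (1 / (real CARD('n) + 1)) = 1 - 1 / (real CARD('n) + 1)" by (simp add: field_simps)
  also have "\<epsilon> powr \<dots> = \<epsilon> / Y" using params(4) by (simp add: powr_diff Y_def)
  finally show "(\<epsilon> ^ CARD('n)) powr (1 / (real CARD('n) + 1)) = \<epsilon> / Y" .
qed

lemma powr_exponent: "0 <= 1 / (real CARD('n) + 1)" "1 / (real CARD('n) + 1) <= 1"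
  by (simp_all add: field_simps)

text \<open>The evaluation estimate with the constants of both sheets. Outer sheet: modulus at least
  1/2, density at least 1/12, kernel at most 2, contribution 96. Inner sheet: modulus at least
  \<alpha>, density at least \<open>\<alpha> / (10 * Y)\<close>, kernel at most
  \<open>4 * p1\<close>, contribution \<open>160 * (Y / \<alpha>)\<close>. The second dominates
  since \<open>\<alpha> <= Y\<close>.\<close>

lemma szego_kernel_bound:
  "nsq sz.\<sigma> (hardy.kf p) <= 1024 * hausdorff_const TYPE('n) i / (measure lborel (ring i (0 :: complex ^ 'n) 1 2 (1/4)) * c) * (Y / \<alpha>)"
proof -
  let ?V = "measure lborel (ring i (0 :: complex ^ 'n) 1 2 (1/4))" and ?k = "hausdorff_const TYPE('n) i"
  let ?n = "1 / (real CARD('n) + 1)"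
  have V: "?V > 0" by (rule measure_ring_pos) auto
  have k: "?k > 0" by (rule hausdorff_const_pos)
  have a0: "\<alpha> > 0" by (rule params)
  have e2: "\<alpha>\<^sup>2 = \<epsilon>" by (simp add: \<epsilon>_def)
  have pi: "p $ i = of_real p1" by (simp add: p_def)
  have ip: "ins i 0 (z - p) = ins i 0 z" for z by (simp add: vec_eq_iff p_def)
  define K where "K = 2 * ?k / (?V * c) * (2\<^sup>2 / ((1/2) * (1/12)) + (4 * p1)\<^sup>2 / (\<alpha> * (\<alpha> / (10 * Y))))"
  have K0: "K >= 0" unfolding K_def using V k c0 a0 Y(1) by simp
  have ev: "ennreal ((norm (g p))\<^sup>2) <= ennreal K * sz.energy g"
    if g: "holomorphic_several g sz.\<Omega>" "continuous_on (closure sz.\<Omega>) g" for g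
    unfolding K_def measure_ring_translate[of i p 1 2 "1/4", symmetric]
  proof (rule sz.hardy_evaluation[OF g])
    show "(0::real) < 1/4" "(0::real) < 1/2" "(0::real) < 1/12" "(0::real) < 2" "0 < \<alpha>" "0 < \<alpha> / (10 * Y)" "0 < 4 * p1"
      using a0 Y(1) p1 by auto
    show cyl: "ins i (p $ i) z \<in> sz.\<Omega>" if "norm (ins i 0 (z - p)) < 1/4" for z
      unfolding sz_\<Omega> pi by (rule slab_subset) (use that p1 params in \<open>auto simp: ip\<close>)
    fix z assume z: "z \<in> ring i p 1 2 (1/4)"
    have zi: "norm (ins i 0 z) < 1/4" using z by (simp add: ring_def ip)
    have z0: "norm (z $ i) ~= 0" using z by (auto simp: ring_def)
    have inO: "ins i (p $ i) z \<in> sz.\<Omega>" by (rule cyl) (use zi in \<open>simp add: ip\<close>)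
    note sl = sz.slice[OF inO]
    let ?P = "sz.A_out z" and ?M = "sz.A_in z"
    have "(norm (ins i 0 z))\<^sup>2 <= (1/4)\<^sup>2" using zi by (intro power_mono) auto
    then have b: "?P + ?M >= 15/16" "?P + ?M <= 1" unfolding sl(1) by (simp_all add: power2_eq_square)
    \<comment> \<open>The larger root is at least half of the sum, and the product \<epsilon> then
      confines the smaller root to [\<epsilon>, 3 \<epsilon>].\<close>
    have P: "15/32 <= ?P" "?P <= 1" using b sl(3,4) by linarith+
    have "?M * (15/32) <= ?M * ?P" using P sl(3) by (intro mult_left_mono) auto
    then have M: "?M <= 3 * \<epsilon>" using sl(2) sl(3) by (simp add: e2 mult.commute)
    have "\<epsilon> = ?M * ?P" using sl(2) by (simp add: e2 mult.commute)
    also have "... <= ?M * 1" using P sl(3) by (intro mult_left_mono) auto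
    finally have M2: "\<epsilon> <= ?M" by simp
    have nT: "norm (sz.T_out z $ i) = sqrt ?P" "norm (sz.T_in z $ i) = sqrt ?M"
      using z0 sl(3,4) by (simp_all add: sz.radial_nth norm_mult norm_divide)
    have TS: "sz.T_out z \<in> sz.S" "sz.T_in z \<in> sz.S"
      using sl(8)[of "sz.T_out z $ i"] sl(8)[of "sz.T_in z $ i"] nT by (simp_all add: radial_def)
    have np: "norm (p $ i) = p1" using p1 by (simp add: pi)
    have sq: "(norm (sz.T_out z $ i))\<^sup>2 = ?P" "(norm (sz.T_in z $ i))\<^sup>2 = ?M"
      unfolding nT using sl(3,4) by simp_all
    have n1: "1 - (norm (sz.T_out z))\<^sup>2 = ?M" "1 - (norm (sz.T_in z))\<^sup>2 = ?P"
    proof -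
      have "ins i 0 (radial i \<tau> z) = ins i 0 z" for \<tau> by (simp add: vec_eq_iff radial_def)
      then show "1 - (norm (sz.T_out z))\<^sup>2 = ?M" "1 - (norm (sz.T_in z))\<^sup>2 = ?P"
        using norm_sq_split[of "sz.T_out z" i] norm_sq_split[of "sz.T_in z" i] sl(1) sq by simp_all
    qed
    have e4: "4 * \<alpha>\<^sup>2 <= 1/256" unfolding e2 using params by simp
    show "1/2 <= norm (sz.T_out z $ i) \<and> 1/12 <= fdens i (sz.T_out z)
      \<and> norm (sz.T_out z $ i) <= 2 * norm (sz.T_out z $ i - p $ i)"
    proof (intro conjI)
      show h: "1/2 <= norm (sz.T_out z $ i)"
        unfolding nT using P by (intro real_le_rsqrt) (simp add: power2_eq_square)
      have "norm (sz.T_out z $ i) - p1 <= norm (sz.T_out z $ i - p $ i)"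
        using norm_triangle_ineq2[of "sz.T_out z $ i" "p $ i"] np by simp
      then show "norm (sz.T_out z $ i) <= 2 * norm (sz.T_out z $ i - p $ i)" using h p1 by linarith
      have F: "((1/4) ^ (CARD('n) + 1)) powr ?n / (2 * sqrt (2 * 1)) <= fdens i (sz.T_out z)"
      proof (rule sz.fdens_lower[OF TS(1)])
        show "(norm (sz.T_out z $ i))\<^sup>2 <= 1" using nT P by simp
        have "(1/4 :: real) ^ CARD('n) * (1/4) <= ?P ^ CARD('n) * (?P + ?M - 4 * \<alpha>\<^sup>2)"
          using P b e4 by (intro mult_mono power_mono) auto
        then show "(1/4) ^ (CARD('n) + 1) <= ((norm (sz.T_out z $ i))\<^sup>2) ^ CARD('n)
            * ((norm (sz.T_out z $ i))\<^sup>2 + (1 - (norm (sz.T_out z))\<^sup>2) - 4 * \<alpha>\<^sup>2)"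
          unfolding sq n1 by simp
      qed auto
      have E: "((1/4 :: real) ^ (CARD('n) + 1)) powr ?n = 1/4"
      proof -
        have "((1/4 :: real) ^ (CARD('n) + 1)) powr ?n = (1/4) powr (real (CARD('n) + 1) * ?n)"
          by (subst powr_realpow[symmetric]) (auto simp only: powr_powr)
        moreover have "real (CARD('n) + 1) * ?n = 1" by (simp add: field_simps)
        moreover have "(1/4 :: real) powr 1 = 1/4" by simp
        ultimately show ?thesis by (simp only:)
      qed
      have "sqrt (2 * 1) <= 3/2" by (rule real_le_lsqrt) (auto simp: power2_eq_square)
      then have L: "1/12 <= 1/4 / (2 * sqrt (2 * 1 :: real))" by (simp add: field_simps)
      show "1/12 <= fdens i (sz.T_out z)" using F unfolding E by (rule order_trans[OF L])
    qed
    show "\<alpha> <= norm (sz.T_in z $ i) \<and> \<alpha> / (10 * Y) <= fdens i (sz.T_in z)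
      \<and> norm (sz.T_in z $ i) <= 4 * p1 * norm (sz.T_in z $ i - p $ i)"
    proof (intro conjI)
      show "\<alpha> <= norm (sz.T_in z $ i)" unfolding nT using M2 by (intro real_le_rsqrt) (simp add: e2)
      have h: "norm (sz.T_in z $ i) <= 2 * \<alpha>"
        unfolding nT using M a0 params(4) by (intro real_le_lsqrt) (auto simp: power_mult_distrib e2 sl(3) less_imp_le)
      \<comment> \<open>The inner circle has radius at most \<open>2 * \<alpha> <= p1 / 4\<close>,
        so its distance from p is at least \<open>p1 / 2\<close> and the kernel is at most
        \<open>4 * \<alpha> / p1 = 4 * p1\<close>.\<close>
      have "p1 - norm (sz.T_in z $ i) <= norm (sz.T_in z $ i - p $ i)"
        using norm_triangle_ineq2[of "p $ i" "sz.T_in z $ i"] np by (simp add: norm_minus_commute)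
      then have "p1 / 2 <= norm (sz.T_in z $ i - p $ i)" using h params(2) p1 by linarith
      then have "4 * p1 * (p1 / 2) <= 4 * p1 * norm (sz.T_in z $ i - p $ i)" using p1 by (intro mult_left_mono) auto
      then show "norm (sz.T_in z $ i) <= 4 * p1 * norm (sz.T_in z $ i - p $ i)" using h by (simp add: \<alpha> power2_eq_square)
      have "(\<epsilon> ^ CARD('n) * (1/2)) powr ?n / (2 * sqrt (2 * (3 * \<epsilon>))) <= fdens i (sz.T_in z)"
      proof (rule sz.fdens_lower[OF TS(2)])
        show "(norm (sz.T_in z $ i))\<^sup>2 <= 3 * \<epsilon>" using nT M sl(3) by simp
        show "0 <= \<epsilon> ^ CARD('n) * (1/2)" using params(4) by simp
        have "\<epsilon> ^ CARD('n) * (1/2) <= ?M ^ CARD('n) * (?P + ?M - 4 * \<alpha>\<^sup>2)"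
          using M2 b e4 params(4) by (intro mult_mono power_mono) auto
        then show "\<epsilon> ^ CARD('n) * (1/2) <= ((norm (sz.T_in z $ i))\<^sup>2) ^ CARD('n)
            * ((norm (sz.T_in z $ i))\<^sup>2 + (1 - (norm (sz.T_in z))\<^sup>2) - 4 * \<alpha>\<^sup>2)"
          unfolding sq n1 by (simp add: add.commute)
      qed
      moreover have "\<alpha> / (10 * Y) <= (\<epsilon> ^ CARD('n) * (1/2)) powr ?n / (2 * sqrt (2 * (3 * \<epsilon>)))"
      proof -
        have "(1/2 :: real) powr 1 <= (1/2) powr ?n" using powr_exponent by (intro powr_mono') auto
        then have "\<epsilon> / Y * (1/2) <= \<epsilon> / Y * (1/2) powr ?n"
          using Y(1) params(4) by (intro mult_left_mono) auto
        also have "... = (\<epsilon> ^ CARD('n) * (1/2)) powr ?n"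
          unfolding Y(3)[symmetric] by (rule powr_mult[symmetric]; use params(4) in simp)
        finally have J: "\<epsilon> / Y * (1/2) <= (\<epsilon> ^ CARD('n) * (1/2)) powr ?n" .
        have s: "sqrt (2 * (3 * \<epsilon>)) <= 5/2 * \<alpha>" using a0
          by (intro real_le_lsqrt) (auto simp: \<epsilon>_def power_mult_distrib power2_eq_square)
        have "\<alpha> / (10 * Y) = (\<epsilon> / Y * (1/2)) / (2 * (5/2 * \<alpha>))" using a0 by (simp add: \<epsilon>_def power2_eq_square)
        also have "... <= (\<epsilon> ^ CARD('n) * (1/2)) powr ?n / (2 * sqrt (2 * (3 * \<epsilon>)))"
          using J s params(4) by (intro frac_le) auto
        finally show ?thesis .
      qed
      ultimately show "\<alpha> / (10 * Y) <= fdens i (sz.T_in z)" by linarith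
    qed
  qed
  \<comment> \<open>The factor 2 is that of \<open>hardy_point_bound\<close>; with 96 + 160 = 256 it
    leads to 1024 = 2 * 2 * 256.\<close>
  have "nsq sz.\<sigma> (hardy.kf p) <= 2 * K"
  proof (rule hardy.nsq_kf_le)
    show "p \<in> sz.\<Omega>" unfolding sz_\<Omega> by (rule p_in)
    show "2 * K >= 0" using K0 by simp
    show "(norm (F p))\<^sup>2 <= 2 * K * nsq sz.\<sigma> f" if "(f, F) \<in> sz.H" for f F
      by (rule sz.hardy_point_bound[OF that _ K0 ev]) (simp_all add: sz_\<Omega> p_in)
  qed
  also have "2 * K = 2 * (2 * ?k / (?V * c)) * (96 + 160 * (Y / \<alpha>))"
  proof -
    have "(4 * p1)\<^sup>2 = 16 * \<alpha>" by (simp add: \<alpha> power_mult_distrib)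
    then have "(4 * p1)\<^sup>2 / (\<alpha> * (\<alpha> / (10 * Y))) = 160 * (Y / \<alpha>)" using a0 Y(1) by (simp add: field_simps)
    then show ?thesis unfolding K_def by simp
  qed
  also have "... <= 2 * (2 * ?k / (?V * c)) * (256 * (Y / \<alpha>))"
  proof (intro mult_left_mono)
    have "1 <= Y / \<alpha>" using Y(2) a0 by simp
    then show "96 + 160 * (Y / \<alpha>) <= 256 * (Y / \<alpha>)" by simp
  qed (use k V c0 in auto)
  finally show ?thesis by (simp add: mult_ac)
qed

end

section \<open>Surface measure from above by counting grid cells\<close>

section \<open>Hausdorff measure of monotone hypersurfaces\<close>

text \<open>Minkowski content. The \<delta>-balls about a largest 2 \<delta>-separated subset of A
  are disjoint and lie in N, which bounds their number by a multiple of \<open>\<delta>\<close> to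
  the power -d; since no point can be added, the balls of radius 2 \<delta> cover A.\<close>

lemma hausdorff_outer_measure_le_neighbourhood:
  fixes A :: "'a::euclidean_space set"
  assumes d: "d >= 1" "DIM('a) = Suc d" and \<delta>0: "\<delta>0 > 0" and B: "B >= 0"
    and cov: "\<And>\<delta>. 0 < \<delta> ==> \<delta> < \<delta>0 ==> \<exists>N\<in>sets borel. (\<Union>x\<in>A. ball x \<delta>) \<subseteq> N \<and> emeasure lborel N <= ennreal (B * \<delta>)"
  shows "hausdorff_outer_measure d A <= ennreal (unit_ball_vol (real d) * 2 ^ d * (B / unit_ball_vol (real (Suc d))))"
proof (rule hausdorff_outer_measure_le_card[OF d(1) \<delta>0])
  fix \<delta> :: real assume \<delta>: "0 < \<delta>" "\<delta> < \<delta>0"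
  let ?w = "unit_ball_vol (real (Suc d))"
  have w: "?w > 0" by (rule unit_ball_vol_pos) (rule of_nat_0_le_iff)
  obtain N where N: "N \<in> sets borel" "(\<Union>x\<in>A. ball x \<delta>) \<subseteq> N" "emeasure lborel N <= ennreal (B * \<delta>)"
    using cov[OF \<delta>] by blast
  define P where "P F \<longleftrightarrow> finite F \<and> F \<subseteq> A \<and> (\<forall>x\<in>F. \<forall>y\<in>F. x ~= y --> 2 * \<delta> <= dist x y)" for F
  have card: "real (card F) * \<delta> ^ d <= B / ?w" if F: "P F" for F
  proof -
    have "disjoint_family_on (%x. ball x \<delta>) F"
      unfolding disjoint_family_on_def
    proof (intro ballI impI)
      fix x y assume xy: "x \<in> F" "y \<in> F" "x ~= y"
      then have "2 * \<delta> <= dist x y" using F by (auto simp: P_def)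
      then show "ball x \<delta> \<inter> ball y \<delta> = {}" by (intro disjoint_ballI) simp
    qed
    then have "(\<Sum>x\<in>F. emeasure lborel (ball x \<delta>)) = emeasure lborel (\<Union>x\<in>F. ball x \<delta>)"
      using F by (intro sum_emeasure) (auto simp: P_def)
    also have "... <= emeasure lborel N" using N F by (intro emeasure_mono) (auto simp: P_def)
    also have "... <= ennreal (B * \<delta>)" by (rule N)
    finally have "(\<Sum>x\<in>F. emeasure lborel (ball x \<delta>)) <= ennreal (B * \<delta>)" .
    moreover have "emeasure lborel (ball x \<delta>) = ennreal (?w * \<delta> ^ Suc d)" for x :: 'a
      using emeasure_ball[of \<delta> x] \<delta> d by simp
    ultimately have "ennreal (real (card F) * (?w * \<delta> ^ Suc d)) <= ennreal (B * \<delta>)"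
      using w \<delta> by (simp add: ennreal_mult ennreal_of_nat_eq_real_of_nat)
    then have "real (card F) * (?w * \<delta> ^ Suc d) <= B * \<delta>" using B \<delta> by (simp add: ennreal_le_iff)
    then have "(real (card F) * ?w * \<delta> ^ d) * \<delta> <= B * \<delta>" by (simp add: mult_ac)
    then have "real (card F) * ?w * \<delta> ^ d <= B" using \<delta> by simp
    then show ?thesis using w by (simp add: field_simps)
  qed
  \<comment> \<open>A bound on all cardinalities, so that a largest separated set exists.\<close>
  define bd where "bd = nat \<lceil>B / ?w / \<delta> ^ d\<rceil>"
  have bd: "card F <= bd" if "P F" for F
  proof -
    have dp: "\<delta> ^ d > 0" using \<delta> by simp
    have "real (card F) <= B / ?w / \<delta> ^ d" unfolding pos_le_divide_eq[OF dp] by (rule card[OF that])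
    then show ?thesis unfolding bd_def by linarith
  qed
  have "P {}" by (simp add: P_def)
  moreover have "\<forall>F. P F --> card F < Suc bd" using bd by (auto simp: less_Suc_eq_le)
  ultimately obtain F where F: "P F" "\<And>G. P G ==> card G <= card F"
    using ex_has_greatest_nat[of P "{}" card "Suc bd"] by blast
  have "A \<subseteq> (\<Union>x\<in>F. cball x (2 * \<delta>))"
  proof
    fix z assume z: "z \<in> A"
    show "z \<in> (\<Union>x\<in>F. cball x (2 * \<delta>))"
    proof (rule ccontr)
      assume "z \<notin> (\<Union>x\<in>F. cball x (2 * \<delta>))"
      then have n: "\<And>x. x \<in> F ==> 2 * \<delta> < dist x z" by auto
      then have zF: "z \<notin> F" using \<delta> by force
      have "P (insert z F)"
        using F(1) z n unfolding P_def by (auto simp: dist_commute less_imp_le)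
      from F(2)[OF this] show False using F(1) zF by (simp add: P_def)
    qed
  qed
  then show "\<exists>F. finite F \<and> A \<subseteq> (\<Union>x\<in>F. cball x (2 * \<delta>)) \<and> real (card F) * \<delta> ^ d <= B / ?w"
    using F(1) card[OF F(1)] by (auto simp: P_def)
qed simp

lemma power_diff_le:
  fixes x y :: real
  assumes "0 <= x" "x <= y"
  shows "y ^ Suc m - x ^ Suc m <= real (Suc m) * (y - x) * y ^ m"
proof (induction m)
  case (Suc m)
  have "y ^ Suc (Suc m) - x ^ Suc (Suc m) = y * (y ^ Suc m - x ^ Suc m) + x ^ Suc m * (y - x)" by (simp add: algebra_simps)
  also have "... <= y * (real (Suc m) * (y - x) * y ^ m) + y ^ Suc m * (y - x)"
    using Suc assms by (intro add_mono mult_left_mono mult_right_mono power_mono) auto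
  also have "... = real (Suc (Suc m)) * (y - x) * y ^ Suc m" by (simp add: algebra_simps)
  finally show ?case .
qed simp

text \<open>A product of two shells that contains the \<delta>-ball about every point whose pair of
  moduli lies in the grid square (k, j). The offset 3/2 instead of 1 keeps the lower limits away
  from 0 for every integer, as the volume formula for polycylinders is for positive radii.\<close>

definition cell :: "'n => real => nat => nat => (complex ^ 'n) set" where
  "cell i \<delta> k j = {z. (real k - 3/2) * \<delta> < norm (z $ i) \<and> norm (z $ i) <= (real k + 2) * \<delta>
     \<and> (real j - 3/2) * \<delta> < norm (ins i 0 z) \<and> norm (ins i 0 z) <= (real j + 2) * \<delta>}"

text \<open>Bounds, per \<delta>, the increment of \<open>B ^ (2 * (n - 1))\<close> over a shell of
  width at most \<open>7/2 * \<delta>\<close> with \<open>B <= 3\<close>. For n = 1 that factor is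
  an indicator, bounded by 1 with no gain of \<delta>.\<close>

definition cell_const :: "nat => real" where
  "cell_const n = (if n = 1 then 1 else 7 * real (2 * (n - 1)) * 3 ^ (2 * (n - 1) - 1))"

text \<open>Inclusion and exclusion of polycylinders makes the volume a product. The shell in
  coordinate i has area of order \<beta> \<delta>; the shell in the other coordinates gives a
  further \<delta> unless n = 1.\<close>

lemma measure_cell:
  fixes i :: "'n::finite" and k j :: nat
  assumes \<delta>: "0 < \<delta>" "\<delta> <= 1" and kj: "(real k + 2) * \<delta> <= 3 * \<beta>" "(real j + 2) * \<delta> <= 3"
  shows "cell i \<delta> k j \<in> sets borel"
    "emeasure lborel (cell i \<delta> k j :: (complex ^ 'n) set) \<le>
      ennreal (21 * polycyl_vol TYPE('n) i * cell_const CARD('n) * \<beta> * \<delta> * (if CARD('n) = 1 then 1 else \<delta>))"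
proof -
  let ?V = "polycyl_vol TYPE('n) i" and ?P = "polycyl i (0 :: complex ^ 'n)" and ?m = "2 * (CARD('n) - 1)"
  have V: "?V > 0" by (rule polycyl_vol_pos)
  define A1 A2 B1 B2 where "A1 = (real k - 3/2) * \<delta>" and "A2 = (real k + 2) * \<delta>"
    and "B1 = (real j - 3/2) * \<delta>" and "B2 = (real j + 2) * \<delta>"
  have h: "real l ~= 3/2" for l :: nat
  proof
    assume "real l = 3/2" then have "real (2 * l) = real 3" by simp
    then have "2 * l = 3" by (simp only: of_nat_eq_iff)
    then show False by presburger
  qed
  have AB: "A1 < A2" "B1 < B2" "A2 > 0" "B2 > 0" "A1 ~= 0" "B1 ~= 0"
    using \<delta> h[of k] h[of j] unfolding A1_def A2_def B1_def B2_def by (auto intro!: mult_strict_right_mono)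
  \<comment> \<open>A negative radius gives the empty set, although for n = 1 the exponent is 0 and
    the power would be 1.\<close>
  define W where "W B = (if B < 0 then 0 else B ^ ?m)" for B :: real
  define A1' where "A1' = max A1 0"
  have M: "measure lborel (?P A B) = (max A 0)\<^sup>2 * W B * ?V" if "A ~= 0" "B ~= 0" for A B
  proof (cases "A < 0 \<or> B < 0")
    case True
    have "z \<notin> ?P A B" for z
      using True norm_ge_zero[of "z $ i - 0 $ i"] norm_ge_zero[of "ins i 0 (z - 0)"] unfolding polycyl_def mem_Collect_eq by linarith
    then have "?P A B = {}" by blast
    then show ?thesis using True by (auto simp: W_def max_def)
  next
    case False
    then show ?thesis using that V emeasure_polycyl[of A B i 0] by (simp add: measure_def W_def max_def)
  qed
  have fm: "?P A B \<in> fmeasurable lborel" for A B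
    using emeasure_polycyl_finite[of i 0 A B] by (intro fmeasurableI) auto
  have c: "cell i \<delta> k j = ?P A2 B2 - (?P A1 B2 \<union> ?P A2 B1)"
    by (auto simp: cell_def polycyl_def A1_def A2_def B1_def B2_def)
  show "cell i \<delta> k j \<in> sets borel" unfolding c by auto
  have sub: "?P A1 B2 \<union> ?P A2 B1 \<subseteq> ?P A2 B2" using AB by (auto simp: polycyl_def)
  have int: "?P A1 B2 \<inter> ?P A2 B1 = ?P A1 B1" using AB by (auto simp: polycyl_def)
  have "measure lborel (cell i \<delta> k j) = measure lborel (?P A2 B2) - measure lborel (?P A1 B2 \<union> ?P A2 B1)"
    unfolding c using fm sub by (intro measurable_measure_Diff) auto
  also have "measure lborel (?P A1 B2 \<union> ?P A2 B1) = measure lborel (?P A1 B2) + measure lborel (?P A2 B1) - measure lborel (?P A1 B1)"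
    unfolding int[symmetric] using fm by (intro measure_Un3) auto
  finally have "measure lborel (cell i \<delta> k j) = (A2\<^sup>2 - A1'\<^sup>2) * (W B2 - W B1) * ?V"
    using AB by (simp add: M A1'_def max_def algebra_simps)
  also have "... <= (21 * \<beta> * \<delta>) * (cell_const CARD('n) * (if CARD('n) = 1 then 1 else \<delta>)) * ?V"
  proof (intro mult_right_mono mult_mono)
    have A: "A1' <= A2" "0 <= A1'" "A2 - A1' <= 7/2 * \<delta>"
      using AB \<delta> by (auto simp: A1'_def A1_def A2_def algebra_simps max_def)
    have "A2\<^sup>2 - A1'\<^sup>2 = (A2 - A1') * (A2 + A1')" by (simp add: power2_eq_square algebra_simps)
    also have "... <= (7/2 * \<delta>) * (2 * (3 * \<beta>))" using A kj AB(3) \<delta> unfolding A2_def[symmetric] by (intro mult_mono) auto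
    finally show "A2\<^sup>2 - A1'\<^sup>2 <= 21 * \<beta> * \<delta>" by (simp add: mult_ac)
    have "A2 <= 3 * \<beta>" using kj by (simp add: A2_def)
    then show "0 <= 21 * \<beta> * \<delta>" using AB(3) \<delta> by simp
    show "0 <= W B2 - W B1" using AB by (auto simp: W_def intro!: power_mono)
    show "W B2 - W B1 <= cell_const CARD('n) * (if CARD('n) = 1 then 1 else \<delta>)"
    proof (cases "CARD('n) = 1")
      case True
      then show ?thesis by (auto simp: W_def cell_const_def)
    next
      case False
      then have "CARD('n) >= 2" using zero_less_card_finite[where 'a = 'n] by linarith
      then have "?m = Suc (?m - 1)" by linarith
      then obtain m where m: "?m = Suc m" by blast
      define B1' where "B1' = max B1 0"
      have W: "W B1 = B1' ^ Suc m" "W B2 = B2 ^ Suc m" unfolding W_def m B1'_def using AB by (auto simp: max_def)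
      have B: "B1' <= B2" "0 <= B1'" "B2 - B1' <= 7/2 * \<delta>"
        using AB \<delta> by (auto simp: B1'_def B1_def B2_def algebra_simps max_def)
      have "W B2 - W B1 <= real (Suc m) * (B2 - B1') * B2 ^ m" unfolding W by (rule power_diff_le[OF B(2,1)])
      also have "... <= real (Suc m) * (7/2 * \<delta>) * 3 ^ m"
        using B kj(2) AB(4) \<delta> unfolding B2_def[symmetric] by (intro mult_mono power_mono) auto
      also have "... <= cell_const CARD('n) * \<delta>"
        using False \<delta> unfolding cell_const_def m by simp
      finally show ?thesis using False by simp
    qed
  qed (use V in auto)
  finally have "measure lborel (cell i \<delta> k j) <= 21 * ?V * cell_const CARD('n) * \<beta> * \<delta> * (if CARD('n) = 1 then 1 else \<delta>)"
    by (simp add: mult_ac split: if_splits)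
  moreover have "emeasure lborel (cell i \<delta> k j) = ennreal (measure lborel (cell i \<delta> k j))"
    unfolding c using fm by (intro emeasure_eq_measure2 fmeasurableD2[where M = lborel] fmeasurable.Diff) auto
  ultimately show "emeasure lborel (cell i \<delta> k j :: (complex ^ 'n) set) \<le>
      ennreal (21 * ?V * cell_const CARD('n) * \<beta> * \<delta> * (if CARD('n) = 1 then 1 else \<delta>))" by (simp add: ennreal_leI)
qed

lemma ball_subset_cell:
  assumes \<delta>: "\<delta> > 0" and x: "dist z x < \<delta>"
  shows "x \<in> cell i \<delta> (nat \<lfloor>norm (z $ i) / \<delta>\<rfloor>) (nat \<lfloor>norm (ins i 0 z) / \<delta>\<rfloor>)"
proof -
  have key: "(real (nat \<lfloor>a / \<delta>\<rfloor>) - 3/2) * \<delta> < b \<and> b <= (real (nat \<lfloor>a / \<delta>\<rfloor>) + 2) * \<delta>"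
    if "a >= 0" "\<bar>b - a\<bar> < \<delta>" for a b :: real
  proof -
    have "a / \<delta> >= 0" using that \<delta> by simp
    then have k: "real (nat \<lfloor>a / \<delta>\<rfloor>) <= a / \<delta>" "a / \<delta> < real (nat \<lfloor>a / \<delta>\<rfloor>) + 1" by (auto simp: of_nat_nat)
    then have "real (nat \<lfloor>a / \<delta>\<rfloor>) * \<delta> <= a" "a < (real (nat \<lfloor>a / \<delta>\<rfloor>) + 1) * \<delta>"
      using \<delta> by (simp_all add: pos_le_divide_eq pos_divide_less_eq)
    then show ?thesis using that(2) \<delta> by (auto simp: algebra_simps abs_less_iff)
  qed
  have n: "norm (x - z) < \<delta>" using x by (simp add: dist_norm norm_minus_commute)
  have "norm (x $ i - z $ i) < \<delta>" using norm_coord_le[of "x - z" i] n by simp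
  then have 1: "\<bar>norm (x $ i) - norm (z $ i)\<bar> < \<delta>" using norm_triangle_ineq3[of "x $ i" "z $ i"] by linarith
  have "ins i 0 x - ins i 0 z = ins i 0 (x - z)" by (simp add: vec_eq_iff)
  then have "norm (ins i 0 x - ins i 0 z) < \<delta>" using norm_ins0_le[of i "x - z"] n by simp
  then have 2: "\<bar>norm (ins i 0 x) - norm (ins i 0 z)\<bar> < \<delta>" using norm_triangle_ineq3[of "ins i 0 x" "ins i 0 z"] by linarith
  show ?thesis unfolding cell_def using key[OF _ 1] key[OF _ 2] by simp
qed

text \<open>105 = 5 * 21: at most 5 / \<delta> cells, or 5 if n = 1, each with the volume bound of
  \<open>measure_cell\<close>. The other factors come from passing from neighbourhoods to Hausdorff
  measure.\<close>

definition monotone_const :: "'n::finite itself => 'n => real" where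
  "monotone_const _ i = unit_ball_vol (real (2 * CARD('n) - 1)) * 2 ^ (2 * CARD('n) - 1)
     * (105 * polycyl_vol TYPE('n) i * cell_const CARD('n) / unit_ball_vol (real (2 * CARD('n))))"

lemma monotone_const_pos: "monotone_const TYPE('n::finite) i >= 0"
  unfolding monotone_const_def
  using polycyl_vol_pos[where 'n = 'n, of i] unit_ball_vol_pos[OF of_nat_0_le_iff, of "2 * CARD('n) - 1"]
    unit_ball_vol_pos[OF of_nat_0_le_iff, of "2 * CARD('n)"]
  by (intro mult_nonneg_nonneg divide_nonneg_nonneg) (auto simp: cell_const_def)

text \<open>Along a monotone curve in the quadrant the cells of a grid that are met lie on different diagonals.\<close>

lemma hausdorff_monotone_le:
  fixes A :: "(complex ^ 'n::finite) set" and i :: 'n and e :: int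
  assumes A: "\<And>z. z \<in> A ==> norm (z $ i) <= \<beta>" "\<And>z. z \<in> A ==> norm z <= 1" and \<beta>: "0 < \<beta>" "\<beta> <= 1"
    and e: "e = 1 \<or> e = -1"
    and mono: "\<And>z w. z \<in> A ==> w \<in> A ==> norm (z $ i) < norm (w $ i) ==> of_int e * norm (ins i 0 z) < of_int e * norm (ins i 0 w)"
  shows "emeasure surface_measure A <= ennreal (monotone_const TYPE('n) i * \<beta>)"
proof (cases "A \<in> sets borel")
  case True
  let ?V = "polycyl_vol TYPE('n) i" and ?d = "2 * CARD('n) - 1"
  let ?C = "105 * ?V * cell_const CARD('n) * \<beta>"
  have V: "?V > 0" by (rule polycyl_vol_pos)
  have cc: "cell_const CARD('n) >= 0" by (simp add: cell_const_def)
  have n1: "CARD('n) >= 1" using zero_less_card_finite[where 'a = 'n] by linarith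
  have Sd: "Suc ?d = 2 * CARD('n)" using n1 by linarith
  have "hausdorff_outer_measure ?d A <= ennreal (unit_ball_vol (real ?d) * 2 ^ ?d * (?C / unit_ball_vol (real (Suc ?d))))"
  proof (rule hausdorff_outer_measure_le_neighbourhood[where ?\<delta>0.0 = \<beta>])
    show "?d >= 1" using n1 by linarith
    show "\<beta> > 0" "?C >= 0" "DIM(complex ^ 'n) = Suc ?d"
      using \<beta> V cc by (auto simp only: Sd DIM_cvec zero_less_mult_iff intro!: mult_nonneg_nonneg)
    fix \<delta> :: real assume \<delta>: "0 < \<delta>" "\<delta> < \<beta>"
    then have \<delta>1: "\<delta> <= 1" using \<beta> by simp
    define k where "k z = nat \<lfloor>norm (z $ i) / \<delta>\<rfloor>" for z :: "complex ^ 'n"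
    define j where "j z = nat \<lfloor>norm (ins i 0 z) / \<delta>\<rfloor>" for z :: "complex ^ 'n"
    have fl: "real (nat \<lfloor>a / \<delta>\<rfloor>) * \<delta> <= a" if "a >= 0" for a
    proof -
      have "a / \<delta> >= 0" using that \<delta> by simp
      then have "real (nat \<lfloor>a / \<delta>\<rfloor>) <= a / \<delta>" by (simp add: of_nat_nat)
      then show ?thesis using \<delta> by (simp add: pos_le_divide_eq)
    qed
    have kj: "real (k z) * \<delta> <= norm (z $ i)" "real (j z) * \<delta> <= norm (ins i 0 z)" for z by (simp_all add: k_def j_def fl)
    define Q where "Q = (%z. (k z, j z)) ` A"
    define L where "L = nat \<lfloor>1 / \<delta>\<rfloor>"
    have b1: "norm (z $ i) <= 1" "norm (ins i 0 z) <= 1" if "z \<in> A" for z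
      using A(2)[OF that] norm_coord_le[of z i] norm_ins0_le[of i z] by linarith+
    have kL: "k z <= L" "j z <= L" if "z \<in> A" for z
      unfolding k_def j_def L_def using b1[OF that] \<delta> by (auto intro!: nat_mono floor_mono divide_right_mono)
    have inj: "inj_on (%(k, j). int k + e * int j) Q"
    proof -
      have less: "False" if "z \<in> A" "w \<in> A" "int (k z) + e * int (j z) = int (k w) + e * int (j w)" "k z < k w" for z w
      proof -
        have "norm (z $ i) < norm (w $ i)"
        proof (rule ccontr)
          assume "\<not> norm (z $ i) < norm (w $ i)"
          then have "k w <= k z" unfolding k_def using \<delta> by (intro nat_mono floor_mono divide_right_mono) auto
          then show False using that by simp
        qed
        note lt = mono[OF that(1,2) this]
        from e show False
        proof
          assume e1: "e = 1"
          with lt have "j z <= j w" unfolding j_def using \<delta> by (intro nat_mono floor_mono divide_right_mono) auto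
          then show False using that e1 by simp
        next
          assume e1: "e = -1"
          with lt have "j w <= j z" unfolding j_def using \<delta> by (intro nat_mono floor_mono divide_right_mono) auto
          then show False using that e1 by simp
        qed
      qed
      show ?thesis
      proof (rule inj_onI, clarsimp simp: Q_def)
        fix z w assume zw: "z \<in> A" "w \<in> A" "int (k z) + e * int (j z) = int (k w) + e * int (j w)"
        have "k z = k w" using less[OF zw] less[OF zw(2,1) zw(3)[symmetric]] by (meson linorder_neqE_nat)
        moreover from this have "e * int (j z) = e * int (j w)" using zw(3) by simp
        then have "j z = j w" using e by auto
        ultimately show "k z = k w \<and> j z = j w" by simp
      qed
    qed
    have Qs: "Q \<subseteq> {..L} \<times> {..L}" using kL by (auto simp: Q_def)
    then have fQ: "finite Q" by (rule finite_subset) simp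
    \<comment> \<open>For n = 1 the second modulus is always 0 and strict monotonicity leaves a
      single value of the first, hence one cell. Otherwise there are at most
      \<open>3 * L + 1\<close> diagonals.\<close>
    have cQ: "real (card Q) * (if CARD('n) = 1 then 1 else \<delta>) <= 5"
    proof (cases "CARD('n) = 1")
      case True
      have z0: "ins i 0 z = 0" for z :: "complex ^ 'n"
      proof -
        obtain l :: 'n where l: "UNIV = {l}" using True by (rule card_1_singletonE)
        have "ins i 0 z $ x = 0" for x
        proof -
          have "x \<in> {l}" "i \<in> {l}" unfolding l[symmetric] by (rule UNIV_I)+
          then show ?thesis by simp
        qed
        then show ?thesis by (simp add: vec_eq_iff)
      qed
      have nl: "\<not> norm (z $ i) < norm (w $ i)" if "z \<in> A" "w \<in> A" for z w
        using mono[OF that] z0[of z] z0[of w] by auto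
      have ne: "norm (z $ i) = norm (w $ i)" if "z \<in> A" "w \<in> A" for z w
        using nl[OF that] nl[OF that(2,1)] by linarith
      have kj1: "(k z, j z) = (k w, j w)" if "z \<in> A" "w \<in> A" for z w
        unfolding k_def j_def ne[OF that] z0[of z] z0[of w] by simp
      have "\<forall>x\<in>Q. \<forall>y\<in>Q. x = y" unfolding Q_def ball_simps by (intro ballI kj1)
      then have "card Q <= 1" using fQ by (simp add: card_le_Suc0_iff_eq)
      then show ?thesis using True by simp
    next
      case False
      have "card Q = card ((%(k, j). int k + e * int j) ` Q)" by (rule card_image[OF inj, symmetric])
      also have "... <= card {- int L..2 * int L}"
      proof (rule card_mono)
        show "(%(k, j). int k + e * int j) ` Q \<subseteq> {- int L..2 * int L}"
        proof clarsimp
          fix a b assume "(a, b) \<in> Q"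
          then have "a <= L" "b <= L" using Qs by auto
          then show "- int L <= int a + e * int b \<and> int a + e * int b <= 2 * int L" using e by auto
        qed
      qed simp
      also have "... = 3 * L + 1" by simp
      finally have "real (card Q) <= 3 * real L + 1" by linarith
      moreover have "real L <= 1 / \<delta>" unfolding L_def using \<delta> by (simp add: of_nat_nat)
      moreover have "1 <= 1 / \<delta>" using \<delta> \<delta>1 by simp
      ultimately have "real (card Q) <= 5 / \<delta>" by simp
      then show ?thesis using False \<delta> by (simp add: pos_le_divide_eq)
    qed
    let ?N = "\<Union>(k, j)\<in>Q. cell i \<delta> k j"
    have cellb: "cell i \<delta> k' j' \<in> sets borel"
      "emeasure lborel (cell i \<delta> k' j' :: (complex ^ 'n) set) <= ennreal (21 * ?V * cell_const CARD('n) * \<beta> * \<delta> * (if CARD('n) = 1 then 1 else \<delta>))"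
      if kQ: "(k', j') \<in> Q" for k' j'
    proof -
      obtain z where z: "z \<in> A" "k' = k z" "j' = j z" using kQ by (auto simp: Q_def)
      have "real (k z) * \<delta> <= \<beta>" "real (j z) * \<delta> <= 1" using kj[of z] A(1)[OF z(1)] b1[OF z(1)] by linarith+
      then have "(real k' + 2) * \<delta> <= 3 * \<beta>" "(real j' + 2) * \<delta> <= 3" using \<delta> \<delta>1 z by (simp_all add: algebra_simps)
      from measure_cell[OF \<delta>(1) \<delta>1 this]
      show "cell i \<delta> k' j' \<in> sets borel"
        "emeasure lborel (cell i \<delta> k' j' :: (complex ^ 'n) set) <= ennreal (21 * ?V * cell_const CARD('n) * \<beta> * \<delta> * (if CARD('n) = 1 then 1 else \<delta>))" .
    qed
    show "\<exists>N\<in>sets borel. (\<Union>x\<in>A. ball x \<delta>) \<subseteq> N \<and> emeasure lborel N <= ennreal (?C * \<delta>)"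
    proof (intro bexI conjI)
      show "?N \<in> sets borel" using cellb(1) fQ by (intro sets.finite_UN) auto
      show "(\<Union>x\<in>A. ball x \<delta>) \<subseteq> ?N"
      proof clarsimp
        fix z x assume "z \<in> A" "dist z x < \<delta>"
        then have "(k z, j z) \<in> Q" "x \<in> cell i \<delta> (k z) (j z)"
          using ball_subset_cell[OF \<delta>(1), of z x i] by (auto simp: Q_def k_def j_def)
        then show "\<exists>y\<in>Q. x \<in> (case y of (k, j) => cell i \<delta> k j)" by (intro bexI[of _ "(k z, j z)"]) simp_all
      qed
      let ?c = "if CARD('n) = 1 then 1 else \<delta>"
      have "emeasure lborel ?N <= (\<Sum>y\<in>Q. emeasure lborel (case y of (k, j) => cell i \<delta> k j))"
        using fQ cellb(1) by (intro emeasure_subadditive_finite) auto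
      also have "... <= (\<Sum>y\<in>Q. ennreal (21 * ?V * cell_const CARD('n) * \<beta> * \<delta> * ?c))"
        using cellb(2) by (intro sum_mono) (auto simp only: split: prod.split)
      also have "... = ennreal (real (card Q) * (21 * ?V * cell_const CARD('n) * \<beta> * \<delta> * ?c))"
        using V cc \<beta> \<delta> by (subst sum_ennreal) auto
      also have "... <= ennreal (?C * \<delta>)"
      proof (rule ennreal_leI)
        have "(real (card Q) * ?c) * (21 * ?V * cell_const CARD('n) * \<beta> * \<delta>) <= 5 * (21 * ?V * cell_const CARD('n) * \<beta> * \<delta>)"
          using cQ V cc \<beta> \<delta> by (intro mult_right_mono) auto
        then show "real (card Q) * (21 * ?V * cell_const CARD('n) * \<beta> * \<delta> * ?c) <= ?C * \<delta>" by (simp add: mult_ac split: if_splits)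
      qed
      finally show "emeasure lborel ?N <= ennreal (?C * \<delta>)" .
    qed
  qed
  also have "unit_ball_vol (real ?d) * 2 ^ ?d * (?C / unit_ball_vol (real (Suc ?d))) = monotone_const TYPE('n) i * \<beta>"
    unfolding monotone_const_def Sd by simp
  finally show ?thesis unfolding emeasure_surface_measure[OF DIM_cvec(2) True] DIM_cvec(1) .
\<comment> \<open>Sets that are not Borel have measure 0 by convention.\<close>
qed (simp add: emeasure_notin_sets)

section \<open>Lower bound for the Szegoe metric at the base point\<close>

section \<open>A test function in the Hardy space\<close>

text \<open>The parameter t turns the fractional powers of \<epsilon> other than Y into integral
  ones: \<open>p1 = t ^ 4\<close>, \<open>\<alpha> = t ^ 8\<close>,
  \<open>\<epsilon> = t ^ 16\<close>.\<close>

locale thin_test = thin_szego i \<alpha> p1 c for i :: "'n::finite" and \<alpha> p1 c :: real +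
  fixes t :: real
  assumes t: "0 < t" "t <= 1/2" and p1t: "p1 = t ^ 4"
begin

lemma powers: "\<alpha> = t ^ 8" "\<epsilon> = t ^ 16" "t ^ 2 <= 1/4" "t ^ 6 <= 1/64"
proof -
  show "\<alpha> = t ^ 8" unfolding \<alpha> p1t by (simp flip: power_mult)
  then show "\<epsilon> = t ^ 16" unfolding \<epsilon>_def by (simp flip: power_mult)
  have "t ^ 2 <= (1/2) ^ 2" "t ^ 6 <= (1/2) ^ 6" using t by (intro power_mono; simp)+
  then show "t ^ 2 <= 1/4" "t ^ 6 <= 1/64" by (simp_all add: power_divide)
qed

lemma boundary:
  assumes z: "z \<in> sz.S"
  defines "a \<equiv> (norm (z $ i))\<^sup>2" and "s \<equiv> 1 - (norm z)\<^sup>2" and "q \<equiv> (norm (ins i 0 z))\<^sup>2"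
  shows "a > 0" "s > 0" "a * s = \<epsilon>" "a + q + s = 1" "q >= 0" "\<epsilon> <= a" "a < 1" "z $ i ~= 0"
    "fdens i z = (a ^ CARD('n) * (a + s - 4 * \<epsilon>)) powr (1 / (real CARD('n) + 1)) / (2 * sqrt (a * ((a - s)\<^sup>2 + a * q)))"
proof -
  note p = sz.S_props[OF z, folded a_def s_def q_def]
  show "a > 0" "s > 0" "a * s = \<epsilon>" "a + q + s = 1" "q >= 0" "\<epsilon> <= a" "a < 1" using p by (simp_all add: \<epsilon>_def)
  show "z $ i ~= 0" using p(1) by (auto simp: a_def)
  show "fdens i z = (a ^ CARD('n) * (a + s - 4 * \<epsilon>)) powr (1 / (real CARD('n) + 1)) / (2 * sqrt (a * ((a - s)\<^sup>2 + a * q)))"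
    unfolding a_def s_def q_def \<epsilon>_def by (rule sz.fdens_on_S[OF z])
qed

text \<open>On the boundary \<open>a * s = \<alpha>^2\<close>, so \<open>\<alpha> <= a\<close> means
  \<open>s <= a\<close>: this is where q changes from increasing to decreasing in a. Since
  \<open>\<alpha> = p1^2\<close>, it is also where \<open>norm (z $ i) = p1\<close>, the modulus at
  which the terms of the test function balance.\<close>

definition A_o where "A_o = {z \<in> sz.S. \<alpha> <= (norm (z $ i))\<^sup>2}"
definition A_i where "A_i = {z \<in> sz.S. (norm (z $ i))\<^sup>2 <= \<alpha>}"

lemma A_sets [measurable]: "A_o \<in> sets borel" "A_i \<in> sets borel"
proof -
  have "A_o = sz.S \<inter> {z. \<alpha> <= (norm (z $ i))\<^sup>2}" "A_i = sz.S \<inter> {z. (norm (z $ i))\<^sup>2 <= \<alpha>}" by (auto simp: A_o_def A_i_def)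
  moreover have "closed {z :: complex ^ 'n. \<alpha> <= (norm (z $ i))\<^sup>2}" "closed {z :: complex ^ 'n. (norm (z $ i))\<^sup>2 <= \<alpha>}"
    by (intro closed_Collect_le continuous_intros)+
  ultimately show "A_o \<in> sets borel" "A_i \<in> sets borel" using sz.closed_S by (auto intro: borel_closed)
qed

text \<open>Along the boundary the change of \<open>a + s = 1 - q\<close> with increasing a has the
  sign of \<open>a1 * a2 - \<epsilon>\<close>, which is constant on each half.\<close>

lemma quotient_identity:
  fixes a1 a2 s1 s2 e :: real
  assumes "a1 * s1 = e" "a2 * s2 = e"
  shows "a1 * a2 * ((a2 + s2) - (a1 + s1)) = (a2 - a1) * (a1 * a2 - e)"
proof -
  have "a1 * a2 * ((a2 + s2) - (a1 + s1)) = a1 * a2 * (a2 - a1) + a1 * (a2 * s2) - a2 * (a1 * s1)" by (simp add: algebra_simps)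
  also have "... = (a2 - a1) * (a1 * a2 - e)" unfolding assms by (simp add: algebra_simps)
  finally show ?thesis .
qed

text \<open>The pair of moduli runs along a decreasing curve on the outer half and along an
  increasing one on the inner half, where moreover the first modulus is at most p1.\<close>

lemma measure_outer: "emeasure surface_measure A_o <= ennreal (monotone_const TYPE('n) i * 1)"
  and measure_inner: "emeasure surface_measure A_i <= ennreal (monotone_const TYPE('n) i * p1)"
proof -
  have nm: "norm (z $ i) <= 1" "norm z <= 1" if "z \<in> sz.S" for z
  proof -
    have "(norm z)\<^sup>2 <= 1" using boundary(2)[OF that] by simp
    then show "norm z <= 1" by (simp add: abs_square_le_1)
    then show "norm (z $ i) <= 1" using norm_coord_le[of z i] by linarith
  qed
  have sq: "(norm (z $ i))\<^sup>2 < (norm (w $ i))\<^sup>2" if "norm (z $ i) < norm (w $ i)" for z w :: "complex ^ 'n"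
    using that by (intro power_strict_mono) auto
  have q: "(norm (ins i 0 z))\<^sup>2 = 1 - ((norm (z $ i))\<^sup>2 + (1 - (norm z)\<^sup>2))" if "z \<in> sz.S" for z
    using boundary(4)[OF that] by linarith
  have e: "\<epsilon> = \<alpha> * \<alpha>" by (simp add: \<epsilon>_def power2_eq_square)
  show "emeasure surface_measure A_o <= ennreal (monotone_const TYPE('n) i * 1)"
  proof (rule hausdorff_monotone_le[where e = "-1"])
    fix z w assume zw: "z \<in> A_o" "w \<in> A_o" "norm (z $ i) < norm (w $ i)"
    then have S: "z \<in> sz.S" "w \<in> sz.S" and b: "\<alpha> <= (norm (z $ i))\<^sup>2" "(norm (z $ i))\<^sup>2 < (norm (w $ i))\<^sup>2"
      using sq by (auto simp: A_o_def)
    note zz = boundary[OF S(1)] and ww = boundary[OF S(2)]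
    have "\<alpha> * \<alpha> <= (norm (z $ i))\<^sup>2 * \<alpha>" using b params(1) by (intro mult_right_mono) auto
    also have "... < (norm (z $ i))\<^sup>2 * (norm (w $ i))\<^sup>2" using b zz(1) by (intro mult_strict_left_mono) auto
    finally have "0 < ((norm (w $ i))\<^sup>2 - (norm (z $ i))\<^sup>2) * ((norm (z $ i))\<^sup>2 * (norm (w $ i))\<^sup>2 - \<epsilon>)"
      using b by (intro mult_pos_pos) (auto simp: e)
    then have "0 < (norm (z $ i))\<^sup>2 * (norm (w $ i))\<^sup>2 * (((norm (w $ i))\<^sup>2 + (1 - (norm w)\<^sup>2)) - ((norm (z $ i))\<^sup>2 + (1 - (norm z)\<^sup>2)))"
      unfolding quotient_identity[OF zz(3) ww(3)] .
    then have "0 < ((norm (w $ i))\<^sup>2 + (1 - (norm w)\<^sup>2)) - ((norm (z $ i))\<^sup>2 + (1 - (norm z)\<^sup>2))"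
      by (rule zero_less_mult_pos) (use zz(1) ww(1) in simp)
    then have "(norm (ins i 0 w))\<^sup>2 < (norm (ins i 0 z))\<^sup>2" unfolding q[OF S(1)] q[OF S(2)] by linarith
    then have "norm (ins i 0 w) < norm (ins i 0 z)" by (rule power2_less_imp_less) simp
    then show "of_int (-1) * norm (ins i 0 z) < of_int (-1) * norm (ins i 0 w)" by simp
  qed (use nm in \<open>auto simp: A_o_def\<close>)
  show "emeasure surface_measure A_i <= ennreal (monotone_const TYPE('n) i * p1)"
  proof (rule hausdorff_monotone_le[where e = 1])
    fix z w assume zw: "z \<in> A_i" "w \<in> A_i" "norm (z $ i) < norm (w $ i)"
    then have S: "z \<in> sz.S" "w \<in> sz.S" and b: "(norm (w $ i))\<^sup>2 <= \<alpha>" "(norm (z $ i))\<^sup>2 < (norm (w $ i))\<^sup>2"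
      using sq by (auto simp: A_i_def)
    note zz = boundary[OF S(1)] and ww = boundary[OF S(2)]
    have "(norm (z $ i))\<^sup>2 * (norm (w $ i))\<^sup>2 <= (norm (z $ i))\<^sup>2 * \<alpha>" using b zz(1) by (intro mult_left_mono) auto
    also have "... < \<alpha> * \<alpha>" using b params(1) by (intro mult_strict_right_mono) auto
    finally have "((norm (w $ i))\<^sup>2 - (norm (z $ i))\<^sup>2) * ((norm (z $ i))\<^sup>2 * (norm (w $ i))\<^sup>2 - \<epsilon>) < 0"
      using b by (intro mult_pos_neg) (auto simp: e)
    then have "0 < (norm (z $ i))\<^sup>2 * (norm (w $ i))\<^sup>2 * (((norm (z $ i))\<^sup>2 + (1 - (norm z)\<^sup>2)) - ((norm (w $ i))\<^sup>2 + (1 - (norm w)\<^sup>2)))"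
      using quotient_identity[OF zz(3) ww(3)] by (simp add: algebra_simps)
    then have "0 < ((norm (z $ i))\<^sup>2 + (1 - (norm z)\<^sup>2)) - ((norm (w $ i))\<^sup>2 + (1 - (norm w)\<^sup>2))"
      by (rule zero_less_mult_pos) (use zz(1) ww(1) in simp)
    then have "(norm (ins i 0 z))\<^sup>2 < (norm (ins i 0 w))\<^sup>2" unfolding q[OF S(1)] q[OF S(2)] by linarith
    then have "norm (ins i 0 z) < norm (ins i 0 w)" by (rule power2_less_imp_less) simp
    then show "of_int 1 * norm (ins i 0 z) < of_int 1 * norm (ins i 0 w)" by simp
  next
    fix z assume "z \<in> A_i"
    then have h: "(norm (z $ i))\<^sup>2 <= \<alpha>" and S: "z \<in> sz.S" by (auto simp: A_i_def)
    have "(norm (z $ i))\<^sup>2 <= p1\<^sup>2" using h unfolding \<alpha> .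
    then show "norm (z $ i) <= p1" by (rule power2_le_imp_le) (use p1 in simp)
    show "norm z <= 1" using nm[OF S] by simp
  qed (use p1 in auto)
qed

text \<open>Here \<open>s <= a\<close>, so the power of the determinant is at most
  \<open>2 * a\<close>. The norm of the gradient is at least \<open>a / 5\<close>: for
  \<open>q >= 1/2\<close> by the term \<open>a * q\<close>, otherwise because a is at least 1/4 and
  s is tiny.\<close>

lemma fdens_outer:
  assumes z: "z \<in> A_o"
  shows "fdens i z <= 5"
proof -
  have S: "z \<in> sz.S" and b: "\<alpha> <= (norm (z $ i))\<^sup>2" using z by (auto simp: A_o_def)
  define a s q where "a = (norm (z $ i))\<^sup>2" and "s = 1 - (norm z)\<^sup>2" and "q = (norm (ins i 0 z))\<^sup>2"
  note p = boundary[OF S, folded a_def s_def q_def]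
  let ?n = "1 / (real CARD('n) + 1)"
  have sa: "s <= a"
  proof (rule ccontr)
    assume "\<not> s <= a"
    then have "\<alpha> * \<alpha> < a * s" using b params(1) by (intro mult_le_less_imp_less) (auto simp: a_def)
    then show False using p(3) by (simp add: \<epsilon>_def power2_eq_square)
  qed
  have m: "a / 20 <= (a - s)\<^sup>2 + a * q"
  proof (cases "q >= 1/2")
    case True
    then have "a * (1/2) <= a * q" using p(1) by (intro mult_left_mono) auto
    then show ?thesis using p(1) zero_le_power2[of "a - s"] by linarith
  next
    case False
    then have a: "a >= 1/4" using p(4) sa by linarith
    have "1/4 * s <= a * s" using a p(2) by (intro mult_right_mono) auto
    then have "s <= 1/1000" using p(3) params by simp
    then have "(1/4 - 1/1000)\<^sup>2 <= (a - s)\<^sup>2" using a by (intro power_mono) auto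
    then have "1/20 <= (a - s)\<^sup>2" by (simp add: power2_eq_square)
    moreover have "0 <= a * q" using p by simp
    ultimately show ?thesis using p(7) by linarith
  qed
  have "(a / 5)\<^sup>2 <= a * (a / 20)" by (simp add: power2_eq_square)
  also have "... <= a * ((a - s)\<^sup>2 + a * q)" using m p(1) by (intro mult_left_mono) auto
  finally have den: "a / 5 <= sqrt (a * ((a - s)\<^sup>2 + a * q))" by (rule real_le_rsqrt)
  have eps0: "\<epsilon> > 0" by (rule params)
  have e4: "0 <= a + s - 4 * \<epsilon>" using sz.S_sum_lower[OF S] by (simp add: a_def s_def \<epsilon>_def)
  have "a + s - 4 * \<epsilon> <= 2 * a" using sa eps0 by linarith
  then have "a ^ CARD('n) * (a + s - 4 * \<epsilon>) <= a ^ CARD('n) * (2 * a)" using p(1) by (intro mult_left_mono) auto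
  also have "... = 2 * a ^ (CARD('n) + 1)" by simp
  also have "... <= 2 ^ (CARD('n) + 1) * a ^ (CARD('n) + 1)" using p(1) by (intro mult_right_mono) auto
  also have "... = (2 * a) ^ (CARD('n) + 1)" by (rule power_mult_distrib[symmetric])
  finally have "(a ^ CARD('n) * (a + s - 4 * \<epsilon>)) powr ?n <= ((2 * a) ^ (CARD('n) + 1)) powr ?n"
    using p(1) e4 by (intro powr_mono2) auto
  also have "... = 2 * a"
  proof -
    have "((2 * a) ^ (CARD('n) + 1)) powr ?n = (2 * a) powr (real (CARD('n) + 1) * ?n)"
      using p(1) by (subst powr_realpow[symmetric]) (auto simp only: powr_powr mult_pos_pos zero_less_numeral)
    moreover have "real (CARD('n) + 1) * ?n = 1" by (simp add: field_simps)
    moreover have "(2 * a) powr 1 = 2 * a" using p(1) by simp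
    ultimately show ?thesis by (simp only:)
  qed
  finally have num: "(a ^ CARD('n) * (a + s - 4 * \<epsilon>)) powr ?n <= 2 * a" .
  have "fdens i z <= (2 * a) / (2 * (a / 5))"
    unfolding p(9) using num den p(1) by (intro frac_le mult_left_mono) auto
  also have "... = 5" using p(1) by simp
  finally show ?thesis .
qed

text \<open>The squared norm of the gradient is at least \<open>t ^ 22 / 4\<close>, whence the
  exponent 11. The power of the determinant is at most \<open>a / Y\<close> because
  \<open>a + s - 4 * \<epsilon> <= 1\<close> and \<open>\<epsilon> <= a\<close>.\<close>

lemma fdens_inner:
  assumes z: "z \<in> A_i"
  shows "fdens i z <= (norm (z $ i))\<^sup>2 / (Y * t ^ 11)"
proof -
  have S: "z \<in> sz.S" and b: "(norm (z $ i))\<^sup>2 <= \<alpha>" using z by (auto simp: A_i_def)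
  define a s q where "a = (norm (z $ i))\<^sup>2" and "s = 1 - (norm z)\<^sup>2" and "q = (norm (ins i 0 z))\<^sup>2"
  note p = boundary[OF S, folded a_def s_def q_def]
  let ?n = "1 / (real CARD('n) + 1)"
  have a64: "a <= 1/64" using b params(3) by (simp add: a_def)
  have m0: "(a - s)\<^sup>2 >= 0" "a * q >= 0" using p by auto
  have t22: "t ^ 22 / 4 <= t ^ 16 / 16" "t ^ 22 / 4 <= t ^ 16 / 4" "t ^ 22 / 4 <= t ^ 20 / 2"
  proof -
    have "t ^ 16 * t ^ 6 <= t ^ 16 * (1/64)" "t ^ 20 * t ^ 2 <= t ^ 20 * (1/4)"
      using powers(3,4) t by (intro mult_left_mono; simp)+
    moreover have "t ^ 16 * t ^ 6 = t ^ 22" "t ^ 20 * t ^ 2 = t ^ 22" by (simp_all flip: power_add)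
    moreover have "t ^ 16 >= 0" "t ^ 20 >= 0" using t by auto
    ultimately show "t ^ 22 / 4 <= t ^ 16 / 16" "t ^ 22 / 4 <= t ^ 16 / 4" "t ^ 22 / 4 <= t ^ 20 / 2" by linarith+
  qed
  have as2: "\<epsilon> * s / 4 <= a * ((a - s)\<^sup>2 + a * q)" if "s >= 2 * a"
  proof -
    have "(s / 2)\<^sup>2 <= (s - a)\<^sup>2" using that p(1,2) by (intro power_mono) auto
    also have "(s - a)\<^sup>2 = (a - s)\<^sup>2" by (rule power2_commute)
    finally have "a * (s / 2)\<^sup>2 <= a * ((a - s)\<^sup>2 + a * q)" using p(1) m0(2) by (intro mult_left_mono) auto
    moreover have "a * (s / 2)\<^sup>2 = (a * s) * s / 4" by (simp add: power2_eq_square)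
    ultimately show ?thesis unfolding p(3) by simp
  qed
  have q2: "a\<^sup>2 / 2 <= a * ((a - s)\<^sup>2 + a * q)" if "q >= 1/2"
  proof -
    have "a * (1/2) <= a * q" using that p(1) by (intro mult_left_mono) auto
    then have "a * (1/2) <= (a - s)\<^sup>2 + a * q" using m0(1) by linarith
    then have "a * (a * (1/2)) <= a * ((a - s)\<^sup>2 + a * q)" by (rule mult_left_mono) (use p(1) in simp)
    then show ?thesis by (simp add: power2_eq_square)
  qed
  \<comment> \<open>If q is large and \<open>s >= 2 * a\<close>, the lower bounds
    \<open>a^2 / 2\<close> and \<open>\<epsilon> * s / 4\<close> with
    \<open>s = \<epsilon> / a\<close> cross near the power 2/3 of \<epsilon>; the threshold
    \<open>t ^ 10\<close> is a nearby integral power. In the other cases one of the two bounds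
    suffices.\<close>
  have m: "t ^ 22 / 4 <= a * ((a - s)\<^sup>2 + a * q)"
  proof (cases "q >= 1/2")
    case False
    then have s: "s >= 1/4" using p(4) a64 by linarith
    then have "\<epsilon> * (1/4) <= \<epsilon> * s" using params(4) by (intro mult_left_mono) auto
    then have "\<epsilon> / 16 <= \<epsilon> * s / 4" by linarith
    then show ?thesis using as2 s a64 t22(1) unfolding powers(2) by linarith
  next
    case q: True
    show ?thesis
    proof (cases "s >= 2 * a")
      case False
      then have "a * s <= a * (2 * a)" using p(1) by (intro mult_left_mono) auto
      then have "\<epsilon> / 2 <= a\<^sup>2" unfolding p(3) by (simp add: power2_eq_square)
      then show ?thesis using q2[OF q] t22(2) unfolding powers(2) by linarith
    next
      case s2: True
      show ?thesis
      proof (cases "a >= t ^ 10")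
        case True
        then have "(t ^ 10)\<^sup>2 <= a\<^sup>2" using t by (intro power_mono) auto
        then have "t ^ 20 <= a\<^sup>2" by (simp flip: power_mult)
        then show ?thesis using q2[OF q] t22(3) by linarith
      next
        case False
        then have "a * s <= t ^ 10 * s" using p(2) by (intro mult_right_mono) auto
        then have "t ^ 10 * t ^ 6 <= t ^ 10 * s" unfolding p(3) powers(2) by (simp flip: power_add)
        then have "t ^ 6 <= s" by (rule mult_left_le_imp_le) (use t in simp)
        then have "t ^ 16 * t ^ 6 <= t ^ 16 * s" using t by (intro mult_left_mono) auto
        then have "t ^ 22 <= t ^ 16 * s" by (simp flip: power_add)
        then show ?thesis using as2[OF s2] unfolding powers(2) by linarith
      qed
    qed
  qed
  have "(t ^ 11 / 2)\<^sup>2 = t ^ 22 / 4" by (simp add: power_divide flip: power_mult)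
  with m have den: "t ^ 11 / 2 <= sqrt (a * ((a - s)\<^sup>2 + a * q))" by (intro real_le_rsqrt) simp
  have e4: "0 <= a + s - 4 * \<epsilon>" using sz.S_sum_lower[OF S] by (simp add: a_def s_def \<epsilon>_def)
  have "a + s - 4 * \<epsilon> <= 1" using p(4,5) params(4) by linarith
  then have "a ^ CARD('n) * (a + s - 4 * \<epsilon>) <= a ^ CARD('n) * 1" using p(1) by (intro mult_left_mono) auto
  then have "(a ^ CARD('n) * (a + s - 4 * \<epsilon>)) powr ?n <= (a ^ CARD('n)) powr ?n"
    using p(1) e4 by (intro powr_mono2) auto
  also have "... = a powr (real CARD('n) * ?n)"
    using p(1) by (subst powr_realpow[symmetric]) (auto simp only: powr_powr)
  also have "real CARD('n) * ?n = 1 - ?n" by (simp add: field_simps)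
  also have "a powr (1 - ?n) = a / a powr ?n" using p(1) by (simp add: powr_diff)
  also have "... <= a / Y"
  proof (rule divide_left_mono)
    show "Y <= a powr ?n" unfolding Y_def using p(6) params(4) by (intro powr_mono2) auto
  qed (use p(1) Y(1) in auto)
  finally have num: "(a ^ CARD('n) * (a + s - 4 * \<epsilon>)) powr ?n <= a / Y" .
  have "fdens i z <= (a / Y) / (2 * (t ^ 11 / 2))"
    unfolding p(9) using num den p(1) Y(1) t by (intro frac_le mult_left_mono) auto
  then show ?thesis by (simp add: a_def mult.commute)
qed

text \<open>On the inner half the factor a of the density bound cancels the growth of g, leaving
  \<open>4 * c * \<alpha> / (Y * t ^ 11) = 4 * c / (Y * t ^ 3)\<close>. The area of that half is at
  most a multiple of \<open>p1 = t ^ 4\<close>, so its share is of order t / Y.\<close>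

lemma energy_bound:
  assumes g: "continuous_on (closure sz.\<Omega>) g"
    and o: "\<And>z. z \<in> A_o ==> (norm (g z))\<^sup>2 <= 4"
    and n: "\<And>z. z \<in> A_i ==> (norm (g z))\<^sup>2 <= 4 * \<alpha> / (norm (z $ i))\<^sup>2"
  shows "sz.energy g <= ennreal (4 * c * monotone_const TYPE('n) i * (5 + t / Y))"
proof -
  let ?m = "monotone_const TYPE('n) i" and ?k = "4 * c / (Y * t ^ 3)"
  have m: "?m >= 0" by (rule monotone_const_pos)
  define g' where "g' z = indicator (closure sz.\<Omega>) z *\<^sub>R g z" for z
  have g'[measurable]: "g' \<in> borel_measurable borel"
    unfolding g'_def[abs_def] by (rule borel_measurable_continuous_on_indicator[OF _ g]) simp
  have g'S: "g' z = g z" if "z \<in> sz.S" for z using that by (simp add: g'_def sz.closure_\<Omega>)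
  have "sz.energy g = (\<integral>\<^sup>+z. ennreal ((norm (g' z))\<^sup>2) \<partial>sz.\<sigma>)"
    unfolding sz.energy_def by (intro nn_integral_cong) (simp add: sz.space_\<sigma> g'S)
  also have "... = (\<integral>\<^sup>+z. ennreal (c * fdens i z) * ennreal ((norm (g' z))\<^sup>2) * indicator sz.S z \<partial>surface_measure)"
    by (rule sz.nn_integral_\<sigma>) measurable
  also have "... <= (\<integral>\<^sup>+z. ennreal (20 * c) * indicator A_o z + ennreal ?k * indicator A_i z \<partial>surface_measure)"
  proof (rule nn_integral_mono)
    fix z
    have f0: "fdens i z >= 0" by (rule sz.fdens_nonneg)
    consider "z \<notin> sz.S" | "z \<in> A_o" | "z \<in> A_i" unfolding A_o_def A_i_def by (cases "\<alpha> <= (norm (z $ i))\<^sup>2") auto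
    then show "ennreal (c * fdens i z) * ennreal ((norm (g' z))\<^sup>2) * indicator sz.S z
      <= ennreal (20 * c) * indicator A_o z + ennreal ?k * indicator A_i z"
    proof cases
      case 1 then show ?thesis by simp
    next
      case 2
      then have S: "z \<in> sz.S" by (simp add: A_o_def)
      have "(c * fdens i z) * (norm (g z))\<^sup>2 <= (c * 5) * 4"
        using fdens_outer[OF 2] o[OF 2] c0 f0 by (intro mult_mono) auto
      then have "ennreal (c * fdens i z) * ennreal ((norm (g' z))\<^sup>2) <= ennreal (20 * c)"
        unfolding g'S[OF S] using c0 f0 by (subst ennreal_mult[symmetric]) (auto intro!: ennreal_leI simp: mult_ac)
      then show ?thesis using S 2 by (simp add: add_increasing2)
    next
      case 3
      then have S: "z \<in> sz.S" by (simp add: A_i_def)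
      let ?a = "(norm (z $ i))\<^sup>2"
      have a: "?a > 0" by (rule boundary(1)[OF S])
      have "(c * fdens i z) * (norm (g z))\<^sup>2 <= (c * (?a / (Y * t ^ 11))) * (4 * \<alpha> / ?a)"
        using fdens_inner[OF 3] n[OF 3] c0 f0 Y(1) t by (intro mult_mono) auto
      also have "... = 4 * c * t ^ 8 / (Y * t ^ 11)" using a unfolding powers(1) by simp
      also have "t ^ 11 = t ^ 8 * t ^ 3" by (simp flip: power_add)
      also have "4 * c * t ^ 8 / (Y * (t ^ 8 * t ^ 3)) = (t ^ 8 * (4 * c)) / (t ^ 8 * (Y * t ^ 3))" by (simp only: mult_ac)
      also have "... = ?k" by (rule mult_divide_mult_cancel_left) (use t in simp)
      finally have "ennreal (c * fdens i z) * ennreal ((norm (g' z))\<^sup>2) <= ennreal ?k"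
        unfolding g'S[OF S] using c0 f0 by (subst ennreal_mult[symmetric]) (auto intro!: ennreal_leI)
      then show ?thesis using S 3 by (simp add: add_increasing)
    qed
  qed
  also have "... = ennreal (20 * c) * emeasure surface_measure A_o + ennreal ?k * emeasure surface_measure A_i"
    by (subst nn_integral_add) (auto simp: nn_integral_cmult_indicator)
  also have "... <= ennreal (20 * c) * ennreal (?m * 1) + ennreal ?k * ennreal (?m * p1)"
    by (intro add_mono mult_left_mono measure_outer measure_inner) auto
  also have "... = ennreal (20 * c * (?m * 1) + ?k * (?m * p1))"
  proof -
    have "ennreal (20 * c) * ennreal (?m * 1) = ennreal (20 * c * (?m * 1))"
      by (rule ennreal_mult[symmetric]) (use c0 m in auto)
    moreover have "ennreal ?k * ennreal (?m * p1) = ennreal (?k * (?m * p1))"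
      by (rule ennreal_mult[symmetric]) (use c0 m p1 Y(1) t in auto)
    moreover have "ennreal (20 * c * (?m * 1)) + ennreal (?k * (?m * p1)) = ennreal (20 * c * (?m * 1) + ?k * (?m * p1))"
      by (rule ennreal_plus[symmetric]) (use c0 m p1 Y(1) t in auto)
    ultimately show ?thesis by (simp only:)
  qed
  also have "20 * c * (?m * 1) + ?k * (?m * p1) = 4 * c * ?m * (5 + t / Y)"
  proof -
    have "t ^ 4 = t * t ^ 3" by (simp add: eval_nat_numeral)
    then have "?k * (?m * p1) = 4 * c * ?m * (t / Y)" unfolding p1t using t by simp
    then show ?thesis by (simp add: algebra_simps)
  qed
  finally show ?thesis .
qed

lemma coord_nonzero: "z \<in> closure sz.\<Omega> ==> z $ i ~= 0"
  unfolding sz.closure_\<Omega> using coord_bounds(3)[of z] boundary(8)[of z] by (auto simp: sz_\<Omega>)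

text \<open>A holomorphic function continuous up to the boundary is its own approximating sequence,
  once its energy is finite.\<close>

lemma hardy_member:
  assumes g: "holomorphic_several g sz.\<Omega>" "continuous_on (closure sz.\<Omega>) g"
    and bnd: "\<And>z. z \<in> A_o ==> (norm (g z))\<^sup>2 <= 4" "\<And>z. z \<in> A_i ==> (norm (g z))\<^sup>2 <= 4 * \<alpha> / (norm (z $ i))\<^sup>2"
  shows "(g, g) \<in> sz.H" "nsq sz.\<sigma> g <= 4 * c * monotone_const TYPE('n) i * (5 + t / Y)"
proof -
  have en: "sz.energy g <= ennreal (4 * c * monotone_const TYPE('n) i * (5 + t / Y))"
    by (rule energy_bound[OF g(2)]) (use bnd in auto)
  have gm: "g \<in> borel_measurable sz.\<sigma>" by (rule sz.continuous_measurable_\<sigma>[OF g(2)])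
  have "integrable sz.\<sigma> (%z. (norm (g z))\<^sup>2)"
    by (rule integrableI_nonneg) (use gm en in \<open>auto simp: sz.energy_def intro: le_less_trans\<close>)
  then have sq: "square_integrable sz.\<sigma> g" using gm by (simp add: square_integrable_def)
  show "(g, g) \<in> sz.H" by (rule sz.hardy_spaceI[where g = "%j. g", OF sq g]) (simp_all add: sz.energy_def)
  show "nsq sz.\<sigma> g <= 4 * c * monotone_const TYPE('n) i * (5 + t / Y)"
    using en c0 monotone_const_pos[where 'n = 'n, of i] t Y(1)
    unfolding sz.energy_nsq[OF sq] by (subst (asm) ennreal_le_iff) auto
qed

text \<open>The test function is at most 2 in modulus on the outer half and at most
  \<open>2 * p1 / norm (z $ i)\<close> on the inner one, the halves being separated by
  \<open>norm (z $ i) = p1\<close>. The factor \<open>1 / \<alpha>\<close> of its squared derivative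
  cancels that of the kernel bound.\<close>

lemma levi_form_szego_ge:
  "1 <= levi_form (%w. ln (Re (szego_kernel c \<Omega> (rho i \<epsilon>) w w))) p (axis i 1)
    * (4096 * hausdorff_const TYPE('n) i * monotone_const TYPE('n) i / measure lborel (ring i (0 :: complex ^ 'n) 1 2 (1/4)) * (5 * Y + t))"
proof -
  let ?f = "%z :: complex ^ 'n. (- of_real p1) * (1 / z $ i) + 1"
  let ?L = "levi_form (%w. ln (Re (szego_kernel c \<Omega> (rho i \<epsilon>) w w))) p (axis i 1)"
  let ?V = "measure lborel (ring i (0 :: complex ^ 'n) 1 2 (1/4))" and ?h = "hausdorff_const TYPE('n) i" and ?m = "monotone_const TYPE('n) i"
  let ?K = "nsq sz.\<sigma> (hardy.kf p)"
  have a0: "\<alpha> > 0" by (rule params)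
  have pO: "p \<in> sz.\<Omega>" unfolding sz_\<Omega> by (rule p_in)
  have pi: "p $ i = of_real p1" by (simp add: p_def)
  have nz: "z $ i ~= 0" if "z \<in> sz.\<Omega>" for z using coord_nonzero that closure_subset by blast
  have V: "?V > 0" by (rule measure_ring_pos) auto
  have h0: "?h > 0" by (rule hausdorff_const_pos)
  \<comment> \<open>The constant function serves to show that the kernel at p is positive.\<close>
  have one: "((%z. 1), (%z. 1)) \<in> sz.H"
  proof (rule hardy_member(1))
    fix z assume "z \<in> A_i"
    then have "(norm (z $ i))\<^sup>2 <= \<alpha>" "(norm (z $ i))\<^sup>2 > 0" using boundary(1) by (auto simp: A_i_def)
    moreover from this(1) have "(norm (z $ i))\<^sup>2 <= 4 * \<alpha>" using a0 by linarith
    ultimately show "(norm (1::complex))\<^sup>2 <= 4 * \<alpha> / (norm (z $ i))\<^sup>2" by (simp add: pos_le_divide_eq)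
  qed (auto intro: holomorphic_several_const)
  have "1 <= nsq sz.\<sigma> (%z. 1) * ?K" using hardy.eval_le[OF pO one] by simp
  then have "?K ~= 0" by auto
  then have K0: "?K > 0" using nsq_nonneg[of sz.\<sigma> "hardy.kf p"] by linarith
  have fn: "norm (?f z) <= 1 + p1 / norm (z $ i)" for z
    using norm_triangle_ineq[of "(- of_real p1) * (1 / z $ i)" 1] p1 by (simp add: norm_mult norm_divide)
  have hol: "holomorphic_several ?f sz.\<Omega>"
    by (intro holomorphic_several_lin holomorphic_inverse_coord(1) holomorphic_several_const nz)
  have fH: "(?f, ?f) \<in> sz.H" "nsq sz.\<sigma> ?f <= 4 * c * ?m * (5 + t / Y)"
  proof -
    have c1: "continuous_on (closure sz.\<Omega>) ?f" by (intro continuous_intros) (use coord_nonzero in auto)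
    have o: "(norm (?f z))\<^sup>2 <= 4" if "z \<in> A_o" for z
    proof -
      have "\<alpha> <= (norm (z $ i))\<^sup>2" using that by (simp add: A_o_def)
      then have "p1\<^sup>2 <= (norm (z $ i))\<^sup>2" unfolding \<alpha> .
      then have "p1 <= norm (z $ i)" by (rule power2_le_imp_le) simp
      moreover from this have "norm (z $ i) > 0" using p1 by linarith
      ultimately have "p1 / norm (z $ i) <= 1" by (simp only: pos_divide_le_eq mult_1_left)
      then have "norm (?f z) <= 2" using fn[of z] by linarith
      then have "(norm (?f z))\<^sup>2 <= 2\<^sup>2" by (intro power_mono) auto
      then show ?thesis by simp
    qed
    have n: "(norm (?f z))\<^sup>2 <= 4 * \<alpha> / (norm (z $ i))\<^sup>2" if "z \<in> A_i" for z
    proof -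
      have z0: "norm (z $ i) > 0" using boundary(8)[of z] that by (auto simp: A_i_def)
      have "(norm (z $ i))\<^sup>2 <= \<alpha>" using that by (simp add: A_i_def)
      then have "(norm (z $ i))\<^sup>2 <= p1\<^sup>2" unfolding \<alpha> .
      then have "norm (z $ i) <= p1" by (rule power2_le_imp_le) (use p1 in simp)
      then have "1 <= p1 / norm (z $ i)" using z0 by simp
      then have "norm (?f z) <= 2 * (p1 / norm (z $ i))" using fn[of z] by linarith
      then have "(norm (?f z))\<^sup>2 <= (2 * (p1 / norm (z $ i)))\<^sup>2" by (intro power_mono) auto
      then show ?thesis by (simp add: \<alpha> power_mult_distrib power_divide)
    qed
    show "(?f, ?f) \<in> sz.H" by (rule hardy_member(1)[OF hol c1], erule o, erule n)
    show "nsq sz.\<sigma> ?f <= 4 * c * ?m * (5 + t / Y)" by (rule hardy_member(2)[OF hol c1], erule o, erule n)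
  qed
  have fp: "?f p = 0" using p1 by (simp add: pi)
  have "(?f has_derivative (%h. (- of_real p1) * (- (h $ i) / (p $ i)\<^sup>2) + 0)) (at p)"
    by (intro derivative_intros holomorphic_inverse_coord(2)[where S = sz.\<Omega>] nz pO)
  from frechet_derivative_at[OF this, symmetric]
  have D: "Dd ?f p (axis i 1) = of_real p1 / (of_real p1)\<^sup>2" by (simp add: pi)
  have nD: "(norm (Dd ?f p (axis i 1)))\<^sup>2 = 1 / \<alpha>"
    unfolding D using p1 by (simp add: \<alpha> norm_divide norm_power power2_eq_square)
  have sk: "szego_kernel c \<Omega> (rho i \<epsilon>) = reproducing_kernel sz.\<sigma> sz.H sz.\<Omega>"
    by (simp add: szego_kernel_def Let_def sz.\<sigma>_def sz_\<Omega> \<epsilon>_def)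
  have main: "1 / \<alpha> <= ?L * ?K * nsq sz.\<sigma> ?f"
    using hardy.levi_form_log_kernel_ge[OF pO K0 fH(1) fp, of i] unfolding nD sk .
  \<comment> \<open>The sign is needed to multiply the upper bound for the other two factors by the
    Levi form; it follows from the lower bound for the product.\<close>
  have L0: "?L >= 0"
  proof (rule ccontr)
    assume "\<not> ?L >= 0"
    then have "?L * (?K * nsq sz.\<sigma> ?f) <= 0" using K0 by (intro mult_nonpos_nonneg) auto
    with main[unfolded mult.assoc] have "1 / \<alpha> <= 0" by (rule order_trans)
    then show False using a0 by simp
  qed
  have "?K * nsq sz.\<sigma> ?f <= (1024 * ?h / (?V * c) * (Y / \<alpha>)) * (4 * c * ?m * (5 + t / Y))"
    using V h0 c0 Y(1) a0 by (intro mult_mono szego_kernel_bound fH(2)) auto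
  also have "... = (4096 * ?h * ?m / ?V * (5 * Y + t)) / \<alpha>"
    using V c0 Y(1) a0 by (simp add: field_simps)
  finally have "?L * (?K * nsq sz.\<sigma> ?f) <= ?L * ((4096 * ?h * ?m / ?V * (5 * Y + t)) / \<alpha>)" using L0 by (rule mult_left_mono)
  with main[unfolded mult.assoc] have "1 / \<alpha> <= ?L * ((4096 * ?h * ?m / ?V * (5 * Y + t)) / \<alpha>)" by (rule order_trans)
  then have "1 / \<alpha> <= (?L * (4096 * ?h * ?m / ?V * (5 * Y + t))) / \<alpha>" by (simp only: times_divide_eq_right)
  then show ?thesis using a0 by (simp only: divide_le_cancel)
qed

end

section \<open>The ratio of the two metrics along \<epsilon> = 2^(-16 k)\<close>

theorem theorem7:
  fixes c :: real
  assumes "c > 0"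
  shows "\<not> (\<exists>m M :: real. 0 < m \<and> m < M \<and>
    (\<forall>(\<Omega> :: (complex ^ 'n) set) \<rho>. strongly_pseudoconvex \<Omega> \<rho> \<longrightarrow>
       (\<forall>z\<in>\<Omega>. \<forall>\<xi>. m * szego_metric c \<Omega> \<rho> z \<xi> \<le> bergman_metric \<Omega> z \<xi> \<and>
                   bergman_metric \<Omega> z \<xi> \<le> M * szego_metric c \<Omega> \<rho> z \<xi>)))"
proof
  assume "\<exists>m M :: real. 0 < m \<and> m < M \<and>
    (\<forall>(\<Omega> :: (complex ^ 'n) set) \<rho>. strongly_pseudoconvex \<Omega> \<rho> -->
       (\<forall>z\<in>\<Omega>. \<forall>\<xi>. m * szego_metric c \<Omega> \<rho> z \<xi> <= bergman_metric \<Omega> z \<xi> \<and>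
                   bergman_metric \<Omega> z \<xi> <= M * szego_metric c \<Omega> \<rho> z \<xi>))"
  \<comment> \<open>The contradiction is with the lower constant: the Bergman metric is too small
    relative to the Szegoe metric.\<close>
  then obtain m :: real where m: "m > 0"
    and le: "\<forall>(\<Omega> :: (complex ^ 'n) set) \<rho>. strongly_pseudoconvex \<Omega> \<rho> -->
       (\<forall>z\<in>\<Omega>. \<forall>\<xi>. m * szego_metric c \<Omega> \<rho> z \<xi> <= bergman_metric \<Omega> z \<xi>)" by blast
  fix i :: 'n
  define C where "C = 4096 * hausdorff_const TYPE('n) i * monotone_const TYPE('n) i / measure lborel (ring i (0 :: complex ^ 'n) 1 2 (1/4))"
  define D where "D = 1280 * polycyl_vol TYPE('n) i / measure lborel (ring i (0 :: complex ^ 'n) (1/4) (1/2) (1/4))"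
  \<comment> \<open>With \<open>t = (1/2) ^ k\<close> the quantity Y becomes
    \<open>b ^ k\<close>.\<close>
  define b where "b = (1/2 :: real) powr (16 / (real CARD('n) + 1))"
  have C: "C >= 0" unfolding C_def using hausdorff_const_pos[where 'n = 'n, of i] monotone_const_pos[where 'n = 'n, of i] by simp
  \<comment> \<open>The factor k is the logarithm on the Bergman side; \<open>b ^ k\<close> and
    \<open>(1/2) ^ k\<close> are the powers of \<epsilon> on the Szegoe side.\<close>
  have key: "m\<^sup>2 <= 4 * C * D * (5 * (real k * b ^ k) + real k * (1/2) ^ k)" if k: "k >= 1" for k
  proof -
    define t :: real where "t = (1/2) ^ k"
    have t: "0 < t" "t <= 1/2" using power_decreasing[OF k, of "1/2::real"] by (simp_all add: t_def)
    have "t ^ 4 <= (1/2) ^ 4" using t by (intro power_mono) auto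
    then interpret T: thin_test i "(t ^ 4)\<^sup>2" "t ^ 4" c t
      using t assms by unfold_locales (auto simp: power_divide)
    have p1: "t ^ 4 = (1/2) ^ (4 * k)" unfolding t_def by (simp add: mult.commute flip: power_mult)
    let ?LS = "levi_form (%w. ln (Re (szego_kernel c T.\<Omega> (rho i T.\<epsilon>) w w))) T.p (axis i 1)"
    let ?LB = "levi_form (%w. ln (Re (bergman_kernel T.\<Omega> w w))) T.p (axis i 1)"
    have S: "1 <= ?LS * (C * (5 * T.Y + t))" using T.levi_form_szego_ge by (simp add: C_def)
    have B: "?LB <= D * real (4 * k)" using T.levi_form_bergman_le[OF p1] unfolding D_def T.U_def .
    have Y: "T.Y = b ^ k"
    proof -
      have "T.Y = (t powr 16) powr (1 / (real CARD('n) + 1))" unfolding T.Y_def T.powers(2) using t by simp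
      also have "(t powr 16) powr (1 / (real CARD('n) + 1)) = b powr real k"
      proof -
        have "t = (1/2) powr real k" by (simp add: t_def powr_realpow)
        then show ?thesis unfolding b_def by (simp add: powr_powr mult_ac)
      qed
      also have "... = b ^ k" by (rule powr_realpow) (simp add: b_def)
      finally show ?thesis .
    qed
    have X0: "C * (5 * T.Y + t) >= 0" using C T.Y(1) t by simp
    \<comment> \<open>\<open>sqrt\<close> is negative on negative numbers, so both Levi forms must
      be known to be positive before the inequality is squared.\<close>
    have LS: "?LS > 0"
    proof (rule ccontr)
      assume "\<not> ?LS > 0"
      then have "?LS * (C * (5 * T.Y + t)) <= 0" using X0 by (intro mult_nonpos_nonneg) auto
      then show False using S by simp
    qed
    have sp: "strongly_pseudoconvex T.\<Omega> (rho i T.\<epsilon>)"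
      unfolding T.\<Omega>_def by (rule strongly_pseudoconvex_dom) (rule T.params)+
    have sq: "m * sqrt ?LS <= sqrt ?LB"
      using le[rule_format, OF sp T.p_in] by (simp add: szego_metric_def bergman_metric_def)
    have pos: "0 < m * sqrt ?LS" using m LS by simp
    with sq have "0 < sqrt ?LB" by linarith
    then have LB: "?LB > 0" by simp
    have "(m * sqrt ?LS)\<^sup>2 <= (sqrt ?LB)\<^sup>2" using sq pos by (intro power_mono) auto
    then have "m\<^sup>2 * ?LS <= ?LB" using LS LB by (simp add: power_mult_distrib)
    also have "... <= D * real (4 * k)" by (rule B)
    finally have mL: "m\<^sup>2 * ?LS <= D * real (4 * k)" .
    have "m\<^sup>2 * 1 <= m\<^sup>2 * (?LS * (C * (5 * T.Y + t)))" using S by (intro mult_left_mono) auto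
    also have "... = (m\<^sup>2 * ?LS) * (C * (5 * T.Y + t))" by simp
    also have "... <= (D * real (4 * k)) * (C * (5 * T.Y + t))" using mL X0 by (rule mult_right_mono)
    also have "... = 4 * C * D * (5 * (real k * b ^ k) + real k * (1/2) ^ k)"
      unfolding Y unfolding t_def by (simp add: algebra_simps)
    finally show ?thesis by simp
  qed
  have "0 < b" by (simp add: b_def)
  moreover have "b < 1"
  proof -
    have "b < (1/2) powr 0" unfolding b_def by (rule powr_less_mono') auto
    then show ?thesis by simp
  qed
  ultimately have "(%k. real k * b ^ k) \<longlonglongrightarrow> 0" by (intro powser_times_n_limit_0) simp
  moreover have "(%k. real k * (1/2) ^ k) \<longlonglongrightarrow> 0" by (intro powser_times_n_limit_0) simp
  ultimately have "(%k. 4 * C * D * (5 * (real k * b ^ k) + real k * (1/2) ^ k)) \<longlonglongrightarrow> 4 * C * D * (5 * 0 + 0)"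
    by (intro tendsto_intros)
  then have "m\<^sup>2 <= 4 * C * D * (5 * 0 + 0)"
    by (rule LIMSEQ_le_const) (use key in blast)
  then show False using m by simp
qed

end
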